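(* There is an absolute constant $C>0$ such that the following holds. Let $\beta\in(0,1/6]$, $\theta\in(0,1)$ and $\mu_0>\mu_1\ge 0$. Let $\Gamma:(\mu_1,\mu_0)\to\overline{\mathcal N}^{-\infty}(\theta)$ be any piecewise linear curve with $T$ linear segments satisfying $\overline\mu(\Gamma(\mu))=\mu$ for all $\mu\in(\mu_1,\mu_0)$. Then, starting from any point $z^0\in\mathcal N^2(\beta)$ with $\overline\mu(z^0)\le\mu_0$, the algorithm SLLS-IPM finds a solution $z^1\in\overline{\mathcal N}^2(\beta)$ with $\overline\mu(z^1)\le\mu_1$ within at most $$C\,\frac{n^{1.5}}{\beta}\,\log\!\Big(\frac{n}{\beta(1-\theta)}\Big)\,T$$ iterations.
   Context: **Linear programs.** $A\in\mathbb R^{m\times n}$ has rank $m\le n$, $b\in\mathbb R^m$, $c\in\mathbb R^n$. The primal-dual pair is (LP): $\min\{\langle c,x\rangle: Ax=b,\ x\ge 0\}$ and $\max\{\langle b,y\rangle: A^\top y+s=c,\ s\ge 0\}$, assumed feasible and bounded. $\mathcal P=\{x\in\mathbb R^n: Ax=b,x\ge0\}$, $\mathcal D=\{s\in\mathbb R^n:\exists y,\ A^\top y+s=c,\ s\ge0\}$, and $\mathcal P_{++},\mathcal D_{++}$ are the subsets of coordinatewise strictly positive points, assumed nonempty. $W=\ker A$, $W^\perp=\operatorname{im}A^\top$. Products, quotients, square roots and inverses of vectors are coordinatewise; for a vector $x$ and subspace $V$, $xV=\{xv:v\in V\}$; $\|\cdot\|$ is the Euclidean norm and $\mathbf 1$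 the all-ones vector. For $z=(x,s)$, $\overline\mu(z)=\langle x,s\rangle/n$. **Neighborhoods.** $\mathcal N^2(\beta)=\{z=(x,s)\in\mathcal P_{++}\times\mathcal D_{++}:\|xs/\overline\mu(z)-\mathbf 1\|\le\beta\}$, $\mathcal N^{-\infty}(\theta)=\{z=(x,s)\in\mathcal P_{++}\times\mathcal D_{++}: xs\ge(1-\theta)\overline\mu(z)\mathbf 1\}$; $\overline{\mathcal N}^2(\beta)$, $\overline{\mathcal N}^{-\infty}(\theta)$ are their closures. **$\rho$-SVD problem** ($\rho\ge1$). Input: a real $p\times q$ matrix $M$. Output: a matrix $C\in\mathbb R^{q\times q}$ whose columns are nonzero and pairwise orthogonal, and a non-increasing $t\in\mathbb R^q_+$, such that $\|Mu\|\le t_i\|u\|$ for all $u$ in the span of columns $i,\dots,q$ of $C$ and all $i\in[q]$, and $\rho^{-1}t\le\sigma(M)\le t$, where $\sigma(M)\in\mathbb R^q$ lists the singular values of $M$ in non-increasing order, padded by zeros. **Algorithm SLLS-IPM.** Parameters: $\beta\in(0,1/6]$ and $\rho\ge1$, with a $\rho$-SVD solver as subroutine; in this statement $\rho=2$. Start at $(x,s)=z^0\in\mathcal N^2(\beta)$. To reach target $\mu_1\ge0$, repeat the following iteration while $\overline\mu(x,s)>\mu_1$. 1. (Corrector) Let $(\Delta x^c,\Delta s^c)\in W\times W^\perp$ be the unique solution of $s\Delta x+x\Delta s=\overline\mu(x,s)\mathbf 1-xs$; set $(x,s)\leftarrow(x+\Delta x^c,s+\Delta s^c)$. Let $\mu=\overline\mu(x,s)$.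 2. (Affine scaling) Let $(\Delta x^a,\Delta s^a)\in W\times W^\perp$ be the unique solution of $s\Delta x+x\Delta s=-xs$, and choose $\alpha^a\in(0,1]$ with $\max\{\frac{\beta}{3\sqrt n},1-\frac{3\|\Delta x^a\Delta s^a\|}{\beta\mu}\}\le\alpha^a\le\max\{\frac{\beta}{2\sqrt n},1-\frac{2\|\Delta x^a\Delta s^a\|}{\beta\mu}\}$. 3. (Partition) $B=\{i:|\Delta x^a_i/x_i|<|\Delta s^a_i/s_i|\}$, $N=[n]\setminus B$. 4. (Cheap lift subspaces $V\subseteq W$, $U\subseteq W^\perp$) If $B=\emptyset$: $V=W$, $U=\{0\}$. If $N=\emptyset$: $V=\{0\}$, $U=W^\perp$. Otherwise let $P$ and $P^\perp=I-P$ be the orthogonal projection matrices onto $x^{-1}W$ and $xW^\perp$; let $\bar L=P_{\cdot,N}(P_{N,N})^+$, $\bar L^\perp=P^\perp_{\cdot,B}(P^\perp_{B,B})^+$ ($^+$ is the Moore–Penrose pseudoinverse), $\bar\ell=\bar L_{B,\cdot}$, $\bar\ell^\perp=\bar L^\perp_{N,\cdot}$. Let $(C,t)$, $(C',t')$ be $\rho$-SVD outputs for $\bar\ell\in\mathbb R^{B\times N}$ and $\bar\ell^\perp\in\mathbb R^{N\times B}$, $p=|\{i:t_i\le1\}|$, $q=|\{i:t'_i\le1\}|$. Set $V=x\,\bar L(\text{span of the last }p\text{ columns of }C)$ and $U=x^{-1}\bar L^\perp(\text{span of the last }q\text{ columns of }C')$. 5. (Subspace layered least squares) With $\hat x=\sqrt{x\mu/s}$,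 $\hat s=\sqrt{s\mu/x}$, let $\Delta x^\ell=\arg\min_{\delta\in V}\|(x_N+\delta_N)/\hat x_N\|$ and $\Delta s^\ell=\arg\min_{\delta\in U}\|(s_B+\delta_B)/\hat s_B\|$ (minimizers are unique). Let $\epsilon=\|(x+\Delta x^\ell)(s+\Delta s^\ell)\|/\mu$. If $\max\{\|\Delta x^\ell\Delta s^\ell\|/\mu,\epsilon\}\le\beta/9$ choose $\alpha^\ell\in[1-\frac{9\epsilon}{\beta},1-\frac{8\epsilon}{\beta}]$, otherwise $\alpha^\ell=0$. 6. Replace $(x,s)$ by whichever of $(x+\alpha^a\Delta x^a,s+\alpha^a\Delta s^a)$ and $(x+\alpha^\ell\Delta x^\ell,s+\alpha^\ell\Delta s^\ell)$ has smaller $\overline\mu$ (the second one in case of a tie). *)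

theory Defs
  imports
    "HOL-Analysis.L2_Norm"
    "Jordan_Normal_Form.DL_Rank"
    "Jordan_Normal_Form.DL_Submatrix"
    "Jordan_Normal_Form.Char_Poly"
    "Jordan_Normal_Form.Matrix_Kernel"
begin

text \<open>
  The constant of the complexity bound does not depend on the dimensions, so the dimensions have to
  be quantifiable natural numbers; hence vectors and matrices are those of \<open>Jordan_Normal_Form\<close>.
  Coordinates are numbered from 0.
\<close>

definition vtimes :: "real vec \<Rightarrow> real vec \<Rightarrow> real vec" (infixl "\<star>" 75) where
  "x \<star> y = vec (dim_vec x) (\<lambda>i. x $ i * y $ i)"

definition vdivide :: "real vec \<Rightarrow> real vec \<Rightarrow> real vec" (infixl "\<oslash>" 75) where
  "x \<oslash> y = vec (dim_vec x) (\<lambda>i. x $ i / y $ i)"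

definition vinv :: "real vec \<Rightarrow> real vec" where
  "vinv x = map_vec inverse x"

definition vsqrt :: "real vec \<Rightarrow> real vec" where
  "vsqrt x = map_vec sqrt x"

definition ones :: "nat \<Rightarrow> real vec" where
  "ones n = vec n (\<lambda>_. 1)"

definition vnorm :: "real vec \<Rightarrow> real" where
  "vnorm v = L2_set (\<lambda>i. v $ i) {..<dim_vec v}"

definition vpos :: "real vec \<Rightarrow> bool" where
  "vpos x \<longleftrightarrow> (\<forall>i<dim_vec x. 0 < x $ i)"

definition nonincreasing_vec :: "real vec \<Rightarrow> bool" where
  "nonincreasing_vec t \<longleftrightarrow> (\<forall>i j. i \<le> j \<longrightarrow> j < dim_vec t \<longrightarrow> t $ j \<le> t $ i)"

abbreviation vspan :: "nat \<Rightarrow> real vec set \<Rightarrow> real vec set" where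
  "vspan n S \<equiv> LinearCombinations.module.span class_ring (module_vec TYPE(real) n) S"


subsection \<open>Projections, pseudoinverses, singular values\<close>

definition orth_proj :: "nat \<Rightarrow> real vec set \<Rightarrow> real mat" where
  "orth_proj n S = (THE P. P \<in> carrier_mat n n \<and>
     (\<forall>v\<in>carrier_vec n. P *\<^sub>v v \<in> S \<and> (\<forall>w\<in>S. (v - P *\<^sub>v v) \<bullet> w = 0)))"

definition pinv :: "real mat \<Rightarrow> real mat" where
  "pinv M = (THE X. X \<in> carrier_mat (dim_col M) (dim_row M) \<and>
     M * X * M = M \<and> X * M * X = X \<and> (M * X)\<^sup>T = M * X \<and> (X * M)\<^sup>T = X * M)"

text \<open>
  Square roots of the eigenvalues of \<open>M\<^sup>T M\<close>, with multiplicity. There is one entry per column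
  of \<open>M\<close>, so the padding by zeros is built in.
\<close>

definition singular_values :: "real mat \<Rightarrow> real vec" where
  "singular_values M = (THE \<sigma>. \<sigma> \<in> carrier_vec (dim_col M) \<and> 0\<^sub>v (dim_col M) \<le> \<sigma> \<and>
     nonincreasing_vec \<sigma> \<and>
     char_poly (M\<^sup>T * M) = (\<Prod>i<dim_col M. [: - ((\<sigma> $ i)\<^sup>2), 1 :]))"

definition rho_svd :: "real \<Rightarrow> real mat \<Rightarrow> real mat \<Rightarrow> real vec \<Rightarrow> bool" where
  "rho_svd \<rho> M C t \<longleftrightarrow> (let q = dim_col M in
     C \<in> carrier_mat q q \<and>
     (\<forall>i<q. col C i \<noteq> 0\<^sub>v q) \<and>
     (\<forall>i<q. \<forall>j<q. i \<noteq> j \<longrightarrow> col C i \<bullet> col C j = 0) \<and>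
     t \<in> carrier_vec q \<and> 0\<^sub>v q \<le> t \<and> nonincreasing_vec t \<and>
     (\<forall>i<q. \<forall>u\<in>vspan q {col C j | j. i \<le> j \<and> j < q}. vnorm (M *\<^sub>v u) \<le> t $ i * vnorm u) \<and>
     (1 / \<rho>) \<cdot>\<^sub>v t \<le> singular_values M \<and> singular_values M \<le> t)"

text \<open>A solver may be nondeterministic: it is the set of the answers it may give.\<close>

definition svd_solver :: "real \<Rightarrow> (real mat \<Rightarrow> (real mat \<times> real vec) set) \<Rightarrow> bool" where
  "svd_solver \<rho> svd \<longleftrightarrow> (\<forall>M. svd M \<noteq> {} \<and> (\<forall>(C, t)\<in>svd M. rho_svd \<rho> M C t))"

definition last_cols_span :: "real mat \<Rightarrow> nat \<Rightarrow> real vec set" where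
  "last_cols_span C p = vspan (dim_row C) {col C j | j. dim_col C - p \<le> j \<and> j < dim_col C}"


subsection \<open>Linear programs\<close>

definition primal_set :: "real mat \<Rightarrow> real vec \<Rightarrow> real vec set" where
  "primal_set A b = {x \<in> carrier_vec (dim_col A). A *\<^sub>v x = b \<and> 0\<^sub>v (dim_col A) \<le> x}"

definition dual_pairs :: "real mat \<Rightarrow> real vec \<Rightarrow> (real vec \<times> real vec) set" where
  "dual_pairs A c = {(y, s). y \<in> carrier_vec (dim_row A) \<and> s \<in> carrier_vec (dim_col A) \<and>
     A\<^sup>T *\<^sub>v y + s = c \<and> 0\<^sub>v (dim_col A) \<le> s}"

definition dual_set :: "real mat \<Rightarrow> real vec \<Rightarrow> real vec set" where
  "dual_set A c = {s. \<exists>y. (y, s) \<in> dual_pairs A c}"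

definition primal_pos :: "real mat \<Rightarrow> real vec \<Rightarrow> real vec set" where
  "primal_pos A b = {x \<in> primal_set A b. vpos x}"

definition dual_pos :: "real mat \<Rightarrow> real vec \<Rightarrow> real vec set" where
  "dual_pos A c = {s \<in> dual_set A c. vpos s}"

definition standard_lp :: "nat \<Rightarrow> nat \<Rightarrow> real mat \<Rightarrow> real vec \<Rightarrow> real vec \<Rightarrow> bool" where
  "standard_lp m n A b c \<longleftrightarrow>
     A \<in> carrier_mat m n \<and> b \<in> carrier_vec m \<and> c \<in> carrier_vec n \<and>
     m \<le> n \<and> vec_space.rank m A = m \<and>
     primal_set A b \<noteq> {} \<and> bdd_below ((\<lambda>x. c \<bullet> x) ` primal_set A b) \<and>
     dual_pairs A c \<noteq> {} \<and> bdd_above ((\<lambda>(y, s). b \<bullet> y) ` dual_pairs A c) \<and>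
     primal_pos A b \<noteq> {} \<and> dual_pos A c \<noteq> {}"

definition W :: "real mat \<Rightarrow> real vec set" where
  "W A = mat_kernel A"

definition Wperp :: "real mat \<Rightarrow> real vec set" where
  "Wperp A = (\<lambda>y. A\<^sup>T *\<^sub>v y) ` carrier_vec (dim_row A)"

definition mubar :: "real vec \<times> real vec \<Rightarrow> real" where
  "mubar z = (fst z \<bullet> snd z) / real (dim_vec (fst z))"

definition pair_closure ::
  "nat \<Rightarrow> (real vec \<times> real vec) set \<Rightarrow> (real vec \<times> real vec) set" where
  "pair_closure n S = {(x, s). x \<in> carrier_vec n \<and> s \<in> carrier_vec n \<and>
     (\<forall>e>0. \<exists>(x', s')\<in>S. vnorm (x' - x) < e \<and> vnorm (s' - s) < e)}"

definition N2 ::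
  "real mat \<Rightarrow> real vec \<Rightarrow> real vec \<Rightarrow> real \<Rightarrow> (real vec \<times> real vec) set" where
  "N2 A b c \<beta> = {(x, s) \<in> primal_pos A b \<times> dual_pos A c.
     vnorm ((1 / mubar (x, s)) \<cdot>\<^sub>v (x \<star> s) - ones (dim_col A)) \<le> \<beta>}"

definition Ninf ::
  "real mat \<Rightarrow> real vec \<Rightarrow> real vec \<Rightarrow> real \<Rightarrow> (real vec \<times> real vec) set" where
  "Ninf A b c \<theta> = {(x, s) \<in> primal_pos A b \<times> dual_pos A c.
     ((1 - \<theta>) * mubar (x, s)) \<cdot>\<^sub>v ones (dim_col A) \<le> x \<star> s}"

text \<open>
  Each piece is affine in the parameter. When \<open>mubar (\<Gamma> \<mu>) = \<mu>\<close> on a primal-dual feasible curve,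
  this is no restriction on the parametrization: \<open>mubar\<close> is affine along feasible line segments.
  Consecutive pieces share their breakpoint, so the curve is continuous.
\<close>

definition piecewise_linear_curve ::
  "nat \<Rightarrow> (real \<Rightarrow> real vec \<times> real vec) \<Rightarrow> real \<Rightarrow> real \<Rightarrow> nat \<Rightarrow> bool" where
  "piecewise_linear_curve n \<Gamma> l u T \<longleftrightarrow>
     (\<exists>r :: nat \<Rightarrow> real. r 0 = l \<and> r T = u \<and> (\<forall>i<T. r i < r (Suc i)) \<and>
        (\<forall>i<T. \<exists>x\<in>carrier_vec n. \<exists>dx\<in>carrier_vec n. \<exists>s\<in>carrier_vec n. \<exists>ds\<in>carrier_vec n.
           \<forall>\<mu>\<in>{r i..r (Suc i)} \<inter> {l<..<u}. \<Gamma> \<mu> = (x + \<mu> \<cdot>\<^sub>v dx, s + \<mu> \<cdot>\<^sub>v ds)))"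


subsection \<open>The algorithm SLLS-IPM\<close>

text \<open>
  The algorithm leaves choices open (step lengths, answers of the solver), so its steps are
  relations.
\<close>

definition newton_dir ::
  "real mat \<Rightarrow> real vec \<Rightarrow> real vec \<Rightarrow> real vec \<Rightarrow> real vec \<Rightarrow> real vec \<Rightarrow> bool" where
  "newton_dir A x s r dx ds \<longleftrightarrow> dx \<in> W A \<and> ds \<in> Wperp A \<and> s \<star> dx + x \<star> ds = r"

definition cheap_lift_spaces ::
  "real mat \<Rightarrow> (real mat \<Rightarrow> (real mat \<times> real vec) set) \<Rightarrow> real vec \<Rightarrow> nat set \<Rightarrow> nat set \<Rightarrow>
   real vec set \<Rightarrow> real vec set \<Rightarrow> bool" where
  "cheap_lift_spaces A svd x B N V U \<longleftrightarrow> (let n = dim_col A in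
     if B = {} then V = W A \<and> U = {0\<^sub>v n}
     else if N = {} then V = {0\<^sub>v n} \<and> U = Wperp A
     else
       let P = orth_proj n ((\<lambda>w. vinv x \<star> w) ` W A);
           P' = 1\<^sub>m n - P;
           L = submatrix P UNIV N * pinv (submatrix P N N);
           L' = submatrix P' UNIV B * pinv (submatrix P' B B)
       in \<exists>(C, t)\<in>svd (submatrix L B UNIV). \<exists>(C', t')\<in>svd (submatrix L' N UNIV).
         (let p = card {i. i < dim_vec t \<and> t $ i \<le> 1};
              q = card {i. i < dim_vec t' \<and> t' $ i \<le> 1}
          in V = (\<lambda>w. x \<star> (L *\<^sub>v w)) ` last_cols_span C p \<and>
             U = (\<lambda>w. vinv x \<star> (L' *\<^sub>v w)) ` last_cols_span C' q))"

definition slls_step ::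
  "real mat \<Rightarrow> real \<Rightarrow> (real mat \<Rightarrow> (real mat \<times> real vec) set) \<Rightarrow>
   real vec \<times> real vec \<Rightarrow> real vec \<times> real vec \<Rightarrow> bool" where
  "slls_step A \<beta> svd z0 z1 \<longleftrightarrow>
    (\<exists>x0 s0 dxc dsc x s dxa dsa \<alpha>a V U dxl dsl \<alpha>l. let
       n = dim_col A;
       \<mu> = mubar (x, s);
       r = vnorm (dxa \<star> dsa) / (\<beta> * \<mu>);
       B = {i. i < n \<and> \<bar>dxa $ i / x $ i\<bar> < \<bar>dsa $ i / s $ i\<bar>};
       N = {..<n} - B;
       xh = vsqrt ((\<mu> \<cdot>\<^sub>v x) \<oslash> s);
       sh = vsqrt ((\<mu> \<cdot>\<^sub>v s) \<oslash> x);
       \<epsilon> = vnorm ((x + dxl) \<star> (s + dsl)) / \<mu>;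
       za = (x + \<alpha>a \<cdot>\<^sub>v dxa, s + \<alpha>a \<cdot>\<^sub>v dsa);
       zl = (x + \<alpha>l \<cdot>\<^sub>v dxl, s + \<alpha>l \<cdot>\<^sub>v dsl)
     in
       z0 = (x0, s0) \<and>
       newton_dir A x0 s0 (mubar z0 \<cdot>\<^sub>v ones n - x0 \<star> s0) dxc dsc \<and>
       x = x0 + dxc \<and> s = s0 + dsc \<and>
       newton_dir A x s (- (x \<star> s)) dxa dsa \<and>
       0 < \<alpha>a \<and> \<alpha>a \<le> 1 \<and>
       max (\<beta> / (3 * sqrt (real n))) (1 - 3 * r) \<le> \<alpha>a \<and>
       \<alpha>a \<le> max (\<beta> / (2 * sqrt (real n))) (1 - 2 * r) \<and>
       cheap_lift_spaces A svd x B N V U \<and>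
       is_arg_min (\<lambda>\<delta>. L2_set (\<lambda>i. (x $ i + \<delta> $ i) / xh $ i) N) (\<lambda>\<delta>. \<delta> \<in> V) dxl \<and>
       is_arg_min (\<lambda>\<delta>. L2_set (\<lambda>i. (s $ i + \<delta> $ i) / sh $ i) B) (\<lambda>\<delta>. \<delta> \<in> U) dsl \<and>
       (if max (vnorm (dxl \<star> dsl) / \<mu>) \<epsilon> \<le> \<beta> / 9
        then 1 - 9 * \<epsilon> / \<beta> \<le> \<alpha>l \<and> \<alpha>l \<le> 1 - 8 * \<epsilon> / \<beta>
        else \<alpha>l = 0) \<and>
       z1 = (if mubar za < mubar zl then za else zl))"

text \<open>\<open>zs 0, \<dots>, zs k\<close> are the iterates of the first \<open>k\<close> iterations of a (possibly unfinished)
  execution from \<open>z\<close> towards the target \<open>\<mu>\<^sub>1\<close>.\<close>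

definition slls_run ::
  "real mat \<Rightarrow> real \<Rightarrow> (real mat \<Rightarrow> (real mat \<times> real vec) set) \<Rightarrow> real \<Rightarrow>
   real vec \<times> real vec \<Rightarrow> nat \<Rightarrow> (nat \<Rightarrow> real vec \<times> real vec) \<Rightarrow> bool" where
  "slls_run A \<beta> svd \<mu>1 z k zs \<longleftrightarrow> zs 0 = z \<and>
     (\<forall>j<k. \<mu>1 < mubar (zs j) \<and> slls_step A \<beta> svd (zs j) (zs (Suc j)))"

text \<open>Whatever choices are made, the execution never gets stuck, it stops after at most \<open>K\<close>
  iterations, and the point at which it stops lies in \<open>S\<close>.\<close>

definition slls_finds_within ::
  "real mat \<Rightarrow> real \<Rightarrow> (real mat \<Rightarrow> (real mat \<times> real vec) set) \<Rightarrow> real \<Rightarrow>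
   real vec \<times> real vec \<Rightarrow> (real vec \<times> real vec) set \<Rightarrow> real \<Rightarrow> bool" where
  "slls_finds_within A \<beta> svd \<mu>1 z S K \<longleftrightarrow>
     (\<forall>k zs. slls_run A \<beta> svd \<mu>1 z k zs \<longrightarrow>
        real k \<le> K \<and>
        (if mubar (zs k) \<le> \<mu>1 then zs k \<in> S else \<exists>z'. slls_step A \<beta> svd (zs k) z'))"

end

theory Submission
  imports Defs
begin

text \<open>
  On one linear segment of the curve each coordinate is polarized: either \<open>x\<^sub>i\<close> or \<open>s\<^sub>i\<close> stays, up to a
  factor polynomial in \<open>n / (1 - \<theta>)\<close>, as large as at the end with the larger parameter. The orthogonality
  relation for two feasible pairs carries this over to all iterates in the segment. Hence, as the duality
  measure decreases along the segment, the singular values of both cheap lifts for the polarized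
  partition decrease, up to polynomial factors, at least as fast as the duality measure.
  Call a singular value large when it exceeds a threshold \<open>1 / \<Omega>\<close> with \<open>\<Omega>\<close> of order \<open>n\<^sup>2 / \<beta>\<close>. If the number
  of large singular values is the same before a step and at a much later iterate, then all large ones
  are huge compared with the progress of that step, so there is a gap in the spectrum. The subspaces
  cut out at this gap contain an almost optimal direction towards the lower end of the segment,
  the affine scaling direction recognizes the polarized partition, and the layered least squares step
  makes more progress than was assumed, a contradiction. So the number of large singular
  values, at most \<open>2 * n\<close>, drops after every \<open>O(sqrt n / \<beta> * ln (n / (\<beta> * (1 - \<theta>))))\<close> iterations in a segment.
\<close>

section \<open>Symmetric real matrices\<close>

text \<open>Lifts at different iterates belong to differently scaled subspaces, so their singular
  values cannot be compared directly; this shapes the proof. A count of large singular values is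
  therefore encoded by a certificate: a k-dimensional family of directions in the unscaled subspace
  all of whose lifts are long in weighted coordinates. Only the weights depend on the iterate, so
  coordinatewise ratios carry a certificate from one iterate to another, and two dimension counts of
  Courant-Fischer type tie it to the solver's output. Quantifying over all lifts also keeps
  projections and pseudoinverses out of the comparison.

  The solver's factor 2 and the fixed threshold 1 of the algorithm do no harm once the gap contains
  a whole interval around 1: the cut then falls into the gap.

  The projections, pseudoinverses and singular values of the algorithm are definite descriptions.
  Their existence and uniqueness rest on diagonalizing symmetric matrices, which explains the role
  of the spectral theorem.\<close>

lemma scalar_prod_self_nonneg: "0 \<le> (v::real vec) \<bullet> v"
  by (auto simp: scalar_prod_def intro: sum_nonneg)

lemma scalar_prod_self_eq_0:
  assumes "(v::real vec) \<in> carrier_vec n"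
  shows "v \<bullet> v = 0 \<longleftrightarrow> v = 0\<^sub>v n"
  using conjugate_square_eq_0_vec[OF assms] by (simp add: conjugate_vec_def)

lemma vnorm_def': "vnorm v = sqrt (v \<bullet> v)"
  by (simp add: vnorm_def L2_set_def scalar_prod_def power2_eq_square atLeast0LessThan)

text \<open>The characteristic polynomial has a complex root \<open>z\<close>. Pairing an
  eigenvector with its conjugate and moving the symmetric matrix across gives
  \<open>z = cnj z\<close>, so the root is real and hence has a real eigenvector, which is
  normalized.\<close>

lemma real_symmetric_eigenvector:
  assumes S: "(S :: real mat) \<in> carrier_mat n n" and sym: "S\<^sup>T = S" and n: "0 < n"
  obtains e u where "u \<in> carrier_vec n" "u \<bullet> u = 1" "S *\<^sub>v u = e \<cdot>\<^sub>v u"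
proof -
  let ?S = "map_mat complex_of_real S"
  have SC: "?S \<in> carrier_mat n n" using S by auto
  have "S $$ (j, i) = S $$ (i, j)" if "i < n" "j < n" for i j
    using arg_cong[OF sym, of "\<lambda>A. A $$ (i, j)"] S that by simp
  then have symC: "?S\<^sup>T = ?S" using S by (intro eq_matI) auto
  have "degree (char_poly ?S) = n" using degree_monic_char_poly[OF SC] by auto
  then obtain z where z: "poly (char_poly ?S) z = 0"
    using fundamental_theorem_of_algebra[of "char_poly ?S"] n by (auto simp: constant_degree)
  then have "eigenvalue ?S z" using eigenvalue_root_char_poly[OF SC] by simp
  then obtain v where v: "v \<in> carrier_vec n" "v \<noteq> 0\<^sub>v n" "?S *\<^sub>v v = z \<cdot>\<^sub>v v"
    using SC by (auto simp: eigenvalue_def eigenvector_def)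
  let ?c = "conjugate v"
  have c: "?c \<in> carrier_vec n" using v by simp
  have Sc: "?S *\<^sub>v ?c = cnj z \<cdot>\<^sub>v ?c"
  proof (rule eq_vecI)
    fix i assume i: "i < dim_vec (cnj z \<cdot>\<^sub>v ?c)"
    then have i: "i < n" using v by auto
    have "cnj ((?S *\<^sub>v v) $ i) = cnj ((z \<cdot>\<^sub>v v) $ i)" using v(3) by simp
    then show "(?S *\<^sub>v ?c) $ i = (cnj z \<cdot>\<^sub>v ?c) $ i"
      using i v(1) S by (simp add: scalar_prod_def)
  qed (use S v in auto)
  have "(?S *\<^sub>v v) \<bullet> ?c = v \<bullet> (?S *\<^sub>v ?c)"
    using transpose_vec_mult_scalar[OF SC c v(1)] by (simp add: symC)
  then have "z * (v \<bullet> ?c) = cnj z * (v \<bullet> ?c)" unfolding v(3) Sc using v(1) c by simp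
  moreover have "v \<bullet> ?c \<noteq> 0" using v conjugate_square_eq_0_vec[of v n] by auto
  ultimately have "z = cnj z" by simp
  then obtain e where e: "z = complex_of_real e" by (metis Reals_cases Reals_cnj_iff)
  have "poly (char_poly S) e = 0"
    using z unfolding e of_real_hom.char_poly_hom[OF S] by simp
  then have "eigenvalue S e" using eigenvalue_root_char_poly[OF S] by simp
  then obtain w where w: "w \<in> carrier_vec n" "w \<noteq> 0\<^sub>v n" "S *\<^sub>v w = e \<cdot>\<^sub>v w"
    using S by (auto simp: eigenvalue_def eigenvector_def)
  have ww: "w \<bullet> w > 0"
    using scalar_prod_self_nonneg[of w] scalar_prod_self_eq_0[OF w(1)] w(2) by linarith
  define u where "u = (1 / sqrt (w \<bullet> w)) \<cdot>\<^sub>v w"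
  show thesis
  proof
    show "u \<in> carrier_vec n" using w by (simp add: u_def)
    show "u \<bullet> u = 1" using w(1) ww by (simp add: u_def)
    show "S *\<^sub>v u = e \<cdot>\<^sub>v u"
      using S w(1,3) by (simp add: u_def mult_mat_vec smult_smult_assoc mult.commute)
  qed
qed

definition diagm :: "nat \<Rightarrow> (nat \<Rightarrow> real) \<Rightarrow> real mat" where
  "diagm n d = mat n n (\<lambda>(i, j). if i = j then d i else 0)"

lemma diagm_carrier [simp]: "diagm n d \<in> carrier_mat n n" by (simp add: diagm_def)

lemma diagm_dim [simp]: "dim_row (diagm n d) = n" "dim_col (diagm n d) = n"
  by (simp_all add: diagm_def)

lemma transpose_diagm [simp]: "(diagm n d)\<^sup>T = diagm n d"
  by (rule eq_matI) (auto simp: diagm_def)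

lemma diagm_mult_vec_index:
  assumes "v \<in> carrier_vec n" "i < n"
  shows "(diagm n d *\<^sub>v v) $ i = d i * v $ i"
proof -
  have "(diagm n d *\<^sub>v v) $ i = (\<Sum>j = 0..<n. (if i = j then d i else 0) * v $ j)"
    using assms by (simp add: diagm_def scalar_prod_def)
  also have "\<dots> = (\<Sum>j = 0..<n. if i = j then d i * v $ j else 0)"
    by (intro sum.cong) auto
  finally show ?thesis using assms by simp
qed

lemma diagm_mult:
  "diagm n d * diagm n e = diagm n (\<lambda>i. d i * e i)"
proof (rule eq_matI)
  fix i j assume ij: "i < dim_row (diagm n (\<lambda>i. d i * e i))" "j < dim_col (diagm n (\<lambda>i. d i * e i))"
  have "(diagm n d * diagm n e) $$ (i, j) = (\<Sum>k = 0..<n. (if i = k then d i else 0) * (if k = j then e k else 0))"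
    using ij by (simp add: diagm_def scalar_prod_def)
  also have "\<dots> = (\<Sum>k = 0..<n. if i = k then d i * (if k = j then e k else 0) else 0)"
    by (intro sum.cong) auto
  finally show "(diagm n d * diagm n e) $$ (i, j) = diagm n (\<lambda>i. d i * e i) $$ (i, j)"
    using ij by (simp add: diagm_def)
qed auto

text \<open>The Householder reflection along \<open>u - unit_vec n 0\<close>. Being symmetric and
  its own inverse, it can be used for conjugation without any separate inverse, which is how the
  induction of the spectral theorem uses it.\<close>

lemma unit_vec_reflection:
  assumes u: "(u :: real vec) \<in> carrier_vec n" and uu: "u \<bullet> u = 1" and n: "0 < n"
  obtains H where "H \<in> carrier_mat n n" "H\<^sup>T = H" "H * H = 1\<^sub>m n" "H *\<^sub>v unit_vec n 0 = u"
proof (cases "u = unit_vec n 0")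
  case True
  then show ?thesis using that[of "1\<^sub>m n"] by auto
next
  case False
  define e where "e = (unit_vec n 0 :: real vec)"
  have e: "e \<in> carrier_vec n" and ee: "e \<bullet> e = 1" using n by (auto simp: e_def)
  define v where "v = u - e"
  have v: "v \<in> carrier_vec n" using u e by (simp add: v_def)
  have "v \<noteq> 0\<^sub>v n"
  proof
    assume "v = 0\<^sub>v n"
    then have "u $ i = e $ i" if "i < n" for i
    proof -
      have "v $ i = 0" using that \<open>v = 0\<^sub>v n\<close> by simp
      then show ?thesis using that u e by (simp add: v_def)
    qed
    then have "u = e" using u e by (intro eq_vecI) auto
    then show False using False e_def by simp
  qed
  define w where "w = v \<bullet> v"
  have w: "w > 0"
    using scalar_prod_self_nonneg[of v] scalar_prod_self_eq_0[OF v] \<open>v \<noteq> 0\<^sub>v n\<close>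
    unfolding w_def by linarith
  have wue: "w = 2 - 2 * (u \<bullet> e)"
    unfolding w_def v_def using u e ee uu
    by (simp add: minus_scalar_prod_distrib[of _ n] scalar_prod_minus_distrib[of _ n] comm_scalar_prod[of e n u])
  \<comment> \<open>With this value the coefficient \<open>2 / w * (v \<bullet> e)\<close> of the
    reflection is \<open>- 1\<close>, so \<open>e\<close> is mapped to
    \<open>e + v = u\<close>.\<close>
  have ve: "v \<bullet> e = - (w / 2)"
    unfolding wue unfolding v_def using u e ee uu
    by (simp add: minus_scalar_prod_distrib[of _ n] field_simps)
  define H where "H = mat n n (\<lambda>(i,j). (if i = j then 1 else 0) - 2 / w * v $ i * v $ j)"
  have H: "H \<in> carrier_mat n n" by (simp add: H_def)
  have Hx: "H *\<^sub>v x = x - (2 / w * (v \<bullet> x)) \<cdot>\<^sub>v v" if x: "x \<in> carrier_vec n" for x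
  proof (rule eq_vecI)
    fix i assume "i < dim_vec (x - (2 / w * (v \<bullet> x)) \<cdot>\<^sub>v v)"
    then have i: "i < n" using v by simp
    have "(H *\<^sub>v x) $ i = (\<Sum>j = 0..<n. ((if i = j then 1 else 0) - 2 / w * v $ i * v $ j) * x $ j)"
      using i x by (simp add: H_def scalar_prod_def)
    also have "\<dots> = (\<Sum>j = 0..<n. (if i = j then x $ j else 0)) - (\<Sum>j = 0..<n. 2 / w * v $ i * (v $ j * x $ j))"
      unfolding sum_subtractf[symmetric] by (intro sum.cong) (auto simp: algebra_simps)
    also have "(\<Sum>j = 0..<n. 2 / w * v $ i * (v $ j * x $ j)) = 2 / w * v $ i * (v \<bullet> x)"
      using x by (simp add: scalar_prod_def sum_distrib_left mult.assoc)
    finally show "(H *\<^sub>v x) $ i = (x - (2 / w * (v \<bullet> x)) \<cdot>\<^sub>v v) $ i"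
      using i x v by (simp add: mult.commute)
  qed (use H x v in auto)
  have HH: "H *\<^sub>v (H *\<^sub>v x) = x" if x: "x \<in> carrier_vec n" for x
  proof -
    define y where "y = x - (2 / w * (v \<bullet> x)) \<cdot>\<^sub>v v"
    have y: "y \<in> carrier_vec n" using x v by (simp add: y_def)
    have "v \<bullet> y = - (v \<bullet> x)"
      unfolding y_def using x v w by (simp add: scalar_prod_minus_distrib[of _ n] w_def[symmetric])
    then show ?thesis unfolding Hx[OF x] y_def[symmetric] Hx[OF y]
      by (intro eq_vecI) (use x v in \<open>auto simp: y_def\<close>)
  qed
  show ?thesis
  proof (rule that[OF H])
    show "H\<^sup>T = H" by (rule eq_matI) (auto simp: H_def)
    show "H * H = 1\<^sub>m n"
    proof (rule eq_matI)
      fix i j assume ij: "i < dim_row (1\<^sub>m n :: real mat)" "j < dim_col (1\<^sub>m n :: real mat)"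
      have "col H j = H *\<^sub>v unit_vec n j"
        by (rule eq_vecI) (use H ij in auto)
      then have "col (H * H) j = H *\<^sub>v (H *\<^sub>v unit_vec n j)"
        using H ij col_mult2[OF H H, of j] by simp
      then have c: "col (H * H) j = unit_vec n j" using HH by simp
      have "(H * H) $$ (i, j) = col (H * H) j $ i" using ij H by auto
      also have "\<dots> = 1\<^sub>m n $$ (i, j)" unfolding c using ij by auto
      finally show "(H * H) $$ (i, j) = 1\<^sub>m n $$ (i, j)" .
    qed (use H in auto)
    have "H *\<^sub>v e = u" unfolding Hx[OF e] ve using w u e
      by (intro eq_vecI) (auto simp: v_def)
    then show "H *\<^sub>v unit_vec n 0 = u" by (simp add: e_def)
  qed
qed


lemma mat_eqI_mult_vec:
  assumes A: "(A :: real mat) \<in> carrier_mat m n" and B: "B \<in> carrier_mat m n"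
    and eq: "\<And>v. v \<in> carrier_vec n \<Longrightarrow> A *\<^sub>v v = B *\<^sub>v v"
  shows "A = B"
proof (rule eq_matI)
  fix i j assume ij: "i < dim_row B" "j < dim_col B"
  have "(A *\<^sub>v unit_vec n j) $ i = (B *\<^sub>v unit_vec n j) $ i" by (simp add: eq)
  then show "A $$ (i, j) = B $$ (i, j)" using A B ij by simp
qed (use A B in auto)

text \<open>Deflation: conjugation by the reflection that carries the first unit vector to an
  eigenvector splits off a 1 by 1 block, and the induction hypothesis diagonalizes the rest.\<close>

theorem real_spectral:
  assumes "(S :: real mat) \<in> carrier_mat n n" and "S\<^sup>T = S"
  shows "\<exists>Q d. Q \<in> carrier_mat n n \<and> Q\<^sup>T * Q = 1\<^sub>m n \<and> Q * Q\<^sup>T = 1\<^sub>m n \<and> S = Q * diagm n d * Q\<^sup>T"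
  using assms
proof (induction n arbitrary: S)
  case 0
  then show ?case by (intro exI[of _ "1\<^sub>m 0"] exI[of _ "\<lambda>_. 0"]) auto
next
  case (Suc n S)
  obtain e u where u: "u \<in> carrier_vec (Suc n)" "u \<bullet> u = 1" "S *\<^sub>v u = e \<cdot>\<^sub>v u"
    by (rule real_symmetric_eigenvector[OF Suc.prems]) auto
  obtain H where H: "H \<in> carrier_mat (Suc n) (Suc n)" "H\<^sup>T = H" "H * H = 1\<^sub>m (Suc n)"
    and He: "H *\<^sub>v unit_vec (Suc n) 0 = u"
    using unit_vec_reflection[OF u(1,2)] by auto
  define K where "K = H * S * H"
  have S: "S \<in> carrier_mat (Suc n) (Suc n)" by fact
  have K: "K \<in> carrier_mat (Suc n) (Suc n)" using H S by (simp add: K_def)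
  have Ksym: "K\<^sup>T = K"
    unfolding K_def using H(1,2) S Suc.prems(2)
    by (simp add: transpose_mult[of _ "Suc n" "Suc n" _ "Suc n"] assoc_mult_mat[of _ "Suc n" "Suc n" _ "Suc n" _ "Suc n"])
  have Kij: "K $$ (j, i) = K $$ (i, j)" if "i < Suc n" "j < Suc n" for i j
    using arg_cong[OF Ksym, of "\<lambda>A. A $$ (i, j)"] K that by simp
  have Ke: "K *\<^sub>v unit_vec (Suc n) 0 = e \<cdot>\<^sub>v unit_vec (Suc n) 0"
  proof -
    have "H *\<^sub>v u = unit_vec (Suc n) 0"
      unfolding He[symmetric] using H by (simp add: assoc_mult_mat_vec[symmetric])
    then show ?thesis
      unfolding K_def using H(1) S u
      by (simp add: assoc_mult_mat_vec[of _ "Suc n" "Suc n" _ "Suc n"] He mult_mat_vec[of _ "Suc n" "Suc n"])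
  qed
  have K0: "K $$ (i, 0) = (if i = 0 then e else 0)" if "i < Suc n" for i
    using arg_cong[OF Ke, of "\<lambda>v. v $ i"] K that by auto
  define S' where "S' = mat n n (\<lambda>(i, j). K $$ (Suc i, Suc j))"
  have S': "S' \<in> carrier_mat n n" by (simp add: S'_def)
  have "S'\<^sup>T = S'" by (rule eq_matI) (auto simp: S'_def Kij)
  then obtain Q d where Q: "Q \<in> carrier_mat n n" "Q\<^sup>T * Q = 1\<^sub>m n" "Q * Q\<^sup>T = 1\<^sub>m n"
    and SQ: "S' = Q * diagm n d * Q\<^sup>T"
    using Suc.IH[OF S'] by blast
  define D where "D = (\<lambda>i. case i of 0 \<Rightarrow> e | Suc i \<Rightarrow> d i)"
  define R where "R = four_block_mat (1\<^sub>m 1) (0\<^sub>m 1 n) (0\<^sub>m n 1) Q"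
  have R: "R \<in> carrier_mat (Suc n) (Suc n)" using Q unfolding R_def by auto
  have RT: "R\<^sup>T = four_block_mat (1\<^sub>m 1) (0\<^sub>m 1 n) (0\<^sub>m n 1) (Q\<^sup>T)"
    unfolding R_def by (subst transpose_four_block_mat[of _ 1 1 _ n _ n]) (use Q in auto)
  \<comment> \<open>The first column of \<open>K\<close> is a multiple of the first unit vector;
    symmetry then clears the first row as well.\<close>
  have Keq: "K = four_block_mat (diagm 1 (\<lambda>_. e)) (0\<^sub>m 1 n) (0\<^sub>m n 1) S'"
    by (rule eq_matI) (use K K0 Kij[of 0] in \<open>auto simp: diagm_def S'_def\<close>)
  have Deq: "diagm (Suc n) D = four_block_mat (diagm 1 (\<lambda>_. e)) (0\<^sub>m 1 n) (0\<^sub>m n 1) (diagm n d)"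
    by (rule eq_matI) (auto simp: diagm_def D_def split: nat.splits)
  have one: "1\<^sub>m (Suc n) = (four_block_mat (1\<^sub>m 1) (0\<^sub>m 1 n) (0\<^sub>m n 1) (1\<^sub>m n) :: real mat)"
    by (rule eq_matI) auto
  have RR: "R\<^sup>T * R = 1\<^sub>m (Suc n)"
    unfolding RT unfolding R_def one using Q
    by (subst mult_four_block_mat[of _ 1 1 _ n _ n _ _ 1 _ n]) auto
  have RR2: "R * R\<^sup>T = 1\<^sub>m (Suc n)"
    unfolding RT unfolding R_def one using Q
    by (subst mult_four_block_mat[of _ 1 1 _ n _ n _ _ 1 _ n]) auto
  have KR: "K = R * diagm (Suc n) D * R\<^sup>T"
    unfolding RT unfolding R_def Deq Keq SQ using Q
    by (subst mult_four_block_mat[of _ 1 1 _ n _ n _ _ 1 _ n]; (simp)?)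
       (subst mult_four_block_mat[of _ 1 1 _ n _ n _ _ 1 _ n];
         (simp add: left_add_zero_mat[of _ n n] mult_carrier_mat[of _ n n _ n])?)
  have S_eq: "S = H * K * H"
  proof (rule mat_eqI_mult_vec[OF S])
    fix v :: "real vec" assume v: "v \<in> carrier_vec (Suc n)"
    have HH: "H *\<^sub>v (H *\<^sub>v w) = w" if "w \<in> carrier_vec (Suc n)" for w
      using H that by (simp add: assoc_mult_mat_vec[symmetric])
    show "S *\<^sub>v v = H * K * H *\<^sub>v v"
      unfolding K_def using H(1) S v
      by (simp add: assoc_mult_mat_vec[of _ "Suc n" "Suc n" _ "Suc n"] HH)
  qed (use H K in simp)
  show ?case
  proof (intro exI conjI)
    let ?Q = "H * R"
    show "?Q \<in> carrier_mat (Suc n) (Suc n)" using H R by simp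
    have T: "?Q\<^sup>T = R\<^sup>T * H" using H R by (simp add: transpose_mult[of _ "Suc n" "Suc n" _ "Suc n"])
    note as = assoc_mult_mat[of _ "Suc n" "Suc n" _ "Suc n" _ "Suc n"]
    have "R\<^sup>T * H * (H * R) = R\<^sup>T * ((H * H) * R)" using H(1) R by (simp add: as)
    then show "?Q\<^sup>T * ?Q = 1\<^sub>m (Suc n)" unfolding T using H R RR by simp
    have "H * R * (R\<^sup>T * H) = H * ((R * R\<^sup>T) * H)" using H(1) R by (simp add: as)
    then show "?Q * ?Q\<^sup>T = 1\<^sub>m (Suc n)" unfolding T using H R RR2 by simp
    show "S = ?Q * diagm (Suc n) D * ?Q\<^sup>T"
      unfolding T S_eq KR using H R
      by (simp add: as mult_carrier_mat[of _ "Suc n" "Suc n" _ "Suc n"])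
  qed
qed

section \<open>Euclidean norms, pseudoinverses of symmetric matrices, orthogonal projections\<close>

lemma vnorm_nonneg [simp]: "0 \<le> vnorm v" by (simp add: vnorm_def)

lemma vnorm_sq: "(vnorm v)\<^sup>2 = v \<bullet> v"
  using scalar_prod_self_nonneg[of v] by (simp add: vnorm_def')

lemma vnorm_zero [simp]: "vnorm (0\<^sub>v n) = 0" by (simp add: vnorm_def')

lemma vnorm_eq_0: "v \<in> carrier_vec n \<Longrightarrow> vnorm v = 0 \<longleftrightarrow> v = 0\<^sub>v n"
  using scalar_prod_self_eq_0[of v n] scalar_prod_self_nonneg[of v] by (simp add: vnorm_def')

lemma vnorm_smult: "vnorm (a \<cdot>\<^sub>v v) = \<bar>a\<bar> * vnorm v"
  unfolding vnorm_def L2_set_def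
  by (simp add: power_mult_distrib sum_distrib_left[symmetric] real_sqrt_mult)

lemma vnorm_uminus [simp]: "vnorm (- v) = vnorm v"
  unfolding vnorm_def L2_set_def by simp

lemma vnorm_add_le:
  assumes "v \<in> carrier_vec n" "w \<in> carrier_vec n"
  shows "vnorm (v + w) \<le> vnorm v + vnorm w"
proof -
  have "vnorm (v + w) = L2_set (\<lambda>i. v $ i + w $ i) {..<n}"
    unfolding vnorm_def using assms by (intro L2_set_cong) auto
  then show ?thesis using L2_set_triangle_ineq[of "\<lambda>i. v $ i" "\<lambda>i. w $ i" "{..<n}"] assms
    by (simp add: vnorm_def)
qed

lemma vnorm_diff_le:
  assumes "v \<in> carrier_vec n" "w \<in> carrier_vec n"
  shows "vnorm (v - w) \<le> vnorm v + vnorm w"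
  using vnorm_add_le[of v n "- w"] assms minus_add_uminus_vec[of v n w] by simp

lemma vnorm_mono_sq: "v \<bullet> v \<le> w \<bullet> w \<Longrightarrow> vnorm v \<le> vnorm w"
  by (simp add: vnorm_def')

lemma scalar_prod_mult_mat:
  assumes "(A :: real mat) \<in> carrier_mat n m" "x \<in> carrier_vec m" "y \<in> carrier_vec n"
  shows "(A *\<^sub>v x) \<bullet> y = x \<bullet> (A\<^sup>T *\<^sub>v y)"
  using transpose_vec_mult_scalar[OF assms] comm_scalar_prod[of "A *\<^sub>v x" n y]
    comm_scalar_prod[of x m "A\<^sup>T *\<^sub>v y"] assms by simp

lemma conj_diagm_mult:
  assumes Q: "Q \<in> carrier_mat n n" "Q\<^sup>T * Q = 1\<^sub>m n"
  shows "(Q * diagm n d * Q\<^sup>T) * (Q * diagm n e * Q\<^sup>T) = Q * diagm n (\<lambda>i. d i * e i) * Q\<^sup>T"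
proof -
  note as = assoc_mult_mat[of _ n n _ n _ n] mult_carrier_mat[of _ n n _ n]
  have "(Q * diagm n d * Q\<^sup>T) * (Q * diagm n e * Q\<^sup>T) = Q * diagm n d * ((Q\<^sup>T * Q) * (diagm n e * Q\<^sup>T))"
    using Q(1) by (simp add: as)
  also have "\<dots> = Q * (diagm n d * diagm n e) * Q\<^sup>T"
    unfolding Q(2) using Q(1) by (simp add: as left_mult_one_mat[of _ n n])
  finally show ?thesis by (simp add: diagm_mult)
qed

lemma transpose_conj_diagm:
  assumes Q: "Q \<in> carrier_mat n n"
  shows "(Q * diagm n d * Q\<^sup>T)\<^sup>T = Q * diagm n d * Q\<^sup>T"
  using Q by (simp add: transpose_mult[of _ n n _ n] assoc_mult_mat[of _ n n _ n _ n] mult_carrier_mat[of _ n n _ n])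

lemma mat_diff_eq_0:
  assumes "(A :: real mat) \<in> carrier_mat n m" "B \<in> carrier_mat n m" "A - B = 0\<^sub>m n m"
  shows "A = B"
proof (rule eq_matI)
  fix i j assume "i < dim_row B" "j < dim_col B"
  moreover have "(A - B) $$ (i, j) = 0\<^sub>m n m $$ (i, j)" using assms(3) by simp
  ultimately show "A $$ (i, j) = B $$ (i, j)" using assms(1,2) by auto
qed (use assms in auto)

lemma vec_diff_eq_0:
  assumes "(v :: real vec) \<in> carrier_vec n" "w \<in> carrier_vec n" "v - w = 0\<^sub>v n"
  shows "v = w"
proof (rule eq_vecI)
  fix i assume "i < dim_vec w"
  moreover have "(v - w) $ i = 0\<^sub>v n $ i" using assms(3) by simp
  ultimately show "v $ i = w $ i" using assms(1,2) by auto
qed (use assms in auto)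

text \<open>In an orthonormal eigenbasis the pseudoinverse inverts the nonzero eigenvalues and keeps
  the zero ones. Since \<open>inverse 0 = 0\<close>, applying \<open>inverse\<close> to every
  eigenvalue does both.\<close>

lemma symmetric_pinv_exists:
  assumes "(S :: real mat) \<in> carrier_mat n n" "S\<^sup>T = S"
  shows "\<exists>X \<in> carrier_mat n n. X\<^sup>T = X \<and> S * X * S = S \<and> X * S * X = X \<and>
    (S * X)\<^sup>T = S * X \<and> (X * S)\<^sup>T = X * S"
proof -
  obtain Q d where Q: "Q \<in> carrier_mat n n" "Q\<^sup>T * Q = 1\<^sub>m n" and S: "S = Q * diagm n d * Q\<^sup>T"
    using real_spectral[OF assms] by blast
  show ?thesis
  proof (intro bexI conjI)
    let ?X = "Q * diagm n (\<lambda>i. inverse (d i)) * Q\<^sup>T"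
    have "a * inverse a * a = a" "inverse a * a * inverse a = inverse a" for a :: real
      by (cases "a = 0"; simp)+
    then have "(\<lambda>i. d i * inverse (d i) * d i) = d"
      "(\<lambda>i. inverse (d i) * d i * inverse (d i)) = (\<lambda>i. inverse (d i))"
      by (simp_all only:)
    then show "S * ?X * S = S" "?X * S * ?X = ?X"
      unfolding S by (simp_all only: conj_diagm_mult[OF Q])
    show "?X\<^sup>T = ?X" "(S * ?X)\<^sup>T = S * ?X" "(?X * S)\<^sup>T = ?X * S"
      unfolding S by (simp_all only: conj_diagm_mult[OF Q] transpose_conj_diagm[OF Q(1)])
    show "?X \<in> carrier_mat n n" using Q by (simp add: mult_carrier_mat[of _ n n _ n])
  qed
qed

text \<open>\<open>M * X\<close> and \<open>M * Y\<close> are orthogonal projections onto the same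
  column space, \<open>X * M\<close> and \<open>Y * M\<close> onto the same row space; transposing a
  product of two of them shows that they agree.\<close>

lemma pinv_unique:
  assumes M: "(M :: real mat) \<in> carrier_mat m n" and X: "X \<in> carrier_mat n m" and Y: "Y \<in> carrier_mat n m"
    and X4: "M * X * M = M" "X * M * X = X" "(M * X)\<^sup>T = M * X" "(X * M)\<^sup>T = X * M"
    and Y4: "M * Y * M = M" "Y * M * Y = Y" "(M * Y)\<^sup>T = M * Y" "(Y * M)\<^sup>T = Y * M"
  shows "X = Y"
proof -
  have a: "M * A * (M * B) = M * B" "A * M * (B * M) = A * M"
    if "M * A * M = M" "M * B * M = M" "A \<in> carrier_mat n m" "B \<in> carrier_mat n m" for A B
    using that M assoc_mult_mat[of "M * A" m m M n B m] assoc_mult_mat[of A n m M n "B * M" n]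
      assoc_mult_mat[of M m n B m M n] by auto
  have "(M * X)\<^sup>T = (M * X)\<^sup>T * (M * Y)\<^sup>T"
    using a(1)[OF Y4(1) X4(1) Y X] transpose_mult[of "M * Y" m m "M * X" m] M X Y by auto
  then have "M * X = M * X * (M * Y)" using X4(3) Y4(3) by simp
  then have 1: "M * X = M * Y" using a(1)[OF X4(1) Y4(1) X Y] by simp
  have "(X * M)\<^sup>T = (Y * M)\<^sup>T * (X * M)\<^sup>T"
    using a(2)[OF X4(1) Y4(1) X Y] transpose_mult[of "X * M" n n "Y * M" n] M X Y by auto
  then have "X * M = Y * M * (X * M)" using X4(4) Y4(4) by simp
  then have 2: "X * M = Y * M" using a(2)[OF Y4(1) X4(1) Y X] by simp
  have "X = Y * (M * X)" using X4(2) assoc_mult_mat[of Y n m M n X m] M X Y unfolding 2 by auto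
  also have "\<dots> = Y" using Y4(2) assoc_mult_mat[of Y n m M n Y m] M X Y unfolding 1 by auto
  finally show ?thesis .
qed

text \<open>Covers the pseudoinverses taken by the algorithm: their arguments are principal
  submatrices of orthogonal projections, which are symmetric.\<close>

lemma pinv_symmetric:
  assumes S: "(S :: real mat) \<in> carrier_mat n n" "S\<^sup>T = S"
  shows "pinv S \<in> carrier_mat n n" "S * pinv S * S = S" "pinv S * S * pinv S = pinv S"
    "(S * pinv S)\<^sup>T = S * pinv S" "(pinv S * S)\<^sup>T = pinv S * S"
proof -
  let ?P = "\<lambda>X. X \<in> carrier_mat (dim_col S) (dim_row S) \<and>
     S * X * S = S \<and> X * S * X = X \<and> (S * X)\<^sup>T = S * X \<and> (X * S)\<^sup>T = X * S"
  have "\<exists>!X. ?P X"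
  proof (rule ex_ex1I)
    show "\<exists>X. ?P X" using symmetric_pinv_exists[OF S] S(1) by auto
    show "X = Y" if "?P X" "?P Y" for X Y
      by (rule pinv_unique[OF S(1)]) (use that S(1) in auto)
  qed
  then have "?P (pinv S)" unfolding pinv_def by (rule theI')
  then show "pinv S \<in> carrier_mat n n" "S * pinv S * S = S" "pinv S * S * pinv S = pinv S"
    "(S * pinv S)\<^sup>T = S * pinv S" "(pinv S * S)\<^sup>T = pinv S * S"
    using S(1) by auto
qed

lemma mat_transpose_mult_self_eq_0:
  assumes "(Y :: real mat) \<in> carrier_mat n m" "Y\<^sup>T * Y = 0\<^sub>m m m"
  shows "Y = 0\<^sub>m n m"
proof (rule eq_matI)
  fix i j assume ij: "i < dim_row (0\<^sub>m n m :: real mat)" "j < dim_col (0\<^sub>m n m :: real mat)"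
  have "(Y\<^sup>T * Y) $$ (j, j) = 0" using assms ij by simp
  then have "col Y j \<bullet> col Y j = 0" using assms(1) ij by simp
  then have "col Y j = 0\<^sub>v n" using scalar_prod_self_eq_0[of "col Y j" n] assms(1) ij by auto
  then show "Y $$ (i, j) = 0\<^sub>m n m $$ (i, j)"
    using arg_cong[of _ _ "\<lambda>v. v $ i"] assms(1) ij by (metis carrier_matD index_col index_zero_mat index_zero_vec(1))
qed (use assms in auto)

text \<open>The projection onto the column space is \<open>H\<close> times the pseudoinverse of its
  Gram matrix times the transpose of \<open>H\<close>; the pseudoinverse admits dependent columns.
  The factor \<open>Y\<close> records that every value of \<open>R\<close> is a combination of the
  columns of \<open>H\<close>.\<close>

lemma range_projection:
  assumes H: "(H :: real mat) \<in> carrier_mat n m"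
  shows "\<exists>R \<in> carrier_mat n n. \<exists>Y \<in> carrier_mat m n. R\<^sup>T = R \<and> R * R = R \<and> R * H = H \<and> R = H * Y"
proof -
  let ?G = "H\<^sup>T * H"
  have G: "?G \<in> carrier_mat m m" "?G\<^sup>T = ?G"
    using H by (auto simp: transpose_mult[of _ m n _ m])
  obtain X where X: "X \<in> carrier_mat m m" "X\<^sup>T = X" "?G * X * ?G = ?G"
    using symmetric_pinv_exists[OF G] by blast
  define R where "R = H * X * H\<^sup>T"
  have R: "R \<in> carrier_mat n n" using H X by (simp add: R_def)
  have "R\<^sup>T = (H\<^sup>T)\<^sup>T * (H * X)\<^sup>T"
    unfolding R_def using H X(1) by (intro transpose_mult[of _ n m _ n]) auto
  also have "(H * X)\<^sup>T = X * H\<^sup>T"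
    using transpose_mult[OF H X(1)] X(2) by simp
  also have "(H\<^sup>T)\<^sup>T * (X * H\<^sup>T) = R"
    unfolding R_def using H X(1) by (simp add: assoc_mult_mat[of _ n m _ m _ n])
  finally have sym: "R\<^sup>T = R" .
  \<comment> \<open>The columns of \<open>Y\<close> lie in the column space of \<open>H\<close> and
    are orthogonal to it, so \<open>Y\<close> vanishes.\<close>
  define Y where "Y = R * H - H"
  have Y: "Y \<in> carrier_mat n m" using R H by (auto simp: Y_def)
  have HTY: "H\<^sup>T * Y = 0\<^sub>m m m"
  proof -
    have "H\<^sup>T * (R * H) = ?G * X * ?G" unfolding R_def using H X
      by (simp add: assoc_mult_mat[of _ m n _ m _ m] assoc_mult_mat[of _ n m _ n _ m]
          assoc_mult_mat[of _ m m _ n _ m] assoc_mult_mat[of _ n m _ m _ n] assoc_mult_mat[of _ m n _ n _ m]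
          assoc_mult_mat[of _ m n _ m _ n] assoc_mult_mat[of _ n m _ m _ m]
          assoc_mult_mat[of _ m m _ m _ m])
    then show ?thesis
      unfolding Y_def using H R X(3)
      by (simp add: mult_minus_distrib_mat[of _ m n _ m])
  qed
  have "Y = (R - 1\<^sub>m n) * H"
    unfolding Y_def using R H by (simp add: minus_mult_distrib_mat[of _ n n _ _ m])
  moreover have "R * H = H * (X * ?G)" unfolding R_def using H X
    by (simp add: assoc_mult_mat[of _ n m _ n _ m] assoc_mult_mat[of _ n m _ m _ n]
        assoc_mult_mat[of _ n m _ m _ m] assoc_mult_mat[of _ m m _ n _ m])
  ultimately have Y2: "Y = H * (X * ?G - 1\<^sub>m m)"
    using H X unfolding Y_def by (simp add: mult_minus_distrib_mat[of _ n m _ m])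
  let ?Z = "X * ?G - 1\<^sub>m m"
  have Z: "?Z \<in> carrier_mat m m" using H X by auto
  have "Y\<^sup>T * Y = (?Z\<^sup>T * H\<^sup>T) * Y"
    using arg_cong[OF Y2, of "\<lambda>A. A\<^sup>T"] transpose_mult[OF H Z] by simp
  also have "\<dots> = ?Z\<^sup>T * (H\<^sup>T * Y)"
    using H Y Z by (intro assoc_mult_mat[of _ m m _ n _ m]) auto
  also have "\<dots> = 0\<^sub>m m m"
    unfolding HTY using Z by (intro right_mult_zero_mat[of _ m m]) simp
  finally have "Y\<^sup>T * Y = 0\<^sub>m m m" .
  then have "Y = 0\<^sub>m n m" by (rule mat_transpose_mult_self_eq_0[OF Y])
  then have RH: "R * H = H" using R H mat_diff_eq_0[of "R * H" n m H] by (auto simp: Y_def)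
  have "R * R = (R * H) * (X * H\<^sup>T)"
    using R H X unfolding R_def
    by (simp add: assoc_mult_mat[of _ n m _ m _ n] mult_carrier_mat[of _ n m _ n] mult_carrier_mat[of _ m m _ n]
          assoc_mult_mat[of _ n n _ m _ n] assoc_mult_mat[of _ n m _ n _ n]) 
  also have "\<dots> = R" unfolding RH unfolding R_def using H X by (simp add: assoc_mult_mat[of _ n m _ m _ n])
  finally have RR: "R * R = R" .
  have "R = H * (X * H\<^sup>T)" unfolding R_def using H X by (simp add: assoc_mult_mat[of _ n m _ m _ n])
  then show ?thesis using R sym RR RH X H by (intro bexI[of _ R] bexI[of _ "X * H\<^sup>T"]) auto
qed

text \<open>Two candidates for the projection differ, at each vector, by an element of
  \<open>S\<close> that is orthogonal to \<open>S\<close>, hence to itself.\<close>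

lemma orth_proj_eqI:
  assumes P: "P \<in> carrier_mat n n"
    and S: "S \<subseteq> carrier_vec n" "\<And>v w. v \<in> S \<Longrightarrow> w \<in> S \<Longrightarrow> v - w \<in> S"
    and 1: "\<And>v. v \<in> carrier_vec n \<Longrightarrow> P *\<^sub>v v \<in> S"
    and 2: "\<And>v w. v \<in> carrier_vec n \<Longrightarrow> w \<in> S \<Longrightarrow> (v - P *\<^sub>v v) \<bullet> w = 0"
  shows "orth_proj n S = P"
  unfolding orth_proj_def
proof (rule the_equality)
  show "P \<in> carrier_mat n n \<and> (\<forall>v\<in>carrier_vec n. P *\<^sub>v v \<in> S \<and> (\<forall>w\<in>S. (v - P *\<^sub>v v) \<bullet> w = 0))"
    using P 1 2 by blast
  fix R assume R: "R \<in> carrier_mat n n \<and> (\<forall>v\<in>carrier_vec n. R *\<^sub>v v \<in> S \<and> (\<forall>w\<in>S. (v - R *\<^sub>v v) \<bullet> w = 0))"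
  then have RC: "R \<in> carrier_mat n n" by blast
  show "R = P"
  proof (rule mat_eqI_mult_vec)
    fix v :: "real vec" assume v: "v \<in> carrier_vec n"
    define d where "d = R *\<^sub>v v - P *\<^sub>v v"
    have dS: "d \<in> S" unfolding d_def using R 1 v S by blast
    then have d: "d \<in> carrier_vec n" using S by blast
    have 0: "(v - P *\<^sub>v v) \<bullet> d = 0" "(v - R *\<^sub>v v) \<bullet> d = 0" using R 2 v dS by auto
    have "v - P *\<^sub>v v - (v - R *\<^sub>v v) = d"
      using P RC v by (intro eq_vecI) (auto simp: d_def)
    then have "d \<bullet> d = 0"
      using P RC v d 0 minus_scalar_prod_distrib[of "v - P *\<^sub>v v" n "v - R *\<^sub>v v" d] by simp
    then have "d = 0\<^sub>v n" using scalar_prod_self_eq_0[OF d] by simp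
    then show "R *\<^sub>v v = P *\<^sub>v v"
      using P RC v vec_diff_eq_0[of "R *\<^sub>v v" n "P *\<^sub>v v"] by (simp add: d_def)
  qed (use RC P in auto)
qed

section \<open>Pseudoinverses, projections and singular values\<close>

lemma char_poly_diagm: "char_poly (diagm n d) = (\<Prod>i<n. [: - d i, 1 :])"
proof -
  have "char_poly (diagm n d) = (\<Prod>a\<leftarrow>diag_mat (diagm n d). [: - a, 1 :])"
    by (rule char_poly_upper_triangular[of _ n]) (auto simp: diagm_def)
  also have "diag_mat (diagm n d) = map d [0..<n]" by (auto simp: diag_mat_def diagm_def)
  finally show ?thesis by (simp add: o_def prod.list_conv_set_nth atLeast0LessThan)
qed

text \<open>Both products have the same multiset of roots, which is read off from the linear
  factors.\<close>

lemma linear_factors_unique: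
  assumes "(\<Prod>i<n::nat. [: - (x i :: real), 1 :]) = (\<Prod>i<n. [: - y i, 1 :])"
  shows "image_mset x (mset_set {..<n}) = image_mset y (mset_set {..<n})"
proof -
  have "proots (\<Prod>i<n. [: - (z i :: real), 1 :]) = image_mset z (mset_set {..<n})" for z
  proof -
    have "proots (\<Prod>i<n. [: - (z i :: real), 1 :]) = (\<Sum>i<n. {#z i#})"
      by (subst proots_prod) (auto intro!: sum.cong)
    also have "\<dots> = image_mset z (mset_set {..<n})" by (induction n) (auto simp: lessThan_Suc)
    finally show ?thesis .
  qed
  then show ?thesis using assms by metis
qed

lemma card_image_mset_filter:
  assumes "image_mset x (mset_set {..<n::nat}) = image_mset y (mset_set {..<n})"
  shows "card {i. i < n \<and> P (x i)} = card {i. i < n \<and> P (y i)}"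
proof -
  have "card {i. i < n \<and> P (z i)} = size (filter_mset P (image_mset z (mset_set {..<n})))" for z
    by (simp add: filter_mset_image_mset Collect_conj_eq lessThan_def conj_commute)
  then show ?thesis using assms by metis
qed

lemma nonincreasing_vec_unique:
  assumes "v \<in> carrier_vec n" "w \<in> carrier_vec n" "nonincreasing_vec v" "nonincreasing_vec w"
    and m: "image_mset (\<lambda>i. v $ i) (mset_set {..<n}) = image_mset (\<lambda>i. w $ i) (mset_set {..<n})"
  shows "v = w"
proof -
  have ms: "mset (rev (list_of_vec z)) = image_mset (\<lambda>i. z $ i) (mset_set {..<n})" 
    if "z \<in> carrier_vec n" for z :: "real vec"
  proof -
    have "list_of_vec z = map (\<lambda>i. z $ i) [0..<n]" using that by (intro nth_equalityI) auto
    then show ?thesis by (simp add: atLeast0LessThan)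
  qed
  have so: "sorted (rev (list_of_vec z))" if "nonincreasing_vec z" for z
    using that by (auto simp: nonincreasing_vec_def sorted_rev_iff_nth_mono list_of_vec_index)
  have "rev (list_of_vec v) = sort (rev (list_of_vec v))" using so[OF assms(3)] by (simp add: sorted_sort_id)
  also have "\<dots> = rev (list_of_vec w)"
    using ms[OF assms(1)] ms[OF assms(2)] m so[OF assms(4)] by (intro properties_for_sort) auto
  finally show ?thesis by (metis rev_rev_ident vec_list)
qed

lemma nonincreasing_vec_exists:
  fixes f :: "nat \<Rightarrow> real"
  shows "\<exists>v \<in> carrier_vec n. nonincreasing_vec v \<and>
    image_mset (\<lambda>i. v $ i) (mset_set {..<n}) = image_mset f (mset_set {..<n})"
proof -
  define l where "l = rev (sort (map f [0..<n]))"
  have l: "length l = n" by (simp add: l_def)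
  have "sorted (rev l)" by (simp add: l_def)
  then have "nonincreasing_vec (vec_of_list l)"
    by (auto simp: nonincreasing_vec_def sorted_rev_iff_nth_mono l vec_of_list_index)
  moreover have "map (\<lambda>i. vec_of_list l $ i) [0..<n] = l"
    by (intro nth_equalityI) (auto simp: l vec_of_list_index)
  then have "image_mset (\<lambda>i. vec_of_list l $ i) (mset [0..<n]) = mset l" by (metis mset_map)
  moreover have "mset l = image_mset f (mset [0..<n])" by (simp add: l_def)
  ultimately show ?thesis
    by (intro bexI[of _ "vec_of_list l"]) (auto simp: l atLeast0LessThan carrier_vecI)
qed


lemma conj_diagm_mult_vec:
  assumes Q: "Q \<in> carrier_mat q q" "Q\<^sup>T * Q = 1\<^sub>m q" and y: "y \<in> carrier_vec q"
  shows "(Q * diagm q d * Q\<^sup>T) *\<^sub>v (Q *\<^sub>v y) = Q *\<^sub>v (diagm q d *\<^sub>v y)" "Q\<^sup>T *\<^sub>v (Q *\<^sub>v y) = y"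
proof -
  show QTQ: "Q\<^sup>T *\<^sub>v (Q *\<^sub>v y) = y" using Q y by (simp add: assoc_mult_mat_vec[of _ q q _ q, symmetric])
  have "(Q * diagm q d * Q\<^sup>T) *\<^sub>v (Q *\<^sub>v y) = (Q * diagm q d) *\<^sub>v (Q\<^sup>T *\<^sub>v (Q *\<^sub>v y))"
    using Q y by (intro assoc_mult_mat_vec[of _ q q _ q]) auto
  also have "\<dots> = Q *\<^sub>v (diagm q d *\<^sub>v y)"
    unfolding QTQ using Q y by (intro assoc_mult_mat_vec[of _ q q _ q]) auto
  finally show "(Q * diagm q d * Q\<^sup>T) *\<^sub>v (Q *\<^sub>v y) = Q *\<^sub>v (diagm q d *\<^sub>v y)" .
qed

lemma gram_quadratic_form:
  assumes M: "(M :: real mat) \<in> carrier_mat p q"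
    and Q: "Q \<in> carrier_mat q q" "Q\<^sup>T * Q = 1\<^sub>m q"
    and SQ: "M\<^sup>T * M = Q * diagm q d * Q\<^sup>T" and y: "y \<in> carrier_vec q"
  shows "(M *\<^sub>v (Q *\<^sub>v y)) \<bullet> (M *\<^sub>v (Q *\<^sub>v y)) = (\<Sum>i<q. d i * (y $ i)\<^sup>2)"
    "(Q *\<^sub>v y) \<bullet> (Q *\<^sub>v y) = (\<Sum>i<q. (y $ i)\<^sup>2)"
proof -
  have Qy: "Q *\<^sub>v y \<in> carrier_vec q" using Q y by simp
  have Dy: "diagm q d *\<^sub>v y \<in> carrier_vec q" using y by (simp add: mult_mat_vec_carrier[of _ q q])
  have "(Q *\<^sub>v y) \<bullet> (Q *\<^sub>v y) = y \<bullet> y"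
    using scalar_prod_mult_mat[OF Q(1) y Qy] conj_diagm_mult_vec(2)[OF Q y] by simp
  then show "(Q *\<^sub>v y) \<bullet> (Q *\<^sub>v y) = (\<Sum>i<q. (y $ i)\<^sup>2)"
    using y by (simp add: scalar_prod_def power2_eq_square atLeast0LessThan)
  have "(M *\<^sub>v (Q *\<^sub>v y)) \<bullet> (M *\<^sub>v (Q *\<^sub>v y)) = (Q *\<^sub>v y) \<bullet> (M\<^sup>T *\<^sub>v (M *\<^sub>v (Q *\<^sub>v y)))"
    by (rule scalar_prod_mult_mat[OF M Qy]) (use M Qy in simp)
  also have "M\<^sup>T *\<^sub>v (M *\<^sub>v (Q *\<^sub>v y)) = (M\<^sup>T * M) *\<^sub>v (Q *\<^sub>v y)"
    by (rule assoc_mult_mat_vec[of _ q p _ q, symmetric]) (use M Qy in auto)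
  also have "\<dots> = Q *\<^sub>v (diagm q d *\<^sub>v y)" unfolding SQ by (rule conj_diagm_mult_vec(1)[OF Q y])
  also have "(Q *\<^sub>v y) \<bullet> (Q *\<^sub>v (diagm q d *\<^sub>v y)) = y \<bullet> (Q\<^sup>T *\<^sub>v (Q *\<^sub>v (diagm q d *\<^sub>v y)))"
    by (rule scalar_prod_mult_mat[OF Q(1) y]) (use Q Dy in simp)
  also have "Q\<^sup>T *\<^sub>v (Q *\<^sub>v (diagm q d *\<^sub>v y)) = diagm q d *\<^sub>v y"
    by (rule conj_diagm_mult_vec(2)[OF Q Dy])
  also have "y \<bullet> (diagm q d *\<^sub>v y) = (\<Sum>i<q. y $ i * (diagm q d *\<^sub>v y) $ i)"
    using Dy by (simp add: scalar_prod_def atLeast0LessThan)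
  also have "\<dots> = (\<Sum>i<q. d i * (y $ i)\<^sup>2)"
    using y by (intro sum.cong) (auto simp: diagm_mult_vec_index power2_eq_square simp del: index_mult_mat_vec)
  finally show "(M *\<^sub>v (Q *\<^sub>v y)) \<bullet> (M *\<^sub>v (Q *\<^sub>v y)) = (\<Sum>i<q. d i * (y $ i)\<^sup>2)" .
qed

text \<open>The description of \<open>singular_values\<close> is meaningful because the
  characteristic polynomial fixes the multiset of eigenvalues of the Gram matrix, nonnegativity
  fixes their square roots, and monotonicity fixes the order. The diagonalization is handed on
  together with them, since the eigenvectors are what realizes the singular values as stretching
  factors.\<close>

lemma singular_values_spectrum:
  assumes M: "(M :: real mat) \<in> carrier_mat p q"
  obtains Q d where "Q \<in> carrier_mat q q" "Q\<^sup>T * Q = 1\<^sub>m q" "Q * Q\<^sup>T = 1\<^sub>m q"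
    "M\<^sup>T * M = Q * diagm q d * Q\<^sup>T" "singular_values M \<in> carrier_vec q"
    "0\<^sub>v q \<le> singular_values M" "nonincreasing_vec (singular_values M)"
    "image_mset (\<lambda>i. (singular_values M $ i)\<^sup>2) (mset_set {..<q}) = image_mset d (mset_set {..<q})"
proof -
  let ?S = "M\<^sup>T * M"
  have S: "?S \<in> carrier_mat q q" "?S\<^sup>T = ?S" using M by (auto simp: transpose_mult[of _ q p _ q])
  obtain Q d where Q: "Q \<in> carrier_mat q q" "Q\<^sup>T * Q = 1\<^sub>m q" "Q * Q\<^sup>T = 1\<^sub>m q"
    and SQ: "?S = Q * diagm q d * Q\<^sup>T" using real_spectral[OF S] by blast
  have cp: "char_poly ?S = (\<Prod>i<q. [: - d i, 1 :])"
  proof -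
    have "similar_mat ?S (diagm q d)"
      unfolding similar_mat_def similar_mat_wit_def Let_def
      using Q(1) M by (intro exI[of _ Q] exI[of _ "Q\<^sup>T"]) (simp add: Q(2,3) SQ[symmetric])
    then show ?thesis using char_poly_similar[of ?S "diagm q d"] by (simp only: char_poly_diagm)
  qed
  \<comment> \<open>An eigenvalue of the Gram matrix is the squared length of the image of its unit
    eigenvector.\<close>
  have d0: "0 \<le> d i" if i: "i < q" for i
  proof -
    have "(\<Sum>j<q. d j * (unit_vec q i $ j)\<^sup>2) = (\<Sum>j<q. if j = i then d i else 0)"
      using i by (intro sum.cong) auto
    then have "d i = (M *\<^sub>v (Q *\<^sub>v unit_vec q i)) \<bullet> (M *\<^sub>v (Q *\<^sub>v unit_vec q i))"
      using gram_quadratic_form(1)[OF M Q(1,2) SQ, of "unit_vec q i"] i by simp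
    then show ?thesis using scalar_prod_self_nonneg[of "M *\<^sub>v (Q *\<^sub>v unit_vec q i)"] by linarith
  qed
  let ?R = "\<lambda>\<sigma>. \<sigma> \<in> carrier_vec (dim_col M) \<and> 0\<^sub>v (dim_col M) \<le> \<sigma> \<and> nonincreasing_vec \<sigma> \<and>
     char_poly ?S = (\<Prod>i<dim_col M. [: - ((\<sigma> $ i)\<^sup>2), 1 :])"
  have R: "?R \<sigma> \<longleftrightarrow> \<sigma> \<in> carrier_vec q \<and> 0\<^sub>v q \<le> \<sigma> \<and> nonincreasing_vec \<sigma> \<and>
     image_mset (\<lambda>i. (\<sigma> $ i)\<^sup>2) (mset_set {..<q}) = image_mset d (mset_set {..<q})" (is "_ \<longleftrightarrow> ?R' \<sigma>") for \<sigma>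
  proof -
    have "(\<Prod>i<q. [: - d i, 1 :]) = (\<Prod>i<q. [: - ((\<sigma> $ i)\<^sup>2), 1 :])"
      if "image_mset (\<lambda>i. (\<sigma> $ i)\<^sup>2) (mset_set {..<q}) = image_mset d (mset_set {..<q})"
    proof -
      have "prod_mset (image_mset (\<lambda>a. [: - a, 1 :]) (image_mset (\<lambda>i. (\<sigma> $ i)\<^sup>2) (mset_set {..<q}))) =
         prod_mset (image_mset (\<lambda>a. [: - a, 1 :]) (image_mset d (mset_set {..<q})))" unfolding that ..
      then show ?thesis by (simp add: image_mset.compositionality o_def prod_unfold_prod_mset)
    qed
    then have "(\<Prod>i<q. [: - d i, 1 :]) = (\<Prod>i<q. [: - ((\<sigma> $ i)\<^sup>2), 1 :]) \<longleftrightarrow>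
       image_mset (\<lambda>i. (\<sigma> $ i)\<^sup>2) (mset_set {..<q}) = image_mset d (mset_set {..<q})"
      using linear_factors_unique[of d q "\<lambda>i. (\<sigma> $ i)\<^sup>2"] by (metis (no_types))
    then show ?thesis unfolding cp using M by simp
  qed
  have "\<exists>!\<sigma>. ?R' \<sigma>"
  proof (rule ex_ex1I)
    obtain v where v: "v \<in> carrier_vec q" "nonincreasing_vec v"
      "image_mset (\<lambda>i. v $ i) (mset_set {..<q}) = image_mset (\<lambda>i. sqrt (d i)) (mset_set {..<q})"
      using nonincreasing_vec_exists by metis
    have v0: "0 \<le> v $ i" if "i < q" for i
    proof -
      have "v $ i \<in> set_mset (image_mset (\<lambda>i. v $ i) (mset_set {..<q}))" using that by simp
      then show ?thesis unfolding v(3) using d0 by auto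
    qed
    have "image_mset (\<lambda>i. (v $ i)\<^sup>2) (mset_set {..<q}) = image_mset (\<lambda>a. a\<^sup>2) (image_mset (\<lambda>i. v $ i) (mset_set {..<q}))"
      by (simp add: image_mset.compositionality o_def)
    also have "\<dots> = image_mset d (mset_set {..<q})"
      unfolding v(3) using d0 by (auto simp: image_mset.compositionality o_def intro!: image_mset_cong)
    finally show "\<exists>\<sigma>. ?R' \<sigma>" using v v0 by (intro exI[of _ v]) (auto simp: less_eq_vec_def)
  next
    fix v w assume v: "?R' v" and w: "?R' w"
    have "image_mset (\<lambda>i. z $ i) (mset_set {..<q}) = image_mset sqrt (image_mset d (mset_set {..<q}))" if z: "?R' z" for z
    proof -
      have "0\<^sub>v q \<le> z" "z \<in> carrier_vec q" using z by blast+
      then have "0 \<le> z $ i" if "i < q" for i using that by (auto simp: less_eq_vec_def)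
      then have "image_mset sqrt (image_mset (\<lambda>i. (z $ i)\<^sup>2) (mset_set {..<q})) = image_mset (\<lambda>i. z $ i) (mset_set {..<q})"
        by (auto simp: image_mset.compositionality o_def intro!: image_mset_cong)
      moreover have "image_mset (\<lambda>i. (z $ i)\<^sup>2) (mset_set {..<q}) = image_mset d (mset_set {..<q})"
        using z by simp
      ultimately show ?thesis by (simp only:)
    qed
    from this[OF v] this[OF w] show "v = w"
      using v w by (intro nonincreasing_vec_unique[of v q w]) (simp_all only:)
  qed
  then have "\<exists>!\<sigma>. ?R \<sigma>" by (simp only: R)
  then have "?R (singular_values M)" unfolding singular_values_def by (rule theI')
  then have "?R' (singular_values M)" by (simp only: R)
  then show ?thesis using that[OF Q SQ] by (simp only:)
qed

text \<open>One half of the Courant-Fischer principle: the columns of \<open>E\<close> are the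
  eigenvectors of the Gram matrix with eigenvalue above \<open>\<tau>\<^sup>2\<close>. Strictness of
  the inequality contains the injectivity of \<open>E\<close>.\<close>

lemma singular_values_leading_space:
  assumes M: "(M :: real mat) \<in> carrier_mat p q" and \<tau>: "0 \<le> \<tau>"
  shows "\<exists>E \<in> carrier_mat q (card {i. i < q \<and> \<tau> < singular_values M $ i}).
     \<forall>u \<in> carrier_vec (card {i. i < q \<and> \<tau> < singular_values M $ i}).
       u \<noteq> 0\<^sub>v (card {i. i < q \<and> \<tau> < singular_values M $ i}) \<longrightarrow>
       \<tau> * vnorm (E *\<^sub>v u) < vnorm (M *\<^sub>v (E *\<^sub>v u))"
proof -
  obtain Q d where Q: "Q \<in> carrier_mat q q" "Q\<^sup>T * Q = 1\<^sub>m q" "Q * Q\<^sup>T = 1\<^sub>m q"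
    and SQ: "M\<^sup>T * M = Q * diagm q d * Q\<^sup>T" and s0: "0\<^sub>v q \<le> singular_values M"
    and ms: "image_mset (\<lambda>i. (singular_values M $ i)\<^sup>2) (mset_set {..<q}) = image_mset d (mset_set {..<q})"
    using singular_values_spectrum[OF M] by metis
  define I where "I = {i. i < q \<and> \<tau>\<^sup>2 < d i}"
  define k where "k = card I"
  have "{i. i < q \<and> \<tau> < singular_values M $ i} = {i. i < q \<and> \<tau>\<^sup>2 < (singular_values M $ i)\<^sup>2}"
    using s0 \<tau> by (auto simp: less_eq_vec_def intro: power_strict_mono power_less_imp_less_base)
  then have k: "card {i. i < q \<and> \<tau> < singular_values M $ i} = k"
    using card_image_mset_filter[OF ms, of "\<lambda>a. \<tau>\<^sup>2 < a"] by (simp add: k_def I_def)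
  have "finite I" by (simp add: I_def)
  then obtain f where f: "bij_betw f {..<k} I" using ex_bij_betw_nat_finite[of I] by (auto simp: k_def atLeast0LessThan)
  define E where "E = mat q k (\<lambda>(i, j). Q $$ (i, f j))"
  have E: "E \<in> carrier_mat q k" by (simp add: E_def)
  have "\<tau> * vnorm (E *\<^sub>v u) < vnorm (M *\<^sub>v (E *\<^sub>v u))" if u: "u \<in> carrier_vec k" "u \<noteq> 0\<^sub>v k" for u
  proof -
    define y where "y = vec q (\<lambda>i. if i \<in> I then u $ (inv_into {..<k} f i) else 0)"
    have y: "y \<in> carrier_vec q" by (simp add: y_def)
    have yf: "y $ (f j) = u $ j" if "j < k" for j
    proof -
      have "f j \<in> I" using that f by (auto simp: bij_betw_def)
      then show ?thesis using that bij_betw_inv_into_left[OF f, of j] by (simp add: y_def I_def)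
    qed
    have Iq: "I \<subseteq> {..<q}" by (auto simp: I_def)
    have EQ: "E *\<^sub>v u = Q *\<^sub>v y"
    proof (rule eq_vecI)
      fix i assume "i < dim_vec (Q *\<^sub>v y)"
      then have i: "i < q" using Q by simp
      have "(Q *\<^sub>v y) $ i = (\<Sum>j<q. Q $$ (i, j) * y $ j)" using i Q y by (simp add: scalar_prod_def atLeast0LessThan)
      also have "\<dots> = (\<Sum>j \<in> I. Q $$ (i, j) * y $ j)"
        by (rule sum.mono_neutral_right) (use Iq in \<open>auto simp: y_def\<close>)
      also have "\<dots> = (\<Sum>j<k. Q $$ (i, f j) * y $ f j)"
        by (rule sum.reindex_bij_betw[OF f, symmetric])
      also have "\<dots> = (E *\<^sub>v u) $ i"
        using i u by (simp add: E_def scalar_prod_def yf atLeast0LessThan)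
      finally show "(E *\<^sub>v u) $ i = (Q *\<^sub>v y) $ i" by simp
    qed (use E Q in auto)
    note n = gram_quadratic_form[OF M Q(1,2) SQ y]
    obtain j where j: "j < k" "u $ j \<noteq> 0"
      using u by (metis carrier_vecD eq_vecI index_zero_vec)
    have fj: "f j \<in> I" using f j by (auto simp: bij_betw_def)
    have "\<tau>\<^sup>2 * ((Q *\<^sub>v y) \<bullet> (Q *\<^sub>v y)) = (\<Sum>i<q. \<tau>\<^sup>2 * (y $ i)\<^sup>2)"
      unfolding n(2) by (simp add: sum_distrib_left)
    also have "\<dots> < (\<Sum>i<q. d i * (y $ i)\<^sup>2)"
    proof (rule sum_strict_mono_ex1)
      show "\<forall>i\<in>{..<q}. \<tau>\<^sup>2 * (y $ i)\<^sup>2 \<le> d i * (y $ i)\<^sup>2"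
        by (auto simp: y_def I_def intro: mult_right_mono)
      show "\<exists>i\<in>{..<q}. \<tau>\<^sup>2 * (y $ i)\<^sup>2 < d i * (y $ i)\<^sup>2"
        using fj Iq j yf[OF j(1)] by (intro bexI[of _ "f j"]) (auto simp: I_def)
    qed simp
    finally have "\<tau>\<^sup>2 * ((Q *\<^sub>v y) \<bullet> (Q *\<^sub>v y)) < (M *\<^sub>v (Q *\<^sub>v y)) \<bullet> (M *\<^sub>v (Q *\<^sub>v y))" unfolding n(1) .
    then have "(\<tau> * vnorm (Q *\<^sub>v y))\<^sup>2 < (vnorm (M *\<^sub>v (Q *\<^sub>v y)))\<^sup>2"
      by (simp add: power_mult_distrib vnorm_sq)
    then show ?thesis unfolding EQ by (rule power_less_imp_less_base) simp
  qed
  then show ?thesis unfolding k using E by blast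
qed

section \<open>Dimension counting with column ranges\<close>

definition hcat :: "real mat \<Rightarrow> real mat \<Rightarrow> real mat" where
  "hcat A B = mat (dim_row A) (dim_col A + dim_col B)
     (\<lambda>(i, j). if j < dim_col A then A $$ (i, j) else B $$ (i, j - dim_col A))"

lemma hcat_carrier:
  "A \<in> carrier_mat m a \<Longrightarrow> B \<in> carrier_mat m b \<Longrightarrow> hcat A B \<in> carrier_mat m (a + b)"
  by (auto simp: hcat_def)

lemma hcat_mult_append:
  assumes A: "A \<in> carrier_mat m a" and B: "B \<in> carrier_mat m b"
    and u: "u \<in> carrier_vec a" and v: "v \<in> carrier_vec b"
  shows "hcat A B *\<^sub>v (u @\<^sub>v v) = A *\<^sub>v u + B *\<^sub>v v"
proof (rule eq_vecI)
  fix i assume "i < dim_vec (A *\<^sub>v u + B *\<^sub>v v)"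
  then have i: "i < m" using B by simp
  have "row (hcat A B) i = row A i @\<^sub>v row B i"
    using A B i by (intro eq_vecI) (auto simp: hcat_def)
  then have "(hcat A B *\<^sub>v (u @\<^sub>v v)) $ i = (row A i @\<^sub>v row B i) \<bullet> (u @\<^sub>v v)"
    using i A by (simp add: hcat_def)
  also have "\<dots> = row A i \<bullet> u + row B i \<bullet> v"
    using A B u v by (intro scalar_prod_append) auto
  finally show "(hcat A B *\<^sub>v (u @\<^sub>v v)) $ i = (A *\<^sub>v u + B *\<^sub>v v) $ i" using i A B by simp
qed (use A B in \<open>auto simp: hcat_def\<close>)

text \<open>Zero rows complete the matrix to a square one. Its transpose annihilates a unit vector,
  so the determinant vanishes and there is a kernel vector.\<close>

lemma wide_mat_kernel:
  assumes A: "(A :: real mat) \<in> carrier_mat m n" and "m < n"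
  obtains v where "v \<in> carrier_vec n" "v \<noteq> 0\<^sub>v n" "A *\<^sub>v v = 0\<^sub>v m"
proof -
  define B where "B = mat n n (\<lambda>(i, j). if i < m then A $$ (i, j) else 0)"
  have B: "B \<in> carrier_mat n n" by (simp add: B_def)
  have "B\<^sup>T *\<^sub>v unit_vec n m = 0\<^sub>v n"
    using \<open>m < n\<close> by (intro eq_vecI) (auto simp: B_def)
  moreover have "unit_vec n m \<noteq> (0\<^sub>v n :: real vec)"
    using \<open>m < n\<close> by (metis index_unit_vec(2) index_zero_vec(1) zero_neq_one)
  ultimately have "det (B\<^sup>T) = 0"
    using det_0_iff_vec_prod_zero_field[of "B\<^sup>T" n] B unit_vec_carrier[of n m] transpose_carrier_mat[of B n n]
    by metis
  then have "det B = 0" using det_transpose[OF B] by simp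
  then obtain v where v: "v \<in> carrier_vec n" "v \<noteq> 0\<^sub>v n" "B *\<^sub>v v = 0\<^sub>v n"
    using det_0_iff_vec_prod_zero_field[OF B] by auto
  have "A *\<^sub>v v = 0\<^sub>v m"
  proof (rule eq_vecI)
    fix i assume "i < dim_vec (0\<^sub>v m :: real vec)"
    then have i: "i < m" by simp
    then have "row B i = row A i" using A \<open>m < n\<close> by (intro eq_vecI) (auto simp: B_def)
    then have "(A *\<^sub>v v) $ i = (B *\<^sub>v v) $ i" using A B i \<open>m < n\<close> by simp
    then show "(A *\<^sub>v v) $ i = 0\<^sub>v m $ i" using v(3) i \<open>m < n\<close> by simp
  qed (use A in auto)
  then show thesis using that v by blast
qed

text \<open>Stands in for the statement that two subspaces of too large total dimension intersect:
  the nontrivial relation between the two blocks is what later arguments use.\<close>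

lemma joint_kernel:
  assumes A: "(A :: real mat) \<in> carrier_mat m a" and B: "B \<in> carrier_mat m b" and "m < a + b"
  obtains u v where "u \<in> carrier_vec a" "v \<in> carrier_vec b" "u \<noteq> 0\<^sub>v a \<or> v \<noteq> 0\<^sub>v b"
    "A *\<^sub>v u + B *\<^sub>v v = 0\<^sub>v m"
proof -
  obtain w where w: "w \<in> carrier_vec (a + b)" "w \<noteq> 0\<^sub>v (a + b)" "hcat A B *\<^sub>v w = 0\<^sub>v m"
    using wide_mat_kernel[OF hcat_carrier[OF A B]] assms(3) by blast
  let ?u = "vec_first w a" and ?v = "vec_last w b"
  have e: "?u @\<^sub>v ?v = w" using w(1) by simp
  have "?u \<noteq> 0\<^sub>v a \<or> ?v \<noteq> 0\<^sub>v b"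
  proof (rule ccontr)
    assume "\<not> ?thesis"
    then have "w = 0\<^sub>v a @\<^sub>v 0\<^sub>v b" using e by simp
    also have "\<dots> = 0\<^sub>v (a + b)" by (intro eq_vecI) auto
    finally show False using w by simp
  qed
  then show thesis
    using that[of ?u ?v] w(3) hcat_mult_append[OF A B, of ?u ?v] e by simp
qed

text \<open>With \<open>w\<close> appended as one more column there are too many columns, so a
  nontrivial relation exists. Independence of the two blocks makes the coefficient of
  \<open>w\<close> nonzero, and the relation can be solved for \<open>w\<close>.\<close>

lemma complementary_ranges:
  assumes A: "(A :: real mat) \<in> carrier_mat m a" and B: "B \<in> carrier_mat m b" and m: "m = a + b"
    and inj: "\<And>u v. u \<in> carrier_vec a \<Longrightarrow> v \<in> carrier_vec b \<Longrightarrow> A *\<^sub>v u + B *\<^sub>v v = 0\<^sub>v m \<Longrightarrow> u = 0\<^sub>v a \<and> v = 0\<^sub>v b"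
    and w: "w \<in> carrier_vec m"
  obtains u v where "u \<in> carrier_vec a" "v \<in> carrier_vec b" "w = A *\<^sub>v u + B *\<^sub>v v"
proof -
  let ?H = "hcat A B" and ?w = "mat_of_cols m [w]"
  have H: "?H \<in> carrier_mat m m" using hcat_carrier[OF A B] m by simp
  have W: "?w \<in> carrier_mat m 1" by (simp add: mat_of_cols_def)
  obtain h c where h: "h \<in> carrier_vec m" and c: "c \<in> carrier_vec 1" and hc: "h \<noteq> 0\<^sub>v m \<or> c \<noteq> 0\<^sub>v 1"
    and eq: "?H *\<^sub>v h + ?w *\<^sub>v c = 0\<^sub>v m"
    using joint_kernel[OF H W] by auto
  let ?u = "vec_first h a" and ?v = "vec_last h b"
  have e: "?u @\<^sub>v ?v = h" using h m by simp
  have Hh: "?H *\<^sub>v h = A *\<^sub>v ?u + B *\<^sub>v ?v"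
    using hcat_mult_append[OF A B, of ?u ?v] e by simp
  have wc: "?w *\<^sub>v c = c $ 0 \<cdot>\<^sub>v w"
    using w c by (intro eq_vecI) (auto simp: mat_of_cols_def scalar_prod_def)
  have Hc: "?H *\<^sub>v h \<in> carrier_vec m" using H h by simp
  have c0: "c $ 0 \<noteq> 0"
  proof
    assume 0: "c $ 0 = 0"
    then have "c = 0\<^sub>v 1" using c by (intro eq_vecI) auto
    have "c $ 0 \<cdot>\<^sub>v w = 0\<^sub>v m" using 0 w by (intro eq_vecI) auto
    then have "A *\<^sub>v ?u + B *\<^sub>v ?v = 0\<^sub>v m" using eq wc Hc Hh by simp
    then have "?u = 0\<^sub>v a \<and> ?v = 0\<^sub>v b" by (intro inj) auto
    then have "h = 0\<^sub>v a @\<^sub>v 0\<^sub>v b" using e by simp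
    also have "\<dots> = 0\<^sub>v m" unfolding m by (intro eq_vecI) auto
    finally show False using hc \<open>c = 0\<^sub>v 1\<close> by simp
  qed
  let ?k = "- 1 / c $ 0"
  have "w = ?k \<cdot>\<^sub>v (A *\<^sub>v ?u + B *\<^sub>v ?v)"
  proof (rule eq_vecI)
    fix i assume "i < dim_vec (?k \<cdot>\<^sub>v (A *\<^sub>v ?u + B *\<^sub>v ?v))"
    then have i: "i < m" using B by simp
    have "(?H *\<^sub>v h + ?w *\<^sub>v c) $ i = 0" using eq i by simp
    then have "(?H *\<^sub>v h) $ i + c $ 0 * w $ i = 0"
      unfolding wc using i Hc w by (subst (asm) index_add_vec) auto
    then have "(A *\<^sub>v ?u + B *\<^sub>v ?v) $ i = - (c $ 0 * w $ i)" unfolding Hh by simp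
    then show "w $ i = (?k \<cdot>\<^sub>v (A *\<^sub>v ?u + B *\<^sub>v ?v)) $ i"
      using i c0 A B by (subst index_smult_vec) auto
  qed (use w A B in auto)
  also have "\<dots> = A *\<^sub>v (?k \<cdot>\<^sub>v ?u) + B *\<^sub>v (?k \<cdot>\<^sub>v ?v)"
    using A B by (simp add: mult_mat_vec[of _ m a] mult_mat_vec[of _ m b] smult_add_distrib_vec[of _ m])
  finally show thesis by (intro that[of "?k \<cdot>\<^sub>v ?u" "?k \<cdot>\<^sub>v ?v"]) auto
qed

section \<open>Trailing columns of an approximate singular value decomposition\<close>

definition tcols :: "real mat \<Rightarrow> nat \<Rightarrow> real mat" where
  "tcols C i = mat (dim_row C) (dim_col C - i) (\<lambda>(r, j). C $$ (r, i + j))"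

lemma tcols_carrier: "C \<in> carrier_mat p q \<Longrightarrow> tcols C i \<in> carrier_mat p (q - i)"
  by (auto simp: tcols_def)

lemma col_tcols: "C \<in> carrier_mat p q \<Longrightarrow> j < q - i \<Longrightarrow> col (tcols C i) j = col C (i + j)"
  by (rule eq_vecI) (auto simp: tcols_def)

lemma span_tcols:
  assumes C: "C \<in> carrier_mat p q"
  shows "vspan p {col C j | j. i \<le> j \<and> j < q} = {tcols C i *\<^sub>v v | v. v \<in> carrier_vec (q - i)}"
proof -
  interpret V: vec_space "TYPE(real)" p .
  have "set (cols (tcols C i)) = (\<lambda>j. col (tcols C i) j) ` {..<q - i}"
    using tcols_carrier[OF C, of i] by (simp add: cols_def atLeast0LessThan)
  also have "\<dots> = (\<lambda>j. col C (i + j)) ` {..<q - i}"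
    by (intro image_cong refl) (simp add: col_tcols[OF C])
  also have "\<dots> = (\<lambda>j. col C j) ` ((\<lambda>j. i + j) ` {..<q - i})" by (simp add: image_image)
  also have "(\<lambda>j. i + j) ` {..<q - i} = {i..<q}"
  proof -
    have "j \<in> (\<lambda>j. i + j) ` {..<q - i}" if "j \<in> {i..<q}" for j
      using that by (intro image_eqI[of _ _ "j - i"]) auto
    then show ?thesis by auto
  qed
  finally have "set (cols (tcols C i)) = {col C j | j. i \<le> j \<and> j < q}" by auto
  then have "vspan p {col C j | j. i \<le> j \<and> j < q} = V.col_space (tcols C i)"
    unfolding V.col_space_def by simp
  also have "\<dots> = {tcols C i *\<^sub>v v | v. v \<in> carrier_vec (q - i)}"
    unfolding V.col_space_eq[OF tcols_carrier[OF C]] using tcols_carrier[OF C, of i] by auto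
  finally show ?thesis .
qed

lemma orthogonal_cols_injective:
  assumes T: "T \<in> carrier_mat p k" and v: "v \<in> carrier_vec k" and 0: "T *\<^sub>v v = 0\<^sub>v p"
    and nz: "\<And>j. j < k \<Longrightarrow> col T j \<noteq> 0\<^sub>v p"
    and orth: "\<And>i j. i < k \<Longrightarrow> j < k \<Longrightarrow> i \<noteq> j \<Longrightarrow> col T i \<bullet> (col T j :: real vec) = 0"
  shows "v = 0\<^sub>v k"
proof (rule eq_vecI)
  fix j assume "j < dim_vec (0\<^sub>v k :: real vec)"
  then have j: "j < k" by simp
  have cj: "col T j \<in> carrier_vec p" using T j by auto
  have "0 = (T *\<^sub>v v) \<bullet> col T j" unfolding 0 using cj by simp
  also have "\<dots> = v \<bullet> (T\<^sup>T *\<^sub>v col T j)" by (rule scalar_prod_mult_mat[OF T v cj])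
  also have "\<dots> = (\<Sum>i<k. v $ i * (col T i \<bullet> col T j))"
    using T v by (simp add: scalar_prod_def atLeast0LessThan)
  also have "\<dots> = (\<Sum>i<k. if i = j then v $ i * (col T i \<bullet> col T j) else 0)"
    by (intro sum.cong) (auto simp: orth j)
  finally have "v $ j * (col T j \<bullet> col T j) = 0" using j by simp
  moreover have "col T j \<bullet> col T j \<noteq> 0" using scalar_prod_self_eq_0[OF cj] nz[OF j] by simp
  ultimately show "v $ j = 0\<^sub>v k $ j" using j by simp
qed (use v in auto)

text \<open>Membership in the span of trailing columns is turned into coefficient vectors of
  \<open>tcols C i\<close>, the form in which dimensions can be counted. Orthogonality of the
  nonzero columns enters only as injectivity.\<close>

lemma rho_svdD:
  assumes svd: "rho_svd \<rho> M C t" and M: "M \<in> carrier_mat p q"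
  shows "C \<in> carrier_mat q q" "t \<in> carrier_vec q" "nonincreasing_vec t"
    "\<And>i. i < q \<Longrightarrow> 0 \<le> t $ i" "\<And>i. i < q \<Longrightarrow> singular_values M $ i \<le> t $ i"
    "\<And>i. i < q \<Longrightarrow> t $ i / \<rho> \<le> singular_values M $ i"
    "\<And>i v. i < q \<Longrightarrow> v \<in> carrier_vec (q - i) \<Longrightarrow>
       vnorm (M *\<^sub>v (tcols C i *\<^sub>v v)) \<le> t $ i * vnorm (tcols C i *\<^sub>v v)"
    "\<And>i v. v \<in> carrier_vec (q - i) \<Longrightarrow> tcols C i *\<^sub>v v = 0\<^sub>v q \<Longrightarrow> v = 0\<^sub>v (q - i)"
proof -
  have q: "dim_col M = q" using M by simp
  have s: "C \<in> carrier_mat q q" "\<forall>i<q. col C i \<noteq> 0\<^sub>v q"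
     "\<forall>i<q. \<forall>j<q. i \<noteq> j \<longrightarrow> col C i \<bullet> col C j = 0"
     "t \<in> carrier_vec q" "0\<^sub>v q \<le> t" "nonincreasing_vec t"
     "\<forall>i<q. \<forall>u\<in>vspan q {col C j | j. i \<le> j \<and> j < q}. vnorm (M *\<^sub>v u) \<le> t $ i * vnorm u"
     "(1 / \<rho>) \<cdot>\<^sub>v t \<le> singular_values M" "singular_values M \<le> t"
    using svd unfolding rho_svd_def Let_def q by blast+
  show "C \<in> carrier_mat q q" "t \<in> carrier_vec q" "nonincreasing_vec t" by fact+
  show "0 \<le> t $ i" "singular_values M $ i \<le> t $ i" "t $ i / \<rho> \<le> singular_values M $ i" if "i < q" for i
    using that s(4,5,8,9) by (auto simp: less_eq_vec_def dest: spec[of _ i])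
  show "vnorm (M *\<^sub>v (tcols C i *\<^sub>v v)) \<le> t $ i * vnorm (tcols C i *\<^sub>v v)"
    if "i < q" "v \<in> carrier_vec (q - i)" for i v
    using s(7) that unfolding span_tcols[OF s(1)] by blast
  show "v = 0\<^sub>v (q - i)" if v: "v \<in> carrier_vec (q - i)" "tcols C i *\<^sub>v v = 0\<^sub>v q" for i v
    by (rule orthogonal_cols_injective[OF tcols_carrier[OF s(1)] v]) (auto simp: col_tcols[OF s(1)] s(2,3))
qed

section \<open>The least norm lift\<close>

text \<open>The columns are unit vectors indexed by \<open>N\<close>: multiplication extends a
  vector by zero outside \<open>N\<close>, and multiplication by the transpose restricts to
  \<open>N\<close>. The order of the indices is that of \<open>pick\<close>, which also underlies
  \<open>submatrix\<close>.\<close>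

definition selm :: "nat \<Rightarrow> nat set \<Rightarrow> real mat" where
  "selm n N = mat n (card N) (\<lambda>(i, j). if i = pick N j then 1 else 0)"

abbreviation restr :: "nat \<Rightarrow> nat set \<Rightarrow> real vec \<Rightarrow> real vec" where
  "restr n N v \<equiv> (selm n N)\<^sup>T *\<^sub>v v"

lemma selm_carrier [simp]: "selm n N \<in> carrier_mat n (card N)" by (simp add: selm_def)

lemma selm_dims [simp]: "dim_row (selm n N) = n" "dim_col (selm n N) = card N" by (simp_all add: selm_def)

lemma restr_carrier [simp]: "v \<in> carrier_vec n \<Longrightarrow> restr n N v \<in> carrier_vec (card N)"
  by (simp add: mult_mat_vec_carrier[of _ "card N" n])

lemma ext_carrier [simp]: "u \<in> carrier_vec (card N) \<Longrightarrow> selm n N *\<^sub>v u \<in> carrier_vec n"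
  by (simp add: mult_mat_vec_carrier[of _ n "card N"])

lemma pick_bij:
  assumes "finite N"
  shows "bij_betw (pick N) {..<card N} N"
proof (rule bij_betwI[where g = "\<lambda>i. card {a \<in> N. a < i}"])
  show "pick N \<in> {..<card N} \<rightarrow> N" using pick_in_set_le by auto
  show "(\<lambda>i. card {a \<in> N. a < i}) \<in> N \<rightarrow> {..<card N}"
    using assms by (auto intro!: psubset_card_mono)
  show "card {a \<in> N. a < pick N j} = j" if "j \<in> {..<card N}" for j
    using card_pick_le that by simp
  show "pick N (card {a \<in> N. a < i}) = i" if "i \<in> N" for i
    using pick_card_in_set that by simp
qed

lemma restr_index:
  assumes N: "N \<subseteq> {..<n}" and v: "v \<in> carrier_vec n" and j: "j < card N"
  shows "restr n N v $ j = v $ pick N j"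
proof -
  have "pick N j < n" using pick_in_set_le[OF j] N by auto
  moreover have "restr n N v $ j = (\<Sum>i<n. (if i = pick N j then 1 else 0) * v $ i)"
    using v j by (simp add: selm_def scalar_prod_def atLeast0LessThan)
  moreover have "\<dots> = (\<Sum>i<n. if i = pick N j then v $ i else 0)" by (intro sum.cong) auto
  ultimately show ?thesis by simp
qed

lemma vnorm_restr:
  assumes N: "N \<subseteq> {..<n}" and v: "v \<in> carrier_vec n"
  shows "vnorm (restr n N v) = L2_set (\<lambda>i. v $ i) N"
proof -
  have "finite N" by (rule finite_subset[OF N]) simp
  have "(\<Sum>j<card N. (restr n N v $ j)\<^sup>2) = (\<Sum>j<card N. (v $ pick N j)\<^sup>2)"
    by (intro sum.cong) (auto simp: restr_index[OF N v] simp del: index_mult_mat_vec)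
  also have "\<dots> = (\<Sum>i\<in>N. (v $ i)\<^sup>2)" by (rule sum.reindex_bij_betw[OF pick_bij[OF \<open>finite N\<close>]])
  finally show ?thesis using v by (simp add: vnorm_def L2_set_def)
qed

lemma restr_eq_iff:
  assumes N: "N \<subseteq> {..<n}" and v: "v \<in> carrier_vec n" "w \<in> carrier_vec n"
  shows "restr n N v = restr n N w \<longleftrightarrow> (\<forall>i\<in>N. v $ i = w $ i)"
proof
  have bij: "bij_betw (pick N) {..<card N} N" by (rule pick_bij[OF finite_subset[OF N]]) simp
  assume e: "restr n N v = restr n N w"
  have "v $ pick N j = w $ pick N j" if "j < card N" for j
    using restr_index[OF N v(1) that] restr_index[OF N v(2) that] e by simp
  then have *: "\<forall>i \<in> pick N ` {..<card N}. v $ i = w $ i" by blast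
  show "\<forall>i\<in>N. v $ i = w $ i" using * unfolding bij_betw_imp_surj_on[OF bij] .
next
  assume "\<forall>i\<in>N. v $ i = w $ i"
  then show "restr n N v = restr n N w"
    by (intro eq_vecI)
      (simp_all add: restr_index[OF N v(1)] restr_index[OF N v(2)] pick_in_set_le del: index_mult_mat_vec)
qed

lemma scalar_prod_split:
  assumes "N \<subseteq> {..<n}" "B = {..<n} - N" and v: "v \<in> carrier_vec n"
  shows "v \<bullet> v = (vnorm (restr n N v))\<^sup>2 + (vnorm (restr n B v))\<^sup>2"
proof -
  have "v \<bullet> v = (\<Sum>i<n. (v $ i)\<^sup>2)" using v by (simp add: scalar_prod_def power2_eq_square atLeast0LessThan)
  also have "\<dots> = (\<Sum>i\<in>B. (v $ i)\<^sup>2) + (\<Sum>i\<in>N. (v $ i)\<^sup>2)"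
    unfolding assms(2) by (rule sum.subset_diff) (use assms(1) in auto)
  finally show ?thesis
    using assms vnorm_restr[OF assms(1) v] vnorm_restr[of B n v]
    by (simp add: L2_set_def sum_nonneg)
qed

lemma submatrix_UNIV_cols:
  assumes P: "(P :: real mat) \<in> carrier_mat p n" and N: "N \<subseteq> {..<n}"
  shows "submatrix P UNIV N = P * selm n N"
proof (rule eq_matI)
  have e: "{j. j < n \<and> j \<in> N} = N" using N by auto
  show "dim_row (submatrix P UNIV N) = dim_row (P * selm n N)"
    "dim_col (submatrix P UNIV N) = dim_col (P * selm n N)"
    using P by (auto simp: dim_submatrix e)
  fix i j assume ij: "i < dim_row (P * selm n N)" "j < dim_col (P * selm n N)"
  then have ij: "i < p" "j < card N" using P by auto
  have pj: "pick N j < n" using pick_in_set_le[OF ij(2)] N by auto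
  have "(P * selm n N) $$ (i, j) = (\<Sum>k<n. P $$ (i, k) * (if k = pick N j then 1 else 0))"
    using P ij by (simp add: selm_def scalar_prod_def atLeast0LessThan)
  also have "\<dots> = (\<Sum>k<n. if k = pick N j then P $$ (i, k) else 0)" by (intro sum.cong) auto
  also have "\<dots> = P $$ (i, pick N j)" using pj by simp
  finally show "submatrix P UNIV N $$ (i, j) = (P * selm n N) $$ (i, j)"
    using P ij by (simp add: submatrix_def e pick_UNIV)
qed

lemma submatrix_UNIV_rows:
  assumes A: "(A :: real mat) \<in> carrier_mat n k" and I: "I \<subseteq> {..<n}"
  shows "submatrix A I UNIV = (selm n I)\<^sup>T * A"
proof (rule eq_matI)
  have e: "{j. j < n \<and> j \<in> I} = I" using I by auto
  show "dim_row (submatrix A I UNIV) = dim_row ((selm n I)\<^sup>T * A)"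
    "dim_col (submatrix A I UNIV) = dim_col ((selm n I)\<^sup>T * A)"
    using A by (auto simp: dim_submatrix e)
  fix i j assume ij: "i < dim_row ((selm n I)\<^sup>T * A)" "j < dim_col ((selm n I)\<^sup>T * A)"
  then have ij: "i < card I" "j < k" using A by auto
  have pj: "pick I i < n" using pick_in_set_le[OF ij(1)] I by auto
  have "((selm n I)\<^sup>T * A) $$ (i, j) = restr n I (col A j) $ i" using A ij by simp
  also have "\<dots> = col A j $ pick I i" using restr_index[OF I _ ij(1), of "col A j"] A ij by auto
  finally show "submatrix A I UNIV $$ (i, j) = ((selm n I)\<^sup>T * A) $$ (i, j)"
    using A ij pj by (simp add: submatrix_def e pick_UNIV)
qed


lemma submatrix_square:
  assumes P: "(P :: real mat) \<in> carrier_mat n n" and N: "N \<subseteq> {..<n}"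
  shows "submatrix P N N = (selm n N)\<^sup>T * (P * selm n N)"
proof -
  have "submatrix P N N = submatrix (P * selm n N) N UNIV"
    by (rule submatrix_split[of P N N, unfolded submatrix_UNIV_cols[OF P N]])
  also have "\<dots> = (selm n N)\<^sup>T * (P * selm n N)"
    by (rule submatrix_UNIV_rows[OF mult_carrier_mat[OF P selm_carrier] N])
  finally show ?thesis .
qed

section \<open>The lift belonging to an orthogonal projection\<close>

locale lift =
  fixes n :: nat and P :: "real mat" and N B :: "nat set"
  assumes P: "P \<in> carrier_mat n n" "P\<^sup>T = P" "P * P = P"
    and N: "N \<subseteq> {..<n}" and B: "B = {..<n} - N"
begin

definition "Z = {v \<in> carrier_vec n. P *\<^sub>v v = v}"

definition "PN = submatrix P N N"

definition "X = pinv PN"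

definition "L = submatrix P UNIV N * X"

definition "l = submatrix L B UNIV"

abbreviation "q \<equiv> card N"

abbreviation "rN \<equiv> restr n N"

abbreviation "rB \<equiv> restr n B"

abbreviation "eN u \<equiv> selm n N *\<^sub>v u"

text \<open>The orthogonal projection onto the column space of \<open>PN\<close>, that is, onto the
  set of restrictions to \<open>N\<close> of the points of \<open>Z\<close>.\<close>

definition "Pr u = PN *\<^sub>v (X *\<^sub>v u)"

lemma Bn: "B \<subseteq> {..<n}" using B by auto

lemma PN_eq: "PN = (selm n N)\<^sup>T * (P * selm n N)"
  unfolding PN_def by (rule submatrix_square[OF P(1) N])

lemma PNc: "PN \<in> carrier_mat q q" unfolding PN_eq using P(1) by (simp add: mult_carrier_mat[of _ q n])

lemma PN_sym: "PN\<^sup>T = PN"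
proof -
  have "PN\<^sup>T = (P * selm n N)\<^sup>T * selm n N"
    unfolding PN_eq using transpose_mult[of "(selm n N)\<^sup>T" q n "P * selm n N" q] P(1) by simp
  also have "(P * selm n N)\<^sup>T = (selm n N)\<^sup>T * P"
    using transpose_mult[of P n n "selm n N" q] P by simp
  finally show ?thesis unfolding PN_eq using P(1) by (simp add: assoc_mult_mat[of _ q n _ n _ q])
qed

lemma PNv: "u \<in> carrier_vec q \<Longrightarrow> PN *\<^sub>v u = rN (P *\<^sub>v eN u)"
  unfolding PN_eq using P(1) by (simp add: assoc_mult_mat_vec[of _ q n _ q] assoc_mult_mat_vec[of _ n n _ q])

lemmas Xp = pinv_symmetric[OF PNc PN_sym, folded X_def]

lemma Lc: "L \<in> carrier_mat n q"
  unfolding L_def submatrix_UNIV_cols[OF P(1) N] using P(1) Xp(1) by (simp add: mult_carrier_mat[of _ n q])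

lemma l_eq: "l = (selm n B)\<^sup>T * L"
  unfolding l_def by (rule submatrix_UNIV_rows[OF Lc Bn])

lemma lc: "l \<in> carrier_mat (card B) q"
  unfolding l_eq using Lc by (simp add: mult_carrier_mat[of _ _ n])

lemma lv: "u \<in> carrier_vec q \<Longrightarrow> l *\<^sub>v u = rB (L *\<^sub>v u)"
  unfolding l_eq by (rule assoc_mult_mat_vec[of _ "card B" n _ q]) (use Lc in auto)

lemma Xc [simp]: "u \<in> carrier_vec q \<Longrightarrow> X *\<^sub>v u \<in> carrier_vec q"
  using Xp(1) by simp

lemma Lv: "u \<in> carrier_vec q \<Longrightarrow> L *\<^sub>v u = P *\<^sub>v eN (X *\<^sub>v u)"
  unfolding L_def submatrix_UNIV_cols[OF P(1) N] using P(1) Xp(1) mult_carrier_mat[OF P(1) selm_carrier[of n N]]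
  by (simp add: assoc_mult_mat_vec[of _ n q _ q] assoc_mult_mat_vec[of _ n n _ q])

lemma Prc [simp]: "u \<in> carrier_vec q \<Longrightarrow> Pr u \<in> carrier_vec q"
  unfolding Pr_def using PNc by simp

lemma rN_L: "u \<in> carrier_vec q \<Longrightarrow> rN (L *\<^sub>v u) = Pr u"
  unfolding Pr_def by (simp add: PNv Lv)

lemma PPv: "v \<in> carrier_vec n \<Longrightarrow> P *\<^sub>v (P *\<^sub>v v) = P *\<^sub>v v"
  using P(1) by (simp add: assoc_mult_mat_vec[of P n n P n, symmetric] P(3))

lemma P_sym: "v \<in> carrier_vec n \<Longrightarrow> w \<in> carrier_vec n \<Longrightarrow> (P *\<^sub>v v) \<bullet> w = v \<bullet> (P *\<^sub>v w)"
  using scalar_prod_mult_mat[OF P(1)] P(2) by simp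

lemma L_in_Z: "u \<in> carrier_vec q \<Longrightarrow> L *\<^sub>v u \<in> Z"
  using P(1) by (simp add: Z_def Lv PPv)

lemma eN_adj: "u \<in> carrier_vec q \<Longrightarrow> v \<in> carrier_vec n \<Longrightarrow> eN u \<bullet> v = u \<bullet> rN v"
  by (rule scalar_prod_mult_mat) auto

lemma L_Pr: "u \<in> carrier_vec q \<Longrightarrow> L *\<^sub>v Pr u = L *\<^sub>v u"
proof -
  assume u: "u \<in> carrier_vec q"
  have "X *\<^sub>v Pr u = (X * PN * X) *\<^sub>v u"
    unfolding Pr_def using u Xp(1) PNc
    by (simp add: assoc_mult_mat_vec[of _ q q _ q] mult_carrier_mat[of _ q q _ q])
  then show ?thesis using u by (simp add: Lv Xp(3))
qed

lemma l_Pr: "u \<in> carrier_vec q \<Longrightarrow> l *\<^sub>v Pr u = l *\<^sub>v u"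
  by (simp add: lv L_Pr)

lemma Pr_Pr: "u \<in> carrier_vec q \<Longrightarrow> Pr (Pr u) = Pr u"
  using L_Pr[of u] rN_L[of u] rN_L[of "Pr u"] by simp

lemma Pr_sym: "u \<in> carrier_vec q \<Longrightarrow> v \<in> carrier_vec q \<Longrightarrow> Pr u \<bullet> v = u \<bullet> Pr v"
proof -
  assume u: "u \<in> carrier_vec q" and v: "v \<in> carrier_vec q"
  have e: "Pr w = (PN * X) *\<^sub>v w" if "w \<in> carrier_vec q" for w
    unfolding Pr_def using that PNc Xp(1) by (simp add: assoc_mult_mat_vec[of _ q q _ q])
  have "PN * X \<in> carrier_mat q q" using PNc Xp(1) by simp
  then show ?thesis using scalar_prod_mult_mat[of "PN * X" q q u v] u v by (simp add: e Xp(4))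
qed

lemma PN_Pr: "u \<in> carrier_vec q \<Longrightarrow> PN *\<^sub>v Pr u = PN *\<^sub>v u"
proof -
  assume u: "u \<in> carrier_vec q"
  have 1: "PN * (PN * X) = PN"
  proof -
    have "PN * X = X\<^sup>T * PN" using Xp(4) transpose_mult[OF PNc Xp(1)] PN_sym by simp
    then have "PN * (PN * X) = PN * (X\<^sup>T * PN)" by simp
    also have "\<dots> = (PN * X * PN)\<^sup>T"
    proof -
      have "(PN * X * PN)\<^sup>T = PN\<^sup>T * (PN * X)\<^sup>T"
        using PNc Xp(1) by (intro transpose_mult[of _ q q _ q]) auto
      also have "(PN * X)\<^sup>T = X\<^sup>T * PN\<^sup>T" by (rule transpose_mult[OF PNc Xp(1)])
      finally show ?thesis by (simp add: PN_sym)
    qed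
    finally show ?thesis by (simp add: Xp(2) PN_sym)
  qed
  have "PN *\<^sub>v Pr u = (PN * (PN * X)) *\<^sub>v u"
    unfolding Pr_def using u PNc Xp(1)
    by (simp add: assoc_mult_mat_vec[of _ q q _ q] mult_carrier_mat[of _ q q _ q])
  then show ?thesis by (simp add: 1)
qed

text \<open>The quadratic form of \<open>PN\<close> at \<open>u\<close> is the squared length of the
  projection of the extension of \<open>u\<close>.\<close>

lemma PN_zero:
  assumes u: "u \<in> carrier_vec q" and "PN *\<^sub>v u = 0\<^sub>v q"
  shows "P *\<^sub>v eN u = 0\<^sub>v n"
proof -
  have e: "eN u \<in> carrier_vec n" using u by simp
  have Pe: "P *\<^sub>v eN u \<in> carrier_vec n" using P(1) e by simp
  have "(P *\<^sub>v eN u) \<bullet> (P *\<^sub>v eN u) = eN u \<bullet> (P *\<^sub>v eN u)"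
    using P_sym[OF e Pe] PPv[OF e] by simp
  also have "\<dots> = u \<bullet> (PN *\<^sub>v u)" using eN_adj[OF u Pe] PNv[OF u] by simp
  also have "\<dots> = 0" using assms by simp
  finally show ?thesis using scalar_prod_self_eq_0[OF Pe] by simp
qed

lemma Z_carrier: "z \<in> Z \<Longrightarrow> z \<in> carrier_vec n" by (simp add: Z_def)

lemma Z_diff: "z \<in> Z \<Longrightarrow> w \<in> Z \<Longrightarrow> z - w \<in> Z"
  using P(1) by (simp add: Z_def mult_minus_distrib_mat_vec[of P n n])

text \<open>The residual \<open>k\<close> is annihilated by \<open>PN\<close>, so its extension by
  zero is orthogonal to \<open>Z\<close>. It is thus orthogonal to \<open>rN z\<close>, and also to
  \<open>Pr (rN z)\<close> because \<open>Pr\<close> kills it, and therefore to itself.\<close>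

lemma Pr_restr:
  assumes z: "z \<in> Z"
  shows "Pr (rN z) = rN z"
proof -
  have zc: "z \<in> carrier_vec n" by (rule Z_carrier[OF z])
  then have r: "rN z \<in> carrier_vec q" by simp
  define k where "k = rN z - Pr (rN z)"
  have k: "k \<in> carrier_vec q" using r by (simp add: k_def)
  have "PN *\<^sub>v k = PN *\<^sub>v rN z - PN *\<^sub>v Pr (rN z)"
    unfolding k_def using PNc r by (simp add: mult_minus_distrib_mat_vec[of _ q q])
  then have "PN *\<^sub>v k = 0\<^sub>v q" using PN_Pr[OF r] PNc r by simp
  then have 0: "P *\<^sub>v eN k = 0\<^sub>v n" by (rule PN_zero[OF k])
  have "k \<bullet> rN z = eN k \<bullet> (P *\<^sub>v z)" using eN_adj[OF k zc] z by (simp add: Z_def)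
  also have "\<dots> = (P *\<^sub>v eN k) \<bullet> z" using P_sym[of "eN k" z] k zc by simp
  finally have 1: "k \<bullet> rN z = 0" using 0 zc by simp
  have "k \<bullet> Pr (rN z) = Pr k \<bullet> rN z" using Pr_sym[OF k r] by simp
  also have "Pr k = 0\<^sub>v q"
  proof -
    have "X *\<^sub>v k = X *\<^sub>v rN z - X *\<^sub>v Pr (rN z)"
      unfolding k_def using Xp(1) r by (simp add: mult_minus_distrib_mat_vec[of _ q q])
    then have "Pr k = Pr (rN z) - Pr (Pr (rN z))"
      unfolding Pr_def using PNc r by (simp add: mult_minus_distrib_mat_vec[of _ q q])
    then show ?thesis using r by (simp add: Pr_Pr)
  qed
  finally have 2: "k \<bullet> Pr (rN z) = 0" using r by simp
  have "k \<bullet> k = k \<bullet> rN z - k \<bullet> Pr (rN z)"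
    using r k scalar_prod_minus_distrib[of k q "rN z" "Pr (rN z)"] by (simp add: k_def[symmetric])
  then have "k = 0\<^sub>v q" using 1 2 scalar_prod_self_eq_0[OF k] by simp
  then show ?thesis using vec_diff_eq_0[of "rN z" q "Pr (rN z)"] r by (simp add: k_def)
qed

lemma Pr_norm_le:
  assumes u: "u \<in> carrier_vec q"
  shows "vnorm (Pr u) \<le> vnorm u"
proof -
  define k where "k = u - Pr u"
  have k: "k \<in> carrier_vec q" and p: "Pr u \<in> carrier_vec q" using u by (auto simp: k_def)
  have uk: "u = k + Pr u" using u by (intro eq_vecI) (auto simp: k_def carrier_vecD[OF p])
  have "k \<bullet> Pr u = u \<bullet> Pr u - Pr u \<bullet> Pr u"
    unfolding k_def by (rule minus_scalar_prod_distrib[OF u p p])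
  also have "Pr u \<bullet> Pr u = u \<bullet> Pr u" using Pr_sym[OF u p] Pr_Pr[OF u] by simp
  finally have 0: "k \<bullet> Pr u = 0" by simp
  have "u \<bullet> u = (k + Pr u) \<bullet> (k + Pr u)" using uk by simp
  also have "\<dots> = k \<bullet> k + Pr u \<bullet> Pr u"
    using k p 0 comm_scalar_prod[OF p k] by (simp add: scalar_prod_add_distrib[of _ q] add_scalar_prod_distrib[of _ q])
  finally show ?thesis using scalar_prod_self_nonneg[of k] by (intro vnorm_mono_sq) simp
qed

text \<open>\<open>L\<close> maps the restriction of a point of \<open>Z\<close> to the lift of least norm.\<close>

lemma min_norm_lift:
  assumes z: "z \<in> Z"
  shows "vnorm (l *\<^sub>v rN z) \<le> vnorm (rB z)"
proof -
  have zc: "z \<in> carrier_vec n" by (rule Z_carrier[OF z])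
  then have r: "rN z \<in> carrier_vec q" by simp
  define w where "w = L *\<^sub>v rN z"
  have w: "w \<in> Z" and wc: "w \<in> carrier_vec n" using L_in_Z[OF r] Z_carrier by (auto simp: w_def)
  have rw: "rN w = rN z" using rN_L[OF r] Pr_restr[OF z] by (simp add: w_def)
  define y where "y = z - w"
  have y: "y \<in> Z" and yc: "y \<in> carrier_vec n" using Z_diff[OF z w] Z_carrier by (auto simp: y_def)
  have ry: "rN y = 0\<^sub>v q" unfolding y_def using zc wc rw r
    by (simp add: mult_minus_distrib_mat_vec[of _ q n])
  have "w \<bullet> y = eN (X *\<^sub>v rN z) \<bullet> (P *\<^sub>v y)"
    unfolding w_def using Lv[OF r] P_sym[of "eN (X *\<^sub>v rN z)" y] r yc by simp
  also have "\<dots> = eN (X *\<^sub>v rN z) \<bullet> y" using y by (simp add: Z_def)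
  also have "\<dots> = (X *\<^sub>v rN z) \<bullet> rN y" using eN_adj[of "X *\<^sub>v rN z" y] r yc by simp
  finally have 0: "w \<bullet> y = 0" using r by (simp add: ry)
  have zwy: "z = w + y" using zc wc by (intro eq_vecI) (auto simp: y_def)
  have "z \<bullet> z = (w + y) \<bullet> (w + y)" using zwy by simp
  also have "\<dots> = w \<bullet> w + y \<bullet> y"
    using wc yc 0 comm_scalar_prod[OF yc wc] by (simp add: scalar_prod_add_distrib[of _ n] add_scalar_prod_distrib[of _ n])
  finally have "w \<bullet> w \<le> z \<bullet> z" using scalar_prod_self_nonneg[of y] by simp
  then have "(vnorm (rB w))\<^sup>2 \<le> (vnorm (rB z))\<^sup>2"
    unfolding scalar_prod_split[OF N B wc] scalar_prod_split[OF N B zc] rw by simp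
  then have "vnorm (rB w) \<le> vnorm (rB z)" by (rule power2_le_imp_le) simp
  then show ?thesis unfolding lv[OF r] w_def .
qed

end

lemma vec_add_eq_0:
  assumes "(v :: real vec) \<in> carrier_vec n" "w \<in> carrier_vec n" "v + w = 0\<^sub>v n"
  shows "v = - w"
proof (rule eq_vecI)
  fix i assume i: "i < dim_vec (- w)"
  have "(v + w) $ i = 0\<^sub>v n $ i" using assms(3) by simp
  then show "v $ i = (- w) $ i" using i assms(1,2) by simp
qed (use assms in auto)

lemma mult_mat_vec_0: "(A :: real mat) \<in> carrier_mat m n \<Longrightarrow> A *\<^sub>v 0\<^sub>v n = 0\<^sub>v m"
  by (rule eq_vecI) auto

lemma mult_mat_vec_uminus:
  "(A :: real mat) \<in> carrier_mat m n \<Longrightarrow> v \<in> carrier_vec n \<Longrightarrow> A *\<^sub>v (- v) = - (A *\<^sub>v v)"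
  by (rule eq_vecI) auto

section \<open>Certified directions, solver output and the spectral gap\<close>

context lift
begin

text \<open>A form of the count of singular values of \<open>l\<close> above \<open>\<tau>\<close>
  that does not mention \<open>l\<close>: the inequality is required of every point of
  \<open>Z\<close> with the given restriction, and the lift of least norm is the critical one.
  Strictness forces the restrictions of the family to be independent.\<close>

definition cert :: "real \<Rightarrow> nat \<Rightarrow> bool" where
  "cert \<tau> k \<longleftrightarrow> (\<exists>F \<in> carrier_mat n k. (\<forall>u\<in>carrier_vec k. F *\<^sub>v u \<in> Z) \<and>
     (\<forall>u\<in>carrier_vec k. u \<noteq> 0\<^sub>v k \<longrightarrow>
        (\<forall>z\<in>Z. rN z = rN (F *\<^sub>v u) \<longrightarrow> \<tau> * vnorm (rN z) < vnorm (rB z))))"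

text \<open>The leading singular directions are lifted by \<open>L\<close>. Any other lift of the
  same restriction is at least as long on \<open>B\<close>, so the stretching inequality holds for
  all of them.\<close>

lemma cert_singular_values:
  assumes \<tau>: "0 \<le> \<tau>"
  shows "cert \<tau> (card {i. i < q \<and> \<tau> < singular_values l $ i})" (is "cert \<tau> ?k")
proof -
  obtain E where E: "E \<in> carrier_mat q ?k"
    and EE: "\<And>u. u \<in> carrier_vec ?k \<Longrightarrow> u \<noteq> 0\<^sub>v ?k \<Longrightarrow> \<tau> * vnorm (E *\<^sub>v u) < vnorm (l *\<^sub>v (E *\<^sub>v u))"
    using singular_values_leading_space[OF lc \<tau>] by blast
  have LE: "L * E \<in> carrier_mat n ?k" using Lc E by simp
  have v: "(L * E) *\<^sub>v u = L *\<^sub>v (E *\<^sub>v u)" if "u \<in> carrier_vec ?k" for u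
    using that Lc E by simp
  show ?thesis unfolding cert_def
  proof (intro bexI[OF _ LE] conjI ballI impI)
    fix u :: "real vec" assume u: "u \<in> carrier_vec ?k"
    then have Eu: "E *\<^sub>v u \<in> carrier_vec q" using E by simp
    show "(L * E) *\<^sub>v u \<in> Z" unfolding v[OF u] by (rule L_in_Z[OF Eu])
    fix z assume u0: "u \<noteq> 0\<^sub>v ?k" and z: "z \<in> Z" and eq: "rN z = rN ((L * E) *\<^sub>v u)"
    have rz: "rN z = Pr (E *\<^sub>v u)" unfolding eq v[OF u] by (rule rN_L[OF Eu])
    \<comment> \<open>Passing from \<open>E *\<^sub>v u\<close> to its projection under
      \<open>Pr\<close> can only shorten the vector on \<open>N\<close>, while its image under
      \<open>l\<close> stays the same.\<close>
    have "\<tau> * vnorm (rN z) \<le> \<tau> * vnorm (E *\<^sub>v u)"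
      unfolding rz by (rule mult_left_mono[OF Pr_norm_le[OF Eu] \<tau>])
    also have "\<dots> < vnorm (l *\<^sub>v (E *\<^sub>v u))" by (rule EE[OF u u0])
    also have "\<dots> = vnorm (l *\<^sub>v rN z)" unfolding rz l_Pr[OF Eu] ..
    also have "\<dots> \<le> vnorm (rB z)" by (rule min_norm_lift[OF z])
    finally show "\<tau> * vnorm (rN z) < vnorm (rB z)" .
  qed
qed

lemma cert_D:
  assumes F: "F \<in> carrier_mat n k" "\<And>u. u \<in> carrier_vec k \<Longrightarrow> F *\<^sub>v u \<in> Z"
    and FF: "\<And>u z. u \<in> carrier_vec k \<Longrightarrow> u \<noteq> 0\<^sub>v k \<Longrightarrow> z \<in> Z \<Longrightarrow> rN z = rN (F *\<^sub>v u) \<Longrightarrow>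
       \<tau> * vnorm (rN z) < vnorm (rB z)"
    and u: "u \<in> carrier_vec k" "u \<noteq> 0\<^sub>v k"
  shows "\<tau> * vnorm (rN (F *\<^sub>v u)) < vnorm (l *\<^sub>v rN (F *\<^sub>v u))"
proof -
  have z: "F *\<^sub>v u \<in> Z" by (rule F(2)[OF u(1)])
  have r: "rN (F *\<^sub>v u) \<in> carrier_vec q" using Z_carrier[OF z] by simp
  have "rN (L *\<^sub>v rN (F *\<^sub>v u)) = rN (F *\<^sub>v u)" unfolding rN_L[OF r] by (rule Pr_restr[OF z])
  then show ?thesis using FF[OF u L_in_Z[OF r]] lv[OF r] by simp
qed

text \<open>Past the first \<open>k0\<close> columns the solver guarantees stretching by at most
  \<open>\<tau>\<close>. With more than \<open>k0\<close> certified directions, a dimension count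
  would put a nonzero certified restriction into the span of these columns.\<close>

lemma cert_le:
  assumes c: "cert \<tau> k" and svd: "rho_svd \<rho> l C t"
  shows "k \<le> card {i. i < q \<and> \<tau> < t $ i}"
proof (rule ccontr)
  define k0 where "k0 = card {i. i < q \<and> \<tau> < t $ i}"
  assume "\<not> ?thesis"
  then have kk: "k0 < k" by (simp add: k0_def)
  obtain F where F: "F \<in> carrier_mat n k" "\<And>u. u \<in> carrier_vec k \<Longrightarrow> F *\<^sub>v u \<in> Z"
    and FF: "\<And>u z. u \<in> carrier_vec k \<Longrightarrow> u \<noteq> 0\<^sub>v k \<Longrightarrow> z \<in> Z \<Longrightarrow> rN z = rN (F *\<^sub>v u) \<Longrightarrow>
       \<tau> * vnorm (rN z) < vnorm (rB z)"
    using c unfolding cert_def by blast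
  note sv = rho_svdD[OF svd lc]
  have k0q: "k0 \<le> q" unfolding k0_def using card_mono[of "{..<q}" "{i. i < q \<and> \<tau> < t $ i}"] by auto
  have small: "t $ k0 \<le> \<tau>" if "k0 < q"
  proof (rule ccontr)
    assume "\<not> t $ k0 \<le> \<tau>"
    then have "{..k0} \<subseteq> {i. i < q \<and> \<tau> < t $ i}"
      using sv(2,3) that by (fastforce simp: nonincreasing_vec_def)
    then have "card {..k0} \<le> k0" unfolding k0_def by (intro card_mono) auto
    then show False by simp
  qed
  define T where "T = tcols C k0"
  have T: "T \<in> carrier_mat q (q - k0)" unfolding T_def by (rule tcols_carrier[OF sv(1)])
  have Tv: "vnorm (l *\<^sub>v (T *\<^sub>v v)) \<le> \<tau> * vnorm (T *\<^sub>v v)" if v: "v \<in> carrier_vec (q - k0)" for v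
  proof (cases "k0 < q")
    case True
    have "vnorm (l *\<^sub>v (T *\<^sub>v v)) \<le> t $ k0 * vnorm (T *\<^sub>v v)"
      unfolding T_def by (rule sv(7)[OF True v])
    also have "\<dots> \<le> \<tau> * vnorm (T *\<^sub>v v)" using small[OF True] by (intro mult_right_mono) auto
    finally show ?thesis .
  next
    \<comment> \<open>Here \<open>k0 = q\<close>: no column is left and \<open>T *\<^sub>v v\<close>
      is the zero vector.\<close>
    case False
    then have "T *\<^sub>v v = 0\<^sub>v q" using T v k0q by (intro eq_vecI) (auto simp: scalar_prod_def)
    then show ?thesis using mult_mat_vec_0[OF lc] by simp
  qed
  define G where "G = (selm n N)\<^sup>T * F"
  have G: "G \<in> carrier_mat q k" unfolding G_def using F(1) by (simp add: mult_carrier_mat[of _ q n])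
  have Gv: "G *\<^sub>v u = rN (F *\<^sub>v u)" if "u \<in> carrier_vec k" for u
    unfolding G_def using F(1) that by (intro assoc_mult_mat_vec[of _ q n _ k]) auto
  obtain u v where u: "u \<in> carrier_vec k" and v: "v \<in> carrier_vec (q - k0)"
    and nz: "u \<noteq> 0\<^sub>v k \<or> v \<noteq> 0\<^sub>v (q - k0)" and eq: "G *\<^sub>v u + T *\<^sub>v v = 0\<^sub>v q"
    by (rule joint_kernel[OF G T]) (use kk k0q in auto)
  have Gc: "G *\<^sub>v u \<in> carrier_vec q" and Tc: "T *\<^sub>v v \<in> carrier_vec q" using G T u v by auto
  have u0: "u \<noteq> 0\<^sub>v k"
  proof
    assume "u = 0\<^sub>v k"
    then have "G *\<^sub>v u = 0\<^sub>v q" using G by auto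
    then have "T *\<^sub>v v = 0\<^sub>v q" using eq Tc by simp
    then have "v = 0\<^sub>v (q - k0)" unfolding T_def by (rule sv(8)[OF v])
    then show False using nz \<open>u = 0\<^sub>v k\<close> by simp
  qed
  have GT: "G *\<^sub>v u = - (T *\<^sub>v v)"
    by (rule vec_add_eq_0[OF Gc Tc eq])
  have nG: "vnorm (G *\<^sub>v u) = vnorm (T *\<^sub>v v)" unfolding GT by simp
  have lG: "vnorm (l *\<^sub>v (G *\<^sub>v u)) = vnorm (l *\<^sub>v (T *\<^sub>v v))"
  proof -
    have "l *\<^sub>v (G *\<^sub>v u) = - (l *\<^sub>v (T *\<^sub>v v))" unfolding GT by (rule mult_mat_vec_uminus[OF lc Tc])
    then show ?thesis by simp
  qed
  have "\<tau> * vnorm (G *\<^sub>v u) < vnorm (l *\<^sub>v (G *\<^sub>v u))"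
    unfolding Gv[OF u] by (rule cert_D[OF F FF u u0])
  then show False using Tv[OF v] unfolding lG nG by simp
qed

lemma card_initial_segment:
  assumes m: "\<And>i j. i \<le> j \<Longrightarrow> j < q \<Longrightarrow> t $ j \<le> (t $ i :: real)" and i: "i < q"
  shows "a < t $ i \<longleftrightarrow> i < card {i. i < q \<and> a < t $ i}"
proof
  assume "a < t $ i"
  then have "{..i} \<subseteq> {i. i < q \<and> a < t $ i}" using m i by fastforce
  then have "card {..i} \<le> card {i. i < q \<and> a < t $ i}" by (intro card_mono) auto
  then show "i < card {i. i < q \<and> a < t $ i}" by simp
next
  assume lt: "i < card {i. i < q \<and> a < t $ i}"
  show "a < t $ i"
  proof (rule ccontr)
    assume "\<not> a < t $ i"
    have "j < i" if "j < q" "a < t $ j" for j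
    proof (rule ccontr)
      assume "\<not> j < i"
      then have "t $ j \<le> t $ i" using m that by simp
      then show False using that \<open>\<not> a < t $ i\<close> by simp
    qed
    then have "{j. j < q \<and> a < t $ j} \<subseteq> {..<i}" by auto
    then have "card {j. j < q \<and> a < t $ j} \<le> card {..<i}" by (intro card_mono) auto
    then show False using lt by simp
  qed
qed

text \<open>The two-sided bound makes \<open>t\<close> vanish exactly where the singular values do.
  Hence the leading space on which \<open>l\<close> is injective and the columns with zero
  \<open>t\<close>, on which \<open>l\<close> vanishes, are complementary, and a kernel vector has
  no component in the former.\<close>

lemma zero_singular_space:
  assumes svd: "rho_svd \<rho> l C t" and \<rho>: "0 < \<rho>"
    and v: "v \<in> carrier_vec q" "l *\<^sub>v v = 0\<^sub>v (card B)"
  shows "\<exists>w \<in> carrier_vec (q - card {i. i < q \<and> 0 < t $ i}). v = tcols C (card {i. i < q \<and> 0 < t $ i}) *\<^sub>v w"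
proof -
  note sv = rho_svdD[OF svd lc]
  define r where "r = card {i. i < q \<and> 0 < t $ i}"
  have rq: "r \<le> q" unfolding r_def using card_mono[of "{..<q}" "{i. i < q \<and> 0 < t $ i}"] by auto
  have "0 < singular_values l $ i \<longleftrightarrow> 0 < t $ i" if "i < q" for i
  proof -
    have "0 < t $ i \<Longrightarrow> 0 < t $ i / \<rho>" using \<rho> by simp
    then show ?thesis using sv(5,6)[OF that] by linarith
  qed
  then have r': "card {i. i < q \<and> 0 < singular_values l $ i} = r"
    unfolding r_def by (intro arg_cong[where f = card]) auto
  obtain E where E: "E \<in> carrier_mat q r"
    and EE: "\<And>u. u \<in> carrier_vec r \<Longrightarrow> u \<noteq> 0\<^sub>v r \<Longrightarrow> 0 * vnorm (E *\<^sub>v u) < vnorm (l *\<^sub>v (E *\<^sub>v u))"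
    using singular_values_leading_space[OF lc order.refl, unfolded r'] by blast
  define T where "T = tcols C r"
  have T: "T \<in> carrier_mat q (q - r)" unfolding T_def by (rule tcols_carrier[OF sv(1)])
  have lT: "l *\<^sub>v (T *\<^sub>v w) = 0\<^sub>v (card B)" if w: "w \<in> carrier_vec (q - r)" for w
  proof (cases "r < q")
    case True
    have "t $ r \<le> 0"
      using card_initial_segment[of t r 0] sv(2,3) True by (auto simp: nonincreasing_vec_def r_def)
    then have "vnorm (l *\<^sub>v (T *\<^sub>v w)) \<le> 0"
      using sv(7)[OF True w] mult_right_mono[of "t $ r" 0 "vnorm (T *\<^sub>v w)"] by (simp add: T_def)
    then have "vnorm (l *\<^sub>v (T *\<^sub>v w)) = 0" using vnorm_nonneg[of "l *\<^sub>v (T *\<^sub>v w)"] by linarith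
    then show ?thesis using vnorm_eq_0[of "l *\<^sub>v (T *\<^sub>v w)" "card B"] lc T w by simp
  next
    case False
    then have "T *\<^sub>v w = 0\<^sub>v q" using T w rq by (intro eq_vecI) (auto simp: scalar_prod_def)
    then show ?thesis using lc by auto
  qed
  have inj: "a = 0\<^sub>v r \<and> w = 0\<^sub>v (q - r)"
    if a: "a \<in> carrier_vec r" and w: "w \<in> carrier_vec (q - r)" and eq: "E *\<^sub>v a + T *\<^sub>v w = 0\<^sub>v q" for a w
  proof -
    have Ec: "E *\<^sub>v a \<in> carrier_vec q" and Tc: "T *\<^sub>v w \<in> carrier_vec q" using E T a w by auto
    have "l *\<^sub>v (E *\<^sub>v a) + l *\<^sub>v (T *\<^sub>v w) = l *\<^sub>v 0\<^sub>v q"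
      unfolding eq[symmetric] by (rule mult_add_distrib_mat_vec[OF lc Ec Tc, symmetric])
    then have "l *\<^sub>v (E *\<^sub>v a) = 0\<^sub>v (card B)" using lT[OF w] lc Ec by auto
    then have a0: "a = 0\<^sub>v r" using EE[OF a] by fastforce
    then have "E *\<^sub>v a = 0\<^sub>v q" using E by auto
    then have "T *\<^sub>v w = 0\<^sub>v q" using eq Tc by simp
    then show ?thesis using sv(8)[OF w] a0 by (simp add: T_def)
  qed
  obtain a w where a: "a \<in> carrier_vec r" and w: "w \<in> carrier_vec (q - r)" and vv: "v = E *\<^sub>v a + T *\<^sub>v w"
    by (rule complementary_ranges[OF E T _ inj v(1)]) (use rq in auto)
  have Ec: "E *\<^sub>v a \<in> carrier_vec q" and Tc: "T *\<^sub>v w \<in> carrier_vec q" using E T a w by auto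
  have "l *\<^sub>v v = l *\<^sub>v (E *\<^sub>v a) + l *\<^sub>v (T *\<^sub>v w)"
    unfolding vv by (rule mult_add_distrib_mat_vec[OF lc Ec Tc])
  then have "l *\<^sub>v (E *\<^sub>v a) = 0\<^sub>v (card B)" using v(2) lT[OF w] lc Ec by auto
  then have a0: "a = 0\<^sub>v r" using EE[OF a] by fastforce
  then have "E *\<^sub>v a = 0\<^sub>v q" using E by auto
  then have "v = T *\<^sub>v w" using vv Tc by simp
  then show ?thesis using w unfolding T_def r_def by blast
qed

end

lemma vec_diff_swap:
  assumes "(u :: real vec) \<in> carrier_vec n" "a \<in> carrier_vec n" "c \<in> carrier_vec n" "u = a + c"
  shows "u - c = a" "c = u - a"
  using assms by (auto intro!: eq_vecI)

context lift
begin

text \<open>The solver's factor 2 turns \<open>1 < t $ i\<close> into a singular value of at least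
  \<open>1 / 2\<close>, which exceeds \<open>\<eta>\<close>; so the fixed threshold 1 cuts the
  spectrum at the gap. A restriction \<open>rN z\<close> is then split into a certified part
  \<open>a\<close> and a part \<open>c\<close> below the cut. The lift of the whole is no longer
  than \<open>z\<close> on \<open>B\<close> and the lift of \<open>c\<close> is short, whereas the
  lift of \<open>a\<close> is at least \<open>R\<close> times as long as \<open>a\<close>; so
  \<open>a\<close> is short.\<close>

lemma gap_lift:
  assumes svd: "rho_svd 2 l C t" and cR: "cert R k" and max: "\<And>k'. cert \<eta> k' \<Longrightarrow> k' \<le> k"
    and \<eta>: "0 < \<eta>" "\<eta> \<le> 1 / 4" and R: "1 \<le> R"
    and p: "p = card {i. i < dim_vec t \<and> t $ i \<le> 1}"
  shows "last_cols_span C p \<subseteq> carrier_vec q"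
    "\<And>c. c \<in> last_cols_span C p \<Longrightarrow> vnorm (rB (L *\<^sub>v c)) \<le> 2 * \<eta> * vnorm (rN (L *\<^sub>v c))"
    "\<And>z. z \<in> Z \<Longrightarrow> \<exists>c \<in> last_cols_span C p.
       vnorm (rN z - rN (L *\<^sub>v c)) \<le> 2 * (vnorm (rB z) + vnorm (rN z)) / R"
proof -
  note sv = rho_svdD[OF svd lc]
  define k0 where "k0 = card {i. i < q \<and> 1 < t $ i}"
  have k0q: "k0 \<le> q" unfolding k0_def using card_mono[of "{..<q}" "{i. i < q \<and> 1 < t $ i}"] by auto
  have pq: "q - p = k0"
  proof -
    have "{i. i < dim_vec t \<and> t $ i \<le> 1} = {..<q} - {i. i < q \<and> 1 < t $ i}"
      using sv(2) by auto
    then have "p = q - k0" unfolding p k0_def by (simp add: card_Diff_subset subset_eq)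
    then show ?thesis using k0q by simp
  qed
  have sub: "{i. i < q \<and> 1 < t $ i} \<subseteq> {i. i < q \<and> \<eta> < singular_values l $ i}"
    using sv(6) \<eta>(2) by fastforce
  have c\<sigma>: "card {i. i < q \<and> \<eta> < singular_values l $ i} \<le> k"
    by (rule max[OF cert_singular_values]) (use \<eta> in simp)
  have "k0 \<le> card {i. i < q \<and> \<eta> < singular_values l $ i}"
    unfolding k0_def by (rule card_mono[OF _ sub]) simp
  moreover have "k \<le> k0"
  proof -
    have "k \<le> card {i. i < q \<and> R < t $ i}" by (rule cert_le[OF cR svd])
    also have "\<dots> \<le> k0" unfolding k0_def by (rule card_mono) (use R in auto)
    finally show ?thesis .
  qed
  \<comment> \<open>The counts form a closed chain of inequalities from \<open>k\<close> through
    \<open>k0\<close> and the number of singular values above \<open>\<eta>\<close> back to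
    \<open>k\<close>, so all are equal.\<close>
  ultimately have kk: "k = k0" and "card {i. i < q \<and> \<eta> < singular_values l $ i} = k0" using c\<sigma> by auto
  then have eqs: "{i. i < q \<and> 1 < t $ i} = {i. i < q \<and> \<eta> < singular_values l $ i}"
    by (intro card_seteq[OF _ sub]) (auto simp: k0_def)
  have tsmall: "t $ k0 \<le> 2 * \<eta>" if "k0 < q"
  proof -
    have "\<not> 1 < t $ k0"
      using card_initial_segment[of t k0 1] sv(2,3) that by (auto simp: nonincreasing_vec_def k0_def)
    then have "\<not> \<eta> < singular_values l $ k0" using eqs that by blast
    then show ?thesis using sv(6)[OF that] by simp
  qed
  define T where "T = tcols C k0"
  have T: "T \<in> carrier_mat q (q - k0)" unfolding T_def by (rule tcols_carrier[OF sv(1)])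
  have span: "last_cols_span C p = {T *\<^sub>v v | v. v \<in> carrier_vec (q - k0)}"
    unfolding last_cols_span_def T_def using sv(1) span_tcols[OF sv(1), of k0] pq by simp
  show S: "last_cols_span C p \<subseteq> carrier_vec q" unfolding span using T by auto
  have small: "vnorm (l *\<^sub>v c) \<le> 2 * \<eta> * vnorm c" if c: "c \<in> last_cols_span C p" for c
  proof -
    obtain v where v: "v \<in> carrier_vec (q - k0)" "c = T *\<^sub>v v" using c unfolding span by blast
    show ?thesis
    proof (cases "k0 < q")
      case True
      have "vnorm (l *\<^sub>v c) \<le> t $ k0 * vnorm c" unfolding v(2) T_def by (rule sv(7)[OF True v(1)])
      also have "\<dots> \<le> 2 * \<eta> * vnorm c" using tsmall[OF True] by (intro mult_right_mono) auto
      finally show ?thesis .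
    next
      case False
      then have "c = 0\<^sub>v q" unfolding v(2) using T v k0q by (intro eq_vecI) (auto simp: scalar_prod_def)
      then show ?thesis using mult_mat_vec_0[OF lc] by simp
    qed
  qed
  \<comment> \<open>The span of the trailing columns need not consist of restrictions of points of
    \<open>Z\<close>. It contains the kernel of \<open>l\<close>, and \<open>Pr c - c\<close> lies
    in that kernel, so with \<open>c\<close> it contains \<open>Pr c\<close>, the only part of
    \<open>c\<close> that the lift sees.\<close>
  have ker: "c \<in> last_cols_span C p" if c: "c \<in> carrier_vec q" "l *\<^sub>v c = 0\<^sub>v (card B)" for c
  proof -
    define r where "r = card {i. i < q \<and> 0 < t $ i}"
    obtain w where w: "w \<in> carrier_vec (q - r)" "c = tcols C r *\<^sub>v w"
      using zero_singular_space[OF svd _ c] unfolding r_def by auto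
    have "k0 \<le> r" unfolding r_def k0_def by (intro card_mono) auto
    then have "vspan q {col C j | j. r \<le> j \<and> j < q} \<subseteq> vspan q {col C j | j. k0 \<le> j \<and> j < q}"
    proof -
      interpret V: vec_space "TYPE(real)" q .
      show ?thesis by (rule V.span_is_monotone) (use \<open>k0 \<le> r\<close> in auto)
    qed
    then show ?thesis
      using w span_tcols[OF sv(1), of r] span_tcols[OF sv(1), of k0] unfolding span T_def by blast
  qed
  have add: "c + c' \<in> last_cols_span C p" if "c \<in> last_cols_span C p" "c' \<in> last_cols_span C p" for c c'
  proof -
    obtain v v' where v: "v \<in> carrier_vec (q - k0)" "c = T *\<^sub>v v" "v' \<in> carrier_vec (q - k0)" "c' = T *\<^sub>v v'"
      using \<open>c \<in> _\<close> \<open>c' \<in> _\<close> unfolding span by blast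
    then have "c + c' = T *\<^sub>v (v + v')" using T by (simp add: mult_add_distrib_mat_vec)
    then show ?thesis unfolding span using v by auto
  qed
  have PrC: "Pr c \<in> last_cols_span C p" if c: "c \<in> last_cols_span C p" for c
  proof -
    have cc: "c \<in> carrier_vec q" using c S by blast
    have "l *\<^sub>v (Pr c - c) = l *\<^sub>v Pr c - l *\<^sub>v c" by (rule mult_minus_distrib_mat_vec[OF lc Prc[OF cc] cc])
    also have "\<dots> = 0\<^sub>v (card B)" unfolding l_Pr[OF cc] using lc cc by auto
    finally have "Pr c - c \<in> last_cols_span C p" by (intro ker) (use cc in auto)
    moreover have "c + (Pr c - c) = Pr c"
      using cc Prc[OF cc, THEN carrier_vecD] by (intro eq_vecI) (simp_all del: Prc)
    ultimately show ?thesis using add[OF c, of "Pr c - c"] by simp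
  qed
  show small': "vnorm (rB (L *\<^sub>v c)) \<le> 2 * \<eta> * vnorm (rN (L *\<^sub>v c))" if c: "c \<in> last_cols_span C p" for c
  proof -
    have cc: "c \<in> carrier_vec q" using c S by blast
    show ?thesis using small[OF PrC[OF c]] unfolding l_Pr[OF cc] lv[OF cc] rN_L[OF cc] .
  qed
  obtain F where F: "F \<in> carrier_mat n k" "\<And>u. u \<in> carrier_vec k \<Longrightarrow> F *\<^sub>v u \<in> Z"
    and FF: "\<And>u z. u \<in> carrier_vec k \<Longrightarrow> u \<noteq> 0\<^sub>v k \<Longrightarrow> z \<in> Z \<Longrightarrow> rN z = rN (F *\<^sub>v u) \<Longrightarrow>
       R * vnorm (rN z) < vnorm (rB z)"
    using cR unfolding cert_def by blast
  define G where "G = (selm n N)\<^sup>T * F"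
  have G: "G \<in> carrier_mat q k" unfolding G_def using F(1) by (simp add: mult_carrier_mat[of _ q n])
  have Gv: "G *\<^sub>v u = rN (F *\<^sub>v u)" if "u \<in> carrier_vec k" for u
    unfolding G_def using F(1) that by (intro assoc_mult_mat_vec[of _ q n _ k]) auto
  have big: "R * vnorm (G *\<^sub>v u) < vnorm (l *\<^sub>v (G *\<^sub>v u))" if "u \<in> carrier_vec k" "u \<noteq> 0\<^sub>v k" for u
    unfolding Gv[OF that(1)] by (rule cert_D[OF F FF that])
  have inj: "u = 0\<^sub>v k \<and> v = 0\<^sub>v (q - k0)"
    if u: "u \<in> carrier_vec k" and v: "v \<in> carrier_vec (q - k0)" and eq: "G *\<^sub>v u + T *\<^sub>v v = 0\<^sub>v q" for u v
  proof -
    have Gc: "G *\<^sub>v u \<in> carrier_vec q" and Tc: "T *\<^sub>v v \<in> carrier_vec q" using G T u v by auto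
    have GT: "G *\<^sub>v u = - (T *\<^sub>v v)" by (rule vec_add_eq_0[OF Gc Tc eq])
    have u0: "u = 0\<^sub>v k"
    proof (rule ccontr)
      assume "u \<noteq> 0\<^sub>v k"
      from big[OF u this] have "R * vnorm (T *\<^sub>v v) < vnorm (l *\<^sub>v (T *\<^sub>v v))"
        unfolding GT mult_mat_vec_uminus[OF lc Tc] by simp
      also have "\<dots> \<le> 2 * \<eta> * vnorm (T *\<^sub>v v)" by (rule small) (use v span in blast)
      also have "\<dots> \<le> R * vnorm (T *\<^sub>v v)" using \<eta> R by (intro mult_right_mono) auto
      finally show False by simp
    qed
    then have "G *\<^sub>v u = 0\<^sub>v q" using mult_mat_vec_0[OF G] by simp
    then have "T *\<^sub>v v = 0\<^sub>v q" using eq Tc by simp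
    then show ?thesis using sv(8)[OF v] u0 by (simp add: T_def)
  qed
  fix z assume z: "z \<in> Z"
  have zc: "z \<in> carrier_vec n" by (rule Z_carrier[OF z])
  then have r: "rN z \<in> carrier_vec q" by simp
  obtain u v where u: "u \<in> carrier_vec k" and v: "v \<in> carrier_vec (q - k0)" and e: "rN z = G *\<^sub>v u + T *\<^sub>v v"
    by (rule complementary_ranges[OF G T _ inj r]) (use kk k0q in auto)
  define a where "a = G *\<^sub>v u"
  define c where "c = T *\<^sub>v v"
  have a: "a \<in> carrier_vec q" and c: "c \<in> carrier_vec q" using G T u v by (auto simp: a_def c_def)
  have e': "rN z = a + c" using e by (simp add: a_def c_def)
  have cS: "c \<in> last_cols_span C p" unfolding span c_def using v by blast
  have aZ: "a = rN (F *\<^sub>v u)" using Gv[OF u] by (simp add: a_def)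
  have fZ: "F *\<^sub>v u \<in> Z" by (rule F(2)[OF u])
  \<comment> \<open>This exhibits \<open>c\<close> as the restriction of a point of
    \<open>Z\<close>, so that \<open>L\<close> reproduces it exactly on \<open>N\<close>.\<close>
  have "z - F *\<^sub>v u \<in> Z" by (rule Z_diff[OF z fZ])
  moreover have "rN (z - F *\<^sub>v u) = c"
  proof -
    have "rN (z - F *\<^sub>v u) = rN z - rN (F *\<^sub>v u)"
      using zc Z_carrier[OF fZ] by (intro mult_minus_distrib_mat_vec[of _ q n]) auto
    also have "\<dots> = c" using vec_diff_swap(2)[OF r a c e'] aZ by simp
    finally show ?thesis .
  qed
  ultimately have Prc': "Pr c = c" using Pr_restr[of "z - F *\<^sub>v u"] by simp
  have ra: "R * vnorm a \<le> vnorm (l *\<^sub>v a)"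
  proof (cases "u = 0\<^sub>v k")
    case True
    then have "a = 0\<^sub>v q" using mult_mat_vec_0[OF G] by (simp add: a_def)
    then show ?thesis by simp
  next
    case False
    then show ?thesis using big[OF u] by (simp add: a_def)
  qed
  have "l *\<^sub>v rN z = l *\<^sub>v a + l *\<^sub>v c" unfolding e' by (rule mult_add_distrib_mat_vec[OF lc a c])
  then have "l *\<^sub>v a = l *\<^sub>v rN z - l *\<^sub>v c"
    using vec_diff_swap(1)[of "l *\<^sub>v rN z" "card B" "l *\<^sub>v a" "l *\<^sub>v c"] lc r a c by simp
  then have "vnorm (l *\<^sub>v a) \<le> vnorm (l *\<^sub>v rN z) + vnorm (l *\<^sub>v c)"
    using vnorm_diff_le[of "l *\<^sub>v rN z" "card B" "l *\<^sub>v c"] lc r c by simp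
  also have "\<dots> \<le> vnorm (rB z) + 2 * \<eta> * vnorm c"
    using min_norm_lift[OF z] small[OF cS] by simp
  also have "vnorm c \<le> vnorm (rN z) + vnorm a"
    using vec_diff_swap(2)[OF r a c e'] vnorm_diff_le[OF r a] by simp
  finally have "R * vnorm a \<le> vnorm (rB z) + 2 * \<eta> * (vnorm (rN z) + vnorm a)"
    using ra \<eta> by (simp add: mult_left_mono)
  moreover have "2 * \<eta> * (vnorm (rN z) + vnorm a) \<le> 1 / 2 * (vnorm (rN z) + vnorm a)"
    using \<eta> by (intro mult_right_mono) auto
  ultimately have "R * vnorm a \<le> vnorm (rB z) + vnorm (rN z) / 2 + vnorm a / 2"
    by (simp add: algebra_simps)
  moreover have "vnorm a \<le> R * vnorm a" using R mult_right_mono[of 1 R "vnorm a"] by simp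
  ultimately have "R * vnorm a \<le> 2 * (vnorm (rB z) + vnorm (rN z))"
  proof -
    have "x \<le> 2 * (b + r)" if "x \<le> b + r / 2 + y / 2" "y \<le> x" "0 \<le> r" "0 \<le> b" for x y b r :: real
      using that by argo
    from this[OF \<open>R * vnorm a \<le> vnorm (rB z) + vnorm (rN z) / 2 + vnorm a / 2\<close>
        \<open>vnorm a \<le> R * vnorm a\<close> vnorm_nonneg vnorm_nonneg] show ?thesis .
  qed
  then have "vnorm a \<le> 2 * (vnorm (rB z) + vnorm (rN z)) / R" using R by (simp add: field_simps)
  moreover have "rN z - rN (L *\<^sub>v c) = a"
    unfolding rN_L[OF c] Prc' by (rule vec_diff_swap(1)[OF r a c e'])
  ultimately show "\<exists>c \<in> last_cols_span C p.
       vnorm (rN z - rN (L *\<^sub>v c)) \<le> 2 * (vnorm (rB z) + vnorm (rN z)) / R"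
    using cS by auto
qed

end

section \<open>Linear programs and Newton directions\<close>

lemma diagm_mult_vec:
  assumes "v \<in> carrier_vec n"
  shows "diagm n d *\<^sub>v v = vec n (\<lambda>i. d i * v $ i)"
  using assms by (intro eq_vecI) (simp_all add: diagm_mult_vec_index del: index_mult_mat_vec)

lemma diagm_inverse:
  assumes v: "v \<in> carrier_vec n" and "\<And>i. i < n \<Longrightarrow> d i \<noteq> 0"
  shows "diagm n d *\<^sub>v (diagm n (\<lambda>i. 1 / d i) *\<^sub>v v) = v" "diagm n (\<lambda>i. 1 / d i) *\<^sub>v (diagm n d *\<^sub>v v) = v"
  using assms by (auto simp: diagm_mult_vec intro!: eq_vecI)

locale lp_matrix =
  fixes m n :: nat and A :: "real mat"
  assumes A: "A \<in> carrier_mat m n"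
begin

lemma W_iff: "w \<in> W A \<longleftrightarrow> w \<in> carrier_vec n \<and> A *\<^sub>v w = 0\<^sub>v m"
  using A by (auto simp: W_def mat_kernel_def)

lemma W_carrier: "w \<in> W A \<Longrightarrow> w \<in> carrier_vec n" by (simp add: W_iff)

lemma Wperp_iff: "v \<in> Wperp A \<longleftrightarrow> (\<exists>y \<in> carrier_vec m. v = A\<^sup>T *\<^sub>v y)"
  using A by (auto simp: Wperp_def)

lemma Wperp_carrier: "v \<in> Wperp A \<Longrightarrow> v \<in> carrier_vec n"
  using A by (auto simp: Wperp_iff)

lemma W_smult: "w \<in> W A \<Longrightarrow> a \<cdot>\<^sub>v w \<in> W A"
  using A by (auto simp: W_iff mult_mat_vec[of A m n])

lemma W_diff: "w \<in> W A \<Longrightarrow> w' \<in> W A \<Longrightarrow> w - w' \<in> W A"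
  using A by (auto simp: W_iff mult_minus_distrib_mat_vec[of A m n])

lemma Wperp_add: "w \<in> Wperp A \<Longrightarrow> w' \<in> Wperp A \<Longrightarrow> w + w' \<in> Wperp A"
proof -
  assume "w \<in> Wperp A" "w' \<in> Wperp A"
  then obtain y y' where "y \<in> carrier_vec m" "w = A\<^sup>T *\<^sub>v y" "y' \<in> carrier_vec m" "w' = A\<^sup>T *\<^sub>v y'"
    unfolding Wperp_iff by blast
  then show ?thesis using A mult_add_distrib_mat_vec[of "A\<^sup>T" n m y y']
    unfolding Wperp_iff by (intro bexI[of _ "y + y'"]) auto
qed

lemma Wperp_smult: "w \<in> Wperp A \<Longrightarrow> a \<cdot>\<^sub>v w \<in> Wperp A"
proof -
  assume "w \<in> Wperp A"
  then obtain y where "y \<in> carrier_vec m" "w = A\<^sup>T *\<^sub>v y" unfolding Wperp_iff by blast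
  then show ?thesis using A mult_mat_vec[of "A\<^sup>T" n m y a]
    unfolding Wperp_iff by (intro bexI[of _ "a \<cdot>\<^sub>v y"]) auto
qed

lemma W_zero: "0\<^sub>v n \<in> W A" using mult_mat_vec_0[OF A] by (simp add: W_iff)

lemma Wperp_zero: "0\<^sub>v n \<in> Wperp A"
  using mult_mat_vec_0[of "A\<^sup>T" n m] A unfolding Wperp_iff by (intro bexI[of _ "0\<^sub>v m"]) auto

lemma Wperp_diff:
  assumes "w \<in> Wperp A" "w' \<in> Wperp A"
  shows "w - w' \<in> Wperp A"
proof -
  have "w - w' = w + (-1) \<cdot>\<^sub>v w'" using Wperp_carrier assms by (intro eq_vecI) auto
  then show ?thesis using Wperp_add Wperp_smult assms by metis
qed

lemma W_Wperp:
  assumes w: "w \<in> W A" and v: "v \<in> Wperp A"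
  shows "(\<Sum>i<n. w $ i * v $ i) = 0"
proof -
  obtain y where y: "y \<in> carrier_vec m" "v = A\<^sup>T *\<^sub>v y" using v by (auto simp: Wperp_iff)
  have wc: "w \<in> carrier_vec n" by (rule W_carrier[OF w])
  have "w \<bullet> v = (A *\<^sub>v w) \<bullet> y" unfolding y(2) by (rule scalar_prod_mult_mat[OF A wc y(1), symmetric])
  also have "\<dots> = 0" using w y by (simp add: W_iff)
  finally show ?thesis using Wperp_carrier[OF v] by (simp add: scalar_prod_def atLeast0LessThan)
qed

text \<open>\<open>R\<close> projects onto the row space scaled by \<open>d\<close>; its kernel is
  the kernel of \<open>A\<close> scaled by \<open>1 / d\<close>. So for \<open>d = x\<close> a
  single matrix and its complement serve both cheap lifts, and for constant \<open>d\<close> it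
  separates \<open>W A\<close> from \<open>Wperp A\<close>.\<close>

lemma scaled_projection:
  assumes d: "\<And>i. i < n \<Longrightarrow> 0 < d i"
  obtains R where "R \<in> carrier_mat n n" "R\<^sup>T = R" "R * R = R"
    "\<And>v. v \<in> carrier_vec n \<Longrightarrow> R *\<^sub>v v = 0\<^sub>v n \<longleftrightarrow> vec n (\<lambda>i. d i * v $ i) \<in> W A"
    "\<And>v. v \<in> carrier_vec n \<Longrightarrow> R *\<^sub>v v = v \<longleftrightarrow> vec n (\<lambda>i. v $ i / d i) \<in> Wperp A"
proof -
  define H where "H = diagm n d * A\<^sup>T"
  have H: "H \<in> carrier_mat n m" using A by (simp add: H_def mult_carrier_mat[of _ n n])
  have HT: "H\<^sup>T = A * diagm n d" unfolding H_def using A by (simp add: transpose_mult[of _ n n _ m])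
  obtain R Y where R: "R \<in> carrier_mat n n" "Y \<in> carrier_mat m n" "R\<^sup>T = R" "R * R = R" "R * H = H" "R = H * Y"
    using range_projection[OF H] by blast
  have 1: "R *\<^sub>v v = 0\<^sub>v n \<longleftrightarrow> vec n (\<lambda>i. d i * v $ i) \<in> W A" if v: "v \<in> carrier_vec n" for v
  proof -
    have HTv: "H\<^sup>T *\<^sub>v v = A *\<^sub>v vec n (\<lambda>i. d i * v $ i)"
      unfolding HT using A v by (simp add: assoc_mult_mat_vec[of _ m n _ n] diagm_mult_vec)
    have "R *\<^sub>v v = 0\<^sub>v n \<longleftrightarrow> H\<^sup>T *\<^sub>v v = 0\<^sub>v m"
    proof
      assume 0: "R *\<^sub>v v = 0\<^sub>v n"
      have "H\<^sup>T = H\<^sup>T * R" using transpose_mult[OF R(1) H] R(3,5) by simp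
      then have "H\<^sup>T *\<^sub>v v = (H\<^sup>T * R) *\<^sub>v v" by (rule arg_cong)
      also have "\<dots> = H\<^sup>T *\<^sub>v (R *\<^sub>v v)" using H R(1) v by (intro assoc_mult_mat_vec[of _ m n _ n]) auto
      also have "\<dots> = 0\<^sub>v m" unfolding 0 using mult_mat_vec_0[of "H\<^sup>T" m n] H by simp
      finally show "H\<^sup>T *\<^sub>v v = 0\<^sub>v m" .
    next
      assume 0: "H\<^sup>T *\<^sub>v v = 0\<^sub>v m"
      have "R = Y\<^sup>T * H\<^sup>T" using transpose_mult[OF H R(2)] R(3,6) by simp
      then have "R *\<^sub>v v = (Y\<^sup>T * H\<^sup>T) *\<^sub>v v" by (rule arg_cong)
      also have "\<dots> = Y\<^sup>T *\<^sub>v (H\<^sup>T *\<^sub>v v)" using H R(2) v by (intro assoc_mult_mat_vec[of _ n m _ n]) auto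
      also have "\<dots> = 0\<^sub>v n" unfolding 0 using mult_mat_vec_0[of "Y\<^sup>T" n m] R(2) by simp
      finally show "R *\<^sub>v v = 0\<^sub>v n" .
    qed
    then show ?thesis unfolding HTv W_iff by simp
  qed
  have 2: "R *\<^sub>v v = v \<longleftrightarrow> vec n (\<lambda>i. v $ i / d i) \<in> Wperp A" if v: "v \<in> carrier_vec n" for v
  proof
    have e: "vec n (\<lambda>i. v $ i / d i) = diagm n (\<lambda>i. 1 / d i) *\<^sub>v v" using v by (simp add: diagm_mult_vec)
    {
      assume a: "R *\<^sub>v v = v"
      have "v = H *\<^sub>v (Y *\<^sub>v v)" using R(6) a assoc_mult_mat_vec[OF H R(2) v] by simp
      also have "\<dots> = diagm n d *\<^sub>v (A\<^sup>T *\<^sub>v (Y *\<^sub>v v))"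
        unfolding H_def using A R(2) v by (intro assoc_mult_mat_vec[of _ n n _ m]) auto
      finally have "vec n (\<lambda>i. v $ i / d i) = diagm n (\<lambda>i. 1 / d i) *\<^sub>v (diagm n d *\<^sub>v (A\<^sup>T *\<^sub>v (Y *\<^sub>v v)))"
        unfolding e by (rule arg_cong)
      also have "\<dots> = A\<^sup>T *\<^sub>v (Y *\<^sub>v v)" by (rule diagm_inverse(2)) (use A R(2) v d in \<open>auto simp: less_imp_neq[symmetric]\<close>)
      finally show "vec n (\<lambda>i. v $ i / d i) \<in> Wperp A"
        unfolding Wperp_iff using R(2) v by (intro bexI[of _ "Y *\<^sub>v v"]) auto
    }
    assume "vec n (\<lambda>i. v $ i / d i) \<in> Wperp A"
    then obtain y where y: "y \<in> carrier_vec m" "diagm n (\<lambda>i. 1 / d i) *\<^sub>v v = A\<^sup>T *\<^sub>v y"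
      unfolding e Wperp_iff by blast
    have "v = diagm n d *\<^sub>v (diagm n (\<lambda>i. 1 / d i) *\<^sub>v v)"
      by (rule diagm_inverse(1)[symmetric]) (use v d in \<open>auto simp: less_imp_neq[symmetric]\<close>)
    also have "\<dots> = H *\<^sub>v y" unfolding y(2) H_def using A y(1)
      by (intro assoc_mult_mat_vec[of _ n n _ m, symmetric]) auto
    finally have vH: "v = H *\<^sub>v y" .
    then have "R *\<^sub>v v = (R * H) *\<^sub>v y" using assoc_mult_mat_vec[OF R(1) H y(1)] by simp
    then show "R *\<^sub>v v = v" unfolding R(5) vH .
  qed
  show thesis by (rule that[OF R(1,3,4) 1 2])
qed

lemma scaled_decomposition:
  assumes d: "\<And>i. i < n \<Longrightarrow> 0 < d i" and v: "v \<in> carrier_vec n"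
  obtains p q where "p \<in> carrier_vec n" "q \<in> carrier_vec n" "vec n (\<lambda>i. d i * p $ i) \<in> W A"
    "vec n (\<lambda>i. q $ i / d i) \<in> Wperp A" "v = p + q"
proof -
  obtain R where R: "R \<in> carrier_mat n n" "R\<^sup>T = R" "R * R = R"
    and 0: "\<And>v. v \<in> carrier_vec n \<Longrightarrow> R *\<^sub>v v = 0\<^sub>v n \<longleftrightarrow> vec n (\<lambda>i. d i * v $ i) \<in> W A"
    and 1: "\<And>v. v \<in> carrier_vec n \<Longrightarrow> R *\<^sub>v v = v \<longleftrightarrow> vec n (\<lambda>i. v $ i / d i) \<in> Wperp A"
    by (rule scaled_projection[of d, OF d]) auto
  define q where "q = R *\<^sub>v v"
  have q: "q \<in> carrier_vec n" using R v by (simp add: q_def)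
  have RR: "R *\<^sub>v q = q" unfolding q_def using assoc_mult_mat_vec[OF R(1) R(1) v] R(3) by simp
  have "R *\<^sub>v (v - q) = R *\<^sub>v v - R *\<^sub>v q" by (rule mult_minus_distrib_mat_vec[OF R(1) v q])
  then have "R *\<^sub>v (v - q) = 0\<^sub>v n" using q by (simp add: RR q_def[symmetric])
  then have "vec n (\<lambda>i. d i * (v - q) $ i) \<in> W A" using 0[of "v - q"] v q by simp
  moreover have "v = (v - q) + q" using v q by (intro eq_vecI) auto
  ultimately show thesis using that[of "v - q" q] 1[OF q] RR q v by simp
qed

text \<open>Replaces membership in a range by a family of linear equations, a form that survives
  passing to limits.\<close>

lemma WperpI:
  assumes v: "v \<in> carrier_vec n" and orth: "\<And>w. w \<in> W A \<Longrightarrow> (\<Sum>i<n. w $ i * v $ i) = 0"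
  shows "v \<in> Wperp A"
proof -
  obtain p q where p: "p \<in> carrier_vec n" "vec n (\<lambda>i. 1 * p $ i) \<in> W A"
    and q: "q \<in> carrier_vec n" "vec n (\<lambda>i. q $ i / 1) \<in> Wperp A" and vpq: "v = p + q"
    by (rule scaled_decomposition[of "\<lambda>_. 1", OF _ v]) auto
  have "vec n (\<lambda>i. 1 * p $ i) = p" "vec n (\<lambda>i. q $ i / 1) = q" using p(1) q(1) by (auto intro!: eq_vecI)
  then have pW: "p \<in> W A" and qW: "q \<in> Wperp A" using p q by simp_all
  have "(\<Sum>i<n. p $ i * p $ i) = (\<Sum>i<n. p $ i * v $ i) - (\<Sum>i<n. p $ i * q $ i)"
    unfolding sum_subtractf[symmetric] vpq using p q by (intro sum.cong) (auto simp: algebra_simps)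
  then have "p \<bullet> p = 0" using orth[OF pW] W_Wperp[OF pW qW] p by (simp add: scalar_prod_def atLeast0LessThan)
  then have "v = q" using scalar_prod_self_eq_0[OF p(1)] vpq q by simp
  then show ?thesis using qW by simp
qed

end

section \<open>Means, affine paths and the energy of a Newton system\<close>

lemma L2_set_abs_le: "finite S \<Longrightarrow> i \<in> S \<Longrightarrow> \<bar>f i\<bar> \<le> L2_set f S"
  using member_le_L2_set[of S i "\<lambda>i. \<bar>f i\<bar>"] by (simp add: L2_set_def)

lemma L2_set_const_mult: "L2_set (\<lambda>i. a * f i) S = \<bar>a\<bar> * L2_set f S"
  by (simp add: L2_set_def power_mult_distrib sum_distrib_left[symmetric] real_sqrt_mult)

text \<open>The mean is the best constant approximation. It lets the distance from centrality be
  estimated with any convenient value \<open>\<nu>\<close> in place of the actual duality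
  measure.\<close>

lemma L2_set_mean_le:
  fixes p :: "nat \<Rightarrow> real"
  assumes n: "0 < n" and M: "M = (\<Sum>i<n. p i) / real n"
  shows "L2_set (\<lambda>i. p i - M) {..<n} \<le> L2_set (\<lambda>i. p i - \<nu>) {..<n}"
proof -
  have s: "(\<Sum>i<n. p i - M) = 0" using n M by (simp add: sum_subtractf)
  have "(\<Sum>i<n. (p i - \<nu>)\<^sup>2) = (\<Sum>i<n. (p i - M)\<^sup>2 + 2 * (M - \<nu>) * (p i - M) + (M - \<nu>)\<^sup>2)"
    by (intro sum.cong) (auto simp: power2_eq_square algebra_simps)
  also have "\<dots> = (\<Sum>i<n. (p i - M)\<^sup>2) + 2 * (M - \<nu>) * (\<Sum>i<n. p i - M) + real n * (M - \<nu>)\<^sup>2"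
    by (simp add: sum.distrib sum_distrib_left)
  finally have "(\<Sum>i<n. (p i - M)\<^sup>2) \<le> (\<Sum>i<n. (p i - \<nu>)\<^sup>2)" using s by simp
  then show ?thesis by (simp add: L2_set_def)
qed

lemma mean_ge:
  fixes p :: "nat \<Rightarrow> real"
  assumes n: "0 < n" and L: "L2_set (\<lambda>i. p i - \<nu>) {..<n} \<le> e"
  shows "\<bar>(\<Sum>i<n. p i) / real n - \<nu>\<bar> \<le> e"
proof -
  have "\<bar>\<Sum>i<n. p i - \<nu>\<bar> \<le> (\<Sum>i<n. \<bar>p i - \<nu>\<bar>)" by (rule sum_abs)
  also have "\<dots> \<le> (\<Sum>i<n. e)"
    using L by (intro sum_mono order.trans[OF L2_set_abs_le[of "{..<n}"]]) auto
  finally have "\<bar>(\<Sum>i<n. p i) - real n * \<nu>\<bar> \<le> real n * e" by (simp add: sum_subtractf)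
  moreover have "(\<Sum>i<n. p i) / real n - \<nu> = ((\<Sum>i<n. p i) - real n * \<nu>) / real n"
    using n by (simp add: field_simps)
  ultimately show ?thesis using n by (simp add: field_simps)
qed

text \<open>If an affine factor stopped being positive, it would have a zero on the way, and the
  product would vanish there.\<close>

lemma affine_path_positive:
  fixes x s :: real
  assumes x: "0 < x" "0 < s" and \<alpha>: "0 \<le> \<alpha>"
    and path: "\<And>a. 0 \<le> a \<Longrightarrow> a \<le> \<alpha> \<Longrightarrow> 0 < (x + a * dx) * (s + a * ds)"
  shows "0 < x + \<alpha> * dx" "0 < s + \<alpha> * ds"
proof -
  have pos: "0 < y + \<alpha> * dy" if y: "0 < y" and nz: "\<And>a. 0 \<le> a \<Longrightarrow> a \<le> \<alpha> \<Longrightarrow> y + a * dy \<noteq> 0" for y dy :: real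
  proof (rule ccontr)
    assume "\<not> 0 < y + \<alpha> * dy"
    then have le: "y + \<alpha> * dy \<le> 0" by simp
    then have dy: "dy < 0" using y \<alpha> by (smt (verit) mult_nonneg_nonneg)
    have "- y / dy \<le> \<alpha>" using le dy by (simp add: field_simps)
    moreover have "0 \<le> - y / dy" using y dy by (simp add: field_simps)
    moreover have "y + (- y / dy) * dy = 0" using dy by simp
    ultimately show False using nz by blast
  qed
  show "0 < x + \<alpha> * dx" by (rule pos[OF x(1)]) (use path in force)
  show "0 < s + \<alpha> * ds" by (rule pos[OF x(2)]) (use path in force)
qed

text \<open>The squared Newton equation is divided by \<open>x i * s i\<close> and summed; the cross
  terms \<open>2 * (dx i * ds i)\<close> add up to zero by orthogonality. The second bound is the
  arithmetic-geometric mean inequality in each coordinate.\<close>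

lemma newton_energy:
  fixes x s dx ds r :: "nat \<Rightarrow> real"
  assumes pos: "\<And>i. i < n \<Longrightarrow> 0 < x i" "\<And>i. i < n \<Longrightarrow> 0 < s i"
    and eq: "\<And>i. i < n \<Longrightarrow> s i * dx i + x i * ds i = r i" and orth: "(\<Sum>i<n. dx i * ds i) = 0"
  shows "(\<Sum>i<n. x i * s i * (dx i / x i)\<^sup>2 + x i * s i * (ds i / s i)\<^sup>2) = (\<Sum>i<n. (r i)\<^sup>2 / (x i * s i))"
    "L2_set (\<lambda>i. dx i * ds i) {..<n} \<le> (\<Sum>i<n. (r i)\<^sup>2 / (x i * s i)) / 2"
proof -
  have "(\<Sum>i<n. (r i)\<^sup>2 / (x i * s i)) = (\<Sum>i<n. x i * s i * (dx i / x i)\<^sup>2 + x i * s i * (ds i / s i)\<^sup>2 + 2 * (dx i * ds i))"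
  proof (intro sum.cong refl)
    fix i assume "i \<in> {..<n}"
    then have p: "0 < x i" "0 < s i" using pos by auto
    have "(r i)\<^sup>2 = (s i * dx i + x i * ds i)\<^sup>2" using eq \<open>i \<in> _\<close> by simp
    then show "(r i)\<^sup>2 / (x i * s i) = x i * s i * (dx i / x i)\<^sup>2 + x i * s i * (ds i / s i)\<^sup>2 + 2 * (dx i * ds i)"
      using p by (simp add: field_simps power2_eq_square)
  qed
  also have "\<dots> = (\<Sum>i<n. x i * s i * (dx i / x i)\<^sup>2 + x i * s i * (ds i / s i)\<^sup>2)"
    unfolding sum.distrib[of "\<lambda>i. x i * s i * (dx i / x i)\<^sup>2 + x i * s i * (ds i / s i)\<^sup>2"] sum_distrib_left[symmetric] orth by simp
  finally show e: "(\<Sum>i<n. x i * s i * (dx i / x i)\<^sup>2 + x i * s i * (ds i / s i)\<^sup>2) = (\<Sum>i<n. (r i)\<^sup>2 / (x i * s i))" ..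
  have "L2_set (\<lambda>i. dx i * ds i) {..<n} \<le> (\<Sum>i<n. \<bar>dx i * ds i\<bar>)" by (rule L2_set_le_sum_abs)
  also have "\<dots> \<le> (\<Sum>i<n. (x i * s i * (dx i / x i)\<^sup>2 + x i * s i * (ds i / s i)\<^sup>2) / 2)"
  proof (intro sum_mono)
    fix i assume "i \<in> {..<n}"
    then have p: "0 < x i" "0 < s i" using pos by auto
    have "2 * (\<bar>dx i / x i\<bar> * \<bar>ds i / s i\<bar>) \<le> (dx i / x i)\<^sup>2 + (ds i / s i)\<^sup>2"
    proof -
      have "2 * (\<bar>a\<bar> * \<bar>e\<bar>) \<le> a\<^sup>2 + e\<^sup>2" for a e :: real
        using sum_squares_bound[of "\<bar>a\<bar>" "\<bar>e\<bar>"] by (simp add: mult.assoc)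
      then show ?thesis .
    qed
    then have "x i * s i * (2 * (\<bar>dx i / x i\<bar> * \<bar>ds i / s i\<bar>)) \<le> x i * s i * ((dx i / x i)\<^sup>2 + (ds i / s i)\<^sup>2)"
      using p by (intro mult_left_mono) auto
    moreover have "x i * s i * (2 * (\<bar>dx i / x i\<bar> * \<bar>ds i / s i\<bar>)) = 2 * \<bar>dx i * ds i\<bar>"
      using p by (simp add: abs_mult field_simps)
    ultimately show "\<bar>dx i * ds i\<bar> \<le> (x i * s i * (dx i / x i)\<^sup>2 + x i * s i * (ds i / s i)\<^sup>2) / 2"
      by (simp add: distrib_left)
  qed
  finally show "L2_set (\<lambda>i. dx i * ds i) {..<n} \<le> (\<Sum>i<n. (r i)\<^sup>2 / (x i * s i)) / 2"
    unfolding sum_divide_distrib[symmetric] e .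
qed

section \<open>Feasible pairs and neighborhoods of the central path\<close>

locale lp = lp_matrix +
  fixes b c :: "real vec"
  assumes b: "b \<in> carrier_vec m" and c: "c \<in> carrier_vec n" and n0: "0 < n"
begin

text \<open>The dual variable is eliminated in favor of membership in \<open>Wperp A\<close>. Signs
  are left out, so that feasibility is preserved along whole lines and in limits.\<close>

definition feas :: "real vec \<Rightarrow> real vec \<Rightarrow> bool" where
  "feas x s \<longleftrightarrow> x \<in> carrier_vec n \<and> s \<in> carrier_vec n \<and> A *\<^sub>v x = b \<and> c - s \<in> Wperp A"

definition pos :: "real vec \<Rightarrow> real vec \<Rightarrow> bool" where
  "pos x s \<longleftrightarrow> (\<forall>i<n. 0 < x $ i \<and> 0 < s $ i)"

lemma dual_set_iff: "s \<in> dual_set A c \<longleftrightarrow> s \<in> carrier_vec n \<and> c - s \<in> Wperp A \<and> 0\<^sub>v n \<le> s"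
proof -
  have d: "dim_row A = m" "dim_col A = n" using A by auto
  have 1: "s \<in> dual_set A c \<longleftrightarrow> (\<exists>y. y \<in> carrier_vec m \<and> s \<in> carrier_vec n \<and> A\<^sup>T *\<^sub>v y + s = c \<and> 0\<^sub>v n \<le> s)"
    unfolding dual_set_def dual_pairs_def d by simp
  have 2: "A\<^sup>T *\<^sub>v y + s = c \<longleftrightarrow> c - s = A\<^sup>T *\<^sub>v y" if s: "s \<in> carrier_vec n" and "y \<in> carrier_vec m" for y
  proof -
    define v where "v = A\<^sup>T *\<^sub>v y"
    have v: "v \<in> carrier_vec n" using A that by (simp add: v_def)
    have "c - s = v" if "v + s = c" using vec_diff_swap(1)[OF c v s that[symmetric]] .
    moreover have "(c - s) + s = c" using c s by (intro eq_vecI) auto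
    ultimately show ?thesis unfolding v_def[symmetric] by blast
  qed
  show ?thesis
  proof
    assume "s \<in> dual_set A c"
    then obtain y where y: "y \<in> carrier_vec m" "s \<in> carrier_vec n" "A\<^sup>T *\<^sub>v y + s = c" "0\<^sub>v n \<le> s" unfolding 1 by blast
    then show "s \<in> carrier_vec n \<and> c - s \<in> Wperp A \<and> 0\<^sub>v n \<le> s" unfolding Wperp_iff using 2[OF y(2,1)] by blast
  next
    assume s: "s \<in> carrier_vec n \<and> c - s \<in> Wperp A \<and> 0\<^sub>v n \<le> s"
    then obtain y where y: "y \<in> carrier_vec m" "c - s = A\<^sup>T *\<^sub>v y" unfolding Wperp_iff by blast
    then show "s \<in> dual_set A c" unfolding 1 using 2[OF _ y(1)] s by blast
  qed
qed

lemma pos_iff: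
  "x \<in> primal_pos A b \<and> s \<in> dual_pos A c \<longleftrightarrow> feas x s \<and> pos x s"
proof -
  have d: "dim_row A = m" "dim_col A = n" using A by auto
  have 0: "0\<^sub>v n \<le> v \<longleftrightarrow> (\<forall>i<n. 0 \<le> v $ i)" if "v \<in> carrier_vec n" for v :: "real vec"
    using that unfolding less_eq_vec_def by (simp add: carrier_vecD)
  have 1: "x \<in> primal_pos A b \<longleftrightarrow> x \<in> carrier_vec n \<and> A *\<^sub>v x = b \<and> (\<forall>i<n. 0 < x $ i)"
  proof (cases "x \<in> carrier_vec n")
    case True
    then show ?thesis unfolding primal_pos_def primal_set_def vpos_def d mem_Collect_eq 0[OF True] carrier_vecD[OF True]
      by (meson less_imp_le)
  next
    case False
    then show ?thesis unfolding primal_pos_def primal_set_def d by simp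
  qed
  have 2: "s \<in> dual_pos A c \<longleftrightarrow> s \<in> carrier_vec n \<and> c - s \<in> Wperp A \<and> (\<forall>i<n. 0 < s $ i)"
  proof (cases "s \<in> carrier_vec n")
    case True
    then show ?thesis unfolding dual_pos_def dual_set_iff vpos_def mem_Collect_eq 0[OF True] carrier_vecD[OF True]
      by (meson less_imp_le)
  next
    case False
    then show ?thesis unfolding dual_pos_def dual_set_iff by simp
  qed
  show ?thesis unfolding 1 2 feas_def pos_def by blast
qed

lemma mubar_eq: "x \<in> carrier_vec n \<Longrightarrow> s \<in> carrier_vec n \<Longrightarrow> mubar (x, s) = (\<Sum>i<n. x $ i * s $ i) / real n"
  by (simp add: mubar_def scalar_prod_def atLeast0LessThan)

lemma N2_iff: "(x, s) \<in> N2 A b c \<beta> \<longleftrightarrow> feas x s \<and> pos x s \<and>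
   L2_set (\<lambda>i. x $ i * s $ i / mubar (x, s) - 1) {..<n} \<le> \<beta>"
proof -
  have "vnorm ((1 / mubar (x, s)) \<cdot>\<^sub>v (x \<star> s) - ones (dim_col A)) =
     L2_set (\<lambda>i. x $ i * s $ i / mubar (x, s) - 1) {..<n}" if "feas x s"
    using that A unfolding vnorm_def feas_def by (intro L2_set_cong) (auto simp: vtimes_def ones_def)
  then show ?thesis unfolding N2_def using pos_iff[of x s] by auto
qed

lemma mubar_pos: "feas x s \<Longrightarrow> pos x s \<Longrightarrow> 0 < mubar (x, s)"
  unfolding feas_def pos_def using mubar_eq[of x s] n0
  by (auto intro!: divide_pos_pos sum_pos simp: lessThan_empty_iff)

lemma N2D:
  assumes "(x, s) \<in> N2 A b c \<beta>"
  shows "x \<in> carrier_vec n" "s \<in> carrier_vec n" "feas x s" "pos x s" "0 < mubar (x, s)"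
    "\<And>i. i < n \<Longrightarrow> 0 < x $ i" "\<And>i. i < n \<Longrightarrow> 0 < s $ i"
    "L2_set (\<lambda>i. x $ i * s $ i - mubar (x, s)) {..<n} \<le> \<beta> * mubar (x, s)"
    "\<And>i. i < n \<Longrightarrow> (1 - \<beta>) * mubar (x, s) \<le> x $ i * s $ i"
    "\<And>i. i < n \<Longrightarrow> x $ i * s $ i \<le> (1 + \<beta>) * mubar (x, s)"
proof -
  have f: "feas x s" "pos x s" and L: "L2_set (\<lambda>i. x $ i * s $ i / mubar (x, s) - 1) {..<n} \<le> \<beta>"
    using assms N2_iff by auto
  then show "feas x s" "pos x s" "x \<in> carrier_vec n" "s \<in> carrier_vec n" "0 < mubar (x, s)"
    "\<And>i. i < n \<Longrightarrow> 0 < x $ i" "\<And>i. i < n \<Longrightarrow> 0 < s $ i"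
    using mubar_pos by (auto simp: feas_def pos_def)
  have "L2_set (\<lambda>i. x $ i * s $ i - mubar (x, s)) {..<n} =
      L2_set (\<lambda>i. mubar (x, s) * (x $ i * s $ i / mubar (x, s) - 1)) {..<n}"
    using \<open>0 < mubar (x, s)\<close> by (intro L2_set_cong) (auto simp: field_simps)
  also have "\<dots> \<le> \<beta> * mubar (x, s)"
    unfolding L2_set_const_mult using L \<open>0 < mubar (x, s)\<close> by (simp add: mult.commute mult_right_mono)
  finally show LL: "L2_set (\<lambda>i. x $ i * s $ i - mubar (x, s)) {..<n} \<le> \<beta> * mubar (x, s)" .
  fix i assume "i < n"
  then have "\<bar>x $ i * s $ i - mubar (x, s)\<bar> \<le> \<beta> * mubar (x, s)"
    using L2_set_abs_le[of "{..<n}" i "\<lambda>i. x $ i * s $ i - mubar (x, s)"] LL by simp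
  then show "(1 - \<beta>) * mubar (x, s) \<le> x $ i * s $ i" "x $ i * s $ i \<le> (1 + \<beta>) * mubar (x, s)"
    by (auto simp: algebra_simps abs_le_iff)
qed

lemma feas_step:
  assumes f: "feas x s" and dx: "dx \<in> W A" and ds: "ds \<in> Wperp A"
  shows "feas (x + a \<cdot>\<^sub>v dx) (s + a \<cdot>\<^sub>v ds)"
proof -
  have x: "x \<in> carrier_vec n" and s: "s \<in> carrier_vec n" and Ax: "A *\<^sub>v x = b" and cs: "c - s \<in> Wperp A"
    using f by (auto simp: feas_def)
  have dxc: "a \<cdot>\<^sub>v dx \<in> carrier_vec n" and dsc: "a \<cdot>\<^sub>v ds \<in> carrier_vec n" using W_carrier[OF dx] Wperp_carrier[OF ds] by auto
  have "A *\<^sub>v (a \<cdot>\<^sub>v dx) = 0\<^sub>v m" using W_smult[OF dx] by (simp add: W_iff)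
  then have "A *\<^sub>v (x + a \<cdot>\<^sub>v dx) = b" using mult_add_distrib_mat_vec[OF A x dxc] Ax b by simp
  moreover have "c - (s + a \<cdot>\<^sub>v ds) = (c - s) - a \<cdot>\<^sub>v ds" using c s dsc by (intro eq_vecI) auto
  then have "c - (s + a \<cdot>\<^sub>v ds) \<in> Wperp A" using Wperp_diff[OF cs Wperp_smult[OF ds, of a]] by simp
  ultimately show ?thesis using x s dxc dsc by (simp add: feas_def)
qed

lemma feas_diff:
  assumes "feas x s" "feas x' s'"
  shows "x - x' \<in> W A" "s - s' \<in> Wperp A"
proof -
  have h: "x \<in> carrier_vec n" "s \<in> carrier_vec n" "A *\<^sub>v x = b" "c - s \<in> Wperp A"
    "x' \<in> carrier_vec n" "s' \<in> carrier_vec n" "A *\<^sub>v x' = b" "c - s' \<in> Wperp A"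
    using assms by (auto simp: feas_def)
  have "A *\<^sub>v (x - x') = A *\<^sub>v x - A *\<^sub>v x'" by (rule mult_minus_distrib_mat_vec[OF A h(1,5)])
  then show "x - x' \<in> W A" using h b by (simp add: W_iff)
  have "s - s' = (c - s') - (c - s)" using h c by (intro eq_vecI) auto
  then show "s - s' \<in> Wperp A" using Wperp_diff[OF h(8,4)] by simp
qed

lemma step_mubar:
  assumes "x \<in> carrier_vec n" "s \<in> carrier_vec n" and dx: "dx \<in> W A" and ds: "ds \<in> Wperp A"
  shows "mubar (x + a \<cdot>\<^sub>v dx, s + a \<cdot>\<^sub>v ds) =
     mubar (x, s) + a * (\<Sum>i<n. s $ i * dx $ i + x $ i * ds $ i) / real n"
proof -
  have c: "dx \<in> carrier_vec n" "ds \<in> carrier_vec n" using W_carrier[OF dx] Wperp_carrier[OF ds] by auto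
  have "(\<Sum>i<n. (x + a \<cdot>\<^sub>v dx) $ i * (s + a \<cdot>\<^sub>v ds) $ i) =
     (\<Sum>i<n. x $ i * s $ i + a * (s $ i * dx $ i + x $ i * ds $ i) + a\<^sup>2 * (dx $ i * ds $ i))"
    using assms c by (intro sum.cong) (auto simp: algebra_simps power2_eq_square)
  also have "\<dots> = (\<Sum>i<n. x $ i * s $ i) + a * (\<Sum>i<n. s $ i * dx $ i + x $ i * ds $ i)"
    by (simp add: sum.distrib sum_distrib_left[symmetric] W_Wperp[OF dx ds])
  finally show ?thesis using assms c mubar_eq[of "x + a \<cdot>\<^sub>v dx" "s + a \<cdot>\<^sub>v ds"] mubar_eq[of x s]
    by (simp add: add_divide_distrib)
qed

text \<open>The products are controlled along the whole path, since at the endpoint alone two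
  negative factors could not be excluded. At the endpoint \<open>\<nu>\<close> is exchanged for the
  actual mean, which is at least \<open>(1 - \<kappa> \<alpha>) * \<nu> \<alpha>\<close>; this is
  the origin of the denominator in \<open>\<kappa>'\<close>.\<close>

lemma N2_path:
  assumes f: "feas x s" "pos x s" and dx: "dx \<in> W A" and ds: "ds \<in> Wperp A" and \<alpha>: "0 \<le> \<alpha>"
    and path: "\<And>a. 0 \<le> a \<Longrightarrow> a \<le> \<alpha> \<Longrightarrow> 0 < \<nu> a \<and>
      L2_set (\<lambda>i. (x $ i + a * dx $ i) * (s $ i + a * ds $ i) - \<nu> a) {..<n} \<le> \<kappa> a * \<nu> a \<and> \<kappa> a < 1"
    and \<kappa>': "\<kappa> \<alpha> / (1 - \<kappa> \<alpha>) \<le> \<beta>"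
  shows "(x + \<alpha> \<cdot>\<^sub>v dx, s + \<alpha> \<cdot>\<^sub>v ds) \<in> N2 A b c \<beta>"
proof -
  have c: "dx \<in> carrier_vec n" "ds \<in> carrier_vec n" "x \<in> carrier_vec n" "s \<in> carrier_vec n"
    using W_carrier[OF dx] Wperp_carrier[OF ds] f(1) by (auto simp: feas_def)
  let ?p = "\<lambda>a i. (x $ i + a * dx $ i) * (s $ i + a * ds $ i)"
  have pp: "0 < ?p a i" if "0 \<le> a" "a \<le> \<alpha>" "i < n" for a i
  proof -
    have "\<bar>?p a i - \<nu> a\<bar> \<le> \<kappa> a * \<nu> a"
      using L2_set_abs_le[of "{..<n}" i "\<lambda>i. ?p a i - \<nu> a"] path[OF that(1,2)] that(3) by simp
    moreover have "\<kappa> a * \<nu> a < \<nu> a" using path[OF that(1,2)] by simp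
    ultimately show ?thesis by simp
  qed
  have ps: "pos (x + \<alpha> \<cdot>\<^sub>v dx) (s + \<alpha> \<cdot>\<^sub>v ds)"
    unfolding pos_def
  proof (intro allI impI)
    fix i assume i: "i < n"
    have "0 < x $ i" "0 < s $ i" using f(2) i by (auto simp: pos_def)
    from affine_path_positive[OF this \<alpha>, of "dx $ i" "ds $ i"] pp[OF _ _ i]
    show "0 < (x + \<alpha> \<cdot>\<^sub>v dx) $ i \<and> 0 < (s + \<alpha> \<cdot>\<^sub>v ds) $ i" using c i by simp
  qed
  let ?M = "mubar (x + \<alpha> \<cdot>\<^sub>v dx, s + \<alpha> \<cdot>\<^sub>v ds)"
  have M: "?M = (\<Sum>i<n. ?p \<alpha> i) / real n" using c by (simp add: mubar_eq)
  have \<nu>: "0 < \<nu> \<alpha>" and L: "L2_set (\<lambda>i. ?p \<alpha> i - \<nu> \<alpha>) {..<n} \<le> \<kappa> \<alpha> * \<nu> \<alpha>" and \<kappa>1: "\<kappa> \<alpha> < 1" using path[OF \<alpha>] by auto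
  have "(1 - \<kappa> \<alpha>) * \<nu> \<alpha> \<le> ?M" using mean_ge[OF n0 L] unfolding M by (simp add: algebra_simps abs_le_iff)
  then have \<nu>M: "\<nu> \<alpha> \<le> ?M / (1 - \<kappa> \<alpha>)" using \<kappa>1 by (simp add: field_simps)
  have fe: "feas (x + \<alpha> \<cdot>\<^sub>v dx) (s + \<alpha> \<cdot>\<^sub>v ds)" by (rule feas_step[OF f(1) dx ds])
  have M0: "0 < ?M" by (rule mubar_pos[OF fe ps])
  have \<kappa>0: "0 \<le> \<kappa> \<alpha>" using order.trans[OF L2_set_nonneg L] \<nu> by (simp add: zero_le_mult_iff)
  have "L2_set (\<lambda>i. ?p \<alpha> i - ?M) {..<n} \<le> \<kappa> \<alpha> * \<nu> \<alpha>"
    using L2_set_mean_le[OF n0 M, of "\<nu> \<alpha>"] L by simp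
  also have "\<dots> \<le> \<kappa> \<alpha> * (?M / (1 - \<kappa> \<alpha>))" by (rule mult_left_mono[OF \<nu>M \<kappa>0])
  also have "\<dots> \<le> \<beta> * ?M" using mult_right_mono[OF \<kappa>', of ?M] M0 by simp
  finally have LM: "L2_set (\<lambda>i. ?p \<alpha> i - ?M) {..<n} \<le> \<beta> * ?M" .
  have "L2_set (\<lambda>i. (x + \<alpha> \<cdot>\<^sub>v dx) $ i * (s + \<alpha> \<cdot>\<^sub>v ds) $ i / ?M - 1) {..<n} =
     L2_set (\<lambda>i. (1 / ?M) * (?p \<alpha> i - ?M)) {..<n}"
    using c M0 by (intro L2_set_cong) (auto simp: field_simps)
  also have "\<dots> \<le> \<beta>" unfolding L2_set_const_mult using LM M0 by (simp add: field_simps)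
  finally show ?thesis unfolding N2_iff using fe ps by simp
qed

end

section \<open>Newton directions and the three kinds of steps\<close>

lemma L2_set_triangle3:
  "L2_set (\<lambda>i. f i + g i + h i) S \<le> L2_set f S + L2_set g S + L2_set h S"
  using L2_set_triangle_ineq[of "\<lambda>i. f i + g i" h S] L2_set_triangle_ineq[of f g S] by linarith

lemma vnorm_vtimes:
  "v \<in> carrier_vec n \<Longrightarrow> vnorm (v \<star> w) = L2_set (\<lambda>i. v $ i * w $ i) {..<n}"
  unfolding vnorm_def by (auto simp: vtimes_def intro!: L2_set_cong)

context lp
begin

lemma newton_dirD:
  assumes nd: "newton_dir A x s r dx ds" and x: "x \<in> carrier_vec n" and s: "s \<in> carrier_vec n"
  shows "dx \<in> W A" "ds \<in> Wperp A" "dx \<in> carrier_vec n" "ds \<in> carrier_vec n"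
    "\<And>i. i < n \<Longrightarrow> s $ i * dx $ i + x $ i * ds $ i = r $ i"
proof -
  show d: "dx \<in> W A" "ds \<in> Wperp A" using nd by (auto simp: newton_dir_def)
  show "dx \<in> carrier_vec n" "ds \<in> carrier_vec n" using W_carrier[OF d(1)] Wperp_carrier[OF d(2)] .
  fix i assume i: "i < n"
  have "(s \<star> dx + x \<star> ds) $ i = r $ i" using nd by (simp add: newton_dir_def)
  then show "s $ i * dx $ i + x $ i * ds $ i = r $ i" using i x s by (simp add: vtimes_def)
qed

text \<open>In coordinates scaled by \<open>sqrt (x / s)\<close> the two unknowns range over
  orthogonal complements, so solving the system is an orthogonal decomposition of the scaled
  right-hand side.\<close>

lemma newton_dir_exists:
  assumes x: "x \<in> carrier_vec n" and s: "s \<in> carrier_vec n" and p: "pos x s" and r: "r \<in> carrier_vec n"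
  shows "\<exists>dx ds. newton_dir A x s r dx ds"
proof -
  define d where "d = (\<lambda>i. sqrt (x $ i / s $ i))"
  have d: "0 < d i" if "i < n" for i using p that by (simp add: pos_def d_def)
  obtain u v where u: "u \<in> carrier_vec n" "vec n (\<lambda>i. d i * u $ i) \<in> W A"
    and v: "v \<in> carrier_vec n" "vec n (\<lambda>i. v $ i / d i) \<in> Wperp A"
    and uv: "vec n (\<lambda>i. r $ i / sqrt (x $ i * s $ i)) = u + v"
    by (rule scaled_decomposition[of d, OF d]) auto
  have "s \<star> vec n (\<lambda>i. d i * u $ i) + x \<star> vec n (\<lambda>i. v $ i / d i) = r"
  proof (rule eq_vecI)
    fix i assume "i < dim_vec r"
    then have i: "i < n" using r by simp
    have xs: "0 < x $ i" "0 < s $ i" using p i by (auto simp: pos_def)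
    have "vec n (\<lambda>i. r $ i / sqrt (x $ i * s $ i)) $ i = u $ i + v $ i" unfolding uv using i u v by simp
    then have "r $ i = sqrt (x $ i * s $ i) * (u $ i + v $ i)" using i xs by (simp add: field_simps)
    moreover have "s $ i * d i = sqrt (x $ i * s $ i)"
    proof -
      have "s $ i * d i = sqrt ((s $ i)\<^sup>2) * sqrt (x $ i / s $ i)" using xs by (simp add: d_def)
      also have "\<dots> = sqrt ((s $ i)\<^sup>2 * (x $ i / s $ i))" by (rule real_sqrt_mult[symmetric])
      also have "(s $ i)\<^sup>2 * (x $ i / s $ i) = x $ i * s $ i" using xs by (simp add: power2_eq_square)
      finally show ?thesis .
    qed
    moreover have "x $ i / d i = sqrt (x $ i * s $ i)"
    proof -
      have "x $ i = d i * (s $ i * d i)"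
        using xs by (simp add: d_def mult.left_commute real_sqrt_mult_self)
      then show ?thesis using d[OF i] \<open>s $ i * d i = _\<close> by (simp add: field_simps)
    qed
    then have "x $ i * (v $ i / d i) = sqrt (x $ i * s $ i) * v $ i"
      by (metis times_divide_eq_left times_divide_eq_right mult.commute)
    ultimately show "(s \<star> vec n (\<lambda>i. d i * u $ i) + x \<star> vec n (\<lambda>i. v $ i / d i)) $ i = r $ i"
      using i x s by (simp add: vtimes_def distrib_left mult.assoc[symmetric])
  qed (use x r in \<open>auto simp: vtimes_def\<close>)
  then show ?thesis using u v unfolding newton_dir_def by blast
qed

text \<open>After the full Newton step the only deviation left is the second order term
  \<open>dx * ds\<close>. The energy identity bounds its norm by \<open>\<beta> / 10\<close> times
  the duality measure, and exchanging the target for the mean costs no more than the passage to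
  \<open>\<beta> / 8\<close>.\<close>

lemma corrector:
  assumes z: "(x, s) \<in> N2 A b c \<beta>" and \<beta>: "0 < \<beta>" "\<beta> \<le> 1 / 6"
    and nd: "newton_dir A x s (mubar (x, s) \<cdot>\<^sub>v ones n - x \<star> s) dx ds"
  shows "(x + dx, s + ds) \<in> N2 A b c (\<beta> / 8)" "mubar (x + dx, s + ds) = mubar (x, s)"
proof -
  note zD = N2D[OF z]
  note nD = newton_dirD[OF nd zD(1,2)]
  define \<mu> where "\<mu> = mubar (x, s)"
  have \<mu>: "0 < \<mu>" using zD(5) by (simp add: \<mu>_def)
  have r: "s $ i * dx $ i + x $ i * ds $ i = \<mu> - x $ i * s $ i" if "i < n" for i
    using nD(5)[OF that] that zD(1) by (simp add: vtimes_def ones_def \<mu>_def)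
  have "(\<Sum>i<n. (\<mu> - x $ i * s $ i)\<^sup>2 / (x $ i * s $ i)) \<le> (\<Sum>i<n. (x $ i * s $ i - \<mu>)\<^sup>2 / ((1 - \<beta>) * \<mu>))"
  proof (intro sum_mono)
    fix i assume "i \<in> {..<n}"
    then have i: "i < n" by simp
    have "(\<mu> - x $ i * s $ i)\<^sup>2 / (x $ i * s $ i) \<le> (\<mu> - x $ i * s $ i)\<^sup>2 / ((1 - \<beta>) * \<mu>)"
      using zD(9)[OF i] \<mu> \<beta> by (intro divide_left_mono) (auto simp: \<mu>_def zD(6,7) i)
    then show "(\<mu> - x $ i * s $ i)\<^sup>2 / (x $ i * s $ i) \<le> (x $ i * s $ i - \<mu>)\<^sup>2 / ((1 - \<beta>) * \<mu>)"
      by (simp add: power2_commute)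
  qed
  also have "\<dots> = (L2_set (\<lambda>i. x $ i * s $ i - \<mu>) {..<n})\<^sup>2 / ((1 - \<beta>) * \<mu>)"
    by (simp add: L2_set_def sum_nonneg sum_divide_distrib)
  also have "\<dots> \<le> (\<beta> * \<mu>)\<^sup>2 / ((1 - \<beta>) * \<mu>)"
    using zD(8) \<beta> \<mu> by (intro divide_right_mono power_mono) (auto simp: \<mu>_def)
  also have "\<dots> \<le> \<beta> * \<mu> / 5"
  proof -
    have "5 * (\<beta> * \<mu>)\<^sup>2 \<le> \<beta> * \<mu> * ((1 - \<beta>) * \<mu>)"
    proof -
      have "5 * \<beta> \<le> 1 - \<beta>" using \<beta> by simp
      then have "(5 * \<beta>) * (\<beta> * \<mu>\<^sup>2) \<le> (1 - \<beta>) * (\<beta> * \<mu>\<^sup>2)" using \<beta> \<mu> by (intro mult_right_mono) auto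
      then show ?thesis by (simp add: power2_eq_square algebra_simps)
    qed
    then show ?thesis using \<mu> \<beta> by (simp add: field_simps)
  qed
  finally have D: "L2_set (\<lambda>i. dx $ i * ds $ i) {..<n} \<le> \<beta> / 10 * \<mu>"
    using newton_energy(2)[of n "\<lambda>i. x $ i" "\<lambda>i. s $ i" "\<lambda>i. dx $ i" "\<lambda>i. ds $ i" "\<lambda>i. \<mu> - x $ i * s $ i"]
      zD(6,7) r W_Wperp[OF nD(1,2)] by simp
  have "(x + 1 \<cdot>\<^sub>v dx, s + 1 \<cdot>\<^sub>v ds) \<in> N2 A b c (\<beta> / 8)"
  proof (rule N2_path[where \<nu> = "\<lambda>_. \<mu>" and \<kappa> = "\<lambda>a. (1 - a) * \<beta> + \<beta> / 10", OF zD(3,4) nD(1,2)])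
    fix a :: real assume a: "0 \<le> a" "a \<le> 1"
    have "L2_set (\<lambda>i. (x $ i + a * dx $ i) * (s $ i + a * ds $ i) - \<mu>) {..<n} =
        L2_set (\<lambda>i. (1 - a) * (x $ i * s $ i - \<mu>) + a\<^sup>2 * (dx $ i * ds $ i)) {..<n}"
    proof (intro L2_set_cong refl)
      fix i assume "i \<in> {..<n}"
      then have "(x $ i + a * dx $ i) * (s $ i + a * ds $ i) =
          x $ i * s $ i + a * (\<mu> - x $ i * s $ i) + a\<^sup>2 * (dx $ i * ds $ i)"
        by (subst r[symmetric]) (auto simp: algebra_simps power2_eq_square)
      then show "(x $ i + a * dx $ i) * (s $ i + a * ds $ i) - \<mu> = (1 - a) * (x $ i * s $ i - \<mu>) + a\<^sup>2 * (dx $ i * ds $ i)"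
        by (simp add: algebra_simps)
    qed
    also have "\<dots> \<le> L2_set (\<lambda>i. (1 - a) * (x $ i * s $ i - \<mu>)) {..<n} + L2_set (\<lambda>i. a\<^sup>2 * (dx $ i * ds $ i)) {..<n}"
      by (rule L2_set_triangle_ineq)
    also have "\<dots> \<le> (1 - a) * (\<beta> * \<mu>) + 1 * (\<beta> / 10 * \<mu>)"
      unfolding L2_set_const_mult using a zD(8) D \<mu> \<beta>
      by (intro add_mono mult_mono) (auto simp: \<mu>_def abs_square_le_1 power_le_one)
    finally have "L2_set (\<lambda>i. (x $ i + a * dx $ i) * (s $ i + a * ds $ i) - \<mu>) {..<n} \<le> ((1 - a) * \<beta> + \<beta> / 10) * \<mu>"
      by (simp add: algebra_simps)
    moreover have "(1 - a) * \<beta> + \<beta> / 10 < 1"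
      using mult_right_mono[of "1 - a" 1 \<beta>] a \<beta> by linarith
    ultimately show "0 < \<mu> \<and> L2_set (\<lambda>i. (x $ i + a * dx $ i) * (s $ i + a * ds $ i) - \<mu>) {..<n}
        \<le> ((1 - a) * \<beta> + \<beta> / 10) * \<mu> \<and> (1 - a) * \<beta> + \<beta> / 10 < 1"
      using \<mu> \<beta> by simp
  next
    show "((1 - 1) * \<beta> + \<beta> / 10) / (1 - ((1 - 1) * \<beta> + \<beta> / 10)) \<le> \<beta> / 8"
      using \<beta> by (simp add: field_simps)
  qed simp
  then show "(x + dx, s + ds) \<in> N2 A b c (\<beta> / 8)" by simp
  have "(\<Sum>i<n. s $ i * dx $ i + x $ i * ds $ i) = real n * \<mu> - (\<Sum>i<n. x $ i * s $ i)"
    by (simp add: r sum_subtractf)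
  also have "\<dots> = 0" using mubar_eq[OF zD(1,2)] n0 by (simp add: \<mu>_def)
  finally show "mubar (x + dx, s + ds) = mubar (x, s)" using step_mubar[OF zD(1,2) nD(1,2), of 1] by simp
qed

text \<open>Relative to the reduced target \<open>(1 - e) * \<mu>\<close>, the inherited deviation
  contributes \<open>\<beta> / 8\<close> and the second order term \<open>\<beta> / 2\<close>,
  together \<open>5 / 8 * \<beta>\<close>. At length 1 the target is zero, so the full step is left
  to the closure.\<close>

lemma affine_step:
  assumes z: "(x, s) \<in> N2 A b c (\<beta> / 8)" and \<beta>: "0 < \<beta>" "\<beta> \<le> 1 / 6"
    and nd: "newton_dir A x s (- (x \<star> s)) dx ds"
  shows "mubar (x + a \<cdot>\<^sub>v dx, s + a \<cdot>\<^sub>v ds) = (1 - a) * mubar (x, s)"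
    "0 \<le> a \<Longrightarrow> a < 1 \<Longrightarrow>
      a \<le> max (\<beta> / (2 * sqrt n)) (1 - 2 * (vnorm (dx \<star> ds) / (\<beta> * mubar (x, s)))) \<Longrightarrow>
      (x + a \<cdot>\<^sub>v dx, s + a \<cdot>\<^sub>v ds) \<in> N2 A b c \<beta>"
proof -
  note zD = N2D[OF z]
  note nD = newton_dirD[OF nd zD(1,2)]
  define \<mu> where "\<mu> = mubar (x, s)"
  have \<mu>: "0 < \<mu>" using zD(5) by (simp add: \<mu>_def)
  have r: "s $ i * dx $ i + x $ i * ds $ i = - (x $ i * s $ i)" if "i < n" for i
    using nD(5)[OF that] that zD(1) by (simp add: vtimes_def)
  have sxs: "(\<Sum>i<n. x $ i * s $ i) = real n * \<mu>" using mubar_eq[OF zD(1,2)] n0 by (simp add: \<mu>_def)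
  have "(\<Sum>i<n. s $ i * dx $ i + x $ i * ds $ i) = - (real n * \<mu>)"
    by (simp add: r sum_negf sxs)
  then show "mubar (x + a \<cdot>\<^sub>v dx, s + a \<cdot>\<^sub>v ds) = (1 - a) * mubar (x, s)"
    using step_mubar[OF zD(1,2) nD(1,2), of a] n0 by (simp add: \<mu>_def algebra_simps)
  define D where "D = L2_set (\<lambda>i. dx $ i * ds $ i) {..<n}"
  have vD: "vnorm (dx \<star> ds) = D" unfolding D_def by (rule vnorm_vtimes[OF nD(3)])
  have D0: "0 \<le> D" by (simp add: D_def)
  have "(\<Sum>i<n. (- (x $ i * s $ i))\<^sup>2 / (x $ i * s $ i)) = (\<Sum>i<n. x $ i * s $ i)"
    using zD(6,7) by (intro sum.cong) (auto simp: power2_eq_square)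
  then have Dn: "D \<le> real n * \<mu> / 2"
    using newton_energy(2)[of n "\<lambda>i. x $ i" "\<lambda>i. s $ i" "\<lambda>i. dx $ i" "\<lambda>i. ds $ i" "\<lambda>i. - (x $ i * s $ i)"]
      zD(6,7) r W_Wperp[OF nD(1,2)] sxs by (simp add: D_def)
  assume a: "0 \<le> a" "a < 1" and am: "a \<le> max (\<beta> / (2 * sqrt n)) (1 - 2 * (vnorm (dx \<star> ds) / (\<beta> * mubar (x, s))))"
  have small: "e\<^sup>2 * D \<le> \<beta> * \<mu> * (1 - e) / 2" if e: "0 \<le> e" "e \<le> a" for e
  proof -
    have e1: "e \<le> 1" using e a by simp
    consider "e \<le> \<beta> / (2 * sqrt n)" | "e \<le> 1 - 2 * (D / (\<beta> * \<mu>))"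
      using am e unfolding vD \<mu>_def by linarith
    then show ?thesis
    proof cases
      \<comment> \<open>The guaranteed short step: the energy identity gives
        \<open>D \<le> n * \<mu> / 2\<close> unconditionally, and
        \<open>e\<^sup>2 \<le> \<beta>\<^sup>2 / (4 * n)\<close> cancels the factor
        \<open>n\<close>.\<close>
      case 1
      have "e\<^sup>2 \<le> (\<beta> / (2 * sqrt n))\<^sup>2" using 1 e by (intro power_mono) auto
      then have e2: "e\<^sup>2 \<le> \<beta>\<^sup>2 / (4 * n)" by (simp add: power_divide power_mult_distrib)
      have "e\<^sup>2 * D \<le> \<beta>\<^sup>2 / (4 * n) * (real n * \<mu> / 2)" by (rule mult_mono[OF e2 Dn]) (use D0 in auto)
      also have "\<dots> = \<beta> * \<mu> * (\<beta> / 8)" using n0 by (simp add: power2_eq_square)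
      also have "\<dots> \<le> \<beta> * \<mu> * ((1 - e) / 2)"
      proof (rule mult_left_mono)
        have "\<beta> / (2 * sqrt n) \<le> \<beta> / (2 * 1)" using n0 \<beta> by (intro divide_left_mono mult_left_mono) auto
        then have "e \<le> 1 / 12" using 1 \<beta> by simp
        then show "\<beta> / 8 \<le> (1 - e) / 2" using \<beta> by simp
      qed (use \<beta> \<mu> in simp)
      finally show ?thesis by simp
    next
      case 2
      then have "2 * (D / (\<beta> * \<mu>)) \<le> 1 - e" by simp
      then have "D \<le> \<beta> * \<mu> * (1 - e) / 2" using \<beta> \<mu> by (simp add: field_simps)
      moreover have "e\<^sup>2 * D \<le> 1 * D" using e e1 D0 by (intro mult_right_mono) (auto simp: power_le_one)
      ultimately show ?thesis by simp
    qed
  qed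
  show "(x + a \<cdot>\<^sub>v dx, s + a \<cdot>\<^sub>v ds) \<in> N2 A b c \<beta>"
  proof (rule N2_path[where \<nu> = "\<lambda>e. (1 - e) * \<mu>" and \<kappa> = "\<lambda>_. 5 / 8 * \<beta>", OF zD(3,4) nD(1,2) a(1)])
    fix e assume e: "0 \<le> e" "e \<le> a"
    have "L2_set (\<lambda>i. (x $ i + e * dx $ i) * (s $ i + e * ds $ i) - (1 - e) * \<mu>) {..<n} =
        L2_set (\<lambda>i. (1 - e) * (x $ i * s $ i - \<mu>) + e\<^sup>2 * (dx $ i * ds $ i)) {..<n}"
    proof (intro L2_set_cong refl)
      fix i assume "i \<in> {..<n}"
      then have "(x $ i + e * dx $ i) * (s $ i + e * ds $ i) =
          x $ i * s $ i + e * (- (x $ i * s $ i)) + e\<^sup>2 * (dx $ i * ds $ i)"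
        by (subst r[symmetric]) (auto simp: algebra_simps power2_eq_square)
      then show "(x $ i + e * dx $ i) * (s $ i + e * ds $ i) - (1 - e) * \<mu> = (1 - e) * (x $ i * s $ i - \<mu>) + e\<^sup>2 * (dx $ i * ds $ i)"
        by (simp add: algebra_simps)
    qed
    also have "\<dots> \<le> L2_set (\<lambda>i. (1 - e) * (x $ i * s $ i - \<mu>)) {..<n} + L2_set (\<lambda>i. e\<^sup>2 * (dx $ i * ds $ i)) {..<n}"
      by (rule L2_set_triangle_ineq)
    also have "\<dots> \<le> (1 - e) * (\<beta> / 8 * \<mu>) + \<beta> * \<mu> * (1 - e) / 2"
      unfolding L2_set_const_mult using e a zD(8) small[OF e]
      by (intro add_mono mult_mono) (auto simp: \<mu>_def D_def)
    finally have "L2_set (\<lambda>i. (x $ i + e * dx $ i) * (s $ i + e * ds $ i) - (1 - e) * \<mu>) {..<n} \<le> 5 / 8 * \<beta> * ((1 - e) * \<mu>)"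
      by (simp add: algebra_simps)
    then show "0 < (1 - e) * \<mu> \<and> L2_set (\<lambda>i. (x $ i + e * dx $ i) * (s $ i + e * ds $ i) - (1 - e) * \<mu>) {..<n}
        \<le> 5 / 8 * \<beta> * ((1 - e) * \<mu>) \<and> 5 / 8 * \<beta> < 1"
      using \<mu> \<beta> e a by simp
  qed (use \<beta> in \<open>simp add: field_simps\<close>)
qed

text \<open>The direction does not solve a Newton system; its products are expressed by the products
  \<open>E\<close> at the full step, as
  \<open>(1 - e) * x * s + e * E - e * (1 - e) * dx * ds\<close>. The first and last terms shrink
  with \<open>1 - e\<close>. The middle one does not, and the bound on \<open>a\<close> in terms of
  \<open>\<epsilon>\<close> keeps it below a multiple of \<open>1 - e\<close>.\<close>

lemma lls_step:
  assumes z: "(x, s) \<in> N2 A b c (\<beta> / 8)" and \<beta>: "0 < \<beta>" "\<beta> \<le> 1 / 6"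
    and dx: "dx \<in> W A" and ds: "ds \<in> Wperp A"
    and D: "vnorm (dx \<star> ds) / mubar (x, s) \<le> \<beta> / 9"
    and \<epsilon>: "\<epsilon> = vnorm ((x + dx) \<star> (s + ds)) / mubar (x, s)"
  shows "\<bar>mubar (x + a \<cdot>\<^sub>v dx, s + a \<cdot>\<^sub>v ds) - (1 - a) * mubar (x, s)\<bar> \<le> \<bar>a\<bar> * (\<epsilon> * mubar (x, s))"
    "0 \<le> a \<Longrightarrow> a < 1 \<Longrightarrow> a \<le> 1 - 8 * \<epsilon> / \<beta> \<Longrightarrow> (x + a \<cdot>\<^sub>v dx, s + a \<cdot>\<^sub>v ds) \<in> N2 A b c \<beta>"
proof -
  note zD = N2D[OF z]
  define \<mu> where "\<mu> = mubar (x, s)"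
  have \<mu>: "0 < \<mu>" using zD(5) by (simp add: \<mu>_def)
  have dc: "dx \<in> carrier_vec n" "ds \<in> carrier_vec n" using W_carrier[OF dx] Wperp_carrier[OF ds] by auto
  define E where "E = (\<lambda>i. (x $ i + dx $ i) * (s $ i + ds $ i))"
  have "vnorm ((x + dx) \<star> (s + ds)) = L2_set (\<lambda>i. (x + dx) $ i * (s + ds) $ i) {..<n}"
    by (rule vnorm_vtimes) (use zD(1) dc in simp)
  also have "\<dots> = L2_set E {..<n}" using zD(1,2) dc by (intro L2_set_cong) (auto simp: E_def)
  finally have LE: "L2_set E {..<n} = \<epsilon> * \<mu>" using \<mu> by (simp add: \<epsilon> \<mu>_def)
  have LD: "L2_set (\<lambda>i. dx $ i * ds $ i) {..<n} \<le> \<beta> / 9 * \<mu>"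
    using D \<mu> vnorm_vtimes[OF dc(1), of ds] by (simp add: \<mu>_def field_simps)
  have sxs: "(\<Sum>i<n. x $ i * s $ i) = real n * \<mu>" using mubar_eq[OF zD(1,2)] n0 by (simp add: \<mu>_def)
  have "(\<Sum>i<n. s $ i * dx $ i + x $ i * ds $ i) = (\<Sum>i<n. E i - x $ i * s $ i - dx $ i * ds $ i)"
    by (intro sum.cong) (auto simp: E_def algebra_simps)
  also have "\<dots> = (\<Sum>i<n. E i) - real n * \<mu>" by (simp add: sum_subtractf sxs W_Wperp[OF dx ds])
  finally have "mubar (x + a \<cdot>\<^sub>v dx, s + a \<cdot>\<^sub>v ds) = \<mu> + a * ((\<Sum>i<n. E i) - real n * \<mu>) / real n"
    using step_mubar[OF zD(1,2) dx ds, of a] by (simp add: \<mu>_def)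
  then have "mubar (x + a \<cdot>\<^sub>v dx, s + a \<cdot>\<^sub>v ds) - (1 - a) * \<mu> = a * ((\<Sum>i<n. E i) / real n)"
    using n0 by (simp add: field_simps)
  moreover have "\<bar>(\<Sum>i<n. E i) / real n\<bar> \<le> \<epsilon> * \<mu>" using mean_ge[OF n0, of E 0 "\<epsilon> * \<mu>"] LE by simp
  ultimately show "\<bar>mubar (x + a \<cdot>\<^sub>v dx, s + a \<cdot>\<^sub>v ds) - (1 - a) * mubar (x, s)\<bar> \<le> \<bar>a\<bar> * (\<epsilon> * mubar (x, s))"
    unfolding \<mu>_def[symmetric] by (simp only: abs_mult mult_left_mono abs_ge_zero)
  have \<epsilon>0: "0 \<le> \<epsilon>" using \<mu> by (simp add: \<epsilon> \<mu>_def)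
  assume a: "0 \<le> a" "a < 1" and ae: "a \<le> 1 - 8 * \<epsilon> / \<beta>"
  show "(x + a \<cdot>\<^sub>v dx, s + a \<cdot>\<^sub>v ds) \<in> N2 A b c \<beta>"
  proof (rule N2_path[where \<nu> = "\<lambda>e. (1 - e) * \<mu>" and \<kappa> = "\<lambda>_. 5 / 8 * \<beta>", OF zD(3,4) dx ds a(1)])
    fix e assume e: "0 \<le> e" "e \<le> a"
    have e8: "\<epsilon> \<le> \<beta> / 8 * (1 - e)"
    proof -
      have "8 * \<epsilon> / \<beta> \<le> 1 - e" using ae e by simp
      then show ?thesis using \<beta> by (simp add: field_simps)
    qed
    have "L2_set (\<lambda>i. (x $ i + e * dx $ i) * (s $ i + e * ds $ i) - (1 - e) * \<mu>) {..<n} =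
        L2_set (\<lambda>i. (1 - e) * (x $ i * s $ i - \<mu>) + e * E i + (- (e * (1 - e))) * (dx $ i * ds $ i)) {..<n}"
      by (intro L2_set_cong refl) (simp add: E_def algebra_simps power2_eq_square)
    also have "\<dots> \<le> L2_set (\<lambda>i. (1 - e) * (x $ i * s $ i - \<mu>)) {..<n} + L2_set (\<lambda>i. e * E i) {..<n}
        + L2_set (\<lambda>i. (- (e * (1 - e))) * (dx $ i * ds $ i)) {..<n}"
      by (rule L2_set_triangle3)
    also have "\<dots> = (1 - e) * L2_set (\<lambda>i. x $ i * s $ i - \<mu>) {..<n} + e * (\<epsilon> * \<mu>)
        + (e * (1 - e)) * L2_set (\<lambda>i. dx $ i * ds $ i) {..<n}"
      unfolding L2_set_const_mult LE using e a by simp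
    also have "\<dots> \<le> (1 - e) * (\<beta> / 8 * \<mu>) + 1 * ((\<beta> / 8 * (1 - e)) * \<mu>) + (1 * (1 - e)) * (\<beta> / 9 * \<mu>)"
      using e a zD(8) e8 LD \<epsilon>0 \<mu> \<beta> by (intro add_mono mult_mono) (auto simp: \<mu>_def)
    also have "\<dots> \<le> 5 / 8 * \<beta> * ((1 - e) * \<mu>)"
    proof -
      define y where "y = \<beta> * ((1 - e) * \<mu>)"
      have "0 \<le> y" using \<beta> \<mu> e a by (simp add: y_def)
      then have "y / 8 + y / 8 + y / 9 \<le> 5 / 8 * y" by simp
      moreover have "(1 - e) * (\<beta> / 8 * \<mu>) + 1 * ((\<beta> / 8 * (1 - e)) * \<mu>) + (1 * (1 - e)) * (\<beta> / 9 * \<mu>) = y / 8 + y / 8 + y / 9"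
        by (simp add: y_def)
      moreover have "5 / 8 * \<beta> * ((1 - e) * \<mu>) = 5 / 8 * y" by (simp add: y_def)
      ultimately show ?thesis by (simp only:)
    qed
    finally show "0 < (1 - e) * \<mu> \<and> L2_set (\<lambda>i. (x $ i + e * dx $ i) * (s $ i + e * ds $ i) - (1 - e) * \<mu>) {..<n}
        \<le> 5 / 8 * \<beta> * ((1 - e) * \<mu>) \<and> 5 / 8 * \<beta> < 1"
      using \<mu> \<beta> e a by simp
  qed (use \<beta> in \<open>simp add: field_simps\<close>)
qed

lemma pair_closure_refl: "S \<subseteq> carrier_vec n \<times> carrier_vec n \<Longrightarrow> z \<in> S \<Longrightarrow> z \<in> pair_closure n S"
proof -
  assume S: "S \<subseteq> carrier_vec n \<times> carrier_vec n" and z: "z \<in> S"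
  obtain x s where xs: "z = (x, s)" by (cases z)
  have "x \<in> carrier_vec n" "s \<in> carrier_vec n" using S z xs by auto
  then show ?thesis unfolding pair_closure_def xs using z xs by (auto intro!: bexI[of _ "(x, s)"])
qed

lemma pair_closure_path:
  assumes c: "x \<in> carrier_vec n" "s \<in> carrier_vec n" "dx \<in> carrier_vec n" "ds \<in> carrier_vec n"
    and S: "\<And>a. 0 \<le> a \<Longrightarrow> a < 1 \<Longrightarrow> (x + a \<cdot>\<^sub>v dx, s + a \<cdot>\<^sub>v ds) \<in> S"
  shows "(x + 1 \<cdot>\<^sub>v dx, s + 1 \<cdot>\<^sub>v ds) \<in> pair_closure n S"
proof -
  have "\<exists>(x', s')\<in>S. vnorm (x' - (x + 1 \<cdot>\<^sub>v dx)) < e \<and> vnorm (s' - (s + 1 \<cdot>\<^sub>v ds)) < e" if e: "0 < e" for e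
  proof -
    define K where "K = 1 + vnorm dx + vnorm ds"
    have K: "1 \<le> K" "vnorm dx < K" "vnorm ds < K"
      using vnorm_nonneg[of dx] vnorm_nonneg[of ds] unfolding K_def by linarith+
    define h where "h = min 1 (e / K)"
    have h: "0 < h" "h \<le> 1" "h * K \<le> e" using e K by (auto simp: h_def min_def field_simps)
    have "x + (1 - h) \<cdot>\<^sub>v dx - (x + 1 \<cdot>\<^sub>v dx) = (- h) \<cdot>\<^sub>v dx" "s + (1 - h) \<cdot>\<^sub>v ds - (s + 1 \<cdot>\<^sub>v ds) = (- h) \<cdot>\<^sub>v ds"
      using c by (auto intro!: eq_vecI simp: algebra_simps)
    moreover have "h * vnorm dx < h * K" "h * vnorm ds < h * K" using h K by auto
    then have "h * vnorm dx < e" "h * vnorm ds < e" using h(3) by linarith+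
    ultimately have "vnorm (x + (1 - h) \<cdot>\<^sub>v dx - (x + 1 \<cdot>\<^sub>v dx)) < e" "vnorm (s + (1 - h) \<cdot>\<^sub>v ds - (s + 1 \<cdot>\<^sub>v ds)) < e"
      unfolding vnorm_smult using h by (auto simp: vnorm_smult)
    then show ?thesis using S[of "1 - h"] h by (intro bexI[of _ "(x + (1 - h) \<cdot>\<^sub>v dx, s + (1 - h) \<cdot>\<^sub>v ds)"]) auto
  qed
  then show ?thesis unfolding pair_closure_def using c by simp
qed

end

text \<open>The minimizer comes from projecting the weighted data onto the weighted column space,
  with weight zero outside \<open>N\<close>. Existence is part of the claim that the algorithm never
  gets stuck.\<close>

lemma least_squares_exists:
  assumes K: "(K :: real mat) \<in> carrier_mat n k" and a: "a \<in> carrier_vec n"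
    and N: "N \<subseteq> {..<n}" and V: "V = {K *\<^sub>v u | u. u \<in> carrier_vec k}"
  shows "\<exists>\<delta>. is_arg_min (\<lambda>\<delta>. L2_set (\<lambda>i. (a $ i + \<delta> $ i) / h $ i) N) (\<lambda>\<delta>. \<delta> \<in> V) \<delta>"
proof -
  define e where "e = (\<lambda>i. if i \<in> N then 1 / h $ i else (0::real))"
  define H where "H = diagm n e * K"
  have H: "H \<in> carrier_mat n k" using K by (simp add: H_def mult_carrier_mat[of _ n n])
  define g where "g = diagm n e *\<^sub>v a"
  have g: "g \<in> carrier_vec n" using a by (simp add: g_def mult_mat_vec_carrier[of _ n n])
  obtain R Y where R: "R \<in> carrier_mat n n" "Y \<in> carrier_mat k n" "R\<^sup>T = R" "R * R = R" "R * H = H" "R = H * Y"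
    using range_projection[OF H] by blast
  have obj: "L2_set (\<lambda>i. (a $ i + (K *\<^sub>v u) $ i) / h $ i) N = vnorm (g + H *\<^sub>v u)" if u: "u \<in> carrier_vec k" for u
  proof -
    have Ku: "K *\<^sub>v u \<in> carrier_vec n" using K u by simp
    have Hu: "H *\<^sub>v u = diagm n e *\<^sub>v (K *\<^sub>v u)" unfolding H_def
      using K u by (intro assoc_mult_mat_vec[of _ n n _ k]) auto
    have "vnorm (g + H *\<^sub>v u) = L2_set (\<lambda>i. e i * (a $ i + (K *\<^sub>v u) $ i)) {..<n}"
      unfolding vnorm_def Hu g_def diagm_mult_vec[OF a] diagm_mult_vec[OF Ku]
      by (intro L2_set_cong) (auto simp: distrib_left simp del: index_mult_mat_vec)
    also have "\<dots> = L2_set (\<lambda>i. (a $ i + (K *\<^sub>v u) $ i) / h $ i) N"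
      unfolding L2_set_def
      by (rule arg_cong[where f = sqrt], rule sum.mono_neutral_cong_right) (use N in \<open>auto simp: e_def\<close>)
    finally show ?thesis ..
  qed
  define u where "u = - (Y *\<^sub>v g)"
  have u: "u \<in> carrier_vec k" using R g by (simp add: u_def)
  have Rg: "R *\<^sub>v g \<in> carrier_vec n" using R g by simp
  have "H *\<^sub>v u = - (H *\<^sub>v (Y *\<^sub>v g))" unfolding u_def by (rule mult_mat_vec_uminus[OF H]) (use R g in simp)
  also have "H *\<^sub>v (Y *\<^sub>v g) = R *\<^sub>v g" using R(6) assoc_mult_mat_vec[OF H R(2) g] by simp
  finally have Hu: "g + H *\<^sub>v u = g - R *\<^sub>v g" using g Rg by (simp add: minus_add_uminus_vec[of g n])
  have best: "vnorm (g + H *\<^sub>v u) \<le> vnorm (g + H *\<^sub>v v)" if v: "v \<in> carrier_vec k" for v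
  proof -
    define p where "p = g - R *\<^sub>v g"
    define q where "q = R *\<^sub>v g + H *\<^sub>v v"
    have p: "p \<in> carrier_vec n" and q: "q \<in> carrier_vec n" using g Rg H v by (auto simp: p_def q_def)
    have Hv: "H *\<^sub>v v \<in> carrier_vec n" using H v by simp
    have pq: "g + H *\<^sub>v v = p + q" using g carrier_vecD[OF Rg] carrier_vecD[OF Hv]
      by (intro eq_vecI) (auto simp: p_def q_def simp del: index_mult_mat_vec)
    have RRg: "R *\<^sub>v (R *\<^sub>v g) = R *\<^sub>v g" using assoc_mult_mat_vec[OF R(1) R(1) g] R(4) by simp
    have RH: "R *\<^sub>v (H *\<^sub>v v) = H *\<^sub>v v" using assoc_mult_mat_vec[OF R(1) H v] R(5) by simp
    have Rq: "R *\<^sub>v q = q" unfolding q_def using mult_add_distrib_mat_vec[OF R(1) Rg Hv] RRg RH by simp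
    have "R *\<^sub>v p = R *\<^sub>v g - R *\<^sub>v (R *\<^sub>v g)" unfolding p_def by (rule mult_minus_distrib_mat_vec[OF R(1) g Rg])
    then have Rp: "R *\<^sub>v p = 0\<^sub>v n" unfolding RRg using Rg by simp
    have "p \<bullet> q = p \<bullet> (R\<^sup>T *\<^sub>v q)" using Rq R(3) by simp
    also have "\<dots> = (R *\<^sub>v p) \<bullet> q" by (rule scalar_prod_mult_mat[OF R(1) p q, symmetric])
    finally have 0: "p \<bullet> q = 0" using Rp q by simp
    have "(p + q) \<bullet> (p + q) = p \<bullet> p + q \<bullet> q"
      using p q 0 comm_scalar_prod[OF q p] by (simp add: scalar_prod_add_distrib[of _ n] add_scalar_prod_distrib[of _ n])
    then show ?thesis unfolding pq Hu p_def[symmetric]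
      using scalar_prod_self_nonneg[of q] by (intro vnorm_mono_sq) simp
  qed
  show ?thesis
    unfolding is_arg_min_def
  proof (intro exI[of _ "K *\<^sub>v u"] conjI)
    show "K *\<^sub>v u \<in> V" unfolding V using u by blast
    show "\<nexists>\<delta>. \<delta> \<in> V \<and> L2_set (\<lambda>i. (a $ i + \<delta> $ i) / h $ i) N < L2_set (\<lambda>i. (a $ i + (K *\<^sub>v u) $ i) / h $ i) N"
    proof
      assume "\<exists>\<delta>. \<delta> \<in> V \<and> L2_set (\<lambda>i. (a $ i + \<delta> $ i) / h $ i) N < L2_set (\<lambda>i. (a $ i + (K *\<^sub>v u) $ i) / h $ i) N"
      then obtain v where v: "v \<in> carrier_vec k"
        and lt: "L2_set (\<lambda>i. (a $ i + (K *\<^sub>v v) $ i) / h $ i) N < L2_set (\<lambda>i. (a $ i + (K *\<^sub>v u) $ i) / h $ i) N"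
        unfolding V by blast
      then show False using best[OF v] unfolding obj[OF v] obj[OF u] by simp
    qed
  qed
qed

text \<open>A subspace given by generators, as the construction of least squares minimizers uses
  it.\<close>

definition mat_range :: "nat \<Rightarrow> real vec set \<Rightarrow> bool" where
  "mat_range n V \<longleftrightarrow> (\<exists>k. \<exists>K \<in> carrier_mat n k. V = {K *\<^sub>v u | u. u \<in> carrier_vec k})"

context lp_matrix
begin

lemma W_mat_range: "mat_range n (W A)"
proof -
  obtain R where R: "R \<in> carrier_mat n n" "R\<^sup>T = R" "R * R = R"
    and 0: "\<And>v. v \<in> carrier_vec n \<Longrightarrow> R *\<^sub>v v = 0\<^sub>v n \<longleftrightarrow> vec n (\<lambda>i. 1 * v $ i) \<in> W A"
    by (rule scaled_projection[of "\<lambda>_. 1"]) auto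
  have 0: "R *\<^sub>v v = 0\<^sub>v n \<longleftrightarrow> v \<in> W A" if "v \<in> carrier_vec n" for v
  proof -
    have "vec n (\<lambda>i. 1 * v $ i) = v" using that by (intro eq_vecI) auto
    then show ?thesis using 0[OF that] by simp
  qed
  have v: "(1\<^sub>m n - R) *\<^sub>v v = v - R *\<^sub>v v" if "v \<in> carrier_vec n" for v
    using minus_mult_distrib_mat_vec[of "1\<^sub>m n" n n R v] R that by simp
  have RR: "R *\<^sub>v (R *\<^sub>v v) = R *\<^sub>v v" if "v \<in> carrier_vec n" for v
    using assoc_mult_mat_vec[OF R(1) R(1) that] R(3) by simp
  have "W A = {(1\<^sub>m n - R) *\<^sub>v u | u. u \<in> carrier_vec n}"
  proof (intro equalityI subsetI)
    fix w assume w: "w \<in> W A"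
    then have wc: "w \<in> carrier_vec n" by (rule W_carrier)
    have "w = (1\<^sub>m n - R) *\<^sub>v w" unfolding v[OF wc] using 0[OF wc] w wc by simp
    then show "w \<in> {(1\<^sub>m n - R) *\<^sub>v u | u. u \<in> carrier_vec n}" using wc by blast
  next
    fix w assume "w \<in> {(1\<^sub>m n - R) *\<^sub>v u | u. u \<in> carrier_vec n}"
    then obtain u where u: "u \<in> carrier_vec n" "w = u - R *\<^sub>v u" using v by auto
    have Ru: "R *\<^sub>v u \<in> carrier_vec n" using R u by simp
    have "R *\<^sub>v w = R *\<^sub>v u - R *\<^sub>v (R *\<^sub>v u)" unfolding u(2) by (rule mult_minus_distrib_mat_vec[OF R(1) u(1) Ru])
    then have "R *\<^sub>v w = 0\<^sub>v n" unfolding RR[OF u(1)] using Ru by simp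
    moreover have "w \<in> carrier_vec n" unfolding u(2) using u Ru by simp
    ultimately show "w \<in> W A" using 0 by blast
  qed
  then show ?thesis unfolding mat_range_def using R by (intro exI[of _ n] bexI[of _ "1\<^sub>m n - R"]) auto
qed

lemma Wperp_mat_range: "mat_range n (Wperp A)"
  unfolding mat_range_def using A
  by (intro exI[of _ m] bexI[of _ "A\<^sup>T"]) (auto simp: Wperp_iff)

lemma zero_mat_range: "mat_range n {0\<^sub>v n}"
  unfolding mat_range_def by (intro exI[of _ 0] bexI[of _ "0\<^sub>m n 0"]) (auto intro!: eq_vecI exI[of _ "0\<^sub>v 0"] simp: scalar_prod_def)

end

section \<open>Certificates for cheap lift directions\<close>

text \<open>The singular values of the cheap lift from \<open>N\<close> to \<open>B\<close> at scaling \<open>d\<close> exceed \<open>\<tau>\<close> in at least \<open>k\<close>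
  directions. No projection occurs here, so certificates at different scalings can be compared
  coordinatewise.\<close>

definition wcert :: "nat \<Rightarrow> real vec set \<Rightarrow> (nat \<Rightarrow> real) \<Rightarrow> nat set \<Rightarrow> nat set \<Rightarrow> real \<Rightarrow> nat \<Rightarrow> bool" where
  "wcert n S d N B \<tau> k \<longleftrightarrow> (\<exists>F \<in> carrier_mat n k. (\<forall>u\<in>carrier_vec k. F *\<^sub>v u \<in> S) \<and>
     (\<forall>u\<in>carrier_vec k. u \<noteq> 0\<^sub>v k \<longrightarrow> (\<forall>z\<in>S. (\<forall>i\<in>N. z $ i = (F *\<^sub>v u) $ i) \<longrightarrow>
        \<tau> * L2_set (\<lambda>i. d i * z $ i) N < L2_set (\<lambda>i. d i * z $ i) B)))"

lemma wcertI:
  assumes "F \<in> carrier_mat n k" "\<And>u. u \<in> carrier_vec k \<Longrightarrow> F *\<^sub>v u \<in> S"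
    "\<And>u z. u \<in> carrier_vec k \<Longrightarrow> u \<noteq> 0\<^sub>v k \<Longrightarrow> z \<in> S \<Longrightarrow> (\<And>i. i \<in> N \<Longrightarrow> z $ i = (F *\<^sub>v u) $ i) \<Longrightarrow>
       \<tau> * L2_set (\<lambda>i. d i * z $ i) N < L2_set (\<lambda>i. d i * z $ i) B"
  shows "wcert n S d N B \<tau> k"
  using assms unfolding wcert_def by blast

lemma wcert_0: "0\<^sub>v n \<in> S \<Longrightarrow> wcert n S d N B \<tau> 0"
proof (rule wcertI[of "0\<^sub>m n 0"])
  fix u :: "real vec" assume S: "0\<^sub>v n \<in> S" and u: "u \<in> carrier_vec 0"
  have "0\<^sub>m n 0 *\<^sub>v u = 0\<^sub>v n" using u by (intro eq_vecI) (auto simp: scalar_prod_def)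
  then show "0\<^sub>m n 0 *\<^sub>v u \<in> S" using S by simp
next
  fix u :: "real vec" assume "u \<in> carrier_vec 0" "u \<noteq> 0\<^sub>v 0"
  then have False using eq_vecI[of u "0\<^sub>v 0"] by auto
  then show "\<tau> * L2_set (\<lambda>i. d i * z $ i) N < L2_set (\<lambda>i. d i * z $ i) B" for z ..
qed simp

text \<open>If \<open>B\<close> is empty the longer norm is zero; if \<open>N\<close> is empty the
  zero vector is a lift of every restriction. So a one-sided partition has no long lifts.\<close>

lemma wcert_trivial:
  assumes k: "wcert n S d N B \<tau> k" and \<tau>: "0 \<le> \<tau>" and S: "0\<^sub>v n \<in> S" and NB: "B = {..<n} - N" "N = {} \<or> B = {}"
  shows "k = 0"
proof (rule ccontr)
  assume k0: "k \<noteq> 0"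
  have "unit_vec k 0 $ 0 = (1 :: real)" using k0 by simp
  then have u: "unit_vec k 0 \<in> carrier_vec k" "unit_vec k 0 \<noteq> (0\<^sub>v k :: real vec)" using k0 by auto
  obtain F where F: "F \<in> carrier_mat n k" "\<And>u. u \<in> carrier_vec k \<Longrightarrow> F *\<^sub>v u \<in> S"
    and FF: "\<And>u z. u \<in> carrier_vec k \<Longrightarrow> u \<noteq> 0\<^sub>v k \<Longrightarrow> z \<in> S \<Longrightarrow> (\<forall>i\<in>N. z $ i = (F *\<^sub>v u) $ i) \<Longrightarrow>
       \<tau> * L2_set (\<lambda>i. d i * z $ i) N < L2_set (\<lambda>i. d i * z $ i) B"
    using k unfolding wcert_def by blast
  show False
  proof (cases "B = {}")
    case True
    have "\<tau> * L2_set (\<lambda>i. d i * (F *\<^sub>v unit_vec k 0) $ i) N < L2_set (\<lambda>i. d i * (F *\<^sub>v unit_vec k 0) $ i) B"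
      by (rule FF[OF u F(2)[OF u(1)]]) simp
    moreover have "0 \<le> \<tau> * L2_set (\<lambda>i. d i * (F *\<^sub>v unit_vec k 0) $ i) N" using \<tau> by simp
    ultimately show False using True by simp
  next
    case False
    then have N: "N = {}" using NB by simp
    have "\<tau> * L2_set (\<lambda>i. d i * 0\<^sub>v n $ i) N < L2_set (\<lambda>i. d i * 0\<^sub>v n $ i) B"
      by (rule FF[OF u S]) (simp add: N)
    moreover have "L2_set (\<lambda>i. d i * 0\<^sub>v n $ i) B = 0" using NB by (simp add: L2_set_def)
    ultimately show False by (simp add: N)
  qed
qed

text \<open>Ties the projection to an unscaled subspace: the range of \<open>P\<close> is
  \<open>S\<close> multiplied by \<open>d\<close>. It is used for the kernel of \<open>A\<close>
  with weights \<open>1 / x\<close> and for the row space with weights \<open>x\<close>.\<close>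

locale weighted_lift = lift +
  fixes S :: "real vec set" and d :: "nat \<Rightarrow> real"
  assumes S: "S \<subseteq> carrier_vec n" and d: "\<And>i. i < n \<Longrightarrow> 0 < d i"
    and ZS: "\<And>v. v \<in> carrier_vec n \<Longrightarrow> P *\<^sub>v v = v \<longleftrightarrow> vec n (\<lambda>i. v $ i / d i) \<in> S"
begin

abbreviation "sc v \<equiv> vec n (\<lambda>i. d i * v $ i)"

abbreviation "us v \<equiv> vec n (\<lambda>i. v $ i / d i)"

lemma us_sc: "v \<in> carrier_vec n \<Longrightarrow> us (sc v) = v" "v \<in> carrier_vec n \<Longrightarrow> sc (us v) = v"
  using d by (auto intro!: eq_vecI simp: less_imp_neq[symmetric])

lemma us_in_S: "z \<in> Z \<Longrightarrow> us z \<in> S"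
  using ZS[of z] by (simp add: Z_def)

lemma sc_in_Z: "w \<in> S \<Longrightarrow> sc w \<in> Z"
  using ZS[of "sc w"] us_sc(1)[of w] S unfolding Z_def by auto

lemma norms:
  assumes "w \<in> carrier_vec n"
  shows "vnorm (rN (sc w)) = L2_set (\<lambda>i. d i * w $ i) N" "vnorm (rB (sc w)) = L2_set (\<lambda>i. d i * w $ i) B"
proof -
  have "vnorm (restr n I (sc w)) = L2_set (\<lambda>i. d i * w $ i) I" if "I \<subseteq> {..<n}" for I
    unfolding vnorm_restr[OF that vec_carrier] using that by (intro L2_set_cong) auto
  then show "vnorm (rN (sc w)) = L2_set (\<lambda>i. d i * w $ i) N" "vnorm (rB (sc w)) = L2_set (\<lambda>i. d i * w $ i) B"
    using N Bn by auto
qed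

lemma restr_sc_eq:
  assumes "v \<in> carrier_vec n" "w \<in> carrier_vec n"
  shows "rN (sc v) = rN (sc w) \<longleftrightarrow> (\<forall>i\<in>N. v $ i = w $ i)"
proof -
  have "sc v $ i = sc w $ i \<longleftrightarrow> v $ i = w $ i" if "i \<in> N" for i
  proof -
    have i: "i < n" using that N by blast
    then show ?thesis using d[OF i] by simp
  qed
  then show ?thesis unfolding restr_eq_iff[OF N vec_carrier vec_carrier] by (intro ball_cong refl)
qed

text \<open>Multiplication by the weights is a bijection from \<open>S\<close> to \<open>Z\<close>
  that respects restrictions to \<open>N\<close> and turns weighted norms into plain ones.\<close>

lemma wcert_iff: "wcert n S d N B \<tau> k \<longleftrightarrow> cert \<tau> k"
proof
  assume "wcert n S d N B \<tau> k"
  then obtain F where F: "F \<in> carrier_mat n k" "\<And>u. u \<in> carrier_vec k \<Longrightarrow> F *\<^sub>v u \<in> S"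
    and FF: "\<And>u z. u \<in> carrier_vec k \<Longrightarrow> u \<noteq> 0\<^sub>v k \<Longrightarrow> z \<in> S \<Longrightarrow> (\<forall>i\<in>N. z $ i = (F *\<^sub>v u) $ i) \<Longrightarrow>
       \<tau> * L2_set (\<lambda>i. d i * z $ i) N < L2_set (\<lambda>i. d i * z $ i) B"
    unfolding wcert_def by blast
  let ?F = "diagm n d * F"
  have Fv: "?F *\<^sub>v u = sc (F *\<^sub>v u)" if "u \<in> carrier_vec k" for u
  proof -
    have "?F *\<^sub>v u = diagm n d *\<^sub>v (F *\<^sub>v u)" using F(1) that by (intro assoc_mult_mat_vec[of _ n n _ k]) auto
    then show ?thesis using diagm_mult_vec[of "F *\<^sub>v u" n d] F(1) that by simp
  qed
  show "cert \<tau> k" unfolding cert_def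
  proof (intro bexI[of _ ?F] conjI ballI impI)
    show "?F \<in> carrier_mat n k" using F(1) by (simp add: mult_carrier_mat[of _ n n])
    fix u :: "real vec" assume u: "u \<in> carrier_vec k"
    have Fu: "F *\<^sub>v u \<in> carrier_vec n" using F(1) u by simp
    show "?F *\<^sub>v u \<in> Z" unfolding Fv[OF u] by (rule sc_in_Z[OF F(2)[OF u]])
    fix z assume u0: "u \<noteq> 0\<^sub>v k" and z: "z \<in> Z" and eq: "rN z = rN (?F *\<^sub>v u)"
    have zc: "z \<in> carrier_vec n" by (rule Z_carrier[OF z])
    have uz: "us z \<in> carrier_vec n" by simp
    have "rN (sc (us z)) = rN (sc (F *\<^sub>v u))" using eq unfolding Fv[OF u] us_sc(2)[OF zc] .
    then have "\<forall>i\<in>N. us z $ i = (F *\<^sub>v u) $ i" unfolding restr_sc_eq[OF uz Fu] .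
    then have "\<tau> * L2_set (\<lambda>i. d i * us z $ i) N < L2_set (\<lambda>i. d i * us z $ i) B"
      by (intro FF[OF u u0 us_in_S[OF z]]) blast
    then show "\<tau> * vnorm (rN z) < vnorm (rB z)" unfolding norms[OF uz, symmetric] us_sc(2)[OF zc] .
  qed
next
  assume "cert \<tau> k"
  then obtain F where F: "F \<in> carrier_mat n k" "\<And>u. u \<in> carrier_vec k \<Longrightarrow> F *\<^sub>v u \<in> Z"
    and FF: "\<And>u z. u \<in> carrier_vec k \<Longrightarrow> u \<noteq> 0\<^sub>v k \<Longrightarrow> z \<in> Z \<Longrightarrow> rN z = rN (F *\<^sub>v u) \<Longrightarrow>
       \<tau> * vnorm (rN z) < vnorm (rB z)"
    unfolding cert_def by blast
  let ?F = "diagm n (\<lambda>i. 1 / d i) * F"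
  have Fv: "?F *\<^sub>v u = us (F *\<^sub>v u)" if "u \<in> carrier_vec k" for u
  proof -
    have "?F *\<^sub>v u = diagm n (\<lambda>i. 1 / d i) *\<^sub>v (F *\<^sub>v u)" using F(1) that by (intro assoc_mult_mat_vec[of _ n n _ k]) auto
    then show ?thesis using diagm_mult_vec[of "F *\<^sub>v u" n "\<lambda>i. 1 / d i"] F(1) that by simp
  qed
  show "wcert n S d N B \<tau> k"
  proof (rule wcertI[of ?F])
    show "?F \<in> carrier_mat n k" using F(1) by (simp add: mult_carrier_mat[of _ n n])
    fix u :: "real vec" assume u: "u \<in> carrier_vec k"
    have Fu: "F *\<^sub>v u \<in> carrier_vec n" using F(1) u by simp
    show "?F *\<^sub>v u \<in> S" unfolding Fv[OF u] by (rule us_in_S[OF F(2)[OF u]])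
    fix w assume u0: "u \<noteq> 0\<^sub>v k" and w: "w \<in> S" and eq: "\<And>i. i \<in> N \<Longrightarrow> w $ i = (?F *\<^sub>v u) $ i"
    have wc: "w \<in> carrier_vec n" using w S by blast
    have "\<forall>i\<in>N. w $ i = us (F *\<^sub>v u) $ i" using eq unfolding Fv[OF u] by blast
    then have "rN (sc w) = rN (sc (us (F *\<^sub>v u)))" unfolding restr_sc_eq[OF wc vec_carrier] .
    then have "\<tau> * vnorm (rN (sc w)) < vnorm (rB (sc w))"
      unfolding us_sc(2)[OF Fu] by (rule FF[OF u u0 sc_in_Z[OF w]])
    then show "\<tau> * L2_set (\<lambda>i. d i * w $ i) N < L2_set (\<lambda>i. d i * w $ i) B" unfolding norms[OF wc] .
  qed
qed

lemma lifted_space: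
  assumes svd: "rho_svd \<rho> l C t" and V: "V = (\<lambda>w. us (L *\<^sub>v w)) ` last_cols_span C p"
  shows "V \<subseteq> S" "mat_range n V"
proof -
  note sv = rho_svdD[OF svd lc]
  have span: "last_cols_span C p = {tcols C (q - p) *\<^sub>v v | v. v \<in> carrier_vec (q - (q - p))}"
    unfolding last_cols_span_def using sv(1) span_tcols[OF sv(1), of "q - p"] by simp
  have T: "tcols C (q - p) \<in> carrier_mat q (q - (q - p))" by (rule tcols_carrier[OF sv(1)])
  show "V \<subseteq> S"
    unfolding V span using T us_in_S[OF L_in_Z] by auto
  let ?K = "diagm n (\<lambda>i. 1 / d i) * (L * tcols C (q - p))"
  have LT: "L * tcols C (q - p) \<in> carrier_mat n (q - (q - p))" using Lc T by simp
  have K: "?K \<in> carrier_mat n (q - (q - p))" using LT by (simp add: mult_carrier_mat[of _ n n])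
  have "?K *\<^sub>v v = us (L *\<^sub>v (tcols C (q - p) *\<^sub>v v))" if v: "v \<in> carrier_vec (q - (q - p))" for v
  proof -
    have "?K *\<^sub>v v = diagm n (\<lambda>i. 1 / d i) *\<^sub>v ((L * tcols C (q - p)) *\<^sub>v v)"
      using LT v by (intro assoc_mult_mat_vec[of _ n n]) auto
    also have "(L * tcols C (q - p)) *\<^sub>v v = L *\<^sub>v (tcols C (q - p) *\<^sub>v v)"
      using Lc T v by (intro assoc_mult_mat_vec) auto
    finally show ?thesis using diagm_mult_vec[of "L *\<^sub>v (tcols C (q - p) *\<^sub>v v)" n "\<lambda>i. 1 / d i"] Lc T v by simp
  qed
  then have "(\<lambda>v. us (L *\<^sub>v (tcols C (q - p) *\<^sub>v v))) ` carrier_vec (q - (q - p)) = (\<lambda>v. ?K *\<^sub>v v) ` carrier_vec (q - (q - p))"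
    by (intro image_cong refl) simp
  moreover have "V = (\<lambda>v. us (L *\<^sub>v (tcols C (q - p) *\<^sub>v v))) ` carrier_vec (q - (q - p))"
    unfolding V span by blast
  ultimately have "V = {?K *\<^sub>v v | v. v \<in> carrier_vec (q - (q - p))}" by blast
  then show "mat_range n V" unfolding mat_range_def using K by blast
qed

text \<open>The consequences of the gap pulled back to unscaled directions, which is where the
  spaces of the algorithm live.\<close>

lemma lifted_space_gap:
  assumes svd: "rho_svd 2 l C t" and V: "V = (\<lambda>w. us (L *\<^sub>v w)) ` last_cols_span C p"
    and p: "p = card {i. i < dim_vec t \<and> t $ i \<le> 1}"
    and cR: "wcert n S d N B R k" and max: "\<And>k'. wcert n S d N B \<eta> k' \<Longrightarrow> k' \<le> k"
    and \<eta>: "0 < \<eta>" "\<eta> \<le> 1 / 4" and R: "1 \<le> R"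
  shows "\<And>\<delta>. \<delta> \<in> V \<Longrightarrow> L2_set (\<lambda>i. d i * \<delta> $ i) B \<le> 2 * \<eta> * L2_set (\<lambda>i. d i * \<delta> $ i) N"
    "\<And>w. w \<in> S \<Longrightarrow> \<exists>\<delta>\<in>V. L2_set (\<lambda>i. d i * (w $ i - \<delta> $ i)) N \<le>
       2 * (L2_set (\<lambda>i. d i * w $ i) B + L2_set (\<lambda>i. d i * w $ i) N) / R"
proof -
  have cR': "cert R k" using cR wcert_iff by blast
  have max': "k' \<le> k" if "cert \<eta> k'" for k' using max wcert_iff that by blast
  have g1: "last_cols_span C p \<subseteq> carrier_vec q"
    by (rule gap_lift(1)[OF svd cR' _ \<eta> R p]) (erule max')
  have g2: "vnorm (rB (L *\<^sub>v c)) \<le> 2 * \<eta> * vnorm (rN (L *\<^sub>v c))" if "c \<in> last_cols_span C p" for c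
    by (rule gap_lift(2)[OF svd cR' _ \<eta> R p that]) (erule max')
  have g3: "\<exists>c \<in> last_cols_span C p. vnorm (rN z - rN (L *\<^sub>v c)) \<le> 2 * (vnorm (rB z) + vnorm (rN z)) / R"
    if "z \<in> Z" for z
    by (rule gap_lift(3)[OF svd cR' _ \<eta> R p that]) (erule max')
  have Lcc: "L *\<^sub>v c \<in> carrier_vec n" if "c \<in> last_cols_span C p" for c using g1 that Lc by auto
  {
    fix \<delta> assume "\<delta> \<in> V"
    then obtain c where c: "c \<in> last_cols_span C p" "\<delta> = us (L *\<^sub>v c)" unfolding V by blast
    have \<delta>: "\<delta> \<in> carrier_vec n" using c by simp
    have e: "sc \<delta> = L *\<^sub>v c" unfolding c(2) by (rule us_sc(2)[OF Lcc[OF c(1)]])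
    show "L2_set (\<lambda>i. d i * \<delta> $ i) B \<le> 2 * \<eta> * L2_set (\<lambda>i. d i * \<delta> $ i) N"
      using g2[OF c(1)] unfolding e[symmetric] norms[OF \<delta>] .
  next
    fix w assume w: "w \<in> S"
    have wc: "w \<in> carrier_vec n" using w S by blast
    obtain c where c: "c \<in> last_cols_span C p"
      and le: "vnorm (rN (sc w) - rN (L *\<^sub>v c)) \<le> 2 * (vnorm (rB (sc w)) + vnorm (rN (sc w))) / R"
      using g3[OF sc_in_Z[OF w]] by blast
    define \<delta> where "\<delta> = us (L *\<^sub>v c)"
    have \<delta>: "\<delta> \<in> carrier_vec n" by (simp add: \<delta>_def)
    have e: "sc \<delta> = L *\<^sub>v c" unfolding \<delta>_def by (rule us_sc(2)[OF Lcc[OF c]])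
    have "rN (sc w) - rN (L *\<^sub>v c) = rN (sc w - sc \<delta>)" unfolding e
      using Lcc[OF c] by (intro mult_minus_distrib_mat_vec[of _ q n, symmetric]) auto
    also have "sc w - sc \<delta> = sc (w - \<delta>)" using wc \<delta> by (intro eq_vecI) (auto simp: algebra_simps)
    finally have "L2_set (\<lambda>i. d i * (w - \<delta>) $ i) N \<le> 2 * (L2_set (\<lambda>i. d i * w $ i) B + L2_set (\<lambda>i. d i * w $ i) N) / R"
      using le norms(1)[of "w - \<delta>"] wc \<delta> unfolding norms[OF wc] by simp
    moreover have "L2_set (\<lambda>i. d i * (w - \<delta>) $ i) N = L2_set (\<lambda>i. d i * (w $ i - \<delta> $ i)) N"
      using wc \<delta> N by (intro L2_set_cong refl) auto
    ultimately show "\<exists>\<delta>\<in>V. L2_set (\<lambda>i. d i * (w $ i - \<delta> $ i)) N \<le>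
       2 * (L2_set (\<lambda>i. d i * w $ i) B + L2_set (\<lambda>i. d i * w $ i) N) / R"
      using c unfolding V \<delta>_def by (intro bexI[of _ "us (L *\<^sub>v c)"]) auto
  }
qed

lemma wcert_le_card:
  assumes "wcert n S d N B \<tau> k" and "rho_svd \<rho> l C t"
  shows "k \<le> card N"
proof -
  have "k \<le> card {i. i < q \<and> \<tau> < t $ i}" using cert_le[OF _ assms(2)] assms(1) wcert_iff by blast
  also have "\<dots> \<le> card {..<q}" by (intro card_mono) auto
  finally show ?thesis by simp
qed

end

context lp_matrix
begin

text \<open>The data of the cheap lift at \<open>x\<close>: the primal side works with the projection onto the scaled
  kernel, the dual side with the complementary projection.\<close>

lemma cheap_lift_cases:
  assumes x: "x \<in> carrier_vec n" "\<And>i. i < n \<Longrightarrow> 0 < x $ i" and B: "B \<subseteq> {..<n}" "B \<noteq> {}" and N: "N = {..<n} - B" "N \<noteq> {}"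
  obtains R where "weighted_lift n (1\<^sub>m n - R) N B (W A) (\<lambda>i. 1 / x $ i)" "weighted_lift n R B N (Wperp A) (\<lambda>i. x $ i)"
    "\<And>svd V U. cheap_lift_spaces A svd x B N V U \<longleftrightarrow>
      (\<exists>(C, t)\<in>svd (lift.l (1\<^sub>m n - R) N B). \<exists>(C', t')\<in>svd (lift.l R B N).
        V = (\<lambda>w. vec n (\<lambda>i. (lift.L (1\<^sub>m n - R) N *\<^sub>v w) $ i / (1 / x $ i))) `
          last_cols_span C (card {i. i < dim_vec t \<and> t $ i \<le> 1}) \<and>
        U = (\<lambda>w. vec n (\<lambda>i. (lift.L R B *\<^sub>v w) $ i / x $ i)) `
          last_cols_span C' (card {i. i < dim_vec t' \<and> t' $ i \<le> 1}))"
proof -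
  obtain R where R: "R \<in> carrier_mat n n" "R\<^sup>T = R" "R * R = R"
    and R0: "\<And>v. v \<in> carrier_vec n \<Longrightarrow> R *\<^sub>v v = 0\<^sub>v n \<longleftrightarrow> vec n (\<lambda>i. x $ i * v $ i) \<in> W A"
    and R1: "\<And>v. v \<in> carrier_vec n \<Longrightarrow> R *\<^sub>v v = v \<longleftrightarrow> vec n (\<lambda>i. v $ i / x $ i) \<in> Wperp A"
    by (rule scaled_projection[of "\<lambda>i. x $ i", OF x(2)]) auto
  let ?P = "1\<^sub>m n - R"
  have P: "?P \<in> carrier_mat n n" using R by auto
  have Pv: "?P *\<^sub>v v = v - R *\<^sub>v v" if "v \<in> carrier_vec n" for v
    using minus_mult_distrib_mat_vec[of "1\<^sub>m n" n n R v] R that by simp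
  have RR: "R *\<^sub>v (R *\<^sub>v v) = R *\<^sub>v v" if "v \<in> carrier_vec n" for v
    using assoc_mult_mat_vec[OF R(1) R(1) that] R(3) by simp
  have PT: "?P\<^sup>T = ?P" using R(1,2) transpose_minus[of "1\<^sub>m n" n n R] by simp
  have PP: "?P * ?P = ?P"
  proof (rule mat_eqI_mult_vec[OF _ P])
    fix v :: "real vec" assume v: "v \<in> carrier_vec n"
    have Rv: "R *\<^sub>v v \<in> carrier_vec n" using R v by simp
    have "(?P * ?P) *\<^sub>v v = ?P *\<^sub>v (v - R *\<^sub>v v)" using assoc_mult_mat_vec[OF P P v] Pv[OF v] by simp
    also have "\<dots> = v - R *\<^sub>v v - (R *\<^sub>v v - R *\<^sub>v (R *\<^sub>v v))"
      using Pv[of "v - R *\<^sub>v v"] v Rv mult_minus_distrib_mat_vec[OF R(1) v Rv] by simp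
    also have "\<dots> = v - R *\<^sub>v v" unfolding RR[OF v] using v carrier_vecD[OF Rv]
      by (intro eq_vecI) (auto simp del: index_mult_mat_vec)
    finally show "(?P * ?P) *\<^sub>v v = ?P *\<^sub>v v" using Pv[OF v] by simp
  qed (use P in simp)
  have Pfix: "?P *\<^sub>v v = v \<longleftrightarrow> R *\<^sub>v v = 0\<^sub>v n" if v: "v \<in> carrier_vec n" for v
  proof -
    have Rv: "R *\<^sub>v v \<in> carrier_vec n" using R v by simp
    have "R *\<^sub>v v = 0\<^sub>v n" if e: "v - R *\<^sub>v v = v"
    proof (rule eq_vecI)
      fix i assume "i < dim_vec (0\<^sub>v n :: real vec)"
      then have i: "i < n" by simp
      have "(v - R *\<^sub>v v) $ i = v $ i" using e by simp
      then show "(R *\<^sub>v v) $ i = 0\<^sub>v n $ i" using i v carrier_vecD[OF Rv] by (simp del: index_mult_mat_vec)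
    qed (use R in simp)
    then show ?thesis unfolding Pv[OF v] using v by auto
  qed
  have BN: "N \<subseteq> {..<n}" "B = {..<n} - N" using B N by auto
  have 1: "weighted_lift n ?P N B (W A) (\<lambda>i. 1 / x $ i)"
  proof
    show "?P *\<^sub>v v = v \<longleftrightarrow> vec n (\<lambda>i. v $ i / (1 / x $ i)) \<in> W A" if "v \<in> carrier_vec n" for v
      unfolding Pfix[OF that] R0[OF that] by (simp add: mult.commute)
  qed (use P PT PP BN x W_carrier in auto)
  have 2: "weighted_lift n R B N (Wperp A) (\<lambda>i. x $ i)"
    by unfold_locales (use R R1 B N x Wperp_carrier in auto)
  interpret I1: weighted_lift n ?P N B "W A" "\<lambda>i. 1 / x $ i" by (rule 1)
  interpret I2: weighted_lift n R B N "Wperp A" "\<lambda>i. x $ i" by (rule 2)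
  let ?S = "(\<lambda>w. vinv x \<star> w) ` W A"
  have S: "?S = {v \<in> carrier_vec n. ?P *\<^sub>v v = v}"
  proof (intro equalityI subsetI)
    fix v assume "v \<in> ?S"
    then obtain w where w: "w \<in> W A" "v = vinv x \<star> w" by blast
    have "v = vec n (\<lambda>i. 1 / x $ i * w $ i)" using x W_carrier[OF w(1)]
      by (auto simp: w(2) vtimes_def vinv_def inverse_eq_divide intro!: eq_vecI)
    then show "v \<in> {v \<in> carrier_vec n. ?P *\<^sub>v v = v}" using I1.sc_in_Z[OF w(1)] unfolding I1.Z_def by simp
  next
    fix v assume v: "v \<in> {v \<in> carrier_vec n. ?P *\<^sub>v v = v}"
    then have w: "vec n (\<lambda>i. v $ i / (1 / x $ i)) \<in> W A" using I1.us_in_S[of v] by (simp add: I1.Z_def)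
    have "v = vinv x \<star> vec n (\<lambda>i. v $ i / (1 / x $ i))"
    proof (rule eq_vecI)
      fix i assume "i < dim_vec (vinv x \<star> vec n (\<lambda>i. v $ i / (1 / x $ i)))"
      then have i: "i < n" using x by (simp add: vtimes_def vinv_def)
      then show "v $ i = (vinv x \<star> vec n (\<lambda>i. v $ i / (1 / x $ i))) $ i"
        using x(1) x(2)[OF i] by (simp add: vtimes_def vinv_def)
    qed (use x v in \<open>simp add: vtimes_def vinv_def\<close>)
    then show "v \<in> ?S" using w by blast
  qed
  have op: "orth_proj n ?S = ?P" unfolding S
  proof (rule orth_proj_eqI[OF P])
    show "v - w \<in> {v \<in> carrier_vec n. ?P *\<^sub>v v = v}"
      if "v \<in> {v \<in> carrier_vec n. ?P *\<^sub>v v = v}" "w \<in> {v \<in> carrier_vec n. ?P *\<^sub>v v = v}" for v w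
      using I1.Z_diff[of v w] that by (simp add: I1.Z_def)
    show "?P *\<^sub>v v \<in> {v \<in> carrier_vec n. ?P *\<^sub>v v = v}" if "v \<in> carrier_vec n" for v
      using I1.PPv[OF that] P that by simp
    show "(v - ?P *\<^sub>v v) \<bullet> w = 0" if v: "v \<in> carrier_vec n" and w: "w \<in> {v \<in> carrier_vec n. ?P *\<^sub>v v = v}" for v w
    proof -
      have wc: "w \<in> carrier_vec n" and Pw: "?P *\<^sub>v w = w" using w by auto
      have Pvc: "?P *\<^sub>v v \<in> carrier_vec n" using P v by simp
      have "(v - ?P *\<^sub>v v) \<bullet> w = v \<bullet> w - (?P *\<^sub>v v) \<bullet> w" by (rule minus_scalar_prod_distrib[OF v Pvc wc])
      also have "(?P *\<^sub>v v) \<bullet> w = v \<bullet> w" using I1.P_sym[OF v wc] Pw by simp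
      finally show ?thesis by simp
    qed
  qed auto
  have d: "dim_col A = n" using A by simp
  \<comment> \<open>The second projection of the algorithm is \<open>R\<close> itself, so the dual
    lift is the same construction with the roles of \<open>N\<close> and \<open>B\<close>
    exchanged.\<close>
  have PR: "1\<^sub>m n - ?P = R" using R(1) by (intro eq_matI) auto
  have vx: "x \<star> v = vec n (\<lambda>i. v $ i / (1 / x $ i))" for v
    using x by (auto simp: vtimes_def mult.commute intro!: eq_vecI)
  have vix: "vinv x \<star> v = vec n (\<lambda>i. v $ i / x $ i)" for v
    using x by (auto simp: vtimes_def vinv_def divide_inverse mult.commute intro!: eq_vecI)
  show thesis
    by (rule that[OF 1 2])
      (simp only: cheap_lift_spaces_def Let_def d op[unfolded vix] PR B N(2) if_False vx vix
        I1.L_def[symmetric] I2.L_def[symmetric] I1.X_def[symmetric] I1.PN_def[symmetric] I2.X_def[symmetric] I2.PN_def[symmetric]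
        I1.l_def[symmetric] I2.l_def[symmetric])
qed

end

section \<open>Steps of the algorithm\<close>

lemma svd_solverD: "svd_solver \<rho> svd \<Longrightarrow> (C, t) \<in> svd M \<Longrightarrow> rho_svd \<rho> M C t"
  unfolding svd_solver_def by fast

lemma svd_solverE:
  assumes "svd_solver \<rho> svd"
  obtains C t where "(C, t) \<in> svd M"
  using assms unfolding svd_solver_def by (metis ex_in_conv surj_pair)

context lp_matrix
begin

lemma cheap_lift_spaces_sub:
  assumes svd: "svd_solver \<rho> svd" and x: "x \<in> carrier_vec n" "\<And>i. i < n \<Longrightarrow> 0 < x $ i"
    and B: "B \<subseteq> {..<n}" and N: "N = {..<n} - B" and cl: "cheap_lift_spaces A svd x B N V U"
  shows "V \<subseteq> W A" "U \<subseteq> Wperp A" "mat_range n V" "mat_range n U"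
proof -
  have d: "dim_col A = n" using A by simp
  have "V \<subseteq> W A \<and> U \<subseteq> Wperp A \<and> mat_range n V \<and> mat_range n U"
  proof (cases "B = {} \<or> N = {}")
    case True
    then show ?thesis
      using cl W_mat_range Wperp_mat_range zero_mat_range W_zero Wperp_zero
      unfolding cheap_lift_spaces_def Let_def d by (auto split: if_splits)
  next
    case False
    then have ne: "B \<noteq> {}" "N \<noteq> {}" by auto
    obtain R where 1: "weighted_lift n (1\<^sub>m n - R) N B (W A) (\<lambda>i. 1 / x $ i)"
      and 2: "weighted_lift n R B N (Wperp A) (\<lambda>i. x $ i)"
      and eq: "\<And>svd V U. cheap_lift_spaces A svd x B N V U \<longleftrightarrow>
      (\<exists>(C, t)\<in>svd (lift.l (1\<^sub>m n - R) N B). \<exists>(C', t')\<in>svd (lift.l R B N).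
        V = (\<lambda>w. vec n (\<lambda>i. (lift.L (1\<^sub>m n - R) N *\<^sub>v w) $ i / (1 / x $ i))) `
          last_cols_span C (card {i. i < dim_vec t \<and> t $ i \<le> 1}) \<and>
        U = (\<lambda>w. vec n (\<lambda>i. (lift.L R B *\<^sub>v w) $ i / x $ i)) `
          last_cols_span C' (card {i. i < dim_vec t' \<and> t' $ i \<le> 1}))"
      by (rule cheap_lift_cases[OF x B ne(1) N ne(2)]) auto
    obtain C t C' t' where C: "(C, t) \<in> svd (lift.l (1\<^sub>m n - R) N B)" and C': "(C', t') \<in> svd (lift.l R B N)"
      and V: "V = (\<lambda>w. vec n (\<lambda>i. (lift.L (1\<^sub>m n - R) N *\<^sub>v w) $ i / (1 / x $ i))) `
          last_cols_span C (card {i. i < dim_vec t \<and> t $ i \<le> 1})"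
      and U: "U = (\<lambda>w. vec n (\<lambda>i. (lift.L R B *\<^sub>v w) $ i / x $ i)) `
          last_cols_span C' (card {i. i < dim_vec t' \<and> t' $ i \<le> 1})"
      using cl unfolding eq by fast
    show ?thesis
      using weighted_lift.lifted_space[OF 1 svd_solverD[OF svd C] V]
        weighted_lift.lifted_space[OF 2 svd_solverD[OF svd C'] U] by blast
  qed
  then show "V \<subseteq> W A" "U \<subseteq> Wperp A" "mat_range n V" "mat_range n U" by auto
qed

lemma cheap_lift_spaces_exist:
  assumes svd: "svd_solver \<rho> svd" and x: "x \<in> carrier_vec n" "\<And>i. i < n \<Longrightarrow> 0 < x $ i"
    and B: "B \<subseteq> {..<n}" and N: "N = {..<n} - B"
  shows "\<exists>V U. cheap_lift_spaces A svd x B N V U"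
proof (cases "B = {} \<or> N = {}")
  case True
  then show ?thesis unfolding cheap_lift_spaces_def Let_def by auto
next
  case False
  then have ne: "B \<noteq> {}" "N \<noteq> {}" by auto
  obtain R where "weighted_lift n (1\<^sub>m n - R) N B (W A) (\<lambda>i. 1 / x $ i)"
    and "weighted_lift n R B N (Wperp A) (\<lambda>i. x $ i)" and
    eq: "\<And>svd V U. cheap_lift_spaces A svd x B N V U \<longleftrightarrow>
    (\<exists>(C, t)\<in>svd (lift.l (1\<^sub>m n - R) N B). \<exists>(C', t')\<in>svd (lift.l R B N).
      V = (\<lambda>w. vec n (\<lambda>i. (lift.L (1\<^sub>m n - R) N *\<^sub>v w) $ i / (1 / x $ i))) `
        last_cols_span C (card {i. i < dim_vec t \<and> t $ i \<le> 1}) \<and>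
      U = (\<lambda>w. vec n (\<lambda>i. (lift.L R B *\<^sub>v w) $ i / x $ i)) `
        last_cols_span C' (card {i. i < dim_vec t' \<and> t' $ i \<le> 1}))"
    by (rule cheap_lift_cases[OF x B ne(1) N ne(2)]) auto
  obtain C t where C: "(C, t) \<in> svd (lift.l (1\<^sub>m n - R) N B)" by (rule svd_solverE[OF svd])
  obtain C' t' where C': "(C', t') \<in> svd (lift.l R B N)" by (rule svd_solverE[OF svd])
  show ?thesis unfolding eq
    by (intro exI, rule bexI[OF _ C], unfold prod.case, rule bexI[OF _ C'], unfold prod.case) (rule conjI[OF refl refl])
qed

end

text \<open>The step relation is cut into its stages so that each stage can be assumed and supplied
  separately; the partition and the error \<open>\<epsilon>\<close> become explicit arguments shared
  between stages.\<close>

definition affine_part ::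
  "real mat \<Rightarrow> real \<Rightarrow> real vec \<Rightarrow> real vec \<Rightarrow> real vec \<Rightarrow> real vec \<Rightarrow> real \<Rightarrow> nat set \<Rightarrow> nat set \<Rightarrow> bool" where
  "affine_part A \<beta> x s dxa dsa \<alpha>a B N \<longleftrightarrow>
     newton_dir A x s (- (x \<star> s)) dxa dsa \<and>
     B = {i. i < dim_col A \<and> \<bar>dxa $ i / x $ i\<bar> < \<bar>dsa $ i / s $ i\<bar>} \<and> N = {..<dim_col A} - B \<and>
     0 < \<alpha>a \<and> \<alpha>a \<le> 1 \<and>
     max (\<beta> / (3 * sqrt (real (dim_col A)))) (1 - 3 * (vnorm (dxa \<star> dsa) / (\<beta> * mubar (x, s)))) \<le> \<alpha>a \<and>
     \<alpha>a \<le> max (\<beta> / (2 * sqrt (real (dim_col A)))) (1 - 2 * (vnorm (dxa \<star> dsa) / (\<beta> * mubar (x, s))))"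

definition scaled_min ::
  "real vec \<Rightarrow> real vec \<Rightarrow> nat set \<Rightarrow> real vec set \<Rightarrow> real vec \<Rightarrow> bool" where
  "scaled_min x h I V dx \<longleftrightarrow>
     is_arg_min (\<lambda>\<delta> :: real vec. L2_set (\<lambda>i. (x $ i + \<delta> $ i) / h $ i) I) (\<lambda>\<delta> :: real vec. \<delta> \<in> V) dx"

definition hat :: "real \<Rightarrow> real vec \<Rightarrow> real vec \<Rightarrow> real vec" where
  "hat \<mu> x s = vsqrt ((\<mu> \<cdot>\<^sub>v x) \<oslash> s)"

definition lls_part ::
  "real mat \<Rightarrow> (real mat \<Rightarrow> (real mat \<times> real vec) set) \<Rightarrow> real vec \<Rightarrow> real vec \<Rightarrow>
   nat set \<Rightarrow> nat set \<Rightarrow> real vec set \<Rightarrow> real vec set \<Rightarrow> real vec \<Rightarrow> real vec \<Rightarrow> bool" where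
  "lls_part A svd x s B N V U dxl dsl \<longleftrightarrow> cheap_lift_spaces A svd x B N V U \<and>
     scaled_min x (hat (mubar (x, s)) x s) N V dxl \<and> scaled_min s (hat (mubar (x, s)) s x) B U dsl"

definition length_part ::
  "real \<Rightarrow> real vec \<Rightarrow> real vec \<Rightarrow> real vec \<Rightarrow> real vec \<Rightarrow> real \<Rightarrow> real \<Rightarrow> bool" where
  "length_part \<beta> x s dxl dsl \<alpha>l \<epsilon> \<longleftrightarrow>
     \<epsilon> = vnorm ((x + dxl) \<star> (s + dsl)) / mubar (x, s) \<and>
     (if max (vnorm (dxl \<star> dsl) / mubar (x, s)) \<epsilon> \<le> \<beta> / 9
      then 1 - 9 * \<epsilon> / \<beta> \<le> \<alpha>l \<and> \<alpha>l \<le> 1 - 8 * \<epsilon> / \<beta> else \<alpha>l = 0)"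

definition better_of :: "real vec \<times> real vec \<Rightarrow> real vec \<times> real vec \<Rightarrow> real vec \<times> real vec" where
  "better_of za zl = (if mubar za < mubar zl then za else zl)"

lemma slls_step_iff:
  "slls_step A \<beta> svd z0 z1 \<longleftrightarrow> (\<exists>x0 s0 dxc dsc x s dxa dsa \<alpha>a B N V U dxl dsl \<alpha>l \<epsilon>. z0 = (x0, s0) \<and>
     newton_dir A x0 s0 (mubar z0 \<cdot>\<^sub>v ones (dim_col A) - x0 \<star> s0) dxc dsc \<and> x = x0 + dxc \<and> s = s0 + dsc \<and>
     affine_part A \<beta> x s dxa dsa \<alpha>a B N \<and> lls_part A svd x s B N V U dxl dsl \<and> length_part \<beta> x s dxl dsl \<alpha>l \<epsilon> \<and>
     z1 = better_of (x + \<alpha>a \<cdot>\<^sub>v dxa, s + \<alpha>a \<cdot>\<^sub>v dsa) (x + \<alpha>l \<cdot>\<^sub>v dxl, s + \<alpha>l \<cdot>\<^sub>v dsl))" (is "_ \<longleftrightarrow> ?R")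
proof
  assume "slls_step A \<beta> svd z0 z1"
  then show ?R
    unfolding slls_step_def Let_def affine_part_def lls_part_def length_part_def better_of_def
      scaled_min_def hat_def
    apply (elim exE conjE)
    apply hypsubst
    apply (rule exI)+
    apply (intro conjI)
    apply (rule refl | assumption)+
    done
next
  assume ?R
  then show "slls_step A \<beta> svd z0 z1"
    unfolding slls_step_def Let_def affine_part_def lls_part_def length_part_def better_of_def
      scaled_min_def hat_def
    apply (elim exE conjE)
    apply hypsubst
    apply (rule exI)+
    apply (intro conjI)
    apply (rule refl | assumption)+
    done
qed

context lp
begin

lemma N2_carrier: "N2 A b c \<beta> \<subseteq> carrier_vec n \<times> carrier_vec n"
  using N2D by fastforce

text \<open>What follows the corrector depends only on the corrected point, which is better centered
  and has the same duality measure. All later estimates start from that point.\<close>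

lemma slls_step_post:
  assumes z: "z0 \<in> N2 A b c \<beta>" and \<beta>: "0 < \<beta>" "\<beta> \<le> 1 / 6" and st: "slls_step A \<beta> svd z0 z1"
  obtains x s dxa dsa \<alpha>a B N V U dxl dsl \<alpha>l \<epsilon> where "(x, s) \<in> N2 A b c (\<beta> / 8)" "mubar (x, s) = mubar z0"
    "affine_part A \<beta> x s dxa dsa \<alpha>a B N" "lls_part A svd x s B N V U dxl dsl" "length_part \<beta> x s dxl dsl \<alpha>l \<epsilon>"
    "z1 = better_of (x + \<alpha>a \<cdot>\<^sub>v dxa, s + \<alpha>a \<cdot>\<^sub>v dsa) (x + \<alpha>l \<cdot>\<^sub>v dxl, s + \<alpha>l \<cdot>\<^sub>v dsl)"
proof -
  have d: "dim_col A = n" using A by simp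
  obtain x0 s0 dxc dsc x s dxa dsa \<alpha>a B N V U dxl dsl \<alpha>l \<epsilon> where z0: "z0 = (x0, s0)"
    and nd: "newton_dir A x0 s0 (mubar z0 \<cdot>\<^sub>v ones n - x0 \<star> s0) dxc dsc" and xs: "x = x0 + dxc" "s = s0 + dsc"
    and ps: "affine_part A \<beta> x s dxa dsa \<alpha>a B N" "lls_part A svd x s B N V U dxl dsl" "length_part \<beta> x s dxl dsl \<alpha>l \<epsilon>"
      "z1 = better_of (x + \<alpha>a \<cdot>\<^sub>v dxa, s + \<alpha>a \<cdot>\<^sub>v dsa) (x + \<alpha>l \<cdot>\<^sub>v dxl, s + \<alpha>l \<cdot>\<^sub>v dsl)"
    using st unfolding slls_step_iff d by (elim exE conjE) (rule that)
  note cr = corrector[OF z[unfolded z0] \<beta> nd[unfolded z0]]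
  show thesis
    by (rule that[OF _ _ ps]) (use cr in \<open>simp_all add: z0 xs\<close>)
qed

lemma post_stepD:
  assumes svd: "svd_solver \<rho> svd" and z: "(x, s) \<in> N2 A b c (\<beta> / 8)"
    and ap: "affine_part A \<beta> x s dxa dsa \<alpha>a B N" and lp: "lls_part A svd x s B N V U dxl dsl"
  shows "V \<subseteq> W A" "U \<subseteq> Wperp A" "dxl \<in> W A" "dsl \<in> Wperp A" "B \<subseteq> {..<n}" "N = {..<n} - B"
proof -
  note zD = N2D[OF z]
  show B: "B \<subseteq> {..<n}" and N: "N = {..<n} - B" using ap A unfolding affine_part_def by auto
  have cl: "cheap_lift_spaces A svd x B N V U" using lp unfolding lls_part_def by blast
  note sub = cheap_lift_spaces_sub[OF svd zD(1,6) B N cl]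
  show V: "V \<subseteq> W A" and U: "U \<subseteq> Wperp A" using sub(1,2) by auto
  have "dxl \<in> V" "dsl \<in> U" using lp unfolding lls_part_def scaled_min_def is_arg_min_def by auto
  then show "dxl \<in> W A" "dsl \<in> Wperp A" using V U by auto
qed

text \<open>The affine candidate alone gives the reduction factor. A step of length 1 ends with
  duality measure 0 and meets every target, so the second alternative occurs only when the algorithm
  stops; iterates from which a further step starts are in the open part.\<close>

lemma post_step_progress:
  assumes svd: "svd_solver \<rho> svd" and z: "(x, s) \<in> N2 A b c (\<beta> / 8)" and \<beta>: "0 < \<beta>" "\<beta> \<le> 1 / 6"
    and ap: "affine_part A \<beta> x s dxa dsa \<alpha>a B N" and lp: "lls_part A svd x s B N V U dxl dsl" and len: "length_part \<beta> x s dxl dsl \<alpha>l \<epsilon>"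
    and z1: "z1 = better_of (x + \<alpha>a \<cdot>\<^sub>v dxa, s + \<alpha>a \<cdot>\<^sub>v dsa) (x + \<alpha>l \<cdot>\<^sub>v dxl, s + \<alpha>l \<cdot>\<^sub>v dsl)"
  shows "z1 \<in> N2 A b c \<beta> \<or> z1 \<in> pair_closure n (N2 A b c \<beta>) \<and> mubar z1 = 0"
    "mubar z1 \<le> (1 - \<beta> / (3 * sqrt n)) * mubar (x, s)"
proof -
  note zD = N2D[OF z]
  note pD = post_stepD[OF svd z ap lp]
  define \<mu> where "\<mu> = mubar (x, s)"
  have \<mu>: "0 < \<mu>" using zD(5) by (simp add: \<mu>_def)
  let ?za = "(x + \<alpha>a \<cdot>\<^sub>v dxa, s + \<alpha>a \<cdot>\<^sub>v dsa)" and ?zl = "(x + \<alpha>l \<cdot>\<^sub>v dxl, s + \<alpha>l \<cdot>\<^sub>v dsl)"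
  have nd: "newton_dir A x s (- (x \<star> s)) dxa dsa" and a0: "0 < \<alpha>a" "\<alpha>a \<le> 1"
    and al: "\<beta> / (3 * sqrt (real n)) \<le> \<alpha>a"
    and au: "\<alpha>a \<le> max (\<beta> / (2 * sqrt (real n))) (1 - 2 * (vnorm (dxa \<star> dsa) / (\<beta> * mubar (x, s))))"
    and \<epsilon>: "\<epsilon> = vnorm ((x + dxl) \<star> (s + dsl)) / mubar (x, s)"
    and l: "if max (vnorm (dxl \<star> dsl) / mubar (x, s)) \<epsilon> \<le> \<beta> / 9
      then 1 - 9 * \<epsilon> / \<beta> \<le> \<alpha>l \<and> \<alpha>l \<le> 1 - 8 * \<epsilon> / \<beta> else \<alpha>l = 0"
    using ap len A unfolding affine_part_def length_part_def by auto
  have z1: "z1 = (if mubar ?za < mubar ?zl then ?za else ?zl)" using z1 unfolding better_of_def .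
  note nD = newton_dirD[OF nd zD(1,2)]
  have dl: "dxl \<in> carrier_vec n" "dsl \<in> carrier_vec n" using W_carrier[OF pD(3)] Wperp_carrier[OF pD(4)] .
  have ma: "mubar ?za = (1 - \<alpha>a) * \<mu>" using affine_step(1)[OF z \<beta> nd] by (simp add: \<mu>_def)
  have "mubar z1 \<le> mubar ?za" unfolding z1 by simp
  also have "\<dots> \<le> (1 - \<beta> / (3 * sqrt n)) * \<mu>" unfolding ma using al \<mu> by (intro mult_right_mono) auto
  finally show "mubar z1 \<le> (1 - \<beta> / (3 * sqrt n)) * mubar (x, s)" by (simp add: \<mu>_def)
  show "z1 \<in> N2 A b c \<beta> \<or> z1 \<in> pair_closure n (N2 A b c \<beta>) \<and> mubar z1 = 0"
  proof (cases "mubar ?za < mubar ?zl")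
    case True
    then have e: "z1 = ?za" using z1 by simp
    show ?thesis
    proof (cases "\<alpha>a < 1")
      case True
      then show ?thesis unfolding e using affine_step(2)[OF z \<beta> nd _ True au] a0 by simp
    next
      case False
      then have a1: "\<alpha>a = 1" using a0 by simp
      have "(x + 1 \<cdot>\<^sub>v dxa, s + 1 \<cdot>\<^sub>v dsa) \<in> pair_closure n (N2 A b c \<beta>)"
      proof (rule pair_closure_path[OF zD(1,2) nD(3,4)])
        fix a :: real assume a: "0 \<le> a" "a < 1"
        show "(x + a \<cdot>\<^sub>v dxa, s + a \<cdot>\<^sub>v dsa) \<in> N2 A b c \<beta>"
          by (rule affine_step(2)[OF z \<beta> nd a]) (use a au a1 in linarith)
      qed
      then show ?thesis unfolding e using ma a1 by simp
    qed
  next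
    case False
    then have e: "z1 = ?zl" using z1 by simp
    \<comment> \<open>A rejected layered step has length 0, so its candidate keeps the old duality
      measure and loses to the affine one.\<close>
    have c1: "max (vnorm (dxl \<star> dsl) / mubar (x, s)) \<epsilon> \<le> \<beta> / 9"
    proof (rule ccontr)
      assume "\<not> ?thesis"
      then have "\<alpha>l = 0" using l by simp
      then have "mubar ?zl = \<mu>" using zD(1,2) dl by (auto simp: \<mu>_def mubar_eq)
      moreover have "mubar ?za < \<mu>" unfolding ma using \<mu> a0 by simp
      ultimately show False using False by simp
    qed
    have D: "vnorm (dxl \<star> dsl) / mubar (x, s) \<le> \<beta> / 9" by (rule order.trans[OF max.cobounded1 c1])
    have e9: "\<epsilon> \<le> \<beta> / 9" by (rule order.trans[OF max.cobounded2 c1])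
    have l1: "1 - 9 * \<epsilon> / \<beta> \<le> \<alpha>l" and l2: "\<alpha>l \<le> 1 - 8 * \<epsilon> / \<beta>" using l by (simp_all only: c1 if_True)
    have \<epsilon>0: "0 \<le> \<epsilon>" using \<mu> by (simp add: \<epsilon> \<mu>_def)
    have "9 * \<epsilon> / \<beta> \<le> 1" using e9 \<beta> by (simp add: field_simps)
    then have l0: "0 \<le> \<alpha>l" using l1 by simp
    have "0 \<le> 8 * \<epsilon> / \<beta>" using \<epsilon>0 \<beta> by simp
    then have l3: "\<alpha>l \<le> 1" using l2 by simp
    note ls = lls_step[OF z \<beta> pD(3,4) D \<epsilon>]
    show ?thesis
    proof (cases "\<alpha>l < 1")
      case True
      then show ?thesis unfolding e using ls(2)[OF l0 True l2] by simp
    next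
      case False
      then have a1: "\<alpha>l = 1" using l3 by simp
      then have "8 * \<epsilon> / \<beta> \<le> 0" using l2 by simp
      then have \<epsilon>z: "\<epsilon> = 0" using \<epsilon>0 \<beta> by (simp add: divide_le_0_iff)
      have "(x + 1 \<cdot>\<^sub>v dxl, s + 1 \<cdot>\<^sub>v dsl) \<in> pair_closure n (N2 A b c \<beta>)"
      proof (rule pair_closure_path[OF zD(1,2) dl])
        fix a :: real assume a: "0 \<le> a" "a < 1"
        show "(x + a \<cdot>\<^sub>v dxl, s + a \<cdot>\<^sub>v dsl) \<in> N2 A b c \<beta>"
          by (rule ls(2)[OF a]) (use a \<epsilon>z in simp)
      qed
      moreover have "mubar ?zl = 0" using ls(1)[of 1] unfolding a1 \<epsilon>z by simp
      ultimately show ?thesis unfolding e using a1 by simp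
    qed
  qed
qed

text \<open>The admissible intervals of step lengths are nonempty: the upper end serves for the
  affine step, the lower end for the layered step. The solver and the least squares problems supply
  the rest.\<close>

lemma post_step_exists:
  assumes svd: "svd_solver \<rho> svd" and z: "(x, s) \<in> N2 A b c (\<beta> / 8)" and \<beta>: "0 < \<beta>" "\<beta> \<le> 1 / 6"
  obtains dxa dsa \<alpha>a B N V U dxl dsl \<alpha>l \<epsilon> where "affine_part A \<beta> x s dxa dsa \<alpha>a B N"
    "lls_part A svd x s B N V U dxl dsl" "length_part \<beta> x s dxl dsl \<alpha>l \<epsilon>"
proof -
  note zD = N2D[OF z]
  have "- (x \<star> s) \<in> carrier_vec n" using zD(1) by (simp add: vtimes_def)
  then obtain dxa dsa where nd: "newton_dir A x s (- (x \<star> s)) dxa dsa"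
    using newton_dir_exists[OF zD(1,2,4)] by blast
  define B where "B = {i. i < n \<and> \<bar>dxa $ i / x $ i\<bar> < \<bar>dsa $ i / s $ i\<bar>}"
  define N where "N = {..<n} - B"
  have B: "B \<subseteq> {..<n}" and N: "N \<subseteq> {..<n}" by (auto simp: B_def N_def)
  obtain V U where cl: "cheap_lift_spaces A svd x B N V U"
    using cheap_lift_spaces_exist[OF svd zD(1,6) B N_def] by blast
  note sub = cheap_lift_spaces_sub[OF svd zD(1,6) B N_def cl]
  have d: "dim_col A = n" using A by simp
  obtain dxl where dxl: "scaled_min x (hat (mubar (x, s)) x s) N V dxl"
    using sub(3) least_squares_exists[OF _ zD(1) N] unfolding mat_range_def scaled_min_def by blast
  obtain dsl where dsl: "scaled_min s (hat (mubar (x, s)) s x) B U dsl"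
    using sub(4) least_squares_exists[OF _ zD(2) B] unfolding mat_range_def scaled_min_def by blast
  define \<epsilon> where "\<epsilon> = vnorm ((x + dxl) \<star> (s + dsl)) / mubar (x, s)"
  have \<epsilon>0: "0 \<le> \<epsilon>" using zD(5) by (simp add: \<epsilon>_def)
  define r where "r = vnorm (dxa \<star> dsa) / (\<beta> * mubar (x, s))"
  have r: "0 \<le> r" using \<beta> zD(5) by (simp add: r_def)
  define \<alpha>a where "\<alpha>a = max (\<beta> / (2 * sqrt (real n))) (1 - 2 * r)"
  have sn: "1 \<le> sqrt (real n)" using n0 by simp
  have q: "0 < \<beta> / (2 * sqrt (real n))" "\<beta> / (3 * sqrt (real n)) \<le> \<beta> / (2 * sqrt (real n))"
    using \<beta> sn by (auto intro!: divide_left_mono)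
  have "\<beta> / (2 * sqrt (real n)) \<le> \<beta> / 2" using \<beta> sn by (intro divide_left_mono) auto
  then have q1: "\<beta> / (2 * sqrt (real n)) \<le> 1" using \<beta> by simp
  have a: "0 < \<alpha>a" unfolding \<alpha>a_def less_max_iff_disj using q(1) by (rule disjI1)
  have a': "\<alpha>a \<le> 1" unfolding \<alpha>a_def by (rule max.boundedI[OF q1]) (use r in simp)
  have a'': "max (\<beta> / (3 * sqrt (real n))) (1 - 3 * r) \<le> \<alpha>a"
    unfolding \<alpha>a_def by (rule max.mono[OF q(2)]) (use r in simp)
  have a3: "\<alpha>a \<le> max (\<beta> / (2 * sqrt (real n))) (1 - 2 * r)" unfolding \<alpha>a_def by (rule order.refl)
  define \<alpha>l where "\<alpha>l = (if max (vnorm (dxl \<star> dsl) / mubar (x, s)) \<epsilon> \<le> \<beta> / 9 then 1 - 9 * \<epsilon> / \<beta> else 0)"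
  have "9 * \<epsilon> / \<beta> \<ge> 8 * \<epsilon> / \<beta>" using \<epsilon>0 \<beta> by (intro divide_right_mono) auto
  then have l: "if max (vnorm (dxl \<star> dsl) / mubar (x, s)) \<epsilon> \<le> \<beta> / 9
      then 1 - 9 * \<epsilon> / \<beta> \<le> \<alpha>l \<and> \<alpha>l \<le> 1 - 8 * \<epsilon> / \<beta> else \<alpha>l = 0" by (simp add: \<alpha>l_def)
  have "affine_part A \<beta> x s dxa dsa \<alpha>a B N"
    unfolding affine_part_def d B_def N_def r_def[symmetric] by (intro conjI refl nd a a' a'' a3)
  moreover have "lls_part A svd x s B N V U dxl dsl" unfolding lls_part_def using cl dxl dsl by blast
  moreover have "length_part \<beta> x s dxl dsl \<alpha>l \<epsilon>" unfolding length_part_def using l \<epsilon>_def by blast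
  ultimately show thesis by (rule that)
qed

lemma slls_step_exists:
  assumes svd: "svd_solver \<rho> svd" and z: "z0 \<in> N2 A b c \<beta>" and \<beta>: "0 < \<beta>" "\<beta> \<le> 1 / 6"
  shows "\<exists>z1. slls_step A \<beta> svd z0 z1"
proof -
  have d: "dim_col A = n" using A by simp
  obtain x0 s0 where z0: "z0 = (x0, s0)" by (cases z0)
  note zD = N2D[OF z[unfolded z0]]
  have "mubar z0 \<cdot>\<^sub>v ones n - x0 \<star> s0 \<in> carrier_vec n" 
    unfolding vtimes_def ones_def carrier_vecD[OF zD(1)] by (intro minus_carrier_vec) simp_all
  then obtain dx ds where nd: "newton_dir A x0 s0 (mubar z0 \<cdot>\<^sub>v ones n - x0 \<star> s0) dx ds"
    using newton_dir_exists[OF zD(1,2,4)] by blast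
  have "(x0 + dx, s0 + ds) \<in> N2 A b c (\<beta> / 8)"
    by (rule corrector(1)[OF z[unfolded z0] \<beta> nd[unfolded z0]])
  then obtain dxa dsa \<alpha>a B N V U dxl dsl \<alpha>l \<epsilon> where ps: "affine_part A \<beta> (x0 + dx) (s0 + ds) dxa dsa \<alpha>a B N"
    "lls_part A svd (x0 + dx) (s0 + ds) B N V U dxl dsl" "length_part \<beta> (x0 + dx) (s0 + ds) dxl dsl \<alpha>l \<epsilon>"
    by (rule post_step_exists[OF svd _ \<beta>])
  have "slls_step A \<beta> svd z0
     (better_of (x0 + dx + \<alpha>a \<cdot>\<^sub>v dxa, s0 + ds + \<alpha>a \<cdot>\<^sub>v dsa) (x0 + dx + \<alpha>l \<cdot>\<^sub>v dxl, s0 + ds + \<alpha>l \<cdot>\<^sub>v dsl))"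
    unfolding slls_step_iff d
    by (rule exI[of _ x0], rule exI[of _ s0], rule exI[of _ dx], rule exI[of _ ds], rule exI[of _ "x0 + dx"], rule exI[of _ "s0 + ds"], rule exI[of _ dxa], rule exI[of _ dsa], rule exI[of _ \<alpha>a], rule exI[of _ B], rule exI[of _ N], rule exI[of _ V], rule exI[of _ U], rule exI[of _ dxl], rule exI[of _ dsl], rule exI[of _ \<alpha>l], rule exI[of _ \<epsilon>], intro conjI refl z0 nd ps)
  then show ?thesis ..
qed

end

section \<open>Polarized segments of the curve\<close>

lemma L2_set_mono_abs:
  assumes "\<And>i. i \<in> S \<Longrightarrow> \<bar>f i\<bar> \<le> g i"
  shows "L2_set f S \<le> L2_set g S"
proof -
  have "L2_set f S = L2_set (\<lambda>i. \<bar>f i\<bar>) S" by (simp add: L2_set_def)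
  also have "\<dots> \<le> L2_set g S" by (rule L2_set_mono) (use assms in auto)
  finally show ?thesis .
qed

text \<open>The family of directions is kept. Changing the weights costs a factor \<open>p\<close>
  in the norms on \<open>B\<close> and a factor \<open>c\<close> in those on \<open>N\<close>,
  uniformly over all lifts, so only the threshold has to be adjusted.\<close>

lemma wcert_transfer:
  assumes c': "wcert n S d' N B \<tau>' k" and \<tau>': "0 \<le> \<tau>'" and p: "0 < p" and c: "0 < c"
    and dB: "\<And>i. i \<in> B \<Longrightarrow> 0 \<le> d' i \<and> d' i \<le> p * d i" and dN: "\<And>i. i \<in> N \<Longrightarrow> 0 \<le> d i \<and> c * d i \<le> d' i"
    and \<tau>: "\<tau> \<le> \<tau>' * c / p"
  shows "wcert n S d N B \<tau> k"
proof -
  obtain F where F: "F \<in> carrier_mat n k" "\<And>u. u \<in> carrier_vec k \<Longrightarrow> F *\<^sub>v u \<in> S"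
    and FF: "\<And>u z. u \<in> carrier_vec k \<Longrightarrow> u \<noteq> 0\<^sub>v k \<Longrightarrow> z \<in> S \<Longrightarrow> (\<forall>i\<in>N. z $ i = (F *\<^sub>v u) $ i) \<Longrightarrow>
       \<tau>' * L2_set (\<lambda>i. d' i * z $ i) N < L2_set (\<lambda>i. d' i * z $ i) B"
    using c' unfolding wcert_def by blast
  show ?thesis
  proof (rule wcertI[OF F])
    fix u z assume u: "u \<in> carrier_vec k" "u \<noteq> 0\<^sub>v k" and z: "z \<in> S" and eq: "\<And>i. i \<in> N \<Longrightarrow> z $ i = (F *\<^sub>v u) $ i"
    have lt: "\<tau>' * L2_set (\<lambda>i. d' i * z $ i) N < L2_set (\<lambda>i. d' i * z $ i) B"
      by (rule FF[OF u z]) (use eq in blast)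
    have "c * L2_set (\<lambda>i. d i * z $ i) N = L2_set (\<lambda>i. c * (d i * z $ i)) N"
      unfolding L2_set_const_mult using c by simp
    also have "\<dots> \<le> L2_set (\<lambda>i. \<bar>d' i * z $ i\<bar>) N"
    proof (rule L2_set_mono_abs)
      fix i assume i: "i \<in> N"
      have "\<bar>c * (d i * z $ i)\<bar> = (c * d i) * \<bar>z $ i\<bar>" using c dN[OF i] by (simp add: abs_mult)
      also have "\<dots> \<le> d' i * \<bar>z $ i\<bar>" using dN[OF i] by (intro mult_right_mono) auto
      also have "\<dots> \<le> \<bar>d' i * z $ i\<bar>" by (simp add: abs_mult mult_right_mono)
      finally show "\<bar>c * (d i * z $ i)\<bar> \<le> \<bar>d' i * z $ i\<bar>" .
    qed
    also have "\<dots> = L2_set (\<lambda>i. d' i * z $ i) N" by (simp add: L2_set_def)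
    finally have 1: "c * L2_set (\<lambda>i. d i * z $ i) N \<le> L2_set (\<lambda>i. d' i * z $ i) N" .
    have "L2_set (\<lambda>i. d' i * z $ i) B \<le> L2_set (\<lambda>i. \<bar>p * (d i * z $ i)\<bar>) B"
    proof (rule L2_set_mono_abs)
      fix i assume i: "i \<in> B"
      have "\<bar>d' i * z $ i\<bar> = d' i * \<bar>z $ i\<bar>" using dB[OF i] by (simp add: abs_mult)
      also have "\<dots> \<le> p * d i * \<bar>z $ i\<bar>" using dB[OF i] by (intro mult_right_mono) auto
      also have "\<dots> \<le> \<bar>p * d i\<bar> * \<bar>z $ i\<bar>" by (intro mult_right_mono) auto
      finally show "\<bar>d' i * z $ i\<bar> \<le> \<bar>p * (d i * z $ i)\<bar>" by (simp add: abs_mult)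
    qed
    also have "\<dots> = L2_set (\<lambda>i. p * (d i * z $ i)) B" by (simp add: L2_set_def)
    also have "\<dots> = p * L2_set (\<lambda>i. d i * z $ i) B" unfolding L2_set_const_mult using p by simp
    finally have 2: "L2_set (\<lambda>i. d' i * z $ i) B \<le> p * L2_set (\<lambda>i. d i * z $ i) B" .
    have "\<tau> * L2_set (\<lambda>i. d i * z $ i) N \<le> \<tau>' * c / p * L2_set (\<lambda>i. d i * z $ i) N"
      by (rule mult_right_mono[OF \<tau>]) simp
    also have "\<dots> = \<tau>' * (c * L2_set (\<lambda>i. d i * z $ i) N) / p" by simp
    also have "\<dots> \<le> \<tau>' * L2_set (\<lambda>i. d' i * z $ i) N / p"
      using p by (intro divide_right_mono mult_left_mono[OF 1 \<tau>']) simp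
    also have "\<dots> < L2_set (\<lambda>i. d' i * z $ i) B / p" using lt p by (intro divide_strict_right_mono)
    also have "\<dots> \<le> L2_set (\<lambda>i. d i * z $ i) B" using 2 p by (simp add: pos_divide_le_eq mult.commute)
    finally show "\<tau> * L2_set (\<lambda>i. d i * z $ i) N < L2_set (\<lambda>i. d i * z $ i) B" .
  qed
qed

text \<open>If \<open>x\<close> shrank by more than the factor \<open>t / (4 * n)\<close> from \<open>b\<close> to \<open>a\<close>, then so did \<open>s\<close>, and the
  product of the two affine functions would be too small shortly after \<open>a\<close>.\<close>

lemma polarize_coordinate:
  fixes x s :: "real \<Rightarrow> real" and n t a b :: real
  assumes n: "1 \<le> n" and t: "0 < t" "t \<le> 1" and ab: "0 \<le> a" "a < b"
    and xl: "\<And>l. 0 \<le> l \<Longrightarrow> l \<le> 1 \<Longrightarrow> x ((1 - l) * a + l * b) = (1 - l) * x a + l * x b"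
    and sl: "\<And>l. 0 \<le> l \<Longrightarrow> l \<le> 1 \<Longrightarrow> s ((1 - l) * a + l * b) = (1 - l) * s a + l * s b"
    and nonneg: "\<And>\<mu>. a \<le> \<mu> \<Longrightarrow> \<mu> \<le> b \<Longrightarrow> 0 \<le> x \<mu> \<and> 0 \<le> s \<mu> \<and> t * \<mu> \<le> x \<mu> * s \<mu>"
    and up: "x b * s b \<le> n * b"
    and dom: "s a * x b \<le> x a * s b" and \<mu>: "a \<le> \<mu>" "\<mu> \<le> b"
  shows "t / (4 * n) * x b \<le> x \<mu>"
proof -
  define k where "k = t / n"
  have k: "0 < k" "k \<le> 1" using n t by (auto simp: k_def divide_le_eq)
  have b0: "0 < b" using ab by simp
  have xsb: "0 < x b * s b"
    using nonneg[of b] ab t b0 by (smt (verit) mult_pos_pos)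
  then have xb: "0 < x b" and sb: "0 < s b" using nonneg[of b] ab by (auto simp: zero_less_mult_iff)
  define p q where "p = x a / x b" and "q = s a / s b"
  have p0: "0 \<le> p" "0 \<le> q" using nonneg[of a] ab xb sb by (auto simp: p_def q_def)
  have qp: "q \<le> p" using dom xb sb by (simp add: p_def q_def field_simps)
  have xa: "x a = p * x b" and sa: "s a = q * s b" using xb sb by (auto simp: p_def q_def)
  have p4: "k / 4 \<le> p"
  proof (rule ccontr)
    assume "\<not> k / 4 \<le> p"
    then have pk: "p < k / 4" by simp
    \<comment> \<open>At this fraction of the way both factors are at most
      \<open>p + l < 2 * l\<close> times their values at \<open>b\<close>. The product is then less
      than \<open>4 * l * l * n * b\<close>, which equals \<open>t * (l * b)\<close>, while it has
      to be at least that.\<close>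
    define l where "l = k / 4"
    have l: "0 \<le> l" "l \<le> 1" using k by (auto simp: l_def)
    let ?m = "(1 - l) * a + l * b"
    have m: "a \<le> ?m" "?m \<le> b"
    proof -
      have "(1 - l) * a + l * a \<le> ?m" using l ab by (intro add_left_mono mult_left_mono) auto
      then show "a \<le> ?m" by (simp add: algebra_simps)
      have "?m \<le> (1 - l) * b + l * b" using l ab by (intro add_right_mono mult_left_mono) auto
      then show "?m \<le> b" by (simp add: algebra_simps)
    qed
    have "t * (l * b) \<le> t * ?m" using t l ab by (intro mult_left_mono) auto
    also have "\<dots> \<le> x ?m * s ?m" using nonneg[OF m] by simp
    also have "\<dots> = ((1 - l) * p + l) * ((1 - l) * q + l) * (x b * s b)"
      unfolding xl[OF l] sl[OF l] xa sa by (simp add: algebra_simps)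
    also have "\<dots> \<le> (p + l) * (p + l) * (x b * s b)"
    proof (intro mult_right_mono mult_mono)
      have "(1 - l) * p \<le> 1 * p" "(1 - l) * q \<le> 1 * q" using l p0 by (intro mult_right_mono; simp)+
      then show "(1 - l) * p + l \<le> p + l" "(1 - l) * q + l \<le> p + l" using qp by auto
    qed (use l p0 xsb in auto)
    also have "\<dots> \<le> (p + l) * (p + l) * (n * b)" using up p0 l by (intro mult_left_mono) auto
    finally have "(n * b) * (k * l) \<le> (n * b) * ((p + l) * (p + l))"
      using n by (simp add: k_def field_simps)
    then have "k * l \<le> (p + l) * (p + l)" using n b0 by (simp add: mult_le_cancel_left)
    moreover have "(p + l) * (p + l) < (2 * l) * (2 * l)"
      using pk p0 k by (intro mult_strict_mono) (auto simp: l_def)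
    moreover have "(2 * l) * (2 * l) = k * l" by (simp add: l_def)
    ultimately show False by simp
  qed
  define l where "l = (\<mu> - a) / (b - a)"
  have l: "0 \<le> l" "l \<le> 1" using \<mu> ab by (auto simp: l_def)
  have "l * (b - a) = \<mu> - a" using ab by (simp add: l_def)
  then have \<mu>l: "\<mu> = (1 - l) * a + l * b" by (simp add: algebra_simps)
  have "t / (4 * n) * x b = ((1 - l) + l) * (k / 4 * x b)" by (simp add: k_def)
  also have "\<dots> = (1 - l) * (k / 4 * x b) + l * (k / 4 * x b)" by (rule distrib_right)
  also have "\<dots> \<le> (1 - l) * (p * x b) + l * (1 * x b)"
    using l xb p4 k by (intro add_mono mult_left_mono mult_right_mono) auto
  also have "\<dots> = x \<mu>" unfolding \<mu>l xl[OF l] xa by simp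
  finally show ?thesis .
qed

section \<open>Scalar estimates between iterates and the curve\<close>

lemma iterate_near_curve:
  fixes n X \<mu> \<nu> s x :: real
  assumes "0 < \<mu>" "0 < x" "0 \<le> X" and 1: "X * s \<le> n * (\<mu> + \<nu>)" "\<nu> \<le> \<mu>" "1 \<le> n" and 2: "5 / 6 * \<mu> \<le> x * s"
  shows "X \<le> 12 / 5 * n * x"
proof -
  have "n * (\<mu> + \<nu>) \<le> n * (\<mu> + \<mu>)" using 1 by (intro mult_left_mono) auto
  also have "\<dots> = 2 * n * \<mu>" by simp
  finally have Xs: "X * s \<le> 2 * n * \<mu>" using 1(1) by simp
  have "X * (5 / 6 * \<mu>) \<le> X * (x * s)" using assms by (intro mult_left_mono) auto
  also have "\<dots> = x * (X * s)" by simp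
  also have "\<dots> \<le> x * (2 * n * \<mu>)" using Xs assms by (intro mult_left_mono) auto
  \<comment> \<open>\<open>12 / 5\<close> is the 2 from \<open>\<nu> \<le> \<mu>\<close> divided by
    the \<open>5 / 6\<close> from centrality of the iterate.\<close>
  finally have "\<mu> * X \<le> \<mu> * (12 / 5 * n * x)" by (simp add: algebra_simps)
  then show ?thesis using assms(1) by (simp add: mult_le_cancel_left)
qed

lemma iterate_below_start:
  fixes n t b x Sb Xb \<mu> :: real
  assumes "0 < b" "0 \<le> Xb" "1 \<le> n" and 1: "x * Sb \<le> n * (\<mu> + b)" "\<mu> \<le> b" "0 \<le> x" and 2: "t * b \<le> Xb * Sb"
  shows "t * x \<le> 2 * n * Xb"
proof -
  have "n * (\<mu> + b) \<le> n * (b + b)" using assms by (intro mult_left_mono) auto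
  then have xS: "x * Sb \<le> 2 * n * b" using 1 by (simp add: algebra_simps)
  have "x * (t * b) \<le> x * (Xb * Sb)" using assms by (intro mult_left_mono) auto
  also have "\<dots> = Xb * (x * Sb)" by simp
  also have "\<dots> \<le> Xb * (2 * n * b)" using xS assms by (intro mult_left_mono) auto
  finally have "b * (t * x) \<le> b * (2 * n * Xb)" by (simp add: algebra_simps)
  then show ?thesis using assms(1) by (simp add: mult_le_cancel_left)
qed

text \<open>Two iterates are compared by a detour over the curve: from \<open>x\<close> to the upper
  end \<open>Xb\<close>, down the curve to \<open>Xm\<close> by polarization, and from there to
  \<open>x'\<close>. The three losses multiply to \<open>96 / 5 * n ^ 3 / t\<^sup>2\<close>.\<close>

lemma polarized_ratio:
  fixes n t x Xb Xm x' :: real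
  assumes t: "0 < t" and n: "1 \<le> n" and 1: "t * x \<le> 2 * n * Xb" and 2: "t / (4 * n) * Xb \<le> Xm"
    and 3: "Xm \<le> 12 / 5 * n * x'" and "0 \<le> x'"
  shows "x \<le> 20 * n ^ 3 / t\<^sup>2 * x'"
proof -
  have "t * Xb \<le> 4 * n * Xm" using 2 n by (simp add: field_simps)
  also have "\<dots> \<le> 4 * n * (12 / 5 * n * x')" using 3 n by (intro mult_left_mono) auto
  finally have tX: "t * Xb \<le> 48 / 5 * n\<^sup>2 * x'" by (simp add: power2_eq_square)
  have "t * (t * x) \<le> t * (2 * n * Xb)" using 1 t by (intro mult_left_mono) auto
  also have "\<dots> = 2 * n * (t * Xb)" by simp
  also have "\<dots> \<le> 2 * n * (48 / 5 * n\<^sup>2 * x')" using tX n by (intro mult_left_mono) auto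
  also have "\<dots> = 96 / 5 * (n ^ 3 * x')" by (simp add: power2_eq_square power3_eq_cube)
  also have "\<dots> \<le> 20 * (n ^ 3 * x')" using n assms(6) by (intro mult_right_mono) auto
  finally have "t\<^sup>2 * x \<le> 20 * n ^ 3 * x'" by (simp add: power2_eq_square)
  then show ?thesis using t by (simp add: field_simps)
qed

text \<open>Polarization keeps the partner coordinate \<open>Sa\<close> comparable with
  \<open>s\<close>, so the upper bound on the product \<open>Xa * Sa\<close> forces
  \<open>Xa\<close> to be small in proportion to \<open>a / \<mu>\<close>.\<close>

lemma small_endpoint:
  fixes n t x s Xa Sa Sb a \<mu> :: real
  assumes t: "0 < t" and n: "1 \<le> n" and pos: "0 < x" "0 \<le> s" "0 \<le> Xa" "0 < \<mu>"
    and 1: "Xa * Sa \<le> n * a" and 2: "t / (4 * n) * Sb \<le> Sa" and 3: "t * s \<le> 2 * n * Sb" and 4: "5 / 6 * \<mu> \<le> x * s"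
    and a: "0 \<le> a"
  shows "Xa * \<mu> \<le> 20 * n ^ 3 / t\<^sup>2 * a * x"
proof -
  have "t * Sb \<le> 4 * n * Sa" using 2 n by (simp add: field_simps)
  then have "Xa * (t * Sb) \<le> Xa * (4 * n * Sa)" using pos by (intro mult_left_mono) auto
  also have "\<dots> = 4 * n * (Xa * Sa)" by simp
  also have "\<dots> \<le> 4 * n * (n * a)" using 1 n by (intro mult_left_mono) auto
  finally have A: "Xa * (t * Sb) \<le> 4 * n\<^sup>2 * a" by (simp add: power2_eq_square)
  have "Xa * (t * (t * s)) \<le> Xa * (t * (2 * n * Sb))" using 3 t pos by (intro mult_left_mono) auto
  also have "\<dots> = 2 * n * (Xa * (t * Sb))" by simp
  also have "\<dots> \<le> 2 * n * (4 * n\<^sup>2 * a)" using A n by (intro mult_left_mono) auto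
  finally have B: "Xa * (t * (t * s)) \<le> 8 * n ^ 3 * a" by (simp add: power2_eq_square power3_eq_cube)
  have "Xa * (t\<^sup>2 * (5 / 6 * \<mu>)) \<le> Xa * (t\<^sup>2 * (x * s))" using 4 pos by (intro mult_left_mono) auto
  also have "\<dots> = x * (Xa * (t * (t * s)))" by (simp add: power2_eq_square)
  also have "\<dots> \<le> x * (8 * n ^ 3 * a)" using B pos by (intro mult_left_mono) auto
  finally have "t\<^sup>2 * (Xa * \<mu>) \<le> 48 / 5 * (n ^ 3 * a * x)" by (simp add: algebra_simps)
  also have "\<dots> \<le> 20 * (n ^ 3 * a * x)" using n a pos by (intro mult_right_mono) auto
  finally show ?thesis using t by (simp add: field_simps)
qed

section \<open>Orthogonality of feasible pairs and limits of points on the curve\<close>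

context lp
begin

text \<open>Closed conditions that hold throughout the closure of the wide neighborhood, with
  \<open>t = 1 - \<theta>\<close>. Unlike the closure, they can be used coordinatewise.\<close>

definition cpt :: "real \<Rightarrow> real \<Rightarrow> real vec \<Rightarrow> real vec \<Rightarrow> bool" where
  "cpt t \<mu> x s \<longleftrightarrow> feas x s \<and> (\<forall>i<n. 0 \<le> x $ i \<and> 0 \<le> s $ i \<and> t * \<mu> \<le> x $ i * s $ i) \<and>
     (\<Sum>i<n. x $ i * s $ i) = real n * \<mu>"

text \<open>The primal and dual differences of two feasible pairs are orthogonal. Expanding shows
  that the cross products sum to \<open>n * (\<mu> + \<mu>')\<close>, and each is
  nonnegative.\<close>

lemma cross_bound:
  assumes f: "feas x s" "feas x' s'" and nn: "\<And>i. i < n \<Longrightarrow> 0 \<le> x $ i \<and> 0 \<le> s $ i" "\<And>i. i < n \<Longrightarrow> 0 \<le> x' $ i \<and> 0 \<le> s' $ i"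
    and \<mu>: "(\<Sum>i<n. x $ i * s $ i) = real n * \<mu>" "(\<Sum>i<n. x' $ i * s' $ i) = real n * \<mu>'" and i: "i < n"
  shows "x' $ i * s $ i \<le> real n * (\<mu> + \<mu>')" "x $ i * s' $ i \<le> real n * (\<mu> + \<mu>')"
proof -
  note d = feas_diff[OF f]
  have c: "x \<in> carrier_vec n" "s \<in> carrier_vec n" "x' \<in> carrier_vec n" "s' \<in> carrier_vec n" using f by (auto simp: feas_def)
  have "0 = (\<Sum>j<n. (x - x') $ j * (s - s') $ j)" using W_Wperp[OF d] by simp
  also have "\<dots> = (\<Sum>j<n. x $ j * s $ j + x' $ j * s' $ j - (x' $ j * s $ j + x $ j * s' $ j))"
    using c by (intro sum.cong) (auto simp: algebra_simps)
  also have "\<dots> = real n * \<mu> + real n * \<mu>' - (\<Sum>j<n. x' $ j * s $ j + x $ j * s' $ j)"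
    by (simp only: sum_subtractf sum.distrib \<mu>)
  finally have e: "(\<Sum>j<n. x' $ j * s $ j + x $ j * s' $ j) = real n * (\<mu> + \<mu>')" by (simp add: algebra_simps)
  have "x' $ i * s $ i + x $ i * s' $ i \<le> (\<Sum>j<n. x' $ j * s $ j + x $ j * s' $ j)"
    by (rule member_le_sum) (use i nn in auto)
  then have le: "x' $ i * s $ i + x $ i * s' $ i \<le> real n * (\<mu> + \<mu>')" unfolding e .
  have "0 \<le> x' $ i * s $ i" "0 \<le> x $ i * s' $ i" using nn[OF i] by auto
  then show "x' $ i * s $ i \<le> real n * (\<mu> + \<mu>')" "x $ i * s' $ i \<le> real n * (\<mu> + \<mu>')" using le by auto
qed

text \<open>Serves both for points of the closure and for the ends of a linear segment, at which the
  curve itself may not be given.\<close>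

lemma cpt_limit:
  assumes cp: "\<And>k. cpt t (\<mu> k) (X k) (Y k)" and xs: "x \<in> carrier_vec n" "s \<in> carrier_vec n"
    and X: "\<And>i. i < n \<Longrightarrow> (\<lambda>k. X k $ i) \<longlonglongrightarrow> x $ i" and Y: "\<And>i. i < n \<Longrightarrow> (\<lambda>k. Y k $ i) \<longlonglongrightarrow> s $ i"
    and \<mu>: "\<mu> \<longlonglongrightarrow> \<nu>"
  shows "cpt t \<nu> x s"
proof -
  have f: "feas (X k) (Y k)" and nn: "\<And>i. i < n \<Longrightarrow> 0 \<le> X k $ i" "\<And>i. i < n \<Longrightarrow> 0 \<le> Y k $ i"
    and t: "\<And>i. i < n \<Longrightarrow> t * \<mu> k \<le> X k $ i * Y k $ i" and sm: "(\<Sum>i<n. X k $ i * Y k $ i) = real n * \<mu> k" for k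
    using cp[of k] unfolding cpt_def by auto
  have Xc: "X k \<in> carrier_vec n" and Yc: "Y k \<in> carrier_vec n" and AX: "A *\<^sub>v X k = b" and cY: "c - Y k \<in> Wperp A" for k
    using f[of k] unfolding feas_def by auto
  have "A *\<^sub>v x = b"
  proof (rule eq_vecI)
    fix j assume "j < dim_vec b"
    then have j: "j < m" using b by simp
    have "(\<lambda>k. \<Sum>i<n. A $$ (j, i) * X k $ i) \<longlonglongrightarrow> (\<Sum>i<n. A $$ (j, i) * x $ i)"
      by (intro tendsto_sum tendsto_mult tendsto_const X) simp
    moreover have e: "(A *\<^sub>v v) $ j = (\<Sum>i<n. A $$ (j, i) * v $ i)" if "v \<in> carrier_vec n" for v
      using A j that by (simp add: scalar_prod_def atLeast0LessThan)
    have "(\<lambda>k. \<Sum>i<n. A $$ (j, i) * X k $ i) = (\<lambda>k. b $ j)"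
      using e[OF Xc] AX by (intro ext) metis
    ultimately have "(\<lambda>k::nat. b $ j) \<longlonglongrightarrow> (\<Sum>i<n. A $$ (j, i) * x $ i)" by simp
    then show "(A *\<^sub>v x) $ j = b $ j" unfolding e[OF xs(1)] by (metis LIMSEQ_const_iff)
  qed (use A b in simp)
  moreover have "c - s \<in> Wperp A"
  proof (rule WperpI)
    show "c - s \<in> carrier_vec n" using c xs(2) by simp
    fix w assume w: "w \<in> W A"
    have "(\<lambda>k. \<Sum>i<n. w $ i * (c $ i - Y k $ i)) \<longlonglongrightarrow> (\<Sum>i<n. w $ i * (c $ i - s $ i))"
      by (intro tendsto_sum tendsto_mult tendsto_diff tendsto_const Y) simp
    moreover have "(\<Sum>i<n. w $ i * (c $ i - Y k $ i)) = 0" for k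
    proof -
      have "(\<Sum>i<n. w $ i * (c $ i - Y k $ i)) = (\<Sum>i<n. w $ i * (c - Y k) $ i)"
        using carrier_vecD[OF Yc[of k]] by (intro sum.cong) auto
      then show ?thesis using W_Wperp[OF w cY[of k]] by simp
    qed
    ultimately have "(\<Sum>i<n. w $ i * (c $ i - s $ i)) = 0" by (simp add: LIMSEQ_const_iff)
    moreover have "(\<Sum>i<n. w $ i * (c - s) $ i) = (\<Sum>i<n. w $ i * (c $ i - s $ i))"
      using carrier_vecD[OF xs(2)] by (intro sum.cong) auto
    ultimately show "(\<Sum>i<n. w $ i * (c - s) $ i) = 0" by simp
  qed
  moreover have "0 \<le> x $ i \<and> 0 \<le> s $ i \<and> t * \<nu> \<le> x $ i * s $ i" if i: "i < n" for i
  proof (intro conjI)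
    show "0 \<le> x $ i" by (rule LIMSEQ_le_const[OF X[OF i]]) (use nn i in auto)
    show "0 \<le> s $ i" by (rule LIMSEQ_le_const[OF Y[OF i]]) (use nn i in auto)
    show "t * \<nu> \<le> x $ i * s $ i"
      by (rule LIMSEQ_le[OF tendsto_mult[OF tendsto_const \<mu>] tendsto_mult[OF X[OF i] Y[OF i]]]) (use t i in auto)
  qed
  moreover have "(\<Sum>i<n. x $ i * s $ i) = real n * \<nu>"
  proof -
    have "(\<lambda>k. \<Sum>i<n. X k $ i * Y k $ i) \<longlonglongrightarrow> (\<Sum>i<n. x $ i * s $ i)"
      by (intro tendsto_sum tendsto_mult X Y) simp_all
    moreover have "(\<lambda>k. \<Sum>i<n. X k $ i * Y k $ i) \<longlonglongrightarrow> real n * \<nu>"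
      unfolding sm by (intro tendsto_mult tendsto_const \<mu>)
    ultimately show ?thesis by (rule LIMSEQ_unique)
  qed
  ultimately show ?thesis unfolding cpt_def feas_def using xs by blast
qed

lemma Ninf_cpt:
  assumes "(x, s) \<in> Ninf A b c \<theta>"
  shows "cpt (1 - \<theta>) (mubar (x, s)) x s"
proof -
  have d: "dim_col A = n" using A by simp
  have pf: "feas x s \<and> pos x s" and le: "((1 - \<theta>) * mubar (x, s)) \<cdot>\<^sub>v ones n \<le> x \<star> s"
    using assms pos_iff[of x s] unfolding Ninf_def d by auto
  then have c: "x \<in> carrier_vec n" "s \<in> carrier_vec n" by (auto simp: feas_def)
  have "(1 - \<theta>) * mubar (x, s) \<le> x $ i * s $ i" if "i < n" for i
    using le that c unfolding less_eq_vec_def by (simp add: vtimes_def ones_def)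
  moreover have "(\<Sum>i<n. x $ i * s $ i) = real n * mubar (x, s)" using mubar_eq[OF c] n0 by simp
  ultimately show ?thesis using pf unfolding cpt_def pos_def by (simp add: less_imp_le)
qed

lemma closure_cpt:
  assumes z: "z \<in> pair_closure n (Ninf A b c \<theta>)"
  shows "cpt (1 - \<theta>) (mubar z) (fst z) (snd z)"
proof -
  obtain x s where zx: "z = (x, s)" by (cases z)
  have c: "x \<in> carrier_vec n" "s \<in> carrier_vec n"
    and ex: "\<And>e. 0 < e \<Longrightarrow> \<exists>(x', s')\<in>Ninf A b c \<theta>. vnorm (x' - x) < e \<and> vnorm (s' - s) < e"
    using z unfolding zx pair_closure_def by auto
  have "\<exists>x' s'. (x', s') \<in> Ninf A b c \<theta> \<and> vnorm (x' - x) < 1 / real (Suc k) \<and> vnorm (s' - s) < 1 / real (Suc k)" for k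
    using ex[of "1 / real (Suc k)"] by auto
  then obtain X Y where XY: "\<And>k. (X k, Y k) \<in> Ninf A b c \<theta>" "\<And>k. vnorm (X k - x) < 1 / real (Suc k)"
    "\<And>k. vnorm (Y k - s) < 1 / real (Suc k)" by metis
  have cp: "cpt (1 - \<theta>) (mubar (X k, Y k)) (X k) (Y k)" for k by (rule Ninf_cpt[OF XY(1)])
  then have XYc: "X k \<in> carrier_vec n" "Y k \<in> carrier_vec n" for k by (auto simp: cpt_def feas_def)
  have lim: "(\<lambda>k. V k $ i) \<longlonglongrightarrow> v $ i"
    if V: "\<And>k. V k \<in> carrier_vec n" "v \<in> carrier_vec n" "\<And>k. vnorm (V k - v) < 1 / real (Suc k)" and i: "i < n" for V v i
  proof (rule LIMSEQ_I)
    fix e :: real assume "0 < e"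
    then obtain k0 where k0: "1 / real (Suc k0) < e" using nat_approx_posE by blast
    have "norm (V k $ i - v $ i) < e" if "k0 \<le> k" for k
    proof -
      have "\<bar>(V k - v) $ i\<bar> \<le> vnorm (V k - v)"
        unfolding vnorm_def using V i carrier_vecD[OF V(2)] by (intro L2_set_abs_le) auto
      moreover have "(V k - v) $ i = V k $ i - v $ i" using V i carrier_vecD[OF V(2)] by simp
      moreover have "1 / real (Suc k) \<le> 1 / real (Suc k0)" using that by (intro divide_left_mono) auto
      ultimately show ?thesis using V(3)[of k] k0 by simp
    qed
    then show "\<exists>no. \<forall>k\<ge>no. norm (V k $ i - v $ i) < e" by blast
  qed
  note lX = lim[OF XYc(1) c(1) XY(2)] and lY = lim[OF XYc(2) c(2) XY(3)]
  have "(\<lambda>k. (\<Sum>i<n. X k $ i * Y k $ i) / real n) \<longlonglongrightarrow> (\<Sum>i<n. x $ i * s $ i) / real n"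
    by (intro tendsto_divide tendsto_sum tendsto_mult tendsto_const lX lY) (use n0 in auto)
  then have "(\<lambda>k. mubar (X k, Y k)) \<longlonglongrightarrow> mubar (x, s)" unfolding mubar_eq[OF XYc] mubar_eq[OF c] .
  from cpt_limit[OF cp c lX lY this] show ?thesis unfolding zx by simp
qed

end

section \<open>Directions that nearly vanish on a partition\<close>

lemma L2_set_split_le:
  fixes n :: nat
  assumes "B \<subseteq> {..<n}" "N = {..<n} - B"
  shows "L2_set f {..<n} \<le> L2_set f B + L2_set f N"
proof -
  have "(\<Sum>i<n. (f i)\<^sup>2) = (\<Sum>i\<in>N. (f i)\<^sup>2) + (\<Sum>i\<in>B. (f i)\<^sup>2)"
    unfolding assms(2) using assms(1) by (intro sum.subset_diff) auto
  then have "L2_set f {..<n} = sqrt ((\<Sum>i\<in>B. (f i)\<^sup>2) + (\<Sum>i\<in>N. (f i)\<^sup>2))" by (simp add: L2_set_def)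
  also have "\<dots> \<le> sqrt (\<Sum>i\<in>B. (f i)\<^sup>2) + sqrt (\<Sum>i\<in>N. (f i)\<^sup>2)"
    by (intro sqrt_add_le_add_sqrt sum_nonneg) auto
  finally show ?thesis by (simp add: L2_set_def)
qed

lemma L2_set_mult_le:
  assumes "0 \<le> K" "\<And>i. i \<in> S \<Longrightarrow> \<bar>g i\<bar> \<le> K"
  shows "L2_set (\<lambda>i. f i * g i) S \<le> K * L2_set f S"
proof -
  have "L2_set (\<lambda>i. f i * g i) S \<le> L2_set (\<lambda>i. K * \<bar>f i\<bar>) S"
    by (rule L2_set_mono_abs) (use assms in \<open>auto simp: abs_mult mult.commute[of K] intro!: mult_left_mono\<close>)
  also have "\<dots> = K * L2_set f S" unfolding L2_set_const_mult using assms(1) by (simp add: L2_set_def)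
  finally show ?thesis .
qed

lemma L2_set_bounded_le:
  assumes "0 \<le> K" "\<And>i. i \<in> S \<Longrightarrow> \<bar>g i\<bar> \<le> K" "S \<subseteq> {..<n}"
  shows "L2_set g S \<le> real n * K"
proof -
  have "L2_set g S \<le> (\<Sum>i\<in>S. \<bar>g i\<bar>)" by (rule L2_set_le_sum_abs)
  also have "\<dots> \<le> (\<Sum>i\<in>S. K)" using assms(2) by (rule sum_mono)
  also have "\<dots> = real (card S) * K" by simp
  also have "\<dots> \<le> real n * K" using card_mono[of "{..<n}" S] assms by (intro mult_right_mono) auto
  finally show ?thesis .
qed

text \<open>On each block one of the two factors has small norm and the other is bounded by 2 in
  every coordinate; the two blocks together give the factor 4.\<close>

lemma split_products:
  fixes u v \<sigma> :: "nat \<Rightarrow> real"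
  assumes BN: "B \<subseteq> {..<n}" "N = {..<n} - B" and \<sigma>: "\<And>i. i < n \<Longrightarrow> 0 \<le> \<sigma> i \<and> \<sigma> i \<le> 7 / 6"
    and u: "L2_set (\<lambda>i. 1 + u i) N \<le> e" "L2_set u B \<le> e'" and v: "L2_set (\<lambda>i. \<sigma> i + v i) B \<le> e" "L2_set v N \<le> e'"
    and e: "e \<le> 1 / 2" "e' \<le> 1 / 2"
  shows "L2_set (\<lambda>i. (1 + u i) * (\<sigma> i + v i)) {..<n} \<le> 4 * e" "L2_set (\<lambda>i. u i * v i) {..<n} \<le> 4 * e'"
proof -
  have f: "finite B" "finite N" using BN finite_subset by auto
  have uN: "\<bar>1 + u i\<bar> \<le> 1 / 2" and vN: "\<bar>v i\<bar> \<le> 1 / 2" if "i \<in> N" for i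
    using L2_set_abs_le[OF f(2) that, of "\<lambda>i. 1 + u i"] L2_set_abs_le[OF f(2) that, of v] u v e by linarith+
  have uB: "\<bar>u i\<bar> \<le> 1 / 2" and vB: "\<bar>\<sigma> i + v i\<bar> \<le> 1 / 2" if "i \<in> B" for i
    using L2_set_abs_le[OF f(1) that, of "\<lambda>i. \<sigma> i + v i"] L2_set_abs_le[OF f(1) that, of u] u v e by linarith+
  have \<sigma>N: "0 \<le> \<sigma> i" "\<sigma> i \<le> 7 / 6" if "i \<in> N" for i using \<sigma> that BN by auto
  have \<sigma>B: "0 \<le> \<sigma> i" "\<sigma> i \<le> 7 / 6" if "i \<in> B" for i using \<sigma> that BN by auto
  have 1: "L2_set (\<lambda>i. (1 + u i) * (\<sigma> i + v i)) N \<le> 2 * L2_set (\<lambda>i. 1 + u i) N"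
  proof (rule L2_set_mult_le)
    show "\<bar>\<sigma> i + v i\<bar> \<le> 2" if "i \<in> N" for i using vN[OF that] \<sigma>N[OF that] by linarith
  qed simp
  have 2: "L2_set (\<lambda>i. (\<sigma> i + v i) * (1 + u i)) B \<le> 2 * L2_set (\<lambda>i. \<sigma> i + v i) B"
  proof (rule L2_set_mult_le)
    show "\<bar>1 + u i\<bar> \<le> 2" if "i \<in> B" for i using uB[OF that] by linarith
  qed simp
  have 3: "L2_set (\<lambda>i. u i * v i) B \<le> 2 * L2_set u B"
  proof (rule L2_set_mult_le)
    show "\<bar>v i\<bar> \<le> 2" if "i \<in> B" for i using vB[OF that] \<sigma>B[OF that] by linarith
  qed simp
  have 4: "L2_set (\<lambda>i. v i * u i) N \<le> 2 * L2_set v N"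
  proof (rule L2_set_mult_le)
    show "\<bar>u i\<bar> \<le> 2" if "i \<in> N" for i using uN[OF that] by linarith
  qed simp
  show "L2_set (\<lambda>i. (1 + u i) * (\<sigma> i + v i)) {..<n} \<le> 4 * e"
    using L2_set_split_le[OF BN, of "\<lambda>i. (1 + u i) * (\<sigma> i + v i)"] 1 2 u v by (simp add: mult.commute)
  show "L2_set (\<lambda>i. u i * v i) {..<n} \<le> 4 * e'"
    using L2_set_split_le[OF BN, of "\<lambda>i. u i * v i"] 3 4 u v by (simp add: mult.commute)
qed

text \<open>\<open>\<sigma> + \<sigma> * u + v\<close> is the residual, divided by the duality
  measure, that the pair with relative changes \<open>u\<close> and \<open>v\<close> leaves in the
  affine scaling system.\<close>

lemma split_residual:
  fixes u v \<sigma> :: "nat \<Rightarrow> real"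
  assumes BN: "B \<subseteq> {..<n}" "N = {..<n} - B" and \<sigma>: "\<And>i. i < n \<Longrightarrow> 0 \<le> \<sigma> i \<and> \<sigma> i \<le> 7 / 6"
    and u: "L2_set (\<lambda>i. 1 + u i) N \<le> e" "L2_set u B \<le> e'" and v: "L2_set (\<lambda>i. \<sigma> i + v i) B \<le> e" "L2_set v N \<le> e'"
  shows "L2_set (\<lambda>i. \<sigma> i + \<sigma> i * u i + v i) {..<n} \<le> 13 / 6 * (e + e')"
proof -
  have 1: "L2_set (\<lambda>i. (1 + u i) * \<sigma> i) N \<le> 7 / 6 * L2_set (\<lambda>i. 1 + u i) N"
  proof (rule L2_set_mult_le)
    show "\<bar>\<sigma> i\<bar> \<le> 7 / 6" if "i \<in> N" for i using \<sigma>[of i] that BN by simp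
  qed simp
  have 2: "L2_set (\<lambda>i. u i * \<sigma> i) B \<le> 7 / 6 * L2_set u B"
  proof (rule L2_set_mult_le)
    show "\<bar>\<sigma> i\<bar> \<le> 7 / 6" if "i \<in> B" for i using \<sigma>[of i] that BN by auto
  qed simp
  have "L2_set (\<lambda>i. \<sigma> i + \<sigma> i * u i + v i) N = L2_set (\<lambda>i. (1 + u i) * \<sigma> i + v i) N"
    by (simp add: algebra_simps)
  also have "\<dots> \<le> L2_set (\<lambda>i. (1 + u i) * \<sigma> i) N + L2_set v N" by (rule L2_set_triangle_ineq)
  also have "\<dots> \<le> 7 / 6 * e + e'" using 1 u v by linarith
  finally have N: "L2_set (\<lambda>i. \<sigma> i + \<sigma> i * u i + v i) N \<le> 7 / 6 * e + e'" .
  have "L2_set (\<lambda>i. \<sigma> i + \<sigma> i * u i + v i) B = L2_set (\<lambda>i. u i * \<sigma> i + (\<sigma> i + v i)) B"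
    by (simp add: algebra_simps)
  also have "\<dots> \<le> L2_set (\<lambda>i. u i * \<sigma> i) B + L2_set (\<lambda>i. \<sigma> i + v i) B" by (rule L2_set_triangle_ineq)
  also have "\<dots> \<le> 7 / 6 * e' + e" using 2 u v by linarith
  finally have B: "L2_set (\<lambda>i. \<sigma> i + \<sigma> i * u i + v i) B \<le> 7 / 6 * e' + e" .
  have "L2_set (\<lambda>i. \<sigma> i + \<sigma> i * u i + v i) {..<n} \<le> (7 / 6 * e' + e) + (7 / 6 * e + e')"
    by (rule order.trans[OF L2_set_split_le[OF BN] add_mono[OF B N]])
  then show ?thesis by (simp add: algebra_simps)
qed

text \<open>Minimizing with weights that agree up to \<open>10 / 9\<close> loses at most the factor
  \<open>(10 / 9)\<^sup>2\<close>, and then \<open>2\<close> is a generous bound.\<close>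

lemma scaled_min_le:
  assumes min: "scaled_min x h I V dx" and \<delta>: "\<delta> \<in> V"
    and c: "\<And>\<delta> i. \<delta> \<in> V \<Longrightarrow> i \<in> I \<Longrightarrow> 9 / 10 * \<bar>f \<delta> i\<bar> \<le> \<bar>(x $ i + \<delta> $ i) / h $ i\<bar> \<and> \<bar>(x $ i + \<delta> $ i) / h $ i\<bar> \<le> 10 / 9 * \<bar>f \<delta> i\<bar>"
  shows "dx \<in> V" "L2_set (f dx) I \<le> 2 * L2_set (f \<delta>) I"
proof -
  define g where "g \<delta> = (\<lambda>i. (x $ i + \<delta> $ i) / h $ i)" for \<delta> :: "real vec"
  have dx: "dx \<in> V" and le: "L2_set (g dx) I \<le> L2_set (g \<delta>) I"
    using min \<delta> unfolding scaled_min_def is_arg_min_linorder g_def by auto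
  show "dx \<in> V" by (rule dx)
  have c': "9 / 10 * \<bar>f \<delta> i\<bar> \<le> \<bar>g \<delta> i\<bar>" "\<bar>g \<delta> i\<bar> \<le> 10 / 9 * \<bar>f \<delta> i\<bar>" if "\<delta> \<in> V" "i \<in> I" for \<delta> i
    using c[OF that] unfolding g_def by auto
  have "9 / 10 * L2_set (f dx) I = L2_set (\<lambda>i. 9 / 10 * f dx i) I" unfolding L2_set_const_mult by simp
  also have "\<dots> \<le> L2_set (\<lambda>i. \<bar>g dx i\<bar>) I"
    by (rule L2_set_mono_abs) (use c'(1)[OF dx] in \<open>simp add: abs_mult\<close>)
  also have "\<dots> = L2_set (g dx) I" by (simp add: L2_set_def)
  finally have 1: "9 / 10 * L2_set (f dx) I \<le> L2_set (g dx) I" .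
  have "L2_set (g \<delta>) I \<le> L2_set (\<lambda>i. 10 / 9 * \<bar>f \<delta> i\<bar>) I"
    by (rule L2_set_mono_abs) (rule c'(2)[OF \<delta>])
  also have "\<dots> = 10 / 9 * L2_set (f \<delta>) I" unfolding L2_set_const_mult by (simp add: L2_set_def)
  finally have "9 / 10 * L2_set (f dx) I \<le> 10 / 9 * L2_set (f \<delta>) I" using 1 le by linarith
  moreover have "0 \<le> L2_set (f \<delta>) I" by simp
  ultimately show "L2_set (f dx) I \<le> 2 * L2_set (f \<delta>) I" by linarith
qed

lemma sqrt_near_1:
  fixes \<sigma> :: real
  assumes "5 / 6 \<le> \<sigma>" "\<sigma> \<le> 7 / 6"
  shows "9 / 10 \<le> sqrt \<sigma>" "sqrt \<sigma> \<le> 10 / 9"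
proof -
  show "9 / 10 \<le> sqrt \<sigma>" by (rule real_le_rsqrt) (use assms in \<open>simp add: power2_eq_square\<close>)
  show "sqrt \<sigma> \<le> 10 / 9" by (rule real_le_lsqrt) (use assms in \<open>simp_all add: power2_eq_square\<close>)
qed

text \<open>The weights of the least squares problems differ from the relative weights
  \<open>1 / p\<close> by the factor \<open>sqrt (p * q / \<mu>)\<close>, which is close to 1 near
  the central path.\<close>

lemma hat_quotient:
  fixes p q \<mu> d :: real
  assumes "0 < p" "0 < q" "0 < \<mu>"
  shows "(p + d) / sqrt (\<mu> * p / q) = sqrt (p * q / \<mu>) * (1 + d / p)"
proof -
  have "\<mu> * p / q = p\<^sup>2 / (p * q / \<mu>)" using assms by (simp add: power2_eq_square)
  then have "sqrt (\<mu> * p / q) = p / sqrt (p * q / \<mu>)" using assms(1) by (simp only: real_sqrt_divide real_sqrt_abs abs_of_pos)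
  then show ?thesis using assms by (simp add: field_simps)
qed

text \<open>The radius \<open>2 * e\<close> in the second clause is what a minimizer for slightly
  different weights still attains, so the clause applies to the direction computed by the algorithm
  and not only to the witness of the first clause.\<close>

definition near_zero :: "nat set \<Rightarrow> nat set \<Rightarrow> real \<Rightarrow> real \<Rightarrow> real vec set \<Rightarrow> (nat \<Rightarrow> real) \<Rightarrow> real vec \<Rightarrow> bool" where
  "near_zero N B e e' V d x \<longleftrightarrow> (\<exists>\<delta>\<in>V. L2_set (\<lambda>i. d i * (x $ i + \<delta> $ i)) N \<le> e) \<and>
     (\<forall>\<delta>\<in>V. L2_set (\<lambda>i. d i * (x $ i + \<delta> $ i)) N \<le> 2 * e \<longrightarrow>
       L2_set (\<lambda>i. d i * \<delta> $ i) B \<le> e')"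


context lp
begin

lemma N2_eighth:
  assumes z: "(x, s) \<in> N2 A b c (\<beta> / 8)" and \<beta>: "\<beta> \<le> 1 / 6" and i: "i < n"
  shows "5 / 6 * mubar (x, s) \<le> x $ i * s $ i" "x $ i * s $ i \<le> 7 / 6 * mubar (x, s)"
    "5 / 6 \<le> x $ i * s $ i / mubar (x, s)" "x $ i * s $ i / mubar (x, s) \<le> 7 / 6"
proof -
  note zD = N2D[OF z]
  have "5 / 6 * mubar (x, s) \<le> (1 - \<beta> / 8) * mubar (x, s)" using \<beta> zD(5) by (intro mult_right_mono) auto
  then show 1: "5 / 6 * mubar (x, s) \<le> x $ i * s $ i" using zD(9)[OF i] by linarith
  have "(1 + \<beta> / 8) * mubar (x, s) \<le> 7 / 6 * mubar (x, s)" using \<beta> zD(5) by (intro mult_right_mono) auto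
  then show 2: "x $ i * s $ i \<le> 7 / 6 * mubar (x, s)" using zD(10)[OF i] by linarith
  show "5 / 6 \<le> x $ i * s $ i / mubar (x, s)" "x $ i * s $ i / mubar (x, s) \<le> 7 / 6"
    using 1 2 by (simp_all only: pos_le_divide_eq[OF zD(5)] pos_divide_le_eq[OF zD(5)])
qed

text \<open>The affine scaling direction is close to any pair of directions that nearly sends \<open>x\<close> to
  zero on \<open>N\<close> and \<open>s\<close> to zero on \<open>B\<close> while nearly fixing the other coordinates: their difference
  solves a Newton system with small right hand side.\<close>

lemma partition_eq:
  assumes z: "(x, s) \<in> N2 A b c (\<beta> / 8)" and \<beta>: "\<beta> \<le> 1 / 6" and nd: "newton_dir A x s (- (x \<star> s)) dxa dsa"
    and BN: "B \<subseteq> {..<n}" "N = {..<n} - B" and dx: "dx \<in> W A" and ds: "ds \<in> Wperp A"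
    and u: "L2_set (\<lambda>i. 1 + dx $ i / x $ i) N \<le> e" "L2_set (\<lambda>i. dx $ i / x $ i) B \<le> e'"
    and v: "L2_set (\<lambda>i. x $ i * (s $ i + ds $ i) / mubar (x, s)) B \<le> e" "L2_set (\<lambda>i. x $ i * ds $ i / mubar (x, s)) N \<le> e'"
    and e: "e \<le> 1 / 20" "e' \<le> 1 / 20"
  shows "{i. i < n \<and> \<bar>dxa $ i / x $ i\<bar> < \<bar>dsa $ i / s $ i\<bar>} = B"
proof -
  note zD = N2D[OF z]
  define \<mu> where "\<mu> = mubar (x, s)"
  have \<mu>: "0 < \<mu>" using zD(5) by (simp add: \<mu>_def)
  define \<sigma> u' v' where "\<sigma> i = x $ i * s $ i / \<mu>" and "u' i = dx $ i / x $ i" and "v' i = x $ i * ds $ i / \<mu>" for i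
  note \<sigma>e = N2_eighth[OF z \<beta>, folded \<mu>_def]
  have \<sigma>b: "5 / 6 \<le> \<sigma> i" "\<sigma> i \<le> 7 / 6" if "i < n" for i using \<sigma>e[OF that] by (simp_all add: \<sigma>_def)
  have \<sigma>0: "0 \<le> \<sigma> i \<and> \<sigma> i \<le> 7 / 6" if "i < n" for i using \<sigma>b[OF that] by simp
  have u1: "L2_set (\<lambda>i. 1 + u' i) N \<le> e" "L2_set u' B \<le> e'" using u by (simp_all add: u'_def[abs_def])
  have "(\<lambda>i. \<sigma> i + v' i) = (\<lambda>i. x $ i * (s $ i + ds $ i) / \<mu>)" by (simp add: \<sigma>_def v'_def algebra_simps add_divide_distrib)
  then have v1: "L2_set (\<lambda>i. \<sigma> i + v' i) B \<le> e" "L2_set v' N \<le> e'" using v by (simp_all add: v'_def[abs_def] \<mu>_def)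
  define \<rho> where "\<rho> i = \<sigma> i + \<sigma> i * u' i + v' i" for i
  have L\<rho>: "L2_set \<rho> {..<n} \<le> 13 / 60"
  proof -
    have "L2_set \<rho> {..<n} \<le> 13 / 6 * (e + e')" unfolding \<rho>_def[abs_def] by (rule split_residual[OF BN \<sigma>0 u1 v1])
    then show ?thesis using e by argo
  qed
  note D = newton_dirD[OF nd zD(1,2)]
  have dc: "dx \<in> carrier_vec n" "ds \<in> carrier_vec n" using W_carrier[OF dx] Wperp_carrier[OF ds] .
  define DX DS where "DX i = dxa $ i - dx $ i" and "DS i = dsa $ i - ds $ i" for i
  have orth: "(\<Sum>i<n. DX i * DS i) = 0"
    using W_Wperp[OF W_diff[OF D(1) dx] Wperp_diff[OF D(2) ds]] D(3,4) dc by (simp add: DX_def DS_def)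
  have eq: "s $ i * DX i + x $ i * DS i = - \<mu> * \<rho> i" if i: "i < n" for i
  proof -
    have "s $ i * dxa $ i + x $ i * dsa $ i = - (x $ i * s $ i)" using D(5)[OF i] i zD(1) by (simp add: vtimes_def)
    moreover have "\<mu> * \<rho> i = x $ i * s $ i + s $ i * dx $ i + x $ i * ds $ i"
      using \<mu> zD(6)[OF i] by (simp add: \<rho>_def \<sigma>_def u'_def v'_def field_simps)
    ultimately show ?thesis by (simp add: DX_def DS_def algebra_simps)
  qed
  have en: "(\<Sum>i<n. x $ i * s $ i * (DX i / x $ i)\<^sup>2 + x $ i * s $ i * (DS i / s $ i)\<^sup>2) = (\<Sum>i<n. (- \<mu> * \<rho> i)\<^sup>2 / (x $ i * s $ i))"
    by (rule newton_energy(1)[OF zD(6,7) eq orth])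
  have "(\<Sum>i<n. (- \<mu> * \<rho> i)\<^sup>2 / (x $ i * s $ i)) \<le> (\<Sum>i<n. 6 / 5 * \<mu> * (\<rho> i)\<^sup>2)"
  proof (rule sum_mono)
    fix i assume "i \<in> {..<n}"
    then have i: "i < n" by simp
    have xs: "0 < x $ i * s $ i" using zD(6,7)[OF i] by simp
    have "(- \<mu> * \<rho> i)\<^sup>2 = \<mu> * (\<rho> i)\<^sup>2 * \<mu>" by (simp add: power2_eq_square)
    also have "\<dots> \<le> \<mu> * (\<rho> i)\<^sup>2 * (6 / 5 * (x $ i * s $ i))" using \<sigma>e(1)[OF i] \<mu> by (intro mult_left_mono) auto
    also have "\<dots> = 6 / 5 * \<mu> * (\<rho> i)\<^sup>2 * (x $ i * s $ i)" by simp
    finally show "(- \<mu> * \<rho> i)\<^sup>2 / (x $ i * s $ i) \<le> 6 / 5 * \<mu> * (\<rho> i)\<^sup>2" using xs by (simp only: pos_divide_le_eq)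
  qed
  also have "\<dots> = 6 / 5 * \<mu> * (L2_set \<rho> {..<n})\<^sup>2" by (simp add: L2_set_def sum_nonneg sum_distrib_left)
  also have "\<dots> \<le> 6 / 5 * \<mu> * (13 / 60)\<^sup>2" using \<mu> L\<rho> by (intro mult_left_mono power_mono) auto
  finally have tot: "(\<Sum>i<n. x $ i * s $ i * (DX i / x $ i)\<^sup>2 + x $ i * s $ i * (DS i / s $ i)\<^sup>2) \<le> 6 / 5 * \<mu> * (13 / 60)\<^sup>2"
    unfolding en .
  \<comment> \<open>Dividing by \<open>x $ i * s $ i \<ge> 5 / 6 * \<mu>\<close> multiplies the
    bound by \<open>(6 / 5)\<^sup>2\<close> in total, and
    \<open>6 / 5 * (13 / 60) = 13 / 50\<close>.\<close>
  have sm: "\<bar>DX i / x $ i\<bar> \<le> 13 / 50 \<and> \<bar>DS i / s $ i\<bar> \<le> 13 / 50" if i: "i < n" for i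
  proof -
    have nn: "0 \<le> x $ j * s $ j * (DX j / x $ j)\<^sup>2" "0 \<le> x $ j * s $ j * (DS j / s $ j)\<^sup>2" if "j < n" for j
      using zD(6,7)[OF that] by simp_all
    have "x $ i * s $ i * (DX i / x $ i)\<^sup>2 + x $ i * s $ i * (DS i / s $ i)\<^sup>2
        \<le> (\<Sum>i<n. x $ i * s $ i * (DX i / x $ i)\<^sup>2 + x $ i * s $ i * (DS i / s $ i)\<^sup>2)"
      by (rule member_le_sum) (use i nn in auto)
    then have b: "x $ i * s $ i * (DX i / x $ i)\<^sup>2 \<le> 6 / 5 * \<mu> * (13 / 60)\<^sup>2" "x $ i * s $ i * (DS i / s $ i)\<^sup>2 \<le> 6 / 5 * \<mu> * (13 / 60)\<^sup>2"
      using tot nn[OF i] by linarith+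
    have "\<bar>r\<bar> \<le> 13 / 50" if r: "x $ i * s $ i * r\<^sup>2 \<le> 6 / 5 * \<mu> * (13 / 60)\<^sup>2" for r
    proof -
      have "5 / 6 * \<mu> * r\<^sup>2 \<le> x $ i * s $ i * r\<^sup>2" using \<sigma>e(1)[OF i] by (intro mult_right_mono) auto
      then have "\<mu> * (r\<^sup>2) \<le> \<mu> * ((13 / 50)\<^sup>2)" using r by (simp add: power2_eq_square)
      then have "r\<^sup>2 \<le> (13 / 50)\<^sup>2" using \<mu> by (simp only: mult_le_cancel_left_pos)
      then show ?thesis by (intro power2_le_imp_le[of "\<bar>r\<bar>"]) auto
    qed
    then show ?thesis using b by blast
  qed
  have f: "finite B" "finite N" using BN finite_subset by auto
  have split: "dxa $ i / x $ i = u' i + DX i / x $ i" "dsa $ i / s $ i = v' i / \<sigma> i + DS i / s $ i" if "i < n" for i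
    using \<mu> zD(6,7)[OF that] by (simp_all add: u'_def v'_def \<sigma>_def DX_def DS_def field_simps)
  \<comment> \<open>On \<open>B\<close> the primal ratio is at most \<open>1 / 20 + 13 / 50\<close>
    in absolute value and the dual one at least \<open>47 / 50 - 13 / 50\<close>. On
    \<open>N\<close> the two sides change roles.\<close>
  have inB: "\<bar>dxa $ i / x $ i\<bar> < \<bar>dsa $ i / s $ i\<bar>" if i: "i \<in> B" for i
  proof -
    have il: "i < n" using i BN by auto
    have "\<bar>u' i\<bar> \<le> 1 / 20" using L2_set_abs_le[OF f(1) i, of u'] u1 e by linarith
    moreover have "\<bar>\<sigma> i + v' i\<bar> \<le> 1 / 20" using L2_set_abs_le[OF f(1) i, of "\<lambda>i. \<sigma> i + v' i"] v1 e by linarith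
    then have "v' i \<le> - \<sigma> i * (47 / 50)" using \<sigma>b[OF il] by linarith
    then have "v' i / \<sigma> i \<le> - (47 / 50)" using \<sigma>b[OF il] by (simp add: pos_divide_le_eq algebra_simps)
    ultimately show ?thesis unfolding split[OF il] using sm[OF il] by linarith
  qed
  have inN: "\<not> \<bar>dxa $ i / x $ i\<bar> < \<bar>dsa $ i / s $ i\<bar>" if i: "i \<in> N" for i
  proof -
    have il: "i < n" using i BN by auto
    have "\<bar>1 + u' i\<bar> \<le> 1 / 20" using L2_set_abs_le[OF f(2) i, of "\<lambda>i. 1 + u' i"] u1 e by linarith
    moreover have "\<bar>v' i\<bar> \<le> 1 / 20" using L2_set_abs_le[OF f(2) i, of v'] v1 e by linarith
    then have "\<bar>v' i / \<sigma> i\<bar> \<le> 3 / 50" using \<sigma>b[OF il] by (simp add: abs_divide pos_divide_le_eq)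
    ultimately show ?thesis unfolding split[OF il] using sm[OF il] by linarith
  qed
  show ?thesis
  proof (intro equalityI subsetI)
    fix i assume "i \<in> {i. i < n \<and> \<bar>dxa $ i / x $ i\<bar> < \<bar>dsa $ i / s $ i\<bar>}"
    then show "i \<in> B" using inN[of i] BN(2) by blast
  next
    fix i assume "i \<in> B"
    then show "i \<in> {i. i < n \<and> \<bar>dxa $ i / x $ i\<bar> < \<bar>dsa $ i / s $ i\<bar>}" using inB BN(1) by blast
  qed
qed

text \<open>The assumptions speak of a partition fixed in advance and of all cheap lift spaces the
  solver may produce for it. Once that partition is recognized, the spaces of the step are among
  them. The products at the full step then give \<open>\<epsilon> \<le> 8 * e\<close>, and a length
  of at least \<open>1 - 9 * \<epsilon> / \<beta>\<close> leaves at most \<open>9 * \<epsilon> /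
  \<beta> + \<epsilon> \<le> 10 * \<epsilon> / \<beta>\<close> of the measure.\<close>

lemma lls_step_collapse:
  assumes svd: "svd_solver \<rho> svd" and z: "(x, s) \<in> N2 A b c (\<beta> / 8)" and \<beta>: "0 < \<beta>" "\<beta> \<le> 1 / 6"
    and ap: "affine_part A \<beta> x s dxa dsa \<alpha>a B N" and lp: "lls_part A svd x s B N V U dxl dsl" and len: "length_part \<beta> x s dxl dsl \<alpha>l \<epsilon>"
    and z1: "z1 = better_of (x + \<alpha>a \<cdot>\<^sub>v dxa, s + \<alpha>a \<cdot>\<^sub>v dsa) (x + \<alpha>l \<cdot>\<^sub>v dxl, s + \<alpha>l \<cdot>\<^sub>v dsl)"
    and BN: "B' \<subseteq> {..<n}" "N' = {..<n} - B'"
    and gV: "\<And>V U. cheap_lift_spaces A svd x B' N' V U \<Longrightarrow> near_zero N' B' e e' V (\<lambda>i. 1 / x $ i) x"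
    and gU: "\<And>V U. cheap_lift_spaces A svd x B' N' V U \<Longrightarrow> near_zero B' N' e e' U (\<lambda>i. x $ i / mubar (x, s)) s"
    and e: "0 \<le> e" "e \<le> \<beta> / 72" "e' \<le> \<beta> / 36"
  shows "mubar z1 \<le> 80 * e / \<beta> * mubar (x, s)"
proof -
  note zD = N2D[OF z]
  define \<mu> where "\<mu> = mubar (x, s)"
  have \<mu>: "0 < \<mu>" using zD(5) by (simp add: \<mu>_def)
  define \<sigma> where "\<sigma> i = x $ i * s $ i / \<mu>" for i
  have \<sigma>b: "5 / 6 \<le> \<sigma> i" "\<sigma> i \<le> 7 / 6" if "i < n" for i using N2_eighth(3,4)[OF z \<beta>(2) that] by (simp_all add: \<sigma>_def \<mu>_def)
  have e20: "e \<le> 1 / 20" "e' \<le> 1 / 20" using e \<beta> by auto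
  have nd: "newton_dir A x s (- (x \<star> s)) dxa dsa" and Bd: "B = {i. i < n \<and> \<bar>dxa $ i / x $ i\<bar> < \<bar>dsa $ i / s $ i\<bar>}"
    using ap A unfolding affine_part_def by auto
  have x1: "1 / x $ i * (x $ i + r) = 1 + r / x $ i" if "i < n" for i r
    using zD(6)[OF that] by (simp add: field_simps)
  have X1: "L2_set (\<lambda>i. 1 / x $ i * (x $ i + \<delta> $ i)) N' = L2_set (\<lambda>i. 1 + \<delta> $ i / x $ i) N'" for \<delta> :: "real vec"
    using BN x1 by (intro L2_set_cong) auto
  \<comment> \<open>The spaces chosen here only provide a pair of directions near the affine scaling
    direction; they may differ from those of the step itself.\<close>
  have BB: "B = B'"
  proof -
    obtain V0 U0 where VU: "cheap_lift_spaces A svd x B' N' V0 U0"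
      using cheap_lift_spaces_exist[OF svd zD(1,6) BN] by blast
    note sub = cheap_lift_spaces_sub[OF svd zD(1,6) BN VU]
    obtain dx where dx: "dx \<in> V0" "L2_set (\<lambda>i. 1 / x $ i * (x $ i + dx $ i)) N' \<le> e" "L2_set (\<lambda>i. 1 / x $ i * dx $ i) B' \<le> e'"
      using gV[OF VU] e(1) unfolding near_zero_def by force
    obtain ds where ds: "ds \<in> U0" "L2_set (\<lambda>i. x $ i / \<mu> * (s $ i + ds $ i)) B' \<le> e" "L2_set (\<lambda>i. x $ i / \<mu> * ds $ i) N' \<le> e'"
      using gU[OF VU] e(1) unfolding near_zero_def \<mu>_def[symmetric] by force
    have dx': "dx \<in> W A" and ds': "ds \<in> Wperp A" using dx(1) ds(1) sub by auto
    show ?thesis unfolding Bd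
      by (rule partition_eq[OF z \<beta>(2) nd BN dx' ds' _ _ _ _ e20]) (use dx ds X1[of dx] in \<open>simp_all add: \<mu>_def[symmetric]\<close>)
  qed
  note pD = post_stepD[OF svd z ap lp]
  have NN: "N = N'" using pD(6) BN BB by simp
  have cl: "cheap_lift_spaces A svd x B' N' V U" and mx: "scaled_min x (hat \<mu> x s) N' V dxl" and ms: "scaled_min s (hat \<mu> s x) B' U dsl"
    using lp unfolding lls_part_def BB NN \<mu>_def by auto
  note gV' = gV[OF cl, unfolded near_zero_def] and gU' = gU[OF cl, unfolded near_zero_def, folded \<mu>_def]
  have dc: "dxl \<in> carrier_vec n" "dsl \<in> carrier_vec n" using W_carrier[OF pD(3)] Wperp_carrier[OF pD(4)] .
  have sq: "9 / 10 \<le> sqrt (\<sigma> i)" "sqrt (\<sigma> i) \<le> 10 / 9" if "i < n" for i using sqrt_near_1[OF \<sigma>b[OF that]] .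
  have hx: "9 / 10 * \<bar>1 / x $ i * (x $ i + \<delta> $ i)\<bar> \<le> \<bar>(x $ i + \<delta> $ i) / hat \<mu> x s $ i\<bar> \<and>
      \<bar>(x $ i + \<delta> $ i) / hat \<mu> x s $ i\<bar> \<le> 10 / 9 * \<bar>1 / x $ i * (x $ i + \<delta> $ i)\<bar>" if "i \<in> N'" for i and \<delta> :: "real vec"
  proof -
    have i: "i < n" using that BN by simp
    have "hat \<mu> x s $ i = sqrt (\<mu> * x $ i / s $ i)" using i zD(1,2) by (simp add: hat_def vsqrt_def vdivide_def)
    then have "\<bar>(x $ i + \<delta> $ i) / hat \<mu> x s $ i\<bar> = sqrt (\<sigma> i) * \<bar>1 / x $ i * (x $ i + \<delta> $ i)\<bar>"
      unfolding x1[OF i] using hat_quotient[OF zD(6)[OF i] zD(7)[OF i] \<mu>, of "\<delta> $ i", folded \<sigma>_def] \<sigma>b[OF i] by (simp add: abs_mult)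
    then show ?thesis using sq[OF i] by (simp only: mult_right_mono abs_ge_zero simp_thms)
  qed
  have hs: "9 / 10 * \<bar>x $ i / \<mu> * (s $ i + \<delta> $ i)\<bar> \<le> \<bar>(s $ i + \<delta> $ i) / hat \<mu> s x $ i\<bar> \<and>
      \<bar>(s $ i + \<delta> $ i) / hat \<mu> s x $ i\<bar> \<le> 10 / 9 * \<bar>x $ i / \<mu> * (s $ i + \<delta> $ i)\<bar>" if "i \<in> B'" for i and \<delta> :: "real vec"
  proof -
    have i: "i < n" using that BN by auto
    note p = zD(6,7)[OF i]
    have "hat \<mu> s x $ i = sqrt (\<mu> * s $ i / x $ i)" using i zD(1,2) by (simp add: hat_def vsqrt_def vdivide_def)
    then have "(s $ i + \<delta> $ i) / hat \<mu> s x $ i = sqrt (\<sigma> i) * (1 + \<delta> $ i / s $ i)"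
      using hat_quotient[OF p(2,1) \<mu>, of "\<delta> $ i"] by (simp add: \<sigma>_def mult.commute)
    moreover have "x $ i / \<mu> * (s $ i + \<delta> $ i) = \<sigma> i * (1 + \<delta> $ i / s $ i)"
      using p \<mu> by (simp add: \<sigma>_def field_simps)
    moreover have "\<sigma> i = sqrt (\<sigma> i) * sqrt (\<sigma> i)" using \<sigma>b[OF i] by simp
    ultimately have q: "x $ i / \<mu> * (s $ i + \<delta> $ i) = sqrt (\<sigma> i) * ((s $ i + \<delta> $ i) / hat \<mu> s x $ i)" by (metis mult.assoc)
    have ab: "\<bar>x $ i / \<mu> * (s $ i + \<delta> $ i)\<bar> = sqrt (\<sigma> i) * \<bar>(s $ i + \<delta> $ i) / hat \<mu> s x $ i\<bar>"
      unfolding q using \<sigma>b[OF i] by (simp add: abs_mult)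
    have "9 / 10 * \<bar>(s $ i + \<delta> $ i) / hat \<mu> s x $ i\<bar> \<le> \<bar>x $ i / \<mu> * (s $ i + \<delta> $ i)\<bar>"
      "\<bar>x $ i / \<mu> * (s $ i + \<delta> $ i)\<bar> \<le> 10 / 9 * \<bar>(s $ i + \<delta> $ i) / hat \<mu> s x $ i\<bar>"
      unfolding ab using sq[OF i] by (intro mult_right_mono; simp)+
    then show ?thesis by argo
  qed
  obtain \<delta>x where \<delta>x: "\<delta>x \<in> V" "L2_set (\<lambda>i. 1 / x $ i * (x $ i + \<delta>x $ i)) N' \<le> e" using gV' by blast
  obtain \<delta>s where \<delta>s: "\<delta>s \<in> U" "L2_set (\<lambda>i. x $ i / \<mu> * (s $ i + \<delta>s $ i)) B' \<le> e" using gU' by blast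
  note mx' = scaled_min_le[where f = "\<lambda>\<delta> i. 1 / x $ i * (x $ i + \<delta> $ i)", OF mx \<delta>x(1) hx]
  note ms' = scaled_min_le[where f = "\<lambda>\<delta> i. x $ i / \<mu> * (s $ i + \<delta> $ i)", OF ms \<delta>s(1) hs]
  have u1: "L2_set (\<lambda>i. 1 / x $ i * (x $ i + dxl $ i)) N' \<le> 2 * e" using mx'(2) \<delta>x(2) by linarith
  have v1: "L2_set (\<lambda>i. x $ i / \<mu> * (s $ i + dsl $ i)) B' \<le> 2 * e" using ms'(2) \<delta>s(2) by linarith
  have u2: "L2_set (\<lambda>i. 1 / x $ i * dxl $ i) B' \<le> e'" using gV' mx'(1) u1 by blast
  have v2: "L2_set (\<lambda>i. x $ i / \<mu> * dsl $ i) N' \<le> e'" using gU' ms'(1) v1 by blast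
  have \<sigma>0: "0 \<le> \<sigma> i \<and> \<sigma> i \<le> 7 / 6" if "i < n" for i using \<sigma>b[OF that] by simp
  have s1: "(\<lambda>i. \<sigma> i + x $ i / \<mu> * dsl $ i) = (\<lambda>i. x $ i / \<mu> * (s $ i + dsl $ i))" by (simp add: \<sigma>_def algebra_simps)
  have u1': "L2_set (\<lambda>i. 1 + 1 / x $ i * dxl $ i) N' \<le> 2 * e" using u1 unfolding X1 by simp
  have v1': "L2_set (\<lambda>i. \<sigma> i + x $ i / \<mu> * dsl $ i) B' \<le> 2 * e" using v1 unfolding s1 .
  have e2: "2 * e \<le> 1 / 2" "e' \<le> 1 / 2" using e20 by argo+
  have pr: "L2_set (\<lambda>i. (1 + 1 / x $ i * dxl $ i) * (\<sigma> i + x $ i / \<mu> * dsl $ i)) {..<n} \<le> 4 * (2 * e)"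
    "L2_set (\<lambda>i. 1 / x $ i * dxl $ i * (x $ i / \<mu> * dsl $ i)) {..<n} \<le> 4 * e'"
    using split_products[where \<sigma> = \<sigma>, OF BN \<sigma>0 u1' u2 v1' v2 e2] by blast+
  have E: "vnorm ((x + dxl) \<star> (s + dsl)) / \<mu> \<le> 8 * e"
  proof -
    have "vnorm ((x + dxl) \<star> (s + dsl)) = L2_set (\<lambda>i. (x + dxl) $ i * (s + dsl) $ i) {..<n}"
      by (rule vnorm_vtimes) (use zD(1) dc in simp)
    also have "\<dots> = L2_set (\<lambda>i. \<mu> * ((1 + 1 / x $ i * dxl $ i) * (\<sigma> i + x $ i / \<mu> * dsl $ i))) {..<n}"
    proof (rule L2_set_cong[OF refl])
      fix i assume "i \<in> {..<n}"
      then have i: "i < n" by simp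
      show "(x + dxl) $ i * (s + dsl) $ i = \<mu> * ((1 + 1 / x $ i * dxl $ i) * (\<sigma> i + x $ i / \<mu> * dsl $ i))"
        using i zD(1,2) dc zD(6)[OF i] \<mu> by (simp add: \<sigma>_def field_simps)
    qed
    also have "\<dots> = \<mu> * L2_set (\<lambda>i. (1 + 1 / x $ i * dxl $ i) * (\<sigma> i + x $ i / \<mu> * dsl $ i)) {..<n}"
      unfolding L2_set_const_mult using \<mu> by simp
    also have "\<dots> \<le> \<mu> * (8 * e)" using pr(1) \<mu> by (intro mult_left_mono) auto
    finally show ?thesis using \<mu> by (simp add: pos_divide_le_eq mult.commute)
  qed
  have D: "vnorm (dxl \<star> dsl) / \<mu> \<le> 4 * e'"
  proof -
    have "vnorm (dxl \<star> dsl) = L2_set (\<lambda>i. dxl $ i * dsl $ i) {..<n}"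
      by (rule vnorm_vtimes[OF dc(1)])
    also have "\<dots> = L2_set (\<lambda>i. \<mu> * (1 / x $ i * dxl $ i * (x $ i / \<mu> * dsl $ i))) {..<n}"
    proof (rule L2_set_cong[OF refl])
      fix i assume "i \<in> {..<n}"
      then have i: "i < n" by simp
      show "dxl $ i * dsl $ i = \<mu> * (1 / x $ i * dxl $ i * (x $ i / \<mu> * dsl $ i))"
        using zD(6)[OF i] \<mu> by simp
    qed
    also have "\<dots> = \<mu> * L2_set (\<lambda>i. 1 / x $ i * dxl $ i * (x $ i / \<mu> * dsl $ i)) {..<n}"
      unfolding L2_set_const_mult using \<mu> by simp
    also have "\<dots> \<le> \<mu> * (4 * e')" using pr(2) \<mu> by (intro mult_left_mono) auto
    finally show ?thesis using \<mu> by (simp add: pos_divide_le_eq mult.commute)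
  qed
  have \<epsilon>: "\<epsilon> = vnorm ((x + dxl) \<star> (s + dsl)) / \<mu>"
    and l: "if max (vnorm (dxl \<star> dsl) / \<mu>) \<epsilon> \<le> \<beta> / 9 then 1 - 9 * \<epsilon> / \<beta> \<le> \<alpha>l \<and> \<alpha>l \<le> 1 - 8 * \<epsilon> / \<beta> else \<alpha>l = 0"
    using len unfolding length_part_def \<mu>_def by auto
  have \<epsilon>8: "\<epsilon> \<le> 8 * e" using E \<epsilon> by simp
  have \<epsilon>0: "0 \<le> \<epsilon>" using \<mu> unfolding \<epsilon> vnorm_def by (simp add: L2_set_nonneg)
  have \<epsilon>9: "\<epsilon> \<le> \<beta> / 9" using \<epsilon>8 e by argo
  have D9: "vnorm (dxl \<star> dsl) / \<mu> \<le> \<beta> / 9" using D e by argo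
  have al: "1 - 9 * \<epsilon> / \<beta> \<le> \<alpha>l" "\<alpha>l \<le> 1 - 8 * \<epsilon> / \<beta>" using l \<epsilon>9 D9 by auto
  have "9 * \<epsilon> / \<beta> \<le> 1" using \<epsilon>9 \<beta> by (simp add: pos_divide_le_eq)
  then have al0: "0 \<le> \<alpha>l" using al(1) by linarith
  have "0 \<le> 8 * \<epsilon> / \<beta>" using \<epsilon>0 \<beta> by simp
  then have al1: "\<alpha>l \<le> 1" using al(2) by linarith
  have "\<bar>mubar (x + \<alpha>l \<cdot>\<^sub>v dxl, s + \<alpha>l \<cdot>\<^sub>v dsl) - (1 - \<alpha>l) * \<mu>\<bar> \<le> \<bar>\<alpha>l\<bar> * (\<epsilon> * \<mu>)"
    using lls_step(1)[OF z \<beta> pD(3,4) D9[unfolded \<mu>_def] \<epsilon>[unfolded \<mu>_def]] by (simp add: \<mu>_def)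
  then have "mubar (x + \<alpha>l \<cdot>\<^sub>v dxl, s + \<alpha>l \<cdot>\<^sub>v dsl) \<le> (1 - \<alpha>l) * \<mu> + \<alpha>l * (\<epsilon> * \<mu>)"
    unfolding abs_of_nonneg[OF al0] by (simp only: abs_le_iff) linarith
  also have "\<dots> \<le> 9 * \<epsilon> / \<beta> * \<mu> + 1 * (\<epsilon> / \<beta> * \<mu>)"
  proof (intro add_mono mult_mono)
    show "\<epsilon> \<le> \<epsilon> / \<beta>" using \<epsilon>0 \<beta> mult_left_le[of \<beta> \<epsilon>] by (simp add: pos_le_divide_eq)
  qed (use al al0 al1 \<mu> \<epsilon>0 \<beta> in auto)
  also have "\<dots> = 10 * \<epsilon> / \<beta> * \<mu>" by (simp add: algebra_simps add_divide_distrib)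
  also have "\<dots> \<le> 80 * e / \<beta> * \<mu>" using \<epsilon>8 \<mu> \<beta> by (intro mult_right_mono divide_right_mono) auto
  finally have "mubar (x + \<alpha>l \<cdot>\<^sub>v dxl, s + \<alpha>l \<cdot>\<^sub>v dsl) \<le> 80 * e / \<beta> * \<mu>" .
  moreover have "mubar z1 \<le> mubar (x + \<alpha>l \<cdot>\<^sub>v dxl, s + \<alpha>l \<cdot>\<^sub>v dsl)" unfolding z1 better_of_def by simp
  ultimately show ?thesis unfolding \<mu>_def by (rule order.trans[rotated])
qed

end

section \<open>From a spectral gap to directions that nearly vanish\<close>

lemma L2_set_diff_le: "L2_set (\<lambda>i. f i - g i) S \<le> L2_set f S + L2_set g S"
proof -
  have "L2_set (\<lambda>i. f i + - g i) S \<le> L2_set f S + L2_set (\<lambda>i. - g i) S" by (rule L2_set_triangle_ineq)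
  then show ?thesis by (simp add: L2_set_def)
qed

text \<open>Certificates on the dual side use the weights \<open>x\<close>, the analysis of a step
  uses \<open>x / \<mu>\<close>.\<close>

lemma near_zero_scale:
  assumes a: "0 < a" and nz: "near_zero N B (a * e) (a * e') V d x"
  shows "near_zero N B e e' V (\<lambda>i. d i / a) x"
proof -
  have sc: "L2_set (\<lambda>i. d i / a * f i) S \<le> r \<longleftrightarrow> L2_set (\<lambda>i. d i * f i) S \<le> a * r" for f :: "nat \<Rightarrow> real" and S r
  proof -
    have "L2_set (\<lambda>i. d i / a * f i) S = L2_set (\<lambda>i. 1 / a * (d i * f i)) S" by simp
    also have "\<dots> = L2_set (\<lambda>i. d i * f i) S / a" unfolding L2_set_const_mult using a by simp
    finally show ?thesis using a by (simp add: pos_divide_le_eq mult.commute)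
  qed
  have 2: "a * (2 * e) = 2 * (a * e)" by simp
  show ?thesis using nz unfolding near_zero_def sc 2 .
qed

lemma near_zero_all:
  assumes "w \<in> V" "L2_set (\<lambda>i. d i * (x $ i + w $ i)) N \<le> e" "0 \<le> e'"
  shows "near_zero N {} e e' V d x"
  using assms unfolding near_zero_def by auto

lemma near_zero_none:
  assumes "B \<subseteq> {..<n}" "0 \<le> e" "0 \<le> e'"
  shows "near_zero {} B e e' {0\<^sub>v n} d x"
proof -
  have "L2_set (\<lambda>i. d i * (0\<^sub>v n :: real vec) $ i) B = L2_set (\<lambda>i. 0) B" using assms(1) by (intro L2_set_cong) auto
  then show ?thesis using assms unfolding near_zero_def by (simp add: L2_set_def)
qed

text \<open>The gap supplies an element of \<open>V\<close> near the given direction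
  \<open>w\<close>, with error at most \<open>4 * K / R\<close> on \<open>N\<close>. Conversely, any
  nearly optimal element of \<open>V\<close> has norm at most \<open>K1 + 2 * e\<close> on
  \<open>N\<close>, and flatness of \<open>V\<close> bounds it on \<open>B\<close> by
  \<open>2 * \<eta>\<close> times that.\<close>

lemma (in weighted_lift) lifted_space_near_zero:
  assumes svd: "rho_svd 2 l C t" and V: "V = (\<lambda>w. us (L *\<^sub>v w)) ` last_cols_span C p"
    and p: "p = card {i. i < dim_vec t \<and> t $ i \<le> 1}"
    and cR: "wcert n S d N B R k" and max: "\<And>k'. wcert n S d N B \<eta> k' \<Longrightarrow> k' \<le> k"
    and \<eta>: "0 < \<eta>" "\<eta> \<le> 1 / 4" and R: "1 \<le> R" and w: "w \<in> S"
    and K: "L2_set (\<lambda>i. d i * w $ i) B \<le> K" "L2_set (\<lambda>i. d i * w $ i) N \<le> K"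
    and K0: "L2_set (\<lambda>i. d i * (x $ i + w $ i)) N \<le> K0" and K1: "L2_set (\<lambda>i. d i * x $ i) N \<le> K1"
    and e: "K0 + 4 * K / R \<le> e" and e': "2 * \<eta> * (K1 + 2 * e) \<le> e'"
  shows "near_zero N B e e' V d x"
proof -
  note gap = lifted_space_gap[OF svd V p cR max \<eta> R]
  obtain \<delta> where \<delta>: "\<delta> \<in> V" and le: "L2_set (\<lambda>i. d i * (w $ i - \<delta> $ i)) N \<le>
       2 * (L2_set (\<lambda>i. d i * w $ i) B + L2_set (\<lambda>i. d i * w $ i) N) / R"
    using gap(2)[OF _ w] by auto
  have "2 * (L2_set (\<lambda>i. d i * w $ i) B + L2_set (\<lambda>i. d i * w $ i) N) / R \<le> 2 * (K + K) / R"
    using K R by (intro divide_right_mono mult_left_mono add_mono) auto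
  then have le': "L2_set (\<lambda>i. d i * (w $ i - \<delta> $ i)) N \<le> 4 * K / R" using le by simp
  have "L2_set (\<lambda>i. d i * (x $ i + \<delta> $ i)) N = L2_set (\<lambda>i. d i * (x $ i + w $ i) - d i * (w $ i - \<delta> $ i)) N"
    by (simp add: algebra_simps)
  also have "\<dots> \<le> L2_set (\<lambda>i. d i * (x $ i + w $ i)) N + L2_set (\<lambda>i. d i * (w $ i - \<delta> $ i)) N" by (rule L2_set_diff_le)
  also have "\<dots> \<le> e" using K0 le' e by linarith
  finally have 1: "\<exists>\<delta>\<in>V. L2_set (\<lambda>i. d i * (x $ i + \<delta> $ i)) N \<le> e" using \<delta> by blast
  have "L2_set (\<lambda>i. d i * \<delta> $ i) B \<le> e'"
    if \<delta>: "\<delta> \<in> V" and le: "L2_set (\<lambda>i. d i * (x $ i + \<delta> $ i)) N \<le> 2 * e" for \<delta>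
  proof -
    have "L2_set (\<lambda>i. d i * \<delta> $ i) N = L2_set (\<lambda>i. d i * (x $ i + \<delta> $ i) - d i * x $ i) N"
      by (simp add: algebra_simps)
    also have "\<dots> \<le> L2_set (\<lambda>i. d i * (x $ i + \<delta> $ i)) N + L2_set (\<lambda>i. d i * x $ i) N" by (rule L2_set_diff_le)
    also have "\<dots> \<le> K1 + 2 * e" using le K1 by linarith
    finally have "2 * \<eta> * L2_set (\<lambda>i. d i * \<delta> $ i) N \<le> 2 * \<eta> * (K1 + 2 * e)" using \<eta> by (intro mult_left_mono) auto
    moreover have "L2_set (\<lambda>i. d i * \<delta> $ i) B \<le> 2 * \<eta> * L2_set (\<lambda>i. d i * \<delta> $ i) N"
      using gap(1)[OF _ \<delta>] by blast
    ultimately show ?thesis using e' by linarith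
  qed
  then show ?thesis using 1 unfolding near_zero_def by blast
qed

text \<open>Makes the sets of certified counts finite, so that the potential can be formed from
  their maxima.\<close>

lemma (in lp_matrix) wcert_bound:
  assumes svd: "svd_solver \<rho> svd" and x: "x \<in> carrier_vec n" "\<And>i. i < n \<Longrightarrow> 0 < x $ i"
    and B: "B \<subseteq> {..<n}" and N: "N = {..<n} - B" and \<tau>: "0 \<le> \<tau>"
  shows "wcert n (W A) (\<lambda>i. 1 / x $ i) N B \<tau> k \<Longrightarrow> k \<le> n" "wcert n (Wperp A) (\<lambda>i. x $ i) B N \<tau> k \<Longrightarrow> k \<le> n"
proof -
  have BN: "B = {..<n} - N" using B N by auto
  have cards: "card N \<le> n" "card B \<le> n" using B N card_mono[of "{..<n}" N] card_mono[of "{..<n}" B] by auto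
  show "k \<le> n" if w: "wcert n (W A) (\<lambda>i. 1 / x $ i) N B \<tau> k"
  proof (cases "N = {} \<or> B = {}")
    case True
    show ?thesis using wcert_trivial[OF w \<tau> W_zero BN True] by simp
  next
    case False
    then have ne: "B \<noteq> {}" "N \<noteq> {}" by auto
    obtain R where 1: "weighted_lift n (1\<^sub>m n - R) N B (W A) (\<lambda>i. 1 / x $ i)"
      by (rule cheap_lift_cases[OF x B ne(1) N ne(2)])
    obtain C t where Ct: "(C, t) \<in> svd (lift.l (1\<^sub>m n - R) N B)" by (rule svd_solverE[OF svd])
    show ?thesis using weighted_lift.wcert_le_card[OF 1 w svd_solverD[OF svd Ct]] cards by simp
  qed
  show "k \<le> n" if w: "wcert n (Wperp A) (\<lambda>i. x $ i) B N \<tau> k"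
  proof (cases "N = {} \<or> B = {}")
    case True
    then have "B = {} \<or> N = {}" by auto
    then show ?thesis using wcert_trivial[OF w \<tau> Wperp_zero N] by simp
  next
    case False
    then have ne: "B \<noteq> {}" "N \<noteq> {}" by auto
    obtain R where 1: "weighted_lift n R B N (Wperp A) (\<lambda>i. x $ i)"
      by (rule cheap_lift_cases[OF x B ne(1) N ne(2)])
    obtain C t where Ct: "(C, t) \<in> svd (lift.l R B N)" by (rule svd_solverE[OF svd])
    show ?thesis using weighted_lift.wcert_le_card[OF 1 w svd_solverD[OF svd Ct]] cards by simp
  qed
qed

section \<open>The polarized partition of a linear segment\<close>

locale segment = lp +
  fixes X Y :: "real \<Rightarrow> real vec" and t lo hi :: real
  assumes t: "0 < t" "t \<le> 1" and lohi: "0 \<le> lo" "lo < hi"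
    and cp: "\<And>\<mu>. lo \<le> \<mu> \<Longrightarrow> \<mu> \<le> hi \<Longrightarrow> cpt t \<mu> (X \<mu>) (Y \<mu>)"
    and affX: "\<And>l i. 0 \<le> l \<Longrightarrow> l \<le> 1 \<Longrightarrow> i < n \<Longrightarrow> X ((1 - l) * lo + l * hi) $ i = (1 - l) * X lo $ i + l * X hi $ i"
    and affY: "\<And>l i. 0 \<le> l \<Longrightarrow> l \<le> 1 \<Longrightarrow> i < n \<Longrightarrow> Y ((1 - l) * lo + l * hi) $ i = (1 - l) * Y lo $ i + l * Y hi $ i"
begin

text \<open>The comparison is cross-multiplied: \<open>i\<close> belongs to \<open>PB\<close> when
  the primal coordinate keeps at least as large a fraction of its value at \<open>hi\<close> as the
  dual one does. Ties go to \<open>PB\<close>.\<close>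

definition "PB = {i. i < n \<and> Y lo $ i * X hi $ i \<le> X lo $ i * Y hi $ i}"
definition "PN = {..<n} - PB"
text \<open>The loss of the scalar estimates \<open>polarized_ratio\<close> and
  \<open>small_endpoint\<close>, used as the price of every comparison between iterates of the
  segment.\<close>

definition "pol = 20 * real n ^ 3 / t\<^sup>2"

lemma PBN: "PB \<subseteq> {..<n}" "PN = {..<n} - PB" "\<And>i. i \<in> PB \<Longrightarrow> i < n" "\<And>i. i \<in> PN \<Longrightarrow> i < n"
  by (auto simp: PB_def PN_def)

lemma n1: "1 \<le> real n" using n0 by simp

lemma pol20: "20 \<le> pol"
proof -
  have "t\<^sup>2 \<le> 1" "0 < t\<^sup>2" using t power_le_one[of t 2] by auto
  moreover have "1 \<le> real n ^ 3" by (rule one_le_power[OF n1])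
  ultimately have "20 * t\<^sup>2 \<le> 20 * real n ^ 3" by linarith
  then show ?thesis using \<open>0 < t\<^sup>2\<close> by (simp add: pol_def pos_le_divide_eq)
qed

lemma cpD:
  assumes "lo \<le> \<mu>" "\<mu> \<le> hi"
  shows "feas (X \<mu>) (Y \<mu>)" "X \<mu> \<in> carrier_vec n" "Y \<mu> \<in> carrier_vec n"
    "\<And>i. i < n \<Longrightarrow> 0 \<le> X \<mu> $ i \<and> 0 \<le> Y \<mu> $ i" "\<And>i. i < n \<Longrightarrow> t * \<mu> \<le> X \<mu> $ i * Y \<mu> $ i"
    "(\<Sum>i<n. X \<mu> $ i * Y \<mu> $ i) = real n * \<mu>" "\<And>i. i < n \<Longrightarrow> X \<mu> $ i * Y \<mu> $ i \<le> real n * \<mu>"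
proof -
  note h = cp[OF assms, unfolded cpt_def]
  show "feas (X \<mu>) (Y \<mu>)" "\<And>i. i < n \<Longrightarrow> 0 \<le> X \<mu> $ i \<and> 0 \<le> Y \<mu> $ i" "\<And>i. i < n \<Longrightarrow> t * \<mu> \<le> X \<mu> $ i * Y \<mu> $ i"
    and sm: "(\<Sum>i<n. X \<mu> $ i * Y \<mu> $ i) = real n * \<mu>" using h by blast+
  then show "X \<mu> \<in> carrier_vec n" "Y \<mu> \<in> carrier_vec n" by (auto simp: feas_def)
  fix i assume i: "i < n"
  have "X \<mu> $ i * Y \<mu> $ i \<le> (\<Sum>i<n. X \<mu> $ i * Y \<mu> $ i)"
    by (rule member_le_sum) (use i h in auto)
  then show "X \<mu> $ i * Y \<mu> $ i \<le> real n * \<mu>" unfolding sm .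
qed

lemma polarized:
  assumes \<mu>: "lo \<le> \<mu>" "\<mu> \<le> hi"
  shows "i \<in> PB \<Longrightarrow> t / (4 * real n) * X hi $ i \<le> X \<mu> $ i" "i \<in> PN \<Longrightarrow> t / (4 * real n) * Y hi $ i \<le> Y \<mu> $ i"
proof -
  have h: "lo \<le> hi" "hi \<le> hi" using lohi by auto
  show "t / (4 * real n) * X hi $ i \<le> X \<mu> $ i" if "i \<in> PB"
  proof -
    have i: "i < n" and dom: "Y lo $ i * X hi $ i \<le> X lo $ i * Y hi $ i" using that by (auto simp: PB_def)
    show ?thesis
      by (rule polarize_coordinate[where x = "\<lambda>\<mu>. X \<mu> $ i" and s = "\<lambda>\<mu>. Y \<mu> $ i", OF n1 t lohi _ _ _ cpD(7)[OF h i] dom \<mu>])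
        (use affX affY cpD(4,5) i in auto)
  qed
  show "t / (4 * real n) * Y hi $ i \<le> Y \<mu> $ i" if "i \<in> PN"
  proof -
    have i: "i < n" and dom: "X lo $ i * Y hi $ i \<le> Y lo $ i * X hi $ i" using that by (auto simp: PB_def PN_def)
    have up: "Y hi $ i * X hi $ i \<le> real n * hi" using cpD(7)[OF h i] by (simp add: mult.commute)
    show ?thesis
      by (rule polarize_coordinate[where s = "\<lambda>\<mu>. X \<mu> $ i" and x = "\<lambda>\<mu>. Y \<mu> $ i", OF n1 t lohi _ _ _ up dom \<mu>])
        (use affX affY cpD(4,5) i in \<open>auto simp: mult.commute\<close>)
  qed
qed

lemma iterate_cross:
  assumes z: "(x, s) \<in> N2 A b c (\<beta> / 8)" and \<nu>: "lo \<le> \<nu>" "\<nu> \<le> hi" and i: "i < n"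
  shows "X \<nu> $ i * s $ i \<le> real n * (mubar (x, s) + \<nu>)" "x $ i * Y \<nu> $ i \<le> real n * (mubar (x, s) + \<nu>)"
proof -
  note zD = N2D[OF z]
  have sm: "(\<Sum>i<n. x $ i * s $ i) = real n * mubar (x, s)" using mubar_eq[OF zD(1,2)] n0 by simp
  have nn: "0 \<le> x $ i \<and> 0 \<le> s $ i" if "i < n" for i using zD(6,7)[OF that] by simp
  show "X \<nu> $ i * s $ i \<le> real n * (mubar (x, s) + \<nu>)" "x $ i * Y \<nu> $ i \<le> real n * (mubar (x, s) + \<nu>)"
    by (rule cross_bound[OF zD(3) cpD(1)[OF \<nu>] nn cpD(4)[OF \<nu>] sm cpD(6)[OF \<nu>] i]; assumption)+
qed

lemma curve_le_iterate:
  assumes z: "(x, s) \<in> N2 A b c (\<beta> / 8)" and \<beta>: "\<beta> \<le> 1 / 6" and \<nu>: "lo \<le> \<nu>" "\<nu> \<le> hi" "\<nu> \<le> mubar (x, s)" and i: "i < n"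
  shows "X \<nu> $ i \<le> 12 / 5 * real n * x $ i" "Y \<nu> $ i \<le> 12 / 5 * real n * s $ i"
proof -
  note zD = N2D[OF z] and e = N2_eighth(1)[OF z \<beta> i] and cr = iterate_cross[OF z \<nu>(1,2) i]
  have nn: "0 \<le> X \<nu> $ i" "0 \<le> Y \<nu> $ i" using cpD(4)[OF \<nu>(1,2) i] by auto
  show "X \<nu> $ i \<le> 12 / 5 * real n * x $ i"
    by (rule iterate_near_curve[OF zD(5) zD(6)[OF i] nn(1) cr(1) \<nu>(3) n1 e])
  show "Y \<nu> $ i \<le> 12 / 5 * real n * s $ i"
    by (rule iterate_near_curve[OF zD(5) zD(7)[OF i] nn(2) _ \<nu>(3) n1])
      (use cr(2) e in \<open>simp_all only: mult.commute[of "s $ i"] mult.commute[of "Y \<nu> $ i"]\<close>)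
qed

lemma iterate_le_start:
  assumes z: "(x, s) \<in> N2 A b c (\<beta> / 8)" and hi: "mubar (x, s) \<le> hi" and i: "i < n"
  shows "t * x $ i \<le> 2 * real n * X hi $ i" "t * s $ i \<le> 2 * real n * Y hi $ i"
proof -
  have h: "lo \<le> hi" "hi \<le> hi" "0 < hi" using lohi by auto
  note zD = N2D[OF z] and cr = iterate_cross[OF z h(1,2) i] and nn = cpD(4)[OF h(1,2) i] and th = cpD(5)[OF h(1,2) i]
  have p: "0 \<le> x $ i" "0 \<le> s $ i" using zD(6,7)[OF i] by auto
  show "t * x $ i \<le> 2 * real n * X hi $ i"
    by (rule iterate_below_start[OF h(3) _ n1 cr(2) hi p(1) th]) (use nn in blast)
  show "t * s $ i \<le> 2 * real n * Y hi $ i"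
    by (rule iterate_below_start[OF h(3) _ n1 _ hi p(2)]) (use nn cr(1) th in \<open>simp_all add: mult.commute\<close>)
qed

lemma endpoint_small:
  assumes z: "(x, s) \<in> N2 A b c (\<beta> / 8)" and \<beta>: "\<beta> \<le> 1 / 6" and hi: "mubar (x, s) \<le> hi"
  shows "i \<in> PN \<Longrightarrow> X lo $ i * mubar (x, s) \<le> pol * lo * x $ i" "i \<in> PB \<Longrightarrow> Y lo $ i * mubar (x, s) \<le> pol * lo * s $ i"
proof -
  have h: "lo \<le> lo" "lo \<le> hi" using lohi by auto
  note zD = N2D[OF z]
  show "X lo $ i * mubar (x, s) \<le> pol * lo * x $ i" if iN: "i \<in> PN"
  proof -
    note i = PBN(4)[OF iN]
    note nn = cpD(4)[OF h i]
    show ?thesis unfolding pol_def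
      by (rule small_endpoint[OF t(1) n1 zD(6)[OF i] less_imp_le[OF zD(7)[OF i]] conjunct1[OF nn] zD(5) cpD(7)[OF h i]
          polarized(2)[OF h iN] iterate_le_start(2)[OF z hi i] N2_eighth(1)[OF z \<beta> i] lohi(1)])
  qed
  show "Y lo $ i * mubar (x, s) \<le> pol * lo * s $ i" if iB: "i \<in> PB"
  proof -
    note i = PBN(3)[OF iB]
    note nn = cpD(4)[OF h i]
    have 1: "Y lo $ i * X lo $ i \<le> real n * lo" using cpD(7)[OF h i] by (simp add: mult.commute)
    have 2: "5 / 6 * mubar (x, s) \<le> s $ i * x $ i" using N2_eighth(1)[OF z \<beta> i] by (simp add: mult.commute)
    show ?thesis unfolding pol_def
      by (rule small_endpoint[OF t(1) n1 zD(7)[OF i] less_imp_le[OF zD(6)[OF i]] conjunct2[OF nn] zD(5) 1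
          polarized(1)[OF h iB] iterate_le_start(1)[OF z hi i] 2 lohi(1)])
  qed
qed

text \<open>On \<open>PN\<close> polarization bounds the dual coordinates,
  \<open>s $ i \<le> pol * s' $ i\<close>. Since the products are close to the duality measures,
  this inverts into a bound on \<open>x'\<close> that carries the ratio of the measures; it is here
  that the lifts become shorter as the measure decreases.\<close>

lemma iterate_ratio:
  assumes z: "(x, s) \<in> N2 A b c (\<beta> / 8)" "(x', s') \<in> N2 A b c (\<beta> / 8)" and \<beta>: "\<beta> \<le> 1 / 6"
    and hi: "mubar (x, s) \<le> hi" and lo: "lo \<le> mubar (x', s')" and le: "mubar (x', s') \<le> mubar (x, s)"
  shows "i \<in> PB \<Longrightarrow> x $ i \<le> pol * x' $ i" "i \<in> PN \<Longrightarrow> x' $ i * mubar (x, s) \<le> 2 * pol * mubar (x', s') * x $ i"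
proof -
  note zD = N2D[OF z(1)] and zD' = N2D[OF z(2)]
  have h: "lo \<le> mubar (x', s')" "mubar (x', s') \<le> hi" using lo le hi by auto
  show "x $ i \<le> pol * x' $ i" if iB: "i \<in> PB"
  proof -
    note i = PBN(3)[OF iB]
    show ?thesis unfolding pol_def
      by (rule polarized_ratio[OF t(1) n1 iterate_le_start(1)[OF z(1) hi i] polarized(1)[OF h iB]
         curve_le_iterate(1)[OF z(2) \<beta> h order.refl i] less_imp_le[OF zD'(6)[OF i]]])
  qed
  show "x' $ i * mubar (x, s) \<le> 2 * pol * mubar (x', s') * x $ i" if iN: "i \<in> PN"
  proof -
    note i = PBN(4)[OF iN]
    have p: "0 < x $ i" "0 < s $ i" "0 < x' $ i" "0 < s' $ i" using zD(6,7)[OF i] zD'(6,7)[OF i] by auto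
    have s: "s $ i \<le> pol * s' $ i" unfolding pol_def
      by (rule polarized_ratio[OF t(1) n1 iterate_le_start(2)[OF z(1) hi i] polarized(2)[OF h iN]
         curve_le_iterate(2)[OF z(2) \<beta> h order.refl i] less_imp_le[OF p(4)]])
    have "x' $ i * (5 / 6 * mubar (x, s)) \<le> x' $ i * (x $ i * s $ i)" using N2_eighth(1)[OF z(1) \<beta> i] p by (intro mult_left_mono) auto
    also have "\<dots> \<le> x' $ i * (x $ i * (pol * s' $ i))" using s p by (intro mult_left_mono) auto
    also have "\<dots> = pol * x $ i * (x' $ i * s' $ i)" by simp
    also have "\<dots> \<le> pol * x $ i * (7 / 6 * mubar (x', s'))" using N2_eighth(2)[OF z(2) \<beta> i] p pol20 by (intro mult_left_mono) auto
    finally have "x' $ i * mubar (x, s) \<le> 7 / 5 * (pol * mubar (x', s') * x $ i)" by (simp add: algebra_simps)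
    also have "\<dots> \<le> 2 * (pol * mubar (x', s') * x $ i)" using p pol20 zD'(5) by (intro mult_right_mono) auto
    finally show ?thesis by simp
  qed
qed

end

section \<open>The potential of an iterate\<close>

text \<open>\<open>G'\<close> holds the counts at the later iterate, \<open>G\<close> those at the
  present one, and \<open>H\<close> the present counts at the higher threshold. Equal outer maxima
  place the maximum in \<open>H\<close>, which means that a gap is present.\<close>

lemma Max_squeeze:
  fixes G G' H :: "nat set"
  assumes "finite G" "G' \<subseteq> H" "H \<subseteq> G" "G' \<noteq> {}"
  shows "Max G' \<le> Max G" "Max G' = Max G \<Longrightarrow> Max G \<in> H" "\<And>k. k \<in> G \<Longrightarrow> k \<le> Max G"
proof -
  have sub: "G' \<subseteq> G" using assms(2,3) by (rule order.trans)
  have f: "finite G'" by (rule finite_subset[OF sub assms(1)])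
  show "Max G' \<le> Max G" by (rule Max_mono[OF sub assms(4,1)])
  show "Max G \<in> H" if "Max G' = Max G" using Max_in[OF f assms(4)] that assms(2) by auto
  show "k \<le> Max G" if "k \<in> G" for k using assms(1) that by simp
qed

context segment
begin

text \<open>The directions \<open>X lo - x\<close> and \<open>Y lo - s\<close> lead to the lower end
  of the segment. There the primal coordinates on \<open>PN\<close> have shrunk at least by the
  factor \<open>R\<close>, and the dual ones on \<open>PB\<close> likewise, so these directions
  nearly cancel \<open>x\<close> and \<open>s\<close> where they should; the gap replaces them by
  elements of the cheap lift spaces.\<close>

lemma lifted_spaces_near_zero:
  assumes svd: "svd_solver 2 svd" and z: "(x, s) \<in> N2 A b c (\<beta> / 8)" and \<beta>: "\<beta> \<le> 1 / 6"
    and lo: "lo \<le> mubar (x, s)" and hi: "mubar (x, s) \<le> hi" and R: "1 \<le> R" and sm: "pol * lo * R \<le> mubar (x, s)"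
    and \<eta>: "0 < \<eta>" "\<eta> \<le> 1 / 4"
    and cP: "wcert n (W A) (\<lambda>i. 1 / x $ i) PN PB R k" and maxP: "\<And>k'. wcert n (W A) (\<lambda>i. 1 / x $ i) PN PB \<eta> k' \<Longrightarrow> k' \<le> k"
    and cD: "wcert n (Wperp A) (\<lambda>i. x $ i) PB PN R l" and maxD: "\<And>k'. wcert n (Wperp A) (\<lambda>i. x $ i) PB PN \<eta> k' \<Longrightarrow> k' \<le> l"
    and e: "e = 13 * (real n)\<^sup>2 / R" "e \<le> 1 / 20"
    and cl: "cheap_lift_spaces A svd x PB PN V U"
  shows "near_zero PN PB e (3 * real n * \<eta>) V (\<lambda>i. 1 / x $ i) x"
    "near_zero PB PN e (3 * real n * \<eta>) U (\<lambda>i. x $ i / mubar (x, s)) s"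
proof -
  note zD = N2D[OF z]
  define \<mu> where "\<mu> = mubar (x, s)"
  have \<mu>: "0 < \<mu>" using zD(5) by (simp add: \<mu>_def)
  have R0: "0 < R" using R by simp
  have d: "dim_col A = n" using A by simp
  have h: "lo \<le> lo" "lo \<le> hi" using lohi by auto
  have wP: "X lo - x \<in> W A" and wD: "Y lo - s \<in> Wperp A" using feas_diff[OF cpD(1)[OF h] zD(3)] by auto
  have w: "(X lo - x) $ i = X lo $ i - x $ i" "(Y lo - s) $ i = Y lo $ i - s $ i" if "i < n" for i
    using that zD(1,2) by auto
  have nn: "real n \<le> (real n)\<^sup>2" using n1 by (simp add: power2_eq_square)
  have e0: "0 \<le> e" using R0 e by simp
  have fin: "PN \<subseteq> {..<n}" "PB \<subseteq> {..<n}" using PBN by auto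
  have P1: "\<bar>1 / x $ i * (X lo - x) $ i\<bar> \<le> 12 / 5 * real n" if i: "i < n" for i
  proof -
    have "\<bar>X lo $ i - x $ i\<bar> \<le> 12 / 5 * real n * x $ i"
    proof -
      have "1 * x $ i \<le> 12 / 5 * real n * x $ i" using zD(6)[OF i] n1 by (intro mult_right_mono) auto
      then show ?thesis using curve_le_iterate(1)[OF z \<beta> h lo i] cpD(4)[OF h i] zD(6)[OF i] by linarith
    qed
    then show ?thesis using zD(6)[OF i] by (simp add: w[OF i] abs_mult pos_divide_le_eq)
  qed
  have P2: "\<bar>1 / x $ i * (x $ i + (X lo - x) $ i)\<bar> \<le> 1 / R" if iN: "i \<in> PN" for i
  proof -
    note i = PBN(4)[OF iN]
    have "X lo $ i * \<mu> * R \<le> pol * lo * x $ i * R"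
      using endpoint_small(1)[OF z \<beta> hi iN] R0 unfolding \<mu>_def by (intro mult_right_mono) auto
    also have "\<dots> = pol * lo * R * x $ i" by simp
    also have "\<dots> \<le> \<mu> * x $ i" using sm zD(6)[OF i] unfolding \<mu>_def by (intro mult_right_mono) auto
    finally have "\<mu> * (X lo $ i * R) \<le> \<mu> * x $ i" by (simp add: mult_ac)
    then have "X lo $ i * R \<le> x $ i" using \<mu> by (simp only: mult_le_cancel_left_pos)
    then show ?thesis using zD(6)[OF i] R0 cpD(4)[OF h i] by (simp add: w[OF i] abs_mult field_simps)
  qed
  have P3: "\<bar>1 / x $ i * x $ i\<bar> \<le> 1" if "i < n" for i using zD(6)[OF that] by simp
  have D1: "\<bar>x $ i * (Y lo - s) $ i\<bar> \<le> 14 / 5 * real n * \<mu>" if i: "i < n" for i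
  proof -
    have xs: "x $ i * s $ i \<le> 7 / 6 * \<mu>" "0 \<le> x $ i * s $ i" using N2_eighth(2)[OF z \<beta> i] zD(6,7)[OF i] by (auto simp: \<mu>_def)
    have "x $ i * Y lo $ i \<le> x $ i * (12 / 5 * real n * s $ i)"
      using curve_le_iterate(2)[OF z \<beta> h lo i] zD(6)[OF i] by (intro mult_left_mono) auto
    also have "\<dots> = 12 / 5 * real n * (x $ i * s $ i)" by simp
    also have "\<dots> \<le> 12 / 5 * real n * (7 / 6 * \<mu>)" using xs by (intro mult_left_mono) auto
    also have "\<dots> = 14 / 5 * real n * \<mu>" by simp
    finally have "x $ i * Y lo $ i \<le> 14 / 5 * real n * \<mu>" .
    moreover have "0 \<le> x $ i * Y lo $ i" using cpD(4)[OF h i] zD(6)[OF i] by simp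
    moreover have "7 / 6 * \<mu> \<le> 14 / 5 * real n * \<mu>" using n1 \<mu> by (intro mult_right_mono) auto
    moreover have "x $ i * (Y lo - s) $ i = x $ i * Y lo $ i - x $ i * s $ i" by (simp add: w[OF i] right_diff_distrib)
    ultimately show ?thesis using xs by linarith
  qed
  have D2: "\<bar>x $ i * (s $ i + (Y lo - s) $ i)\<bar> \<le> 7 / 6 * \<mu> / R" if iB: "i \<in> PB" for i
  proof -
    note i = PBN(3)[OF iB]
    have xs: "x $ i * s $ i \<le> 7 / 6 * \<mu>" "0 < x $ i" "0 < s $ i" using N2_eighth(2)[OF z \<beta> i] zD(6,7)[OF i] by (auto simp: \<mu>_def)
    have "x $ i * R * (Y lo $ i * \<mu>) \<le> x $ i * R * (pol * lo * s $ i)"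
      using endpoint_small(2)[OF z \<beta> hi iB] R0 xs unfolding \<mu>_def by (intro mult_left_mono) auto
    also have "\<dots> = pol * lo * R * (x $ i * s $ i)" by simp
    also have "\<dots> \<le> \<mu> * (7 / 6 * \<mu>)" using sm[folded \<mu>_def] xs \<mu> by (intro mult_mono[of _ \<mu> "x $ i * s $ i"]) simp_all
    finally have "\<mu> * (x $ i * Y lo $ i * R) \<le> \<mu> * (7 / 6 * \<mu>)" by (simp add: mult_ac)
    then have "x $ i * Y lo $ i * R \<le> 7 / 6 * \<mu>" using \<mu> by (simp only: mult_le_cancel_left_pos)
    then have "x $ i * Y lo $ i \<le> 7 / 6 * \<mu> / R" using R0 by (simp only: pos_le_divide_eq)
    moreover have "0 \<le> x $ i * Y lo $ i" using cpD(4)[OF h i] xs by simp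
    ultimately show ?thesis by (simp add: w[OF i])
  qed
  have D3: "\<bar>x $ i * s $ i\<bar> \<le> 7 / 6 * \<mu>" if i: "i < n" for i
    using N2_eighth(2)[OF z \<beta> i] zD(6,7)[OF i] by (simp add: \<mu>_def)
  have "real n * (1 / R) + 4 * (real n * (12 / 5 * real n)) / R = (real n + 48 / 5 * (real n)\<^sup>2) / R"
    by (simp add: power2_eq_square add_divide_distrib)
  \<comment> \<open>The constant 13 covers \<open>1 + 48 / 5\<close> here and
    \<open>7 / 6 + 56 / 5\<close> on the dual side.\<close>
  also have "\<dots> \<le> e" unfolding e(1) using nn R0 by (intro divide_right_mono) linarith+
  finally have eP: "real n * (1 / R) + 4 * (real n * (12 / 5 * real n)) / R \<le> e" .
  have "2 * \<eta> * (real n * 1 + 2 * e) \<le> 2 * \<eta> * (3 / 2 * real n)" using e(2) n1 \<eta> by (intro mult_left_mono) linarith+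
  also have "\<dots> = 3 * real n * \<eta>" by simp
  finally have eP': "2 * \<eta> * (real n * 1 + 2 * e) \<le> 3 * real n * \<eta>" .
  have "real n * (7 / 6 * \<mu> / R) + 4 * (real n * (14 / 5 * real n * \<mu>)) / R = \<mu> * ((7 / 6 * real n + 56 / 5 * (real n)\<^sup>2) / R)"
    by (simp add: power2_eq_square add_divide_distrib algebra_simps)
  also have "\<dots> \<le> \<mu> * e" unfolding e(1) using nn R0 \<mu> by (intro mult_left_mono divide_right_mono) linarith+
  finally have eD: "real n * (7 / 6 * \<mu> / R) + 4 * (real n * (14 / 5 * real n * \<mu>)) / R \<le> \<mu> * e" .
  have "2 * \<eta> * (\<mu> * (7 / 6 * real n + 2 * e)) \<le> 2 * \<eta> * (\<mu> * (3 / 2 * real n))"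
    using e(2) n1 \<eta> \<mu> by (intro mult_left_mono) (linarith | simp)+
  then have eD': "2 * \<eta> * (real n * (7 / 6 * \<mu>) + 2 * (\<mu> * e)) \<le> \<mu> * (3 * real n * \<eta>)" by (simp add: algebra_simps)
  have LP: "L2_set (\<lambda>i. 1 / x $ i * (X lo - x) $ i) S \<le> real n * (12 / 5 * real n)" if "S \<subseteq> {..<n}" for S
    by (rule L2_set_bounded_le[OF _ _ that]) (use P1 that in auto)
  have LD: "L2_set (\<lambda>i. x $ i * (Y lo - s) $ i) S \<le> real n * (14 / 5 * real n * \<mu>)" if "S \<subseteq> {..<n}" for S
    by (rule L2_set_bounded_le[OF _ _ that]) (use D1 that \<mu> in auto)
  have LP2: "L2_set (\<lambda>i. 1 / x $ i * (x $ i + (X lo - x) $ i)) PN \<le> real n * (1 / R)"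
    by (rule L2_set_bounded_le[OF _ P2 fin(1)]) (use R0 in auto)
  have LD2: "L2_set (\<lambda>i. x $ i * (s $ i + (Y lo - s) $ i)) PB \<le> real n * (7 / 6 * \<mu> / R)"
    by (rule L2_set_bounded_le[OF _ D2 fin(2)]) (use R0 \<mu> in auto)
  have LP3: "L2_set (\<lambda>i. 1 / x $ i * x $ i) PN \<le> real n * 1"
    by (rule L2_set_bounded_le[OF _ P3 fin(1)]) (use PBN in auto)
  have LD3: "L2_set (\<lambda>i. x $ i * s $ i) PB \<le> real n * (7 / 6 * \<mu>)"
    by (rule L2_set_bounded_le[OF _ D3 fin(2)]) (use PBN \<mu> in auto)
  have p0: "0 \<le> 4 * (real n * (12 / 5 * real n)) / R" "0 \<le> 4 * (real n * (14 / 5 * real n * \<mu>)) / R" using R0 \<mu> by auto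
  have e'0: "0 \<le> 3 * real n * \<eta>" using \<eta> by simp
  have m0: "0 \<le> \<mu> * e" "0 \<le> \<mu> * (3 * real n * \<eta>)" using \<mu> e0 e'0 by simp_all
  have "near_zero PN PB e (3 * real n * \<eta>) V (\<lambda>i. 1 / x $ i) x \<and>
    near_zero PB PN (\<mu> * e) (\<mu> * (3 * real n * \<eta>)) U (\<lambda>i. x $ i) s"
  proof (cases "PB = {}")
    case True
    then have VU: "V = W A" "U = {0\<^sub>v n}" using cl unfolding cheap_lift_spaces_def Let_def d by auto
    have "near_zero PN {} e (3 * real n * \<eta>) V (\<lambda>i. 1 / x $ i) x"
      by (rule near_zero_all[OF wP[folded VU(1)] _ e'0]) (use LP2 eP p0 in linarith)
    moreover have "near_zero {} PN (\<mu> * e) (\<mu> * (3 * real n * \<eta>)) U (\<lambda>i. x $ i) s"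
      unfolding VU(2) by (rule near_zero_none[OF fin(1) m0])
    ultimately show ?thesis unfolding True by blast
  next
    case ne1: False
    show ?thesis
    proof (cases "PN = {}")
      case True
      then have VU: "U = Wperp A" "V = {0\<^sub>v n}" using cl ne1 unfolding cheap_lift_spaces_def Let_def d by auto
      have "near_zero PB {} (\<mu> * e) (\<mu> * (3 * real n * \<eta>)) U (\<lambda>i. x $ i) s"
        by (rule near_zero_all[OF wD[folded VU(1)] _ m0(2)]) (use LD2 eD p0 in linarith)
      moreover have "near_zero {} PB e (3 * real n * \<eta>) V (\<lambda>i. 1 / x $ i) x"
        unfolding VU(2) by (rule near_zero_none[OF fin(2) e0 e'0])
      ultimately show ?thesis unfolding True by blast
    next
      case ne2: False
      have "\<exists>Q C t' C' t''. weighted_lift n (1\<^sub>m n - Q) PN PB (W A) (\<lambda>i. 1 / x $ i) \<and>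
        weighted_lift n Q PB PN (Wperp A) (\<lambda>i. x $ i) \<and>
        (C, t') \<in> svd (lift.l (1\<^sub>m n - Q) PN PB) \<and> (C', t'') \<in> svd (lift.l Q PB PN) \<and>
        V = (\<lambda>w. vec n (\<lambda>i. (lift.L (1\<^sub>m n - Q) PN *\<^sub>v w) $ i / (1 / x $ i))) `
          last_cols_span C (card {i. i < dim_vec t' \<and> t' $ i \<le> 1}) \<and>
        U = (\<lambda>w. vec n (\<lambda>i. (lift.L Q PB *\<^sub>v w) $ i / x $ i)) `
          last_cols_span C' (card {i. i < dim_vec t'' \<and> t'' $ i \<le> 1})"
      proof (rule cheap_lift_cases[OF zD(1,6) PBN(1) ne1 PBN(2) ne2], goal_cases)
        case (2 Q)
        from cl[unfolded 2(3)] 2(1,2) show ?case by blast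
      qed
      then obtain Q C t' C' t'' where 1: "weighted_lift n (1\<^sub>m n - Q) PN PB (W A) (\<lambda>i. 1 / x $ i)"
        and 2: "weighted_lift n Q PB PN (Wperp A) (\<lambda>i. x $ i)"
        and Ct: "(C, t') \<in> svd (lift.l (1\<^sub>m n - Q) PN PB)" "(C', t'') \<in> svd (lift.l Q PB PN)"
        and V: "V = (\<lambda>w. vec n (\<lambda>i. (lift.L (1\<^sub>m n - Q) PN *\<^sub>v w) $ i / (1 / x $ i))) `
          last_cols_span C (card {i. i < dim_vec t' \<and> t' $ i \<le> 1})"
        and U: "U = (\<lambda>w. vec n (\<lambda>i. (lift.L Q PB *\<^sub>v w) $ i / x $ i)) `
          last_cols_span C' (card {i. i < dim_vec t'' \<and> t'' $ i \<le> 1})"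
        by blast
      have "near_zero PN PB e (3 * real n * \<eta>) V (\<lambda>i. 1 / x $ i) x"
        by (rule weighted_lift.lifted_space_near_zero[OF 1 svd_solverD[OF svd Ct(1)] V refl cP _ \<eta> R wP LP[OF fin(2)] LP[OF fin(1)] LP2 LP3 eP eP'])
          (erule maxP)
      moreover have "near_zero PB PN (\<mu> * e) (\<mu> * (3 * real n * \<eta>)) U (\<lambda>i. x $ i) s"
        by (rule weighted_lift.lifted_space_near_zero[OF 2 svd_solverD[OF svd Ct(2)] U refl cD _ \<eta> R wD LD[OF fin(1)] LD[OF fin(2)] LD2 LD3 eD eD'])
          (erule maxD)
      ultimately show ?thesis by blast
    qed
  qed
  then show "near_zero PN PB e (3 * real n * \<eta>) V (\<lambda>i. 1 / x $ i) x"
    "near_zero PB PN e (3 * real n * \<eta>) U (\<lambda>i. x $ i / mubar (x, s)) s"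
    using near_zero_scale[OF \<mu>] unfolding \<mu>_def by blast+
qed

text \<open>The largest element plays the role of the number of singular values above
  \<open>\<tau>\<close>. Unlike that number it also makes sense when one part of the partition is
  empty.\<close>

definition cP :: "real \<Rightarrow> real vec \<Rightarrow> nat set" where
  "cP \<tau> x = {k. wcert n (W A) (\<lambda>i. 1 / x $ i) PN PB \<tau> k}"

definition cD :: "real \<Rightarrow> real vec \<Rightarrow> nat set" where
  "cD \<tau> x = {k. wcert n (Wperp A) (\<lambda>i. x $ i) PB PN \<tau> k}"

definition potential :: "real \<Rightarrow> real vec \<Rightarrow> nat" where
  "potential \<tau> x = Max (cP \<tau> x) + Max (cD \<tau> x)"

lemma certs_bounded:
  assumes svd: "svd_solver \<rho> svd" and z: "(x, s) \<in> N2 A b c \<beta>" and \<tau>: "0 \<le> \<tau>"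
  shows "cP \<tau> x \<subseteq> {..n}" "cD \<tau> x \<subseteq> {..n}" "cP \<tau> x \<noteq> {}" "cD \<tau> x \<noteq> {}" "finite (cP \<tau> x)" "finite (cD \<tau> x)"
proof -
  note zD = N2D[OF z]
  show 1: "cP \<tau> x \<subseteq> {..n}" "cD \<tau> x \<subseteq> {..n}"
    using wcert_bound[OF svd zD(1,6) PBN(1,2) \<tau>] by (auto simp: cP_def cD_def)
  show "cP \<tau> x \<noteq> {}" "cD \<tau> x \<noteq> {}" unfolding cP_def cD_def using wcert_0[OF W_zero] wcert_0[OF Wperp_zero] by blast+
  show "finite (cP \<tau> x)" "finite (cD \<tau> x)" using 1 finite_subset by auto
qed

lemma potential_le:
  assumes svd: "svd_solver \<rho> svd" and z: "(x, s) \<in> N2 A b c \<beta>" and \<tau>: "0 \<le> \<tau>"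
  shows "potential \<tau> x \<le> 2 * n"
proof -
  note h = certs_bounded[OF assms]
  have "Max (cP \<tau> x) \<le> n" "Max (cD \<tau> x) \<le> n" using Max_in[OF h(5,3)] Max_in[OF h(6,4)] h(1,2) by auto
  then show ?thesis by (simp add: potential_def)
qed

text \<open>If the potential does not drop, then no singular value of either cheap lift at \<open>x\<close> lies between
  \<open>1 / \<Omega>\<close> and \<open>\<Omega> * \<mu> / \<mu>\<^sub>1\<close>, where \<open>\<mu>\<close> and \<open>\<mu>\<^sub>1\<close> are the duality measures before and after the step.
  With such a gap the step would have reached less than \<open>\<mu>\<^sub>1\<close>.\<close>

lemma potential_drop:
  assumes svd: "svd_solver 2 svd" and z: "(x, s) \<in> N2 A b c (\<beta> / 8)" and z': "(x', s') \<in> N2 A b c (\<beta> / 8)"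
    and \<beta>: "0 < \<beta>" "\<beta> \<le> 1 / 6"
    and ap: "affine_part A \<beta> x s dxa dsa \<alpha>a B N" and lp: "lls_part A svd x s B N V U dxl dsl" and len: "length_part \<beta> x s dxl dsl \<alpha>l \<epsilon>"
    and z1: "z1 = better_of (x + \<alpha>a \<cdot>\<^sub>v dxa, s + \<alpha>a \<cdot>\<^sub>v dsa) (x + \<alpha>l \<cdot>\<^sub>v dxl, s + \<alpha>l \<cdot>\<^sub>v dsl)"
    and \<Omega>: "\<Omega> = 3000 * (real n)\<^sup>2 / \<beta>"
    and hi: "mubar (x, s) \<le> hi" and lo: "lo \<le> mubar (x', s')"
    and far: "2 * pol\<^sup>2 * \<Omega>\<^sup>2 * mubar (x', s') \<le> mubar z1"
  shows "potential (1 / \<Omega>) x' < potential (1 / \<Omega>) x"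
proof (rule ccontr)
  assume no: "\<not> ?thesis"
  note zD = N2D[OF z] and zD' = N2D[OF z']
  define \<mu> \<mu>' \<mu>1 where "\<mu> = mubar (x, s)" and "\<mu>' = mubar (x', s')" and "\<mu>1 = mubar z1"
  have \<mu>: "0 < \<mu>" "0 < \<mu>'" using zD(5) zD'(5) by (simp_all add: \<mu>_def \<mu>'_def)
  have nn: "1 \<le> (real n)\<^sup>2" using n1 by simp
  have "3000 * 1 \<le> 3000 * (real n)\<^sup>2 / \<beta>" using \<beta> nn by (simp add: pos_le_divide_eq)
  then have \<Omega>1: "3000 \<le> \<Omega>" unfolding \<Omega> by simp
  have "1 * 1 \<le> 2 * (pol\<^sup>2 * \<Omega>\<^sup>2)" "pol * \<Omega> \<le> 2 * (pol\<^sup>2 * \<Omega>\<^sup>2)"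
  proof -
    have "1 * 1 \<le> pol * \<Omega>" using pol20 \<Omega>1 by (intro mult_mono) auto
    then have "1 * 1 \<le> pol * \<Omega> * (pol * \<Omega>)" "1 * (pol * \<Omega>) \<le> pol * \<Omega> * (pol * \<Omega>)"
      by (intro mult_mono mult_right_mono; simp)+
    then show "1 * 1 \<le> 2 * (pol\<^sup>2 * \<Omega>\<^sup>2)" "pol * \<Omega> \<le> 2 * (pol\<^sup>2 * \<Omega>\<^sup>2)"
      by (simp_all add: power2_eq_square mult_ac)
  qed
  then have \<Lambda>: "1 \<le> 2 * pol\<^sup>2 * \<Omega>\<^sup>2" "pol * \<Omega> \<le> 2 * pol\<^sup>2 * \<Omega>\<^sup>2" by simp_all
  have far': "2 * pol\<^sup>2 * \<Omega>\<^sup>2 * \<mu>' \<le> \<mu>1" using far by (simp add: \<mu>'_def \<mu>1_def)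
  have "1 * \<mu>' \<le> 2 * pol\<^sup>2 * \<Omega>\<^sup>2 * \<mu>'" using \<Lambda>(1) \<mu> by (intro mult_right_mono) auto
  then have \<mu>'1: "\<mu>' \<le> \<mu>1" using far' by linarith
  then have \<mu>1: "0 < \<mu>1" using \<mu> by linarith
  have "\<mu>1 \<le> (1 - \<beta> / (3 * sqrt n)) * \<mu>" using post_step_progress(2)[OF svd z \<beta> ap lp len z1] by (simp add: \<mu>_def \<mu>1_def)
  also have "\<dots> \<le> 1 * \<mu>" using \<mu> \<beta> by (intro mult_right_mono) auto
  finally have \<mu>1\<mu>: "\<mu>1 \<le> \<mu>" by simp
  \<comment> \<open>The upper end of the gap is chosen so that the bound
    \<open>80 * e / \<beta> * \<mu>\<close> for the measure after the step becomes
    \<open>1040 / 3000 * \<mu>1\<close>, less than \<open>\<mu>1\<close> itself. This is what the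
    factor \<open>3000 * n\<^sup>2 / \<beta>\<close> in \<open>\<Omega>\<close> has to
    achieve.\<close>
  define R where "R = \<Omega> * \<mu> / \<mu>1"
  have "\<Omega> * \<mu>1 \<le> \<Omega> * \<mu>" using \<mu>1\<mu> \<Omega>1 by (intro mult_left_mono) auto
  then have R\<Omega>: "\<Omega> \<le> R" using \<mu>1 by (simp add: R_def pos_le_divide_eq)
  then have R1: "1 \<le> R" using \<Omega>1 by linarith
  have \<eta>: "0 < 1 / \<Omega>" "1 / \<Omega> \<le> 1 / 4" using \<Omega>1 by (auto simp: pos_divide_le_eq)
  then have \<eta>R: "1 / \<Omega> \<le> R" using R1 by linarith
  have le: "mubar (x', s') \<le> mubar (x, s)" using \<mu>'1 \<mu>1\<mu> by (simp add: \<mu>_def \<mu>'_def)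
  have lo': "lo \<le> mubar (x, s)" using lo le by linarith
  note ratio = iterate_ratio[OF z z' \<beta>(2) hi lo le]
  \<comment> \<open>Origin of the factor in \<open>far\<close>: \<open>2 * pol\<^sup>2\<close> pays
    for comparing the weights on both parts, and \<open>\<Omega>\<^sup>2\<close> for raising the
    threshold from \<open>1 / \<Omega>\<close> at \<open>x'\<close> to
    \<open>\<Omega> * \<mu> / \<mu>1\<close> at \<open>x\<close>.\<close>
  have "R * (2 * pol\<^sup>2 * \<mu>' * \<Omega>) = 2 * pol\<^sup>2 * \<Omega>\<^sup>2 * \<mu>' * (\<mu> / \<mu>1)" by (simp add: R_def power2_eq_square)
  also have "\<dots> \<le> \<mu>1 * (\<mu> / \<mu>1)" using far' \<mu> \<mu>1 by (intro mult_right_mono) auto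
  also have "\<dots> = \<mu>" using \<mu>1 by simp
  finally have R\<mu>: "R \<le> \<mu> / (2 * pol\<^sup>2 * \<mu>' * \<Omega>)" using pol20 \<mu> \<Omega>1 by (simp add: pos_le_divide_eq)
  have pol0: "0 < pol" using pol20 by linarith
  have e1: "1 / \<Omega> * (\<mu> / (2 * pol * \<mu>')) / pol = \<mu> / (2 * pol\<^sup>2 * \<mu>' * \<Omega>)"
    "1 / \<Omega> * (1 / pol) / (2 * pol * \<mu>' / \<mu>) = \<mu> / (2 * pol\<^sup>2 * \<mu>' * \<Omega>)"
    by (simp_all add: power2_eq_square)
  have subP: "cP (1 / \<Omega>) x' \<subseteq> cP R x"
  proof
    fix k assume "k \<in> cP (1 / \<Omega>) x'"
    then have k: "wcert n (W A) (\<lambda>i. 1 / x' $ i) PN PB (1 / \<Omega>) k" by (simp add: cP_def)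
    have "wcert n (W A) (\<lambda>i. 1 / x $ i) PN PB R k"
    proof (rule wcert_transfer[OF k, of pol "\<mu> / (2 * pol * \<mu>')"])
      show "0 \<le> 1 / x' $ i \<and> 1 / x' $ i \<le> pol * (1 / x $ i)" if "i \<in> PB" for i
        using ratio(1)[OF that] zD(6)[OF PBN(3)[OF that]] zD'(6)[OF PBN(3)[OF that]] by (simp add: field_simps)
      show "0 \<le> 1 / x $ i \<and> \<mu> / (2 * pol * \<mu>') * (1 / x $ i) \<le> 1 / x' $ i" if "i \<in> PN" for i
        using ratio(2)[OF that, folded \<mu>_def \<mu>'_def] zD(6)[OF PBN(4)[OF that]] zD'(6)[OF PBN(4)[OF that]] \<mu> pol0
        by (simp add: field_simps)
      show "R \<le> 1 / \<Omega> * (\<mu> / (2 * pol * \<mu>')) / pol" unfolding e1 by (rule R\<mu>)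
    qed (use \<eta> pol0 \<mu> in auto)
    then show "k \<in> cP R x" by (simp add: cP_def)
  qed
  have subD: "cD (1 / \<Omega>) x' \<subseteq> cD R x"
  proof
    fix k assume "k \<in> cD (1 / \<Omega>) x'"
    then have k: "wcert n (Wperp A) (\<lambda>i. x' $ i) PB PN (1 / \<Omega>) k" by (simp add: cD_def)
    have "wcert n (Wperp A) (\<lambda>i. x $ i) PB PN R k"
    proof (rule wcert_transfer[OF k, of "2 * pol * \<mu>' / \<mu>" "1 / pol"])
      show "0 \<le> x' $ i \<and> x' $ i \<le> 2 * pol * \<mu>' / \<mu> * x $ i" if "i \<in> PN" for i
        using ratio(2)[OF that, folded \<mu>_def \<mu>'_def] zD'(6)[OF PBN(4)[OF that]] \<mu> by (simp add: field_simps)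
      show "0 \<le> x $ i \<and> 1 / pol * x $ i \<le> x' $ i" if "i \<in> PB" for i
        using ratio(1)[OF that] zD(6)[OF PBN(3)[OF that]] pol0 by (simp add: field_simps)
      show "R \<le> 1 / \<Omega> * (1 / pol) / (2 * pol * \<mu>' / \<mu>)" unfolding e1 by (rule R\<mu>)
    qed (use \<eta> pol0 \<mu> in auto)
    then show "k \<in> cD R x" by (simp add: cD_def)
  qed
  have x0: "0 < x $ i" if "i \<in> PB \<or> i \<in> PN" for i using zD(6) PBN(3,4) that by blast
  \<comment> \<open>Same iterate, lower threshold: a transfer in which both weight factors are
    1.\<close>
  have mono: "cP R x \<subseteq> cP (1 / \<Omega>) x" "cD R x \<subseteq> cD (1 / \<Omega>) x"
  proof -
    show "cP R x \<subseteq> cP (1 / \<Omega>) x" unfolding cP_def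
      by (intro Collect_mono impI, erule wcert_transfer[where p = 1 and c = 1]) (use R1 \<eta> \<eta>R x0 in \<open>auto simp: less_imp_le\<close>)
    show "cD R x \<subseteq> cD (1 / \<Omega>) x" unfolding cD_def
      by (intro Collect_mono impI, erule wcert_transfer[where p = 1 and c = 1]) (use R1 \<eta> \<eta>R x0 in \<open>auto simp: less_imp_le\<close>)
  qed
  note cb = certs_bounded[OF svd z less_imp_le[OF \<eta>(1)]] and cb' = certs_bounded[OF svd z' less_imp_le[OF \<eta>(1)]]
  note mP = Max_squeeze[OF cb(5) subP mono(1) cb'(3)] and mD = Max_squeeze[OF cb(6) subD mono(2) cb'(4)]
  \<comment> \<open>Neither maximum can grow from \<open>x\<close> to \<open>x'\<close>, so without
    a drop of the sum both are unchanged. Each common value is then certified at \<open>x\<close>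
    for the threshold \<open>R\<close>, while no larger one is certified for
    \<open>1 / \<Omega>\<close>.\<close>
  have eqs: "Max (cP (1 / \<Omega>) x') = Max (cP (1 / \<Omega>) x)" "Max (cD (1 / \<Omega>) x') = Max (cD (1 / \<Omega>) x)"
    using no mP(1) mD(1) unfolding potential_def by linarith+
  \<comment> \<open>The lower end \<open>lo\<close> does not exceed the later measure
    \<open>\<mu>'\<close>, so the separation in \<open>far\<close> applies to it as well.\<close>
  have smR: "pol * lo * R \<le> mubar (x, s)"
  proof -
    have "pol * \<Omega> * lo \<le> 2 * pol\<^sup>2 * \<Omega>\<^sup>2 * \<mu>'" using \<Lambda> lo lohi(1) pol20 \<Omega>1 \<mu> unfolding \<mu>'_def[symmetric]
      by (intro mult_mono[of "pol * \<Omega>"]) simp_all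
    then have "pol * \<Omega> * lo * (\<mu> / \<mu>1) \<le> \<mu>1 * (\<mu> / \<mu>1)" using far' \<mu> \<mu>1 by (intro mult_right_mono) auto
    then show ?thesis using \<mu>1 by (simp add: R_def \<mu>_def mult_ac)
  qed
  define e where "e = 13 * (real n)\<^sup>2 / R"
  have "e \<le> 13 * (real n)\<^sup>2 / \<Omega>" unfolding e_def using R\<Omega> R1 \<Omega>1 by (intro divide_left_mono) auto
  also have "\<dots> = 13 / 3000 * \<beta>" using n0 by (simp add: \<Omega>)
  finally have e: "e \<le> \<beta> / 72" using \<beta> by linarith
  have e20: "e \<le> 1 / 20" using e \<beta> by linarith
  have e0: "0 \<le> e" using R1 by (simp add: e_def)
  have e': "3 * real n * (1 / \<Omega>) \<le> \<beta> / 36"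
  proof -
    have "3 * real n * 36 \<le> 3000 * (real n)\<^sup>2" using n1 by (simp add: power2_eq_square)
    then show ?thesis using \<beta> n0 by (simp add: \<Omega> field_simps)
  qed
  note near = lifted_spaces_near_zero[OF svd z \<beta>(2) lo' hi R1 smR \<eta>(1,2) mP(2)[OF eqs(1), unfolded cP_def mem_Collect_eq, folded cP_def] _
      mD(2)[OF eqs(2), unfolded cD_def mem_Collect_eq, folded cD_def] _ e_def e20]
  have kP: "k' \<le> Max (cP (1 / \<Omega>) x)" if "wcert n (W A) (\<lambda>i. 1 / x $ i) PN PB (1 / \<Omega>) k'" for k'
    using mP(3)[of k'] that by (simp add: cP_def)
  have kD: "k' \<le> Max (cD (1 / \<Omega>) x)" if "wcert n (Wperp A) (\<lambda>i. x $ i) PB PN (1 / \<Omega>) k'" for k'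
    using mD(3)[of k'] that by (simp add: cD_def)
  have "mubar z1 \<le> 80 * e / \<beta> * mubar (x, s)"
  proof (rule lls_step_collapse[OF svd z \<beta> ap lp len z1 PBN(1,2) _ _ e0 e e'])
    fix V U assume cl: "cheap_lift_spaces A svd x PB PN V U"
    show "near_zero PN PB e (3 * real n * (1 / \<Omega>)) V (\<lambda>i. 1 / x $ i) x"
      by (rule near(1)[OF _ _ cl]) (erule kP kD)+
    show "near_zero PB PN e (3 * real n * (1 / \<Omega>)) U (\<lambda>i. x $ i / mubar (x, s)) s"
      by (rule near(2)[OF _ _ cl]) (erule kP kD)+
  qed
  then have "\<mu>1 \<le> 80 * e / \<beta> * \<mu>" by (simp add: \<mu>_def \<mu>1_def)
  also have "\<dots> = 1040 / 3000 * \<mu>1" using \<beta> \<mu> \<mu>1 n0 by (simp add: e_def R_def \<Omega>)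
  finally show False using \<mu>1 by linarith
qed

end

section \<open>Counting iterations\<close>

text \<open>\<open>J\<close> is an interval of indices. More than \<open>h * (M + 1)\<close>
  elements would leave room for \<open>M + 2\<close> samples at distance \<open>h\<close>, hence for
  \<open>M + 1\<close> strict drops starting from a value of at most \<open>M\<close>.\<close>

lemma card_le_potential:
  fixes f :: "nat \<Rightarrow> nat"
  assumes fin: "finite J" and conv: "\<And>i j l. i \<in> J \<Longrightarrow> l \<in> J \<Longrightarrow> i \<le> j \<Longrightarrow> j \<le> l \<Longrightarrow> j \<in> J"
    and drop: "\<And>j. j \<in> J \<Longrightarrow> j + h \<in> J \<Longrightarrow> f (j + h) < f j" and le: "\<And>j. j \<in> J \<Longrightarrow> f j \<le> M"
  shows "card J \<le> h * (M + 1)"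
proof (rule ccontr)
  assume no: "\<not> card J \<le> h * (M + 1)"
  then have ne: "J \<noteq> {}" by auto
  define p where "p = Min J"
  have p: "p \<in> J" using fin ne by (simp add: p_def)
  have big: "p + h * (M + 1) \<le> Max J"
  proof (rule ccontr)
    assume "\<not> p + h * (M + 1) \<le> Max J"
    then have "j \<in> {p..<p + h * (M + 1)}" if "j \<in> J" for j
      using Max_ge[OF fin that] Min_le[OF fin that] by (simp add: p_def)
    then have "J \<subseteq> {p..<p + h * (M + 1)}" by (rule subsetI)
    from card_mono[OF _ this] show False using no by simp
  qed
  have inJ: "p + h * i \<in> J" if "i \<le> M + 1" for i
  proof (rule conv[OF p Max_in[OF fin ne]])
    have "h * i \<le> h * (M + 1)" using that by (rule mult_le_mono2)
    then show "p + h * i \<le> Max J" using big by linarith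
  qed simp
  have "f (p + h * i) + i \<le> M" if "i \<le> M + 1" for i
    using that
  proof (induction i)
    case 0
    then show ?case using le[OF p] by simp
  next
    case (Suc i)
    have e: "p + h * Suc i = p + h * i + h" by simp
    have "f (p + h * Suc i) < f (p + h * i)"
      unfolding e by (rule drop[OF inJ inJ[of "Suc i", unfolded e]]) (use Suc in auto)
    then show ?case using Suc by linarith
  qed
  from this[of "M + 1"] show False by simp
qed

lemma geometric_decay:
  fixes \<mu> :: "nat \<Rightarrow> real"
  assumes "\<And>j. j < k \<Longrightarrow> \<mu> (Suc j) \<le> q * \<mu> j" "0 \<le> q" "j + d \<le> k"
  shows "\<mu> (j + d) \<le> q ^ d * \<mu> j"
  using assms(3)
proof (induction d)
  case (Suc d)
  have "\<mu> (Suc (j + d)) \<le> q * \<mu> (j + d)" by (rule assms(1)) (use Suc in simp)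
  also have "\<dots> \<le> q * (q ^ d * \<mu> j)" using Suc assms(2) by (intro mult_left_mono) auto
  finally show ?case by (simp add: mult_ac)
qed simp

text \<open>Intervals open below and closed above: a start at the upper end of the parameter range
  is counted, the target value is not.\<close>

lemma breakpoint_interval:
  fixes r :: "nat \<Rightarrow> real"
  assumes "r 0 < \<mu>" "\<mu> \<le> r T"
  shows "\<exists>i<T. r i < \<mu> \<and> \<mu> \<le> r (Suc i)"
  using assms(2)
proof (induction T)
  case (Suc T)
  then show ?case by (cases "\<mu> \<le> r T") (auto intro: less_SucI)
qed (use assms(1) in simp)

lemma strict_chain_le:
  fixes r :: "nat \<Rightarrow> real"
  assumes "\<And>i. i < T \<Longrightarrow> r i < r (Suc i)"
  shows "i \<le> j \<Longrightarrow> j \<le> T \<Longrightarrow> r i \<le> r j"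
proof (induction j)
  case (Suc j)
  then show ?case using assms[of j] by (cases "i = Suc j") auto
qed simp

context lp
begin

definition post_step :: "real \<Rightarrow> (real mat \<Rightarrow> (real mat \<times> real vec) set) \<Rightarrow> real vec \<Rightarrow> real vec \<Rightarrow> real vec \<times> real vec \<Rightarrow> bool" where
  "post_step \<beta> svd x s z1 \<longleftrightarrow> (\<exists>dxa dsa \<alpha>a B N V U dxl dsl \<alpha>l \<epsilon>. affine_part A \<beta> x s dxa dsa \<alpha>a B N \<and>
     lls_part A svd x s B N V U dxl dsl \<and> length_part \<beta> x s dxl dsl \<alpha>l \<epsilon> \<and>
     z1 = better_of (x + \<alpha>a \<cdot>\<^sub>v dxa, s + \<alpha>a \<cdot>\<^sub>v dsa) (x + \<alpha>l \<cdot>\<^sub>v dxl, s + \<alpha>l \<cdot>\<^sub>v dsl))"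

text \<open>The curve is prescribed on an open interval, but the lower end of a segment is used as a
  target point. The affine formulas extend to the closed interval, and the conditions follow by a
  limit from inside.\<close>

lemma curve_segment:
  assumes \<theta>: "0 < \<theta>" "\<theta> < 1" and lu: "0 \<le> l" "l \<le> lo" "lo < hi" "hi \<le> u"
    and cr: "x \<in> carrier_vec n" "dx \<in> carrier_vec n" "s \<in> carrier_vec n" "ds \<in> carrier_vec n"
    and \<Gamma>: "\<forall>\<mu>\<in>{lo..hi} \<inter> {l<..<u}. \<Gamma> \<mu> = (x + \<mu> \<cdot>\<^sub>v dx, s + \<mu> \<cdot>\<^sub>v ds)"
    and cl: "\<forall>\<mu>\<in>{l<..<u}. \<Gamma> \<mu> \<in> pair_closure n (Ninf A b c \<theta>) \<and> mubar (\<Gamma> \<mu>) = \<mu>"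
  shows "segment m n A b c (\<lambda>\<mu>. x + \<mu> \<cdot>\<^sub>v dx) (\<lambda>\<mu>. s + \<mu> \<cdot>\<^sub>v ds) (1 - \<theta>) lo hi"
proof unfold_locales
  have idx: "(x + \<mu> \<cdot>\<^sub>v dx) $ i = x $ i + \<mu> * dx $ i" "(s + \<mu> \<cdot>\<^sub>v ds) $ i = s $ i + \<mu> * ds $ i" if "i < n" for \<mu> i
    using that cr by auto
  have inner: "cpt (1 - \<theta>) \<mu> (x + \<mu> \<cdot>\<^sub>v dx) (s + \<mu> \<cdot>\<^sub>v ds)" if \<mu>: "lo < \<mu>" "\<mu> < hi" for \<mu>
  proof -
    have in1: "\<mu> \<in> {lo..hi} \<inter> {l<..<u}" and in2: "\<mu> \<in> {l<..<u}" using \<mu> lu by auto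
    have e: "\<Gamma> \<mu> = (x + \<mu> \<cdot>\<^sub>v dx, s + \<mu> \<cdot>\<^sub>v ds)" using \<Gamma> in1 by blast
    have "\<Gamma> \<mu> \<in> pair_closure n (Ninf A b c \<theta>)" "mubar (\<Gamma> \<mu>) = \<mu>" using cl in2 by auto
    from closure_cpt[OF this(1)] this(2) show ?thesis by (simp add: e)
  qed
  show "cpt (1 - \<theta>) \<mu> (x + \<mu> \<cdot>\<^sub>v dx) (s + \<mu> \<cdot>\<^sub>v ds)" if \<mu>: "lo \<le> \<mu>" "\<mu> \<le> hi" for \<mu>
  proof -
    define mid where "mid = (lo + hi) / 2"
    have mid: "lo < mid" "mid < hi" using lu by (auto simp: mid_def)
    define d where "d = mid - \<mu>"
    \<comment> \<open>The factors start at \<open>1 / 2\<close>, not at 1, and move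
      \<open>\<mu>\<close> towards the midpoint; so all \<open>\<nu> k\<close> are strictly inside
      the interval even if \<open>\<mu>\<close> is one of its ends.\<close>
    define \<nu> where "\<nu> k = \<mu> + d * (1 / real (Suc (Suc k)))" for k
    have in\<nu>: "lo < \<nu> k \<and> \<nu> k < hi" for k
    proof -
      define q where "q = 1 / real (Suc (Suc k))"
      have q: "0 < q" "q < 1" by (auto simp: q_def)
      have "0 \<le> (1 - q) * (\<mu> - lo)" "0 \<le> (1 - q) * (hi - \<mu>)" "0 < q * (mid - lo)" "0 < q * (hi - mid)"
        using q \<mu> mid by simp_all
      moreover have "\<nu> k - lo = (1 - q) * (\<mu> - lo) + q * (mid - lo)" "hi - \<nu> k = (1 - q) * (hi - \<mu>) + q * (hi - mid)"
        unfolding \<nu>_def q_def[symmetric] d_def by (simp_all add: algebra_simps)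
      ultimately show ?thesis by linarith
    qed
    have "(\<lambda>k. 1 / real (Suc k)) \<longlonglongrightarrow> 0" by (rule LIMSEQ_Suc[OF lim_1_over_n])
    then have "(\<lambda>k. 1 / real (Suc (Suc k))) \<longlonglongrightarrow> 0" by (rule LIMSEQ_Suc)
    then have "\<nu> \<longlonglongrightarrow> \<mu> + d * 0" unfolding \<nu>_def[abs_def] by (intro tendsto_intros)
    then have lim: "\<nu> \<longlonglongrightarrow> \<mu>" by simp
    show ?thesis
    proof (rule cpt_limit[OF _ _ _ _ _ lim])
      show "cpt (1 - \<theta>) (\<nu> k) (x + \<nu> k \<cdot>\<^sub>v dx) (s + \<nu> k \<cdot>\<^sub>v ds)" for k using in\<nu>[of k] by (intro inner) auto
      show "x + \<mu> \<cdot>\<^sub>v dx \<in> carrier_vec n" "s + \<mu> \<cdot>\<^sub>v ds \<in> carrier_vec n" using cr by auto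
      show "(\<lambda>k. (x + \<nu> k \<cdot>\<^sub>v dx) $ i) \<longlonglongrightarrow> (x + \<mu> \<cdot>\<^sub>v dx) $ i" if "i < n" for i
        unfolding idx[OF that] by (intro tendsto_intros lim)
      show "(\<lambda>k. (s + \<nu> k \<cdot>\<^sub>v ds) $ i) \<longlonglongrightarrow> (s + \<mu> \<cdot>\<^sub>v ds) $ i" if "i < n" for i
        unfolding idx[OF that] by (intro tendsto_intros lim)
    qed
  qed
  show "(x + ((1 - l) * lo + l * hi) \<cdot>\<^sub>v dx) $ i = (1 - l) * (x + lo \<cdot>\<^sub>v dx) $ i + l * (x + hi \<cdot>\<^sub>v dx) $ i" if "i < n" for l i
    unfolding idx[OF that] by (simp add: algebra_simps)
  show "(s + ((1 - l) * lo + l * hi) \<cdot>\<^sub>v ds) $ i = (1 - l) * (s + lo \<cdot>\<^sub>v ds) $ i + l * (s + hi \<cdot>\<^sub>v ds) $ i" if "i < n" for l i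
    unfolding idx[OF that] by (simp add: algebra_simps)
qed (use \<theta> lu in auto)

end

text \<open>The distance between compared iterates is \<open>Suc H\<close>: one step whose progress
  is examined, and \<open>H\<close> more by which guaranteed progress brings the measure below that
  of the examined step by the required factor.\<close>

lemma (in segment) segment_count:
  assumes svd: "svd_solver 2 svd" and \<beta>: "0 < \<beta>" "\<beta> \<le> 1 / 6"
    and z: "\<And>j. j < k \<Longrightarrow> (xs j, ss j) \<in> N2 A b c (\<beta> / 8)" and ps: "\<And>j. j < k \<Longrightarrow> post_step \<beta> svd (xs j) (ss j) (zs (Suc j))"
    and mu: "\<And>j. j < k \<Longrightarrow> mubar (xs j, ss j) = mubar (zs j)"
    and \<Omega>: "\<Omega> = 3000 * (real n)\<^sup>2 / \<beta>" and H: "2 * pol\<^sup>2 * \<Omega>\<^sup>2 * (1 - \<beta> / (3 * sqrt n)) ^ H \<le> 1"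
  shows "card {j. j < k \<and> lo < mubar (zs j) \<and> mubar (zs j) \<le> hi} \<le> Suc H * (2 * n + 1)"
proof -
  define \<mu> where "\<mu> j = mubar (zs j)" for j
  define q where "q = 1 - \<beta> / (3 * sqrt n)"
  have "\<beta> \<le> 3 * sqrt n" using \<beta> n1 real_sqrt_ge_one[OF n1] by linarith
  then have q: "0 \<le> q" "q \<le> 1" using \<beta> n0 by (auto simp: q_def pos_divide_le_eq)
  have \<mu>0: "0 < \<mu> j" if "j < k" for j using N2D(5)[OF z[OF that]] mu[OF that] by (simp add: \<mu>_def)
  have step: "\<mu> (Suc j) \<le> q * \<mu> j" if j: "j < k" for j
    using ps[OF j] post_step_progress(2)[OF svd z[OF j] \<beta>] unfolding post_step_def \<mu>_def q_def mu[OF j, symmetric] by blast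
  note decay = geometric_decay[of k \<mu>, OF step q(1)]
  have anti: "\<mu> j \<le> \<mu> i" if "i \<le> j" "j < k" for i j
  proof -
    have "\<mu> (i + (j - i)) \<le> q ^ (j - i) * \<mu> i" by (rule decay) (use that in auto)
    also have "\<dots> \<le> 1 * \<mu> i" using power_le_one[OF q] \<mu>0[of i] that by (intro mult_right_mono) auto
    finally show ?thesis using that by simp
  qed
  let ?J = "{j. j < k \<and> lo < \<mu> j \<and> \<mu> j \<le> hi}"
  have "card ?J \<le> Suc H * (2 * n + 1)"
  proof (rule card_le_potential[where f = "\<lambda>j. potential (1 / \<Omega>) (xs j)"])
    show "finite ?J" by simp
    show "j \<in> ?J" if "i \<in> ?J" "l \<in> ?J" "i \<le> j" "j \<le> l" for i j l
    proof -
      have "j < k" "l < k" "lo < \<mu> l" "\<mu> i \<le> hi" using that by auto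
      moreover have "\<mu> j \<le> \<mu> i" "\<mu> l \<le> \<mu> j" using that by (auto intro: anti)
      ultimately show ?thesis by simp
    qed
    have \<Omega>0: "0 \<le> 1 / \<Omega>" using \<beta> by (simp add: \<Omega>)
    show "potential (1 / \<Omega>) (xs j) \<le> 2 * n" if "j \<in> ?J" for j
      by (rule potential_le[OF svd z \<Omega>0]) (use that in simp)
    show "potential (1 / \<Omega>) (xs (j + Suc H)) < potential (1 / \<Omega>) (xs j)" if "j \<in> ?J" "j + Suc H \<in> ?J" for j
    proof -
      have j: "j < k" "j + Suc H < k" "Suc j < k" "\<mu> j \<le> hi" "lo < \<mu> (j + Suc H)" using that by auto
      have "Suc j + H \<le> k" using j(2) by linarith
      then have "\<mu> (Suc j + H) \<le> q ^ H * \<mu> (Suc j)" by (rule decay[rotated])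
      then have "2 * pol\<^sup>2 * \<Omega>\<^sup>2 * \<mu> (j + Suc H) \<le> 2 * pol\<^sup>2 * \<Omega>\<^sup>2 * (q ^ H * \<mu> (Suc j))" by (intro mult_left_mono) auto
      also have "\<dots> = 2 * pol\<^sup>2 * \<Omega>\<^sup>2 * q ^ H * \<mu> (Suc j)" by simp
      also have "\<dots> \<le> 1 * \<mu> (Suc j)" using H \<mu>0[OF j(3)] unfolding q_def[symmetric] by (intro mult_right_mono) auto
      finally have far: "2 * pol\<^sup>2 * \<Omega>\<^sup>2 * mubar (xs (j + Suc H), ss (j + Suc H)) \<le> mubar (zs (Suc j))"
        using mu[OF j(2)] by (simp add: \<mu>_def)
      have hi: "mubar (xs j, ss j) \<le> hi" and lo: "lo \<le> mubar (xs (j + Suc H), ss (j + Suc H))"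
        using mu[OF j(1)] mu[OF j(2)] j by (auto simp: \<mu>_def)
      show ?thesis
        using ps[OF j(1)] potential_drop[OF svd z[OF j(1)] z[OF j(2)] \<beta> _ _ _ _ \<Omega> hi lo far] unfolding post_step_def by blast
    qed
  qed
  then show ?thesis by (simp add: \<mu>_def)
qed

text \<open>All polynomial factors are absorbed into powers of \<open>K\<close>, which is at least
  6: \<open>\<Lambda>\<close> is \<open>7200000000 * (\<beta> ^ 8 * t ^ 6) * K ^ 10\<close>, and
  \<open>7200000000 \<le> 6 ^ 13\<close>, so \<open>\<Lambda> \<le> K ^ 23\<close>. Then
  \<open>414 = 2 * 3 * 3 * 23\<close> collects rounding, \<open>2 * n + 1 \<le> 3 * n\<close>, the 3
  of the guaranteed step length, and the exponent.\<close>

lemma iteration_constant: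
  fixes n :: nat and \<beta> t :: real
  assumes n: "0 < n" and \<beta>: "0 < \<beta>" "\<beta> \<le> 1 / 6" and t: "0 < t" "t \<le> 1"
  defines "\<Lambda> \<equiv> 2 * (20 * real n ^ 3 / t\<^sup>2)\<^sup>2 * (3000 * (real n)\<^sup>2 / \<beta>)\<^sup>2"
  obtains H where "\<Lambda> * (1 - \<beta> / (3 * sqrt n)) ^ H \<le> 1"
    "real (Suc H * (2 * n + 1)) \<le> 414 * (real n powr (3 / 2) / \<beta>) * ln (real n / (\<beta> * t))"
proof -
  define K where "K = real n / (\<beta> * t)"
  have n1: "1 \<le> real n" using n by simp
  have "\<beta> * t \<le> 1 / 6 * 1" by (rule mult_mono) (use \<beta> t in simp_all)
  then have bt: "0 < \<beta> * t" "\<beta> * t \<le> 1 / 6" using \<beta> t by simp_all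
  have "6 * (\<beta> * t) \<le> real n" using bt n1 by linarith
  then have K6: "6 \<le> K" using bt by (simp add: K_def pos_le_divide_eq)
  have lnK: "1 \<le> ln K"
  proof -
    have "exp 1 \<le> (3 :: real)" by (rule exp_le)
    then have "exp 1 \<le> K" using K6 by linarith
    then show ?thesis using K6 by (simp add: ln_ge_iff)
  qed
  have tb: "\<beta> ^ 8 * t ^ 6 \<le> 1" using \<beta> t by (intro mult_le_one power_le_one) auto
  have \<Lambda>e: "\<Lambda> = 7200000000 * (\<beta> ^ 8 * t ^ 6) * K ^ 10"
    using \<beta> t by (simp add: \<Lambda>_def K_def power_mult_distrib power_divide field_simps power_numeral_reduce)
  have "7200000000 * (\<beta> ^ 8 * t ^ 6) * K ^ 10 \<le> 6 ^ 13 * K ^ 10"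
  proof (rule mult_right_mono)
    have "7200000000 * (\<beta> ^ 8 * t ^ 6) \<le> 7200000000 * 1" using tb by (rule mult_left_mono) simp
    also have "\<dots> \<le> (6 :: real) ^ 13" by simp
    finally show "7200000000 * (\<beta> ^ 8 * t ^ 6) \<le> 6 ^ 13" .
  qed (use K6 in simp)
  also have "\<dots> \<le> K ^ 13 * K ^ 10" using K6 by (intro mult_right_mono power_mono) auto
  also have "\<dots> = K ^ 23" by (simp flip: power_add)
  finally have \<Lambda>K: "\<Lambda> \<le> K ^ 23" unfolding \<Lambda>e .
  define L where "L = 23 * ln K"
  have L1: "23 \<le> L" using lnK by (simp add: L_def)
  have "ln (K ^ 23) = L" using K6 by (simp add: ln_realpow L_def)
  then have expL: "exp L = K ^ 23" using K6 by (metis exp_ln less_le_trans zero_less_numeral zero_less_power)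
  define q where "q = \<beta> / (3 * sqrt n)"
  have sn: "1 \<le> sqrt n" by (rule real_sqrt_ge_one[OF n1])
  have "\<beta> \<le> 3 * sqrt n" using \<beta> sn by linarith
  then have q: "0 < q" "q \<le> 1" using \<beta> n by (auto simp: q_def pos_divide_le_eq)
  define H where "H = nat \<lceil>L / q\<rceil>"
  have Hq: "L / q \<le> real H" "real H \<le> L / q + 1" using L1 q by (auto simp: H_def)
  have "(1 - q) ^ H \<le> exp (- q) ^ H" using q exp_ge_add_one_self[of "- q"] by (intro power_mono) auto
  also have "\<dots> = exp (- (q * real H))" by (simp add: exp_of_nat_mult[symmetric] mult.commute)
  also have "\<dots> \<le> exp (- L)" using Hq(1) q by (simp add: pos_divide_le_eq mult.commute)
  finally have qH: "(1 - q) ^ H \<le> exp (- L)" .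
  have "\<Lambda> * (1 - q) ^ H \<le> exp L * exp (- L)"
    using \<Lambda>K qH q unfolding expL[symmetric] by (intro mult_mono) auto
  then have 1: "\<Lambda> * (1 - \<beta> / (3 * sqrt n)) ^ H \<le> 1" by (simp add: q_def flip: exp_add)
  \<comment> \<open>Leaves room in a factor 2 for both the rounding up and the successor.\<close>
  have "2 \<le> L / q" using L1 q by (simp add: pos_le_divide_eq)
  then have "real (Suc H) \<le> 2 * (L / q)" using Hq by simp
  then have "real (Suc H) * (2 * real n + 1) \<le> 2 * (L / q) * (3 * real n)" using n1 L1 q by (intro mult_mono) auto
  also have "\<dots> = 414 * (real n * sqrt n / \<beta>) * ln K" by (simp add: L_def q_def)
  also have "real n * sqrt n = real n powr (3 / 2)"
  proof -
    have "real n powr (3 / 2) = real n powr (1 + 1 / 2)" by simp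
    also have "\<dots> = real n * sqrt n" using n1 unfolding powr_add by (simp add: powr_half_sqrt)
    finally show ?thesis ..
  qed
  finally have 2: "real (Suc H) * (2 * real n + 1) \<le> 414 * (real n powr (3 / 2) / \<beta>) * ln K" .
  have e: "real (Suc H * (2 * n + 1)) = real (Suc H) * (2 * real n + 1)"
    by (simp only: of_nat_mult of_nat_add of_nat_numeral of_nat_1)
  show thesis by (rule that[OF 1]) (use 2 in \<open>simp only: e K_def\<close>)
qed

text \<open>An iterate from which a step is taken has measure above the target, hence positive, so
  the boundary alternative of the invariant is excluded for it.\<close>

lemma (in lp) run_post_steps:
  assumes svd: "svd_solver \<rho> svd" and \<beta>: "0 < \<beta>" "\<beta> \<le> 1 / 6" and \<mu>1: "0 \<le> \<mu>1"
    and z0: "z0 \<in> N2 A b c \<beta>" and run: "slls_run A \<beta> svd \<mu>1 z0 k zs"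
  shows "j \<le> k \<Longrightarrow> zs j \<in> N2 A b c \<beta> \<or> zs j \<in> pair_closure n (N2 A b c \<beta>) \<and> mubar (zs j) = 0"
    "j < k \<Longrightarrow> \<exists>x s. (x, s) \<in> N2 A b c (\<beta> / 8) \<and> mubar (x, s) = mubar (zs j) \<and> post_step \<beta> svd x s (zs (Suc j))"
proof -
  have r0: "zs 0 = z0" and r: "\<And>j. j < k \<Longrightarrow> \<mu>1 < mubar (zs j) \<and> slls_step A \<beta> svd (zs j) (zs (Suc j))"
    using run by (auto simp: slls_run_def)
  have post: "\<exists>x s. (x, s) \<in> N2 A b c (\<beta> / 8) \<and> mubar (x, s) = mubar (zs j) \<and> post_step \<beta> svd x s (zs (Suc j))"
    if j: "j < k" and zj: "zs j \<in> N2 A b c \<beta>" for j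
  proof -
    have st: "slls_step A \<beta> svd (zs j) (zs (Suc j))" using r[OF j] by blast
    show ?thesis
      by (rule slls_step_post[OF zj \<beta> st]) (unfold post_step_def, blast)
  qed
  have inv: "zs j \<in> N2 A b c \<beta> \<or> zs j \<in> pair_closure n (N2 A b c \<beta>) \<and> mubar (zs j) = 0" if "j \<le> k" for j
    using that
  proof (induction j)
    case 0
    then show ?case using z0 r0 by simp
  next
    case (Suc j)
    then have j: "j < k" by simp
    have zj: "zs j \<in> N2 A b c \<beta>" using Suc.IH j r[OF j] \<mu>1 by auto
    obtain x s where xs: "(x, s) \<in> N2 A b c (\<beta> / 8)" "post_step \<beta> svd x s (zs (Suc j))" using post[OF j zj] by blast
    show ?case using xs(2) post_step_progress(1)[OF svd xs(1) \<beta>] unfolding post_step_def by blast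
  qed
  show "j \<le> k \<Longrightarrow> zs j \<in> N2 A b c \<beta> \<or> zs j \<in> pair_closure n (N2 A b c \<beta>) \<and> mubar (zs j) = 0" by (rule inv)
  assume j: "j < k"
  then have "zs j \<in> N2 A b c \<beta>" using inv[of j] r[OF j] \<mu>1 by auto
  then show "\<exists>x s. (x, s) \<in> N2 A b c (\<beta> / 8) \<and> mubar (x, s) = mubar (zs j) \<and> post_step \<beta> svd x s (zs (Suc j))"
    by (rule post[OF j])
qed

text \<open>Each iterate above the target is assigned to the parameter interval that contains its
  duality measure. The iterates need not follow the curve, so the bound for one segment applies to
  each of the \<open>T\<close> classes separately.\<close>

lemma (in lp) run_length:
  assumes svd: "svd_solver 2 svd" and \<beta>: "0 < \<beta>" "\<beta> \<le> 1 / 6" and \<theta>: "0 < \<theta>" "\<theta> < 1" and \<mu>1: "0 \<le> \<mu>1"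
    and pl: "piecewise_linear_curve n \<Gamma> \<mu>1 \<mu>0 T"
    and cl: "\<forall>\<mu>\<in>{\<mu>1<..<\<mu>0}. \<Gamma> \<mu> \<in> pair_closure n (Ninf A b c \<theta>) \<and> mubar (\<Gamma> \<mu>) = \<mu>"
    and z0: "z0 \<in> N2 A b c \<beta>" and \<mu>0: "mubar z0 \<le> \<mu>0" and run: "slls_run A \<beta> svd \<mu>1 z0 k zs"
  shows "real k \<le> 414 * (real n powr (3 / 2) / \<beta>) * ln (real n / (\<beta> * (1 - \<theta>))) * real T"
proof -
  obtain r where r: "r 0 = \<mu>1" "r T = \<mu>0" "\<And>i. i < T \<Longrightarrow> r i < r (Suc i)"
    and seg: "\<And>i. i < T \<Longrightarrow> \<exists>x\<in>carrier_vec n. \<exists>dx\<in>carrier_vec n. \<exists>s\<in>carrier_vec n. \<exists>ds\<in>carrier_vec n.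
           \<forall>\<mu>\<in>{r i..r (Suc i)} \<inter> {\<mu>1<..<\<mu>0}. \<Gamma> \<mu> = (x + \<mu> \<cdot>\<^sub>v dx, s + \<mu> \<cdot>\<^sub>v ds)"
    using pl unfolding piecewise_linear_curve_def by blast
  note mono = strict_chain_le[of T r, OF r(3)]
  note rp = run_post_steps[OF svd \<beta> \<mu>1 z0 run]
  have "\<forall>j. \<exists>x s. j < k \<longrightarrow> (x, s) \<in> N2 A b c (\<beta> / 8) \<and> mubar (x, s) = mubar (zs j) \<and> post_step \<beta> svd x s (zs (Suc j))"
    using rp(2) by blast
  then obtain xs ss where xs: "\<And>j. j < k \<Longrightarrow> (xs j, ss j) \<in> N2 A b c (\<beta> / 8)"
    "\<And>j. j < k \<Longrightarrow> mubar (xs j, ss j) = mubar (zs j)" "\<And>j. j < k \<Longrightarrow> post_step \<beta> svd (xs j) (ss j) (zs (Suc j))"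
    by metis
  have t: "0 < 1 - \<theta>" "1 - \<theta> \<le> 1" using \<theta> by auto
  obtain H where H: "2 * (20 * real n ^ 3 / (1 - \<theta>)\<^sup>2)\<^sup>2 * (3000 * (real n)\<^sup>2 / \<beta>)\<^sup>2 * (1 - \<beta> / (3 * sqrt n)) ^ H \<le> 1"
    "real (Suc H * (2 * n + 1)) \<le> 414 * (real n powr (3 / 2) / \<beta>) * ln (real n / (\<beta> * (1 - \<theta>)))"
    by (rule iteration_constant[OF n0 \<beta> t])
  define J where "J i = {j. j < k \<and> r i < mubar (zs j) \<and> mubar (zs j) \<le> r (Suc i)}" for i
  have card: "card (J i) \<le> Suc H * (2 * n + 1)" if i: "i < T" for i
  proof -
    obtain x dx s ds where cr: "x \<in> carrier_vec n" "dx \<in> carrier_vec n" "s \<in> carrier_vec n" "ds \<in> carrier_vec n"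
      and \<Gamma>: "\<forall>\<mu>\<in>{r i..r (Suc i)} \<inter> {\<mu>1<..<\<mu>0}. \<Gamma> \<mu> = (x + \<mu> \<cdot>\<^sub>v dx, s + \<mu> \<cdot>\<^sub>v ds)"
      using seg[OF i] by blast
    have "\<mu>1 \<le> r i" "r (Suc i) \<le> \<mu>0" using mono[of 0 i] mono[of "Suc i" T] i r by auto
    then interpret sg: segment m n A b c "\<lambda>\<mu>. x + \<mu> \<cdot>\<^sub>v dx" "\<lambda>\<mu>. s + \<mu> \<cdot>\<^sub>v ds" "1 - \<theta>" "r i" "r (Suc i)"
      using curve_segment[OF \<theta> \<mu>1 _ r(3)[OF i] _ cr \<Gamma> cl] by blast
    show ?thesis unfolding J_def
      by (rule sg.segment_count[where xs = xs and ss = ss and zs = zs, OF svd \<beta> xs(1) xs(3) xs(2) refl]) (use H(1) in \<open>simp_all add: sg.pol_def\<close>)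
  qed
  have dec: "mubar (zs (Suc j)) \<le> mubar (zs j)" if j: "j < k" for j
  proof -
    have "mubar (zs (Suc j)) \<le> (1 - \<beta> / (3 * sqrt n)) * mubar (xs j, ss j)"
      using xs(3)[OF j] post_step_progress(2)[OF svd xs(1)[OF j] \<beta>] unfolding post_step_def by blast
    also have "\<dots> \<le> 1 * mubar (xs j, ss j)" using N2D(5)[OF xs(1)[OF j]] \<beta> by (intro mult_right_mono) auto
    finally show ?thesis using xs(2)[OF j] by simp
  qed
  have r0: "zs 0 = z0" and rr: "\<And>j. j < k \<Longrightarrow> \<mu>1 < mubar (zs j)" using run by (auto simp: slls_run_def)
  have le0: "mubar (zs j) \<le> \<mu>0" if "j \<le> k" for j
    using that
  proof (induction j)
    case (Suc j)
    then show ?case using dec[of j] by simp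
  qed (use r0 \<mu>0 in simp)
  have "{..<k} \<subseteq> (\<Union>i<T. J i)"
  proof
    fix j assume "j \<in> {..<k}"
    then have j: "j < k" by simp
    have "\<exists>i<T. r i < mubar (zs j) \<and> mubar (zs j) \<le> r (Suc i)"
      by (rule breakpoint_interval) (use rr[OF j] le0[of j] j r in auto)
    then show "j \<in> (\<Union>i<T. J i)" using j by (auto simp: J_def)
  qed
  moreover have "finite (\<Union>i<T. J i)" by (auto simp: J_def)
  ultimately have "card {..<k} \<le> card (\<Union>i<T. J i)" by (intro card_mono)
  also have "\<dots> \<le> (\<Sum>i<T. card (J i))" by (rule card_UN_le) simp
  also have "\<dots> \<le> (\<Sum>i<T. Suc H * (2 * n + 1))" by (intro sum_mono card) simp
  also have "\<dots> = Suc H * (2 * n + 1) * T" by simp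
  finally have "real k \<le> real (Suc H * (2 * n + 1) * T)" by (simp only: card_lessThan of_nat_le_iff)
  also have "\<dots> = real (Suc H * (2 * n + 1)) * real T" by (rule of_nat_mult)
  also have "\<dots> \<le> 414 * (real n powr (3 / 2) / \<beta>) * ln (real n / (\<beta> * (1 - \<theta>))) * real T"
    using H(2) by (rule mult_right_mono) simp
  finally show ?thesis .
qed

theorem theorem1p1:
  shows "\<exists>C>0. \<forall>(m::nat) (n::nat) (A::real mat) (b::real vec) (c::real vec)
      (\<beta>::real) (\<theta>::real) (\<mu>0::real) (\<mu>1::real)
      (\<Gamma>::real \<Rightarrow> real vec \<times> real vec) (T::nat) (z0::real vec \<times> real vec)
      (svd::real mat \<Rightarrow> (real mat \<times> real vec) set).
    standard_lp m n A b c \<longrightarrow>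
    svd_solver 2 svd \<longrightarrow>
    0 < \<beta> \<longrightarrow> \<beta> \<le> 1 / 6 \<longrightarrow> 0 < \<theta> \<longrightarrow> \<theta> < 1 \<longrightarrow> 0 \<le> \<mu>1 \<longrightarrow> \<mu>1 < \<mu>0 \<longrightarrow>
    piecewise_linear_curve n \<Gamma> \<mu>1 \<mu>0 T \<longrightarrow>
    (\<forall>\<mu>\<in>{\<mu>1<..<\<mu>0}. \<Gamma> \<mu> \<in> pair_closure n (Ninf A b c \<theta>) \<and> mubar (\<Gamma> \<mu>) = \<mu>) \<longrightarrow>
    z0 \<in> N2 A b c \<beta> \<longrightarrow> mubar z0 \<le> \<mu>0 \<longrightarrow>
    slls_finds_within A \<beta> svd \<mu>1 z0 (pair_closure n (N2 A b c \<beta>))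
      (C * (real n powr (3 / 2) / \<beta>) * ln (real n / (\<beta> * (1 - \<theta>))) * real T)"
proof -
  have main: "slls_finds_within A \<beta> svd \<mu>1 z0 (pair_closure n (N2 A b c \<beta>))
      (414 * (real n powr (3 / 2) / \<beta>) * ln (real n / (\<beta> * (1 - \<theta>))) * real T)"
    if lp: "standard_lp m n A b c" and svd: "svd_solver 2 svd" and \<beta>: "0 < \<beta>" "\<beta> \<le> 1 / 6" and \<theta>: "0 < \<theta>" "\<theta> < 1"
      and \<mu>1: "0 \<le> \<mu>1" and \<mu>: "\<mu>1 < \<mu>0" and pl: "piecewise_linear_curve n \<Gamma> \<mu>1 \<mu>0 T"
      and cl: "\<forall>\<mu>\<in>{\<mu>1<..<\<mu>0}. \<Gamma> \<mu> \<in> pair_closure n (Ninf A b c \<theta>) \<and> mubar (\<Gamma> \<mu>) = \<mu>"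
      and z0: "z0 \<in> N2 A b c \<beta>" and \<mu>0: "mubar z0 \<le> \<mu>0"
    for m n :: nat and A b c \<beta> \<theta> \<mu>0 \<mu>1 \<Gamma> T z0 svd
  proof -
    \<comment> \<open>In dimension 0 the duality measure is the quotient \<open>0 / 0 = 0\<close>,
      contradicting the positive measures along the curve.\<close>
    have n0: "0 < n"
    proof (rule ccontr)
      assume "\<not> 0 < n"
      have mid: "(\<mu>1 + \<mu>0) / 2 \<in> {\<mu>1<..<\<mu>0}" using \<mu> by simp
      then have "\<Gamma> ((\<mu>1 + \<mu>0) / 2) \<in> pair_closure n (Ninf A b c \<theta>)" using cl by blast
      then have "dim_vec (fst (\<Gamma> ((\<mu>1 + \<mu>0) / 2))) = n" by (auto simp: pair_closure_def)
      then have "mubar (\<Gamma> ((\<mu>1 + \<mu>0) / 2)) = 0" using \<open>\<not> 0 < n\<close> by (simp add: mubar_def)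
      then show False using cl mid \<mu> \<mu>1 by simp
    qed
    interpret lp m n A b c using lp n0 by unfold_locales (auto simp: standard_lp_def)
    show ?thesis
      unfolding slls_finds_within_def
    proof (intro allI impI conjI)
      fix k zs assume run: "slls_run A \<beta> svd \<mu>1 z0 k zs"
      show "real k \<le> 414 * (real n powr (3 / 2) / \<beta>) * ln (real n / (\<beta> * (1 - \<theta>))) * real T"
        by (rule run_length[OF svd \<beta> \<theta> \<mu>1 pl cl z0 \<mu>0 run])
      have inv: "zs k \<in> N2 A b c \<beta> \<or> zs k \<in> pair_closure n (N2 A b c \<beta>) \<and> mubar (zs k) = 0"
        by (rule run_post_steps(1)[OF svd \<beta> \<mu>1 z0 run order.refl])
      show "if mubar (zs k) \<le> \<mu>1 then zs k \<in> pair_closure n (N2 A b c \<beta>) else \<exists>z'. slls_step A \<beta> svd (zs k) z'"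
      proof (cases "mubar (zs k) \<le> \<mu>1")
        case True
        then show ?thesis using inv pair_closure_refl[OF N2_carrier, of "zs k" \<beta>] by presburger
      next
        case False
        then have "zs k \<in> N2 A b c \<beta>" using inv \<mu>1 by auto
        then show ?thesis using False slls_step_exists[OF svd _ \<beta>] by simp
      qed
    qed
  qed
  show ?thesis by (rule exI[of _ 414], intro conjI allI impI, simp, rule main)
qed

end
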